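(* Let $\mathbf{k}$ be a field, $\Sigma$ a finite set, $\alpha=(\alpha_I,\alpha_\circ)$ a rational evaluation, and $(\mathcal{K},\mathrm{tr}_{\mathcal{K}})$ the associated symmetric Frobenius algebra. Let $\mathcal{C}_{\mathcal{K}}$ be the quotient of the Frobenius–Brauer category $\mathcal{C}'_{\mathcal{K}}$ by the ideal of negligible morphisms, let $\mathcal{F}:\mathcal{C}_{\mathcal{K}}\to\mathsf{Kar}(\mathcal{C}_\alpha)$ be the fully faithful monoidal functor taking $+$ to $X_0^+=(+,e_0^+)$, $-$ to $X_0^-=(-,e_0^-)$, and an arc with a dot $x\in\mathcal{K}$ to the arc with the same label, and let $$\mathsf{Kar}(\mathcal{F}):\ \mathsf{Kar}(\mathcal{C}_{\mathcal{K}})\longrightarrow\mathsf{Kar}(\mathcal{C}_\alpha)$$ be the monoidal functor induced by $\mathcal{F}$ on Karoubi envelopes. Then $\mathsf{Kar}(\mathcal{F})$ is an equivalence of categories.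
   Context: Evaluations. $\Sigma^*$ is the free monoid of words in $\Sigma$ (including the empty word $\emptyset$) and $\Sigma^*_\circ$ is the set of words up to cyclic equivalence $\omega_1\omega_2\sim\omega_2\omega_1$. An evaluation is a pair $\alpha=(\alpha_I,\alpha_\circ)$ of functions $\alpha_I:\Sigma^*\to\mathbf{k}$, $\alpha_\circ:\Sigma^*_\circ\to\mathbf{k}$. Cobordisms. A finite sign sequence $\varepsilon$ is viewed as an oriented $0$-manifold. A cobordism from $\varepsilon$ to $\varepsilon'$ is a compact oriented $1$-manifold with finitely many interior dots labelled by elements of $\Sigma$, some of whose boundary points ("outer" ones) are identified with the points of $\varepsilon$ (at the bottom) and $\varepsilon'$ (at the top), the strand being oriented upward at a $+$ and downward at a $-$; the remaining boundary points are called inner. Cobordisms are taken up to structure-preserving diffeomorphism rel outer boundary. Components are outer arcs (two outer endpoints), half-intervals (one outer and one inner endpoint), floating intervals (two inner endpoints) and circles; each carries a word read from head to tail (against the orientation), up to cyclic rotation for a circle. Composition $yx$ is stacking $y$ on top of $x$; the tensor product is juxtaposition. A closed cobordism (no outer boundary) evaluates to the product over its components of $\alpha_I(\omega)$ for an interval with word $\omega$ and $\alpha_\circ(\omega)$ for a circle with word $\omega$. The category $\mathcal{C}_\alpha$ has finite sign sequences as objects; $\mathrm{Hom}(\varepsilon,\varepsilon')$ is spanned over $\mathbf{k}$ by cobordisms from $\varepsilon$ to $\varepsilon'$ modulo the linear combinations $x$ such that, for every cobordism $y$ from $\varepsilon'$ to $\varepsilon$, the closure of $yx$ (joining the $i$-th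 bottom point with the $i$-th top point by an undecorated arc for every $i$) evaluates to $0$. It is a rigid symmetric monoidal $\mathbf{k}$-linear category; its unit object $\mathbf 1$ is the empty sequence $\emptyset_0$. Put $A(\varepsilon)=\mathrm{Hom}_{\mathcal{C}_\alpha}(\emptyset_0,\varepsilon)$. The evaluation $\alpha$ is rational if $A(+-)$ is finite-dimensional (equivalently, all hom spaces of $\mathcal{C}_\alpha$ are finite-dimensional). The Karoubi envelope $\mathsf{Kar}(\mathcal{C})$ of a $\mathbf{k}$-linear category $\mathcal{C}$ is obtained by first forming finite direct sums of objects and then splitting all idempotents; for an idempotent $e\in\mathrm{End}(X)$ the corresponding object is denoted $(X,e)$. A $\mathbf{k}$-linear functor $\mathcal{C}\to\mathsf{Kar}(\mathcal{D})$ extends canonically to $\mathsf{Kar}(\mathcal{C})\to\mathsf{Kar}(\mathcal{D})$. State spaces. $A(+)$ is spanned by the half-intervals $|\omega\rangle$ with word $\omega$, and $A(-)$ by the half-intervals $\langle\omega|$; the pairing $A(-)\otimes A(+)\to\mathbf{k}$, $(\langle\omega_1|,|\omega_2\rangle)=\alpha_I(\omega_1\omega_2)$, is perfect. Let $k=\dim A(+)$ and fix a basis $v^1,\dots,v^k$ of $A(+)$ and the dual basis $v_1,\dots,v_k$ of $A(-)$, $(v_j,v^i)=\delta_{i,j}$. The algebra $A(+-)$ and $\mathcal{K}$. Bending strands gives identifications $\mathrm{End}_{\mathcal{C}_\alpha}(+)\cong A(+-)\cong\mathrm{End}_{\mathcal{C}_\alpha}(-)^{\mathrm{op}}$, and $A(+-)$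 is given the algebra structure transported from composition in $\mathrm{End}_{\mathcal{C}_\alpha}(+)$, with unit $1$ the undecorated arc; it acts on $A(+)$ on the left by composition. It is spanned by arcs decorated by words and by pairs of half-intervals $|\omega_1\rangle\otimes\langle\omega_2|$. $\mathcal{K}\subset A(+-)$ is the kernel of the action on $A(+)$; it is a two-sided ideal and a unital algebra with unit $1_{\mathcal{K}}=1-\sum_{i=1}^k v^i\otimes v_i$. The map $\mathrm{tr}_{\mathcal{K}}:\mathcal{K}\to\mathbf{k}$ is the restriction to $\mathcal{K}$ of the circular closure map on $A(+-)$, which joins the $+$ and $-$ endpoints by an undecorated arc and evaluates via $\alpha$ (an arc with word $\omega$ goes to $\alpha_\circ(\omega)$, $|\omega_1\rangle\otimes\langle\omega_2|$ goes to $\alpha_I(\omega_2\omega_1)$). With it $\mathcal{K}$ is a symmetric Frobenius algebra. Let $e_0^+\in\mathrm{End}_{\mathcal{C}_\alpha}(+)$ and $e_0^-\in\mathrm{End}_{\mathcal{C}_\alpha}(-)$ be the idempotents corresponding to $1_{\mathcal{K}}$ under the bending identifications; these identifications restrict to $\mathrm{End}(X_0^+)\cong\mathcal{K}\cong\mathrm{End}(X_0^-)^{\mathrm{op}}$. Frobenius–Brauer category. For a symmetric Frobenius algebra $(B,\mathrm{tr}_B)$ over $\mathbf{k}$, $\mathcal{C}'_B$ is the $\mathbf{k}$-linear symmetric monoidal category whose objects are finite sign sequences and whose morphisms are $\mathbf{k}$-linear combinations of oriented $1$-cobordisms without inner endpoints, with dots labelled by elements of $B$, modulo the relations: the diagram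 is $\mathbf{k}$-linear in the label of each dot; two consecutive dots on a strand with labels $b_1,b_2$ (read from head to tail) equal one dot labelled $b_1b_2$; a dot labelled $1$ can be erased; a circle carrying a dot labelled $b$ equals $\mathrm{tr}_B(b)$. A morphism $x:\varepsilon\to\varepsilon'$ in $\mathcal{C}'_B$ is negligible if for every $y:\varepsilon'\to\varepsilon$ the closure of $yx$ (joining corresponding bottom and top endpoints by arcs) equals $0\in\mathbf{k}$; $\mathcal{C}_B$ is the quotient of $\mathcal{C}'_B$ by the ideal of negligible morphisms. The functor $\mathcal{F}$: the strand $+\to+$ (respectively $-\to-$) with dot $x\in\mathcal{K}$ goes to the element of $\mathrm{End}(X_0^+)$ (respectively $\mathrm{End}(X_0^-)$) corresponding to $x$; the arc $\mathbf{1}\to{+}{-}$ with dot $x$ goes to $x\in A(+-)$ viewed as a morphism $\mathbf{1}\to X_0^+\otimes X_0^-$; other arcs are treated likewise (bending strands), and permutation diagrams go to permutation morphisms. *)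

theory Defs
  imports "HOL-Library.Multiset" "HOL-Library.Product_Plus" "HOL-Library.Poly_Mapping"
    "Jordan_Normal_Form.Matrix"
begin

section \<open>Categories, functors, equivalences\<close>

text \<open>Hom-sets are given by \<open>Arr C X Y\<close>; they need not be disjoint, so composition
  \<open>Cmp C X Y Z g f\<close> (of \<open>f : X \<rightarrow> Y\<close> and \<open>g : Y \<rightarrow> Z\<close>) is indexed by the objects.\<close>

record ('o, 'm) cat =
  Obj :: "'o set"
  Arr :: "'o \<Rightarrow> 'o \<Rightarrow> 'm set"
  Cmp :: "'o \<Rightarrow> 'o \<Rightarrow> 'o \<Rightarrow> 'm \<Rightarrow> 'm \<Rightarrow> 'm"
  Ide :: "'o \<Rightarrow> 'm"

record ('o, 'm, 'k) lincat = "('o, 'm) cat" +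
  Add :: "'o \<Rightarrow> 'o \<Rightarrow> 'm \<Rightarrow> 'm \<Rightarrow> 'm"
  Zer :: "'o \<Rightarrow> 'o \<Rightarrow> 'm"
  Scl :: "'o \<Rightarrow> 'o \<Rightarrow> 'k \<Rightarrow> 'm \<Rightarrow> 'm"

record ('o1, 'm1, 'o2, 'm2) ftr =
  FObj :: "'o1 \<Rightarrow> 'o2"
  FArr :: "'o1 \<Rightarrow> 'o1 \<Rightarrow> 'm1 \<Rightarrow> 'm2"

locale category =
  fixes C :: "('o, 'm, 'z) cat_scheme"
  assumes Ide_closed: "X \<in> Obj C \<Longrightarrow> Ide C X \<in> Arr C X X"
    and Cmp_closed: "\<lbrakk>X \<in> Obj C; Y \<in> Obj C; Z \<in> Obj C; f \<in> Arr C X Y; g \<in> Arr C Y Z\<rbrakk>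
      \<Longrightarrow> Cmp C X Y Z g f \<in> Arr C X Z"
    and Cmp_assoc: "\<lbrakk>W \<in> Obj C; X \<in> Obj C; Y \<in> Obj C; Z \<in> Obj C;
        f \<in> Arr C W X; g \<in> Arr C X Y; h \<in> Arr C Y Z\<rbrakk>
      \<Longrightarrow> Cmp C W Y Z h (Cmp C W X Y g f) = Cmp C W X Z (Cmp C X Y Z h g) f"
    and Cmp_Ide_right: "\<lbrakk>X \<in> Obj C; Y \<in> Obj C; f \<in> Arr C X Y\<rbrakk> \<Longrightarrow> Cmp C X X Y f (Ide C X) = f"
    and Cmp_Ide_left: "\<lbrakk>X \<in> Obj C; Y \<in> Obj C; f \<in> Arr C X Y\<rbrakk> \<Longrightarrow> Cmp C X Y Y (Ide C Y) f = f"

locale cat_functor = C: category C + D: category D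
  for C :: "('o1, 'm1, 'z1) cat_scheme" and D :: "('o2, 'm2, 'z2) cat_scheme" +
  fixes F :: "('o1, 'm1, 'o2, 'm2) ftr"
  assumes FObj_closed: "X \<in> Obj C \<Longrightarrow> FObj F X \<in> Obj D"
    and FArr_closed: "\<lbrakk>X \<in> Obj C; Y \<in> Obj C; f \<in> Arr C X Y\<rbrakk>
      \<Longrightarrow> FArr F X Y f \<in> Arr D (FObj F X) (FObj F Y)"
    and FArr_Ide: "X \<in> Obj C \<Longrightarrow> FArr F X X (Ide C X) = Ide D (FObj F X)"
    and FArr_Cmp: "\<lbrakk>X \<in> Obj C; Y \<in> Obj C; Z \<in> Obj C; f \<in> Arr C X Y; g \<in> Arr C Y Z\<rbrakk>
      \<Longrightarrow> FArr F X Z (Cmp C X Y Z g f)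
        = Cmp D (FObj F X) (FObj F Y) (FObj F Z) (FArr F Y Z g) (FArr F X Y f)"

definition id_ftr :: "('o, 'm, 'o, 'm) ftr" where
  "id_ftr = \<lparr>FObj = (\<lambda>X. X), FArr = (\<lambda>X Y f. f)\<rparr>"

definition comp_ftr ::
  "('o2, 'm2, 'o3, 'm3) ftr \<Rightarrow> ('o1, 'm1, 'o2, 'm2) ftr \<Rightarrow> ('o1, 'm1, 'o3, 'm3) ftr" where
  "comp_ftr G F = \<lparr>FObj = (\<lambda>X. FObj G (FObj F X)),
     FArr = (\<lambda>X Y f. FArr G (FObj F X) (FObj F Y) (FArr F X Y f))\<rparr>"

definition is_iso :: "('o, 'm, 'z) cat_scheme \<Rightarrow> 'o \<Rightarrow> 'o \<Rightarrow> 'm \<Rightarrow> bool" where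
  "is_iso C X Y f \<longleftrightarrow> f \<in> Arr C X Y \<and>
     (\<exists>g\<in>Arr C Y X. Cmp C X Y X g f = Ide C X \<and> Cmp C Y X Y f g = Ide C Y)"

definition naturally_isomorphic ::
  "('o1, 'm1, 'z1) cat_scheme \<Rightarrow> ('o2, 'm2, 'z2) cat_scheme \<Rightarrow>
   ('o1, 'm1, 'o2, 'm2) ftr \<Rightarrow> ('o1, 'm1, 'o2, 'm2) ftr \<Rightarrow> bool" where
  "naturally_isomorphic C D F G \<longleftrightarrow> (\<exists>\<eta>.
     (\<forall>X\<in>Obj C. is_iso D (FObj F X) (FObj G X) (\<eta> X)) \<and>
     (\<forall>X\<in>Obj C. \<forall>Y\<in>Obj C. \<forall>f\<in>Arr C X Y.
        Cmp D (FObj F X) (FObj F Y) (FObj G Y) (\<eta> Y) (FArr F X Y f)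
      = Cmp D (FObj F X) (FObj G X) (FObj G Y) (FArr G X Y f) (\<eta> X)))"

definition is_equivalence ::
  "('o1, 'm1, 'z1) cat_scheme \<Rightarrow> ('o2, 'm2, 'z2) cat_scheme \<Rightarrow>
   ('o1, 'm1, 'o2, 'm2) ftr \<Rightarrow> bool" where
  "is_equivalence C D F \<longleftrightarrow> cat_functor C D F \<and>
     (\<exists>G. cat_functor D C G \<and>
          naturally_isomorphic C C id_ftr (comp_ftr G F) \<and>
          naturally_isomorphic D D (comp_ftr F G) id_ftr)"


section \<open>Linear categories: quotients and Karoubi envelopes\<close>

definition Sum :: "('o, 'm, 'k) lincat \<Rightarrow> 'o \<Rightarrow> 'o \<Rightarrow> 'm list \<Rightarrow> 'm" where
  "Sum C X Y fs = foldr (Add C X Y) fs (Zer C X Y)"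

definition lincomb :: "('o, 'm, 'k) lincat \<Rightarrow> 'o \<Rightarrow> 'o \<Rightarrow> 'k list \<Rightarrow> 'm list \<Rightarrow> 'm" where
  "lincomb C X Y cs fs = Sum C X Y (map2 (Scl C X Y) cs fs)"

definition spans :: "('o, 'm, 'k) lincat \<Rightarrow> 'o \<Rightarrow> 'o \<Rightarrow> 'm list \<Rightarrow> bool" where
  "spans C X Y fs \<longleftrightarrow> set fs \<subseteq> Arr C X Y \<and>
     (\<forall>g\<in>Arr C X Y. \<exists>cs. length cs = length fs \<and> g = lincomb C X Y cs fs)"

definition is_basis :: "('o, 'm, 'k::zero) lincat \<Rightarrow> 'o \<Rightarrow> 'o \<Rightarrow> 'm list \<Rightarrow> bool" where
  "is_basis C X Y fs \<longleftrightarrow> spans C X Y fs \<and>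
     (\<forall>cs. length cs = length fs \<and> lincomb C X Y cs fs = Zer C X Y \<longrightarrow> (\<forall>c\<in>set cs. c = 0))"

definition fin_dim :: "('o, 'm, 'k) lincat \<Rightarrow> 'o \<Rightarrow> 'o \<Rightarrow> bool" where
  "fin_dim C X Y \<longleftrightarrow> (\<exists>fs. spans C X Y fs)"

definition coset ::
  "('o, 'm, 'k) lincat \<Rightarrow> ('o \<Rightarrow> 'o \<Rightarrow> 'm set) \<Rightarrow> 'o \<Rightarrow> 'o \<Rightarrow> 'm \<Rightarrow> 'm set" where
  "coset C N X Y f = Add C X Y f ` N X Y"

text \<open>The quotient by an ideal \<open>N\<close>: morphisms are cosets, and the operations are induced
  from representatives (for an ideal the unions below run over one and the same coset).\<close>

definition quot ::
  "('o, 'm, 'k) lincat \<Rightarrow> ('o \<Rightarrow> 'o \<Rightarrow> 'm set) \<Rightarrow> ('o, 'm set, 'k) lincat" where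
  "quot C N = \<lparr>
     Obj = Obj C,
     Arr = (\<lambda>X Y. coset C N X Y ` Arr C X Y),
     Cmp = (\<lambda>X Y Z G F. \<Union>g\<in>G. \<Union>f\<in>F. coset C N X Z (Cmp C X Y Z g f)),
     Ide = (\<lambda>X. coset C N X X (Ide C X)),
     Add = (\<lambda>X Y F G. \<Union>f\<in>F. \<Union>g\<in>G. coset C N X Y (Add C X Y f g)),
     Zer = (\<lambda>X Y. coset C N X Y (Zer C X Y)),
     Scl = (\<lambda>X Y c F. \<Union>f\<in>F. coset C N X Y (Scl C X Y c f))\<rparr>"

text \<open>Finite direct sums: a list of objects stands for its direct sum, and the entry \<open>(i, j)\<close>
  of a morphism \<open>Xs \<rightarrow> Ys\<close> is its component \<open>Xs ! j \<rightarrow> Ys ! i\<close>.\<close>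

definition add_env :: "('o, 'm, 'k) lincat \<Rightarrow> ('o list, 'm mat, 'k) lincat" where
  "add_env C = \<lparr>
     Obj = {Xs. set Xs \<subseteq> Obj C},
     Arr = (\<lambda>Xs Ys. {M \<in> carrier_mat (length Ys) (length Xs).
       \<forall>i<length Ys. \<forall>j<length Xs. M $$ (i, j) \<in> Arr C (Xs ! j) (Ys ! i)}),
     Cmp = (\<lambda>Xs Ys Zs N M. mat (length Zs) (length Xs) (\<lambda>(i, j).
       Sum C (Xs ! j) (Zs ! i)
         (map (\<lambda>l. Cmp C (Xs ! j) (Ys ! l) (Zs ! i) (N $$ (i, l)) (M $$ (l, j)))
           [0..<length Ys]))),
     Ide = (\<lambda>Xs. mat (length Xs) (length Xs) (\<lambda>(i, j).
       if i = j then Ide C (Xs ! i) else Zer C (Xs ! j) (Xs ! i))),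
     Add = (\<lambda>Xs Ys M N. mat (length Ys) (length Xs) (\<lambda>(i, j).
       Add C (Xs ! j) (Ys ! i) (M $$ (i, j)) (N $$ (i, j)))),
     Zer = (\<lambda>Xs Ys. mat (length Ys) (length Xs) (\<lambda>(i, j). Zer C (Xs ! j) (Ys ! i))),
     Scl = (\<lambda>Xs Ys c M. mat (length Ys) (length Xs) (\<lambda>(i, j).
       Scl C (Xs ! j) (Ys ! i) c (M $$ (i, j))))\<rparr>"

definition idem_env :: "('o, 'm, 'k) lincat \<Rightarrow> ('o \<times> 'm, 'm, 'k) lincat" where
  "idem_env C = \<lparr>
     Obj = {(X, e). X \<in> Obj C \<and> e \<in> Arr C X X \<and> Cmp C X X X e e = e},
     Arr = (\<lambda>(X, e) (Y, e'). {f \<in> Arr C X Y. Cmp C X Y Y e' (Cmp C X X Y f e) = f}),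
     Cmp = (\<lambda>(X, _) (Y, _) (Z, _). Cmp C X Y Z),
     Ide = (\<lambda>(X, e). e),
     Add = (\<lambda>(X, _) (Y, _). Add C X Y),
     Zer = (\<lambda>(X, _) (Y, _). Zer C X Y),
     Scl = (\<lambda>(X, _) (Y, _). Scl C X Y)\<rparr>"

definition Kar :: "('o, 'm, 'k) lincat \<Rightarrow> ('o list \<times> 'm mat, 'm mat, 'k) lincat" where
  "Kar C = idem_env (add_env C)"

text \<open>The extension of \<open>F : C \<rightarrow> Kar D\<close> to \<open>Kar C\<close>.  If \<open>F X\<^sub>j = (Ls\<^sub>j, e\<^sub>j)\<close>, a matrix
  \<open>M : Xs \<rightarrow> Ys\<close> is sent to the block matrix with blocks \<open>F (M $$ (i, j))\<close>, between the
  concatenations of the lists \<open>Ls\<close>; \<open>positions\<close> lists the pairs (block, index in block).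
  The idempotent \<open>e\<close> of \<open>(Xs, e)\<close> is sent to an idempotent of that concatenation.\<close>

definition positions :: "'x list list \<Rightarrow> (nat \<times> nat) list" where
  "positions Ls = concat (map (\<lambda>a. map (Pair a) [0..<length (Ls ! a)]) [0..<length Ls])"

definition block_image :: "('o1, 'm1, 'o2 list \<times> 'm2 mat, 'm2 mat) ftr \<Rightarrow>
    'o1 list \<Rightarrow> 'o1 list \<Rightarrow> 'm1 mat \<Rightarrow> 'm2 mat" where
  "block_image F Xs Ys M =
    (let px = positions (map (fst \<circ> FObj F) Xs); py = positions (map (fst \<circ> FObj F) Ys)
     in mat (length py) (length px) (\<lambda>(i, j).
       FArr F (Xs ! fst (px ! j)) (Ys ! fst (py ! i)) (M $$ (fst (py ! i), fst (px ! j)))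
         $$ (snd (py ! i), snd (px ! j))))"

definition Kar_functor :: "('o1, 'm1, 'o2 list \<times> 'm2 mat, 'm2 mat) ftr \<Rightarrow>
    ('o1 list \<times> 'm1 mat, 'm1 mat, 'o2 list \<times> 'm2 mat, 'm2 mat) ftr" where
  "Kar_functor F = \<lparr>
     FObj = (\<lambda>(Xs, e). (concat (map (fst \<circ> FObj F) Xs), block_image F Xs Xs e)),
     FArr = (\<lambda>(Xs, _) (Ys, _) M. block_image F Xs Ys M)\<rparr>"


section \<open>Dotted one-dimensional cobordisms\<close>

quotient_type 'l cword = "'l list" / "\<lambda>u v. \<exists>x y. u = x @ y \<and> v = y @ x"
  morphisms rep_cword cyc
proof (rule equivpI)
  show "reflp (\<lambda>u v::'l list. \<exists>x y. u = x @ y \<and> v = y @ x)"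
    by (rule reflpI) (metis append_Nil append_Nil2)
  show "symp (\<lambda>u v::'l list. \<exists>x y. u = x @ y \<and> v = y @ x)"
    by (rule sympI) blast
  show "transp (\<lambda>u v::'l list. \<exists>x y. u = x @ y \<and> v = y @ x)"
  proof (rule transpI)
    fix u v w :: "'l list"
    assume "\<exists>x y. u = x @ y \<and> v = y @ x" "\<exists>x y. v = x @ y \<and> w = y @ x"
    then obtain a b c d where "u = a @ b" "v = b @ a" "v = c @ d" "w = d @ c" by blast
    then have "\<exists>m. w = rotate m u"
      by (metis rotate_append rotate_rotate)
    then obtain m where "w = rotate m u" ..
    then have "u = take (m mod length u) u @ drop (m mod length u) u"
      "w = drop (m mod length u) u @ take (m mod length u) u"
      by (simp_all add: rotate_drop_take)
    then show "\<exists>x y. u = x @ y \<and> w = y @ x" by blast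
  qed
qed

lift_definition cword_set :: "'l cword \<Rightarrow> 'l set" is set by auto

datatype sign = Pos | Neg

text \<open>Outer points of a cobordism \<open>\<epsilon> \<rightarrow> \<epsilon>'\<close> are \<open>Bot i\<close> for \<open>i < length \<epsilon>\<close> and \<open>Top j\<close>
  for \<open>j < length \<epsilon>'\<close>; points \<open>Mid i\<close> occur only while gluing.\<close>

datatype pt = Bot nat | Mid nat | Top nat

text \<open>A segment is (tail, head, word read from head to tail), where \<open>None\<close> is an inner endpoint.
  A diffeomorphism class of cobordisms rel outer boundary is given by the multiset of its
  segments and the multiset of the cyclic words on its circles; addition of such pairs is
  disjoint union.  Hence linear combinations of diagrams, of type \<open>('l, 'k) lin\<close>, form a
  commutative algebra, whose (convolution) product \<open>*\<close> is the bilinear extension of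
  disjoint union.\<close>

type_synonym 'l seg = "pt option \<times> pt option \<times> 'l list"
type_synonym 'l diag = "'l seg multiset \<times> 'l cword multiset"
type_synonym ('l, 'k) lin = "'l diag \<Rightarrow>\<^sub>0 'k"

abbreviation seg_tail :: "'l seg \<Rightarrow> pt option" where "seg_tail s \<equiv> fst s"
abbreviation seg_head :: "'l seg \<Rightarrow> pt option" where "seg_head s \<equiv> fst (snd s)"
abbreviation seg_word :: "'l seg \<Rightarrow> 'l list" where "seg_word s \<equiv> snd (snd s)"

text \<open>Strands go up at \<open>Pos\<close> and down at \<open>Neg\<close>.\<close>

definition tail_pts :: "sign list \<Rightarrow> sign list \<Rightarrow> pt set" where
  "tail_pts \<epsilon> \<epsilon>' = Bot ` {i. i < length \<epsilon> \<and> \<epsilon> ! i = Pos} \<union> Top ` {j. j < length \<epsilon>' \<and> \<epsilon>' ! j = Neg}"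

definition head_pts :: "sign list \<Rightarrow> sign list \<Rightarrow> pt set" where
  "head_pts \<epsilon> \<epsilon>' = Bot ` {i. i < length \<epsilon> \<and> \<epsilon> ! i = Neg} \<union> Top ` {j. j < length \<epsilon>' \<and> \<epsilon>' ! j = Pos}"

definition cobs :: "'l set \<Rightarrow> sign list \<Rightarrow> sign list \<Rightarrow> 'l diag set" where
  "cobs L \<epsilon> \<epsilon>' = {(A, U).
     filter_mset (\<lambda>p. p \<noteq> None) (image_mset seg_tail A) = image_mset Some (mset_set (tail_pts \<epsilon> \<epsilon>')) \<and>
     filter_mset (\<lambda>p. p \<noteq> None) (image_mset seg_head A) = image_mset Some (mset_set (head_pts \<epsilon> \<epsilon>')) \<and>
     (\<forall>s\<in>#A. set (seg_word s) \<subseteq> L) \<and> (\<forall>c\<in>#U. cword_set c \<subseteq> L)}"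

definition cobs_no_inner :: "'l set \<Rightarrow> sign list \<Rightarrow> sign list \<Rightarrow> 'l diag set" where
  "cobs_no_inner L \<epsilon> \<epsilon>' =
     {(A, U) \<in> cobs L \<epsilon> \<epsilon>'. \<forall>s\<in>#A. seg_tail s \<noteq> None \<and> seg_head s \<noteq> None}"

definition map_diag :: "(pt \<Rightarrow> pt) \<Rightarrow> 'l diag \<Rightarrow> 'l diag" where
  "map_diag \<rho> = (\<lambda>(A, U).
     (image_mset (\<lambda>(t, h, w). (map_option \<rho> t, map_option \<rho> h, w)) A, U))"

text \<open>Join the head at \<open>Mid m\<close> to the tail at \<open>Mid m\<close> (when gluing, each occurs exactly once
  in the diagram); the segment containing the head is traversed first, so its word comes
  last.\<close>

definition glue :: "nat \<Rightarrow> 'l diag \<Rightarrow> 'l diag" where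
  "glue m = (\<lambda>(A, U).
     let s = (THE s. s \<in># A \<and> seg_head s = Some (Mid m));
         r = (THE r. r \<in># A \<and> seg_tail r = Some (Mid m))
     in if s = r then (A - {#s#}, add_mset (cyc (seg_word s)) U)
        else (add_mset (seg_tail s, seg_head r, seg_word r @ seg_word s) (A - {#s#} - {#r#}), U))"

definition glue_all :: "nat \<Rightarrow> 'l diag \<Rightarrow> 'l diag" where
  "glue_all n D = fold glue [0..<n] D"

fun top_to_mid :: "pt \<Rightarrow> pt" where
  "top_to_mid (Top i) = Mid i" | "top_to_mid p = p"

fun bot_to_mid :: "pt \<Rightarrow> pt" where
  "bot_to_mid (Bot i) = Mid i" | "bot_to_mid p = p"

text \<open>\<open>stack n E D\<close> is \<open>E\<close> on top of \<open>D\<close>, along \<open>n\<close> common points.\<close>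

definition stack :: "nat \<Rightarrow> 'l diag \<Rightarrow> 'l diag \<Rightarrow> 'l diag" where
  "stack n E D = glue_all n (map_diag top_to_mid D + map_diag bot_to_mid E)"

definition closure_diag :: "nat \<Rightarrow> 'l diag \<Rightarrow> 'l diag" where
  "closure_diag n D = glue_all n (map_diag (top_to_mid \<circ> bot_to_mid) D)"

definition id_diag :: "sign list \<Rightarrow> 'l diag" where
  "id_diag \<epsilon> = (mset (map (\<lambda>i. if \<epsilon> ! i = Pos then (Some (Bot i), Some (Top i), [])
                                 else (Some (Top i), Some (Bot i), [])) [0..<length \<epsilon>]), {#})"


section \<open>Linear combinations of cobordisms\<close>

abbreviation gen :: "'x \<Rightarrow> 'x \<Rightarrow>\<^sub>0 'k::field" where
  "gen d \<equiv> Poly_Mapping.single d 1"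

definition scale :: "'k::field \<Rightarrow> ('x \<Rightarrow>\<^sub>0 'k) \<Rightarrow> ('x \<Rightarrow>\<^sub>0 'k)" where
  "scale c f = Poly_Mapping.map ((*) c) f"

definition lin_ext :: "('x \<Rightarrow> ('y \<Rightarrow>\<^sub>0 'k::field)) \<Rightarrow> ('x \<Rightarrow>\<^sub>0 'k) \<Rightarrow> ('y \<Rightarrow>\<^sub>0 'k)" where
  "lin_ext \<phi> f = (\<Sum>d\<in>Poly_Mapping.keys f. scale (Poly_Mapping.lookup f d) (\<phi> d))"

definition lin_eval :: "('x \<Rightarrow> 'k::field) \<Rightarrow> ('x \<Rightarrow>\<^sub>0 'k) \<Rightarrow> 'k" where
  "lin_eval \<phi> f = (\<Sum>d\<in>Poly_Mapping.keys f. Poly_Mapping.lookup f d * \<phi> d)"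

definition relabel :: "(pt \<Rightarrow> pt) \<Rightarrow> ('l, 'k::field) lin \<Rightarrow> ('l, 'k) lin" where
  "relabel \<rho> = lin_ext (\<lambda>D. gen (map_diag \<rho> D))"

definition stack_lin ::
  "nat \<Rightarrow> ('l, 'k::field) lin \<Rightarrow> ('l, 'k) lin \<Rightarrow> ('l, 'k) lin" where
  "stack_lin n g f = lin_ext (\<lambda>E. lin_ext (\<lambda>D. gen (stack n E D)) f) g"

definition closure_lin :: "nat \<Rightarrow> ('l, 'k::field) lin \<Rightarrow> ('l, 'k) lin" where
  "closure_lin n = lin_ext (\<lambda>D. gen (closure_diag n D))"

definition free_cat ::
  "(sign list \<Rightarrow> sign list \<Rightarrow> 'l diag set) \<Rightarrow> (sign list, ('l, 'k::field) lin, 'k) lincat" where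
  "free_cat cob = \<lparr>
     Obj = UNIV,
     Arr = (\<lambda>\<epsilon> \<epsilon>'. {f. Poly_Mapping.keys f \<subseteq> cob \<epsilon> \<epsilon>'}),
     Cmp = (\<lambda>\<epsilon> \<epsilon>' \<epsilon>'' g f. stack_lin (length \<epsilon>') g f),
     Ide = (\<lambda>\<epsilon>. gen (id_diag \<epsilon>)),
     Add = (\<lambda>_ _ f g. f + g),
     Zer = (\<lambda>_ _. 0),
     Scl = (\<lambda>_ _ c f. scale c f)\<rparr>"


section \<open>The category of an evaluation\<close>

type_synonym ('a, 'k) evaluation = "('a list \<Rightarrow> 'k) \<times> ('a cword \<Rightarrow> 'k)"

text \<open>A closed cobordism is a union of floating intervals and circles.\<close>

definition eval_diag :: "('a, 'k::field) evaluation \<Rightarrow> 'a diag \<Rightarrow> 'k" where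
  "eval_diag \<alpha> = (\<lambda>(A, U). (\<Prod>s\<in>#A. fst \<alpha> (seg_word s)) * (\<Prod>c\<in>#U. snd \<alpha> c))"

definition eval_lin :: "('a, 'k::field) evaluation \<Rightarrow> ('a, 'k) lin \<Rightarrow> 'k" where
  "eval_lin \<alpha> = lin_eval (eval_diag \<alpha>)"

definition null ::
  "'a set \<Rightarrow> ('a, 'k::field) evaluation \<Rightarrow> sign list \<Rightarrow> sign list \<Rightarrow> ('a, 'k) lin set" where
  "null S \<alpha> \<epsilon> \<epsilon>' = {x \<in> Arr (free_cat (cobs S)) \<epsilon> \<epsilon>'. \<forall>y\<in>cobs S \<epsilon>' \<epsilon>.
     eval_lin \<alpha> (closure_lin (length \<epsilon>) (stack_lin (length \<epsilon>') (gen y) x)) = 0}"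

definition C_alpha ::
  "'a set \<Rightarrow> ('a, 'k::field) evaluation \<Rightarrow> (sign list, ('a, 'k) lin set, 'k) lincat" where
  "C_alpha S \<alpha> = quot (free_cat (cobs S)) (null S \<alpha>)"

definition rational :: "'a set \<Rightarrow> ('a, 'k::field) evaluation \<Rightarrow> bool" where
  "rational S \<alpha> \<longleftrightarrow> fin_dim (C_alpha S \<alpha>) [] [Pos, Neg]"

abbreviation cls :: "'a set \<Rightarrow> ('a, 'k::field) evaluation \<Rightarrow> sign list \<Rightarrow> sign list
    \<Rightarrow> ('a, 'k) lin \<Rightarrow> ('a, 'k) lin set" where
  "cls S \<alpha> \<equiv> coset (free_cat (cobs S)) (null S \<alpha>)"

text \<open>\<open>bend S \<alpha> \<rho> \<epsilon> \<epsilon>' F\<close> moves outer points of (the class) \<open>F\<close> along \<open>\<rho>\<close>, with result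
  in \<open>Hom(\<epsilon>, \<epsilon>')\<close>.\<close>

definition bend :: "'a set \<Rightarrow> ('a, 'k::field) evaluation \<Rightarrow> (pt \<Rightarrow> pt) \<Rightarrow>
    sign list \<Rightarrow> sign list \<Rightarrow> ('a, 'k) lin set \<Rightarrow> ('a, 'k) lin set" where
  "bend S \<alpha> \<rho> \<epsilon> \<epsilon>' F = (\<Union>f\<in>F. cls S \<alpha> \<epsilon> \<epsilon>' (relabel \<rho> f))"

fun shift :: "nat \<Rightarrow> nat \<Rightarrow> pt \<Rightarrow> pt" where
  "shift m n (Bot i) = Bot (m + i)"
| "shift m n (Top j) = Top (n + j)"
| "shift m n (Mid i) = Mid i"

text \<open>\<open>F \<otimes> G\<close> for \<open>F : \<epsilon> \<rightarrow> \<epsilon>'\<close> and \<open>G : \<delta> \<rightarrow> \<delta>'\<close>.\<close>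

definition tensor :: "'a set \<Rightarrow> ('a, 'k::field) evaluation \<Rightarrow>
    sign list \<Rightarrow> sign list \<Rightarrow> sign list \<Rightarrow> sign list \<Rightarrow>
    ('a, 'k) lin set \<Rightarrow> ('a, 'k) lin set \<Rightarrow> ('a, 'k) lin set" where
  "tensor S \<alpha> \<epsilon> \<epsilon>' \<delta> \<delta>' F G = (\<Union>f\<in>F. \<Union>g\<in>G.
     cls S \<alpha> (\<epsilon> @ \<delta>) (\<epsilon>' @ \<delta>') (f * relabel (shift (length \<epsilon>) (length \<epsilon>')) g))"

text \<open>The pairing of \<open>A(-)\<close> with \<open>A(+)\<close> joins the two outer points, both called \<open>Top 0\<close>.\<close>

definition pairing :: "('a, 'k::field) evaluation \<Rightarrow>
    ('a, 'k) lin set \<Rightarrow> ('a, 'k) lin set \<Rightarrow> 'k" where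
  "pairing \<alpha> W V = (THE c. \<exists>w\<in>W. \<exists>v\<in>V. c = eval_lin \<alpha>
     (lin_ext (\<lambda>D. gen (glue_all 1 D)) (relabel top_to_mid w * relabel top_to_mid v)))"

definition dual_basis :: "'a set \<Rightarrow> ('a, 'k::field) evaluation \<Rightarrow>
    ('a, 'k) lin set list \<Rightarrow> ('a, 'k) lin set list \<Rightarrow> bool" where
  "dual_basis S \<alpha> vs ws \<longleftrightarrow> length ws = length vs \<and> set ws \<subseteq> Arr (C_alpha S \<alpha>) [] [Neg] \<and>
     (\<forall>i<length vs. \<forall>j<length vs. pairing \<alpha> (ws ! j) (vs ! i) = (if i = j then 1 else 0))"


section \<open>The algebra structure on \<open>A(+-)\<close> and the ideal \<open>K\<close>\<close>

text \<open>In \<open>A(+-)\<close> the head is \<open>Top 0\<close> and the tail is \<open>Top 1\<close>.\<close>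

definition arc_to :: "pt \<Rightarrow> pt \<Rightarrow> pt \<Rightarrow> pt" where
  "arc_to t h p = (if p = Top 0 then h else t)"

definition end_plus :: "'a set \<Rightarrow> ('a, 'k::field) evaluation \<Rightarrow>
    ('a, 'k) lin set \<Rightarrow> ('a, 'k) lin set" where
  "end_plus S \<alpha> = bend S \<alpha> (arc_to (Bot 0) (Top 0)) [Pos] [Pos]"

definition end_minus :: "'a set \<Rightarrow> ('a, 'k::field) evaluation \<Rightarrow>
    ('a, 'k) lin set \<Rightarrow> ('a, 'k) lin set" where
  "end_minus S \<alpha> = bend S \<alpha> (arc_to (Top 0) (Bot 0)) [Neg] [Neg]"

definition from_end_plus :: "'a set \<Rightarrow> ('a, 'k::field) evaluation \<Rightarrow>
    ('a, 'k) lin set \<Rightarrow> ('a, 'k) lin set" where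
  "from_end_plus S \<alpha> = bend S \<alpha> (\<lambda>p. if p = Bot 0 then Top 1 else p) [] [Pos, Neg]"

definition one_arc :: "'a set \<Rightarrow> ('a, 'k::field) evaluation \<Rightarrow> ('a, 'k) lin set" where
  "one_arc S \<alpha> = cls S \<alpha> [] [Pos, Neg] (gen ({#(Some (Top 1), Some (Top 0), [])#}, {#}))"

definition K_carrier :: "'a set \<Rightarrow> ('a, 'k::field) evaluation \<Rightarrow> ('a, 'k) lin set set" where
  "K_carrier S \<alpha> = {x \<in> Arr (C_alpha S \<alpha>) [] [Pos, Neg]. \<forall>v\<in>Arr (C_alpha S \<alpha>) [] [Pos].
     Cmp (C_alpha S \<alpha>) [] [Pos] [Pos] (end_plus S \<alpha> x) v = Zer (C_alpha S \<alpha>) [] [Pos]}"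

definition K_one :: "'a set \<Rightarrow> ('a, 'k::field) evaluation \<Rightarrow>
    ('a, 'k) lin set list \<Rightarrow> ('a, 'k) lin set list \<Rightarrow> ('a, 'k) lin set" where
  "K_one S \<alpha> vs ws = Add (C_alpha S \<alpha>) [] [Pos, Neg] (one_arc S \<alpha>)
     (Scl (C_alpha S \<alpha>) [] [Pos, Neg] (- 1)
       (Sum (C_alpha S \<alpha>) [] [Pos, Neg] (map2 (tensor S \<alpha> [] [Pos] [] [Neg]) vs ws)))"

definition circular_closure :: "('a, 'k::field) evaluation \<Rightarrow> ('a, 'k) lin set \<Rightarrow> 'k" where
  "circular_closure \<alpha> X = (THE c. \<exists>x\<in>X. c = eval_lin \<alpha>
     (lin_ext (\<lambda>D. gen (glue_all 1 D)) (relabel (\<lambda>p. Mid 0) x)))"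

record ('k, 'b) trace_alg = "('k, 'b) module" +
  trace :: "'b \<Rightarrow> 'k"

definition K_alg :: "'a set \<Rightarrow> ('a, 'k::field) evaluation \<Rightarrow>
    ('a, 'k) lin set list \<Rightarrow> ('a, 'k) lin set list \<Rightarrow> ('k, ('a, 'k) lin set) trace_alg" where
  "K_alg S \<alpha> vs ws = \<lparr>
     carrier = K_carrier S \<alpha>,
     mult = (\<lambda>x y. from_end_plus S \<alpha>
       (Cmp (C_alpha S \<alpha>) [Pos] [Pos] [Pos] (end_plus S \<alpha> x) (end_plus S \<alpha> y))),
     one = K_one S \<alpha> vs ws,
     zero = Zer (C_alpha S \<alpha>) [] [Pos, Neg],
     add = Add (C_alpha S \<alpha>) [] [Pos, Neg],
     smult = Scl (C_alpha S \<alpha>) [] [Pos, Neg],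
     trace = circular_closure \<alpha>\<rparr>"


section \<open>The Frobenius--Brauer category\<close>

text \<open>Diagrams with a variable word at one place of one component.\<close>

definition contexts :: "('b list \<Rightarrow> 'b diag) set" where
  "contexts = {\<lambda>u. ({#(t, h, a @ u @ b)#}, {#}) + D | t h a b D. True} \<union>
              {\<lambda>u. ({#}, {#cyc (a @ u @ b)#}) + D | a b D. True}"

inductive_set brauer_rel ::
  "('k::field, 'b) trace_alg \<Rightarrow> sign list \<Rightarrow> sign list \<Rightarrow> ('b, 'k) lin set"
  for B \<epsilon> \<epsilon>' where
  zero: "0 \<in> brauer_rel B \<epsilon> \<epsilon>'"
| add: "\<lbrakk>f \<in> brauer_rel B \<epsilon> \<epsilon>'; g \<in> brauer_rel B \<epsilon> \<epsilon>'\<rbrakk> \<Longrightarrow> f + g \<in> brauer_rel B \<epsilon> \<epsilon>'"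
| scale: "f \<in> brauer_rel B \<epsilon> \<epsilon>' \<Longrightarrow> scale c f \<in> brauer_rel B \<epsilon> \<epsilon>'"
| dot_add: "\<lbrakk>\<Gamma> \<in> contexts; \<Gamma> [] \<in> cobs_no_inner (carrier B) \<epsilon> \<epsilon>'; x \<in> carrier B; y \<in> carrier B\<rbrakk>
    \<Longrightarrow> gen (\<Gamma> [x \<oplus>\<^bsub>B\<^esub> y]) - gen (\<Gamma> [x]) - gen (\<Gamma> [y]) \<in> brauer_rel B \<epsilon> \<epsilon>'"
| dot_smult: "\<lbrakk>\<Gamma> \<in> contexts; \<Gamma> [] \<in> cobs_no_inner (carrier B) \<epsilon> \<epsilon>'; x \<in> carrier B\<rbrakk>
    \<Longrightarrow> gen (\<Gamma> [c \<odot>\<^bsub>B\<^esub> x]) - scale c (gen (\<Gamma> [x])) \<in> brauer_rel B \<epsilon> \<epsilon>'"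
| dot_mult: "\<lbrakk>\<Gamma> \<in> contexts; \<Gamma> [] \<in> cobs_no_inner (carrier B) \<epsilon> \<epsilon>'; x \<in> carrier B; y \<in> carrier B\<rbrakk>
    \<Longrightarrow> gen (\<Gamma> [x, y]) - gen (\<Gamma> [x \<otimes>\<^bsub>B\<^esub> y]) \<in> brauer_rel B \<epsilon> \<epsilon>'"
| dot_one: "\<lbrakk>\<Gamma> \<in> contexts; \<Gamma> [] \<in> cobs_no_inner (carrier B) \<epsilon> \<epsilon>'\<rbrakk>
    \<Longrightarrow> gen (\<Gamma> [\<one>\<^bsub>B\<^esub>]) - gen (\<Gamma> []) \<in> brauer_rel B \<epsilon> \<epsilon>'"
| circle: "\<lbrakk>D \<in> cobs_no_inner (carrier B) \<epsilon> \<epsilon>'; x \<in> carrier B\<rbrakk>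
    \<Longrightarrow> gen (({#}, {#cyc [x]#}) + D) - scale (trace B x) (gen D) \<in> brauer_rel B \<epsilon> \<epsilon>'"

definition C_brauer' ::
  "('k::field, 'b) trace_alg \<Rightarrow> (sign list, ('b, 'k) lin set, 'k) lincat" where
  "C_brauer' B = quot (free_cat (cobs_no_inner (carrier B))) (brauer_rel B)"

definition brauer_closure ::
  "('k::field, 'b) trace_alg \<Rightarrow> sign list \<Rightarrow> ('b, 'k) lin set \<Rightarrow> ('b, 'k) lin set" where
  "brauer_closure B \<epsilon> X = (\<Union>x\<in>X.
     coset (free_cat (cobs_no_inner (carrier B))) (brauer_rel B) [] [] (closure_lin (length \<epsilon>) x))"

definition negligible ::
  "('k::field, 'b) trace_alg \<Rightarrow> sign list \<Rightarrow> sign list \<Rightarrow> ('b, 'k) lin set set" where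
  "negligible B \<epsilon> \<epsilon>' = {x \<in> Arr (C_brauer' B) \<epsilon> \<epsilon>'. \<forall>y\<in>Arr (C_brauer' B) \<epsilon>' \<epsilon>.
     brauer_closure B \<epsilon> (Cmp (C_brauer' B) \<epsilon> \<epsilon>' \<epsilon> y x) = Zer (C_brauer' B) [] []}"

definition C_brauer ::
  "('k::field, 'b) trace_alg \<Rightarrow> (sign list, ('b, 'k) lin set set, 'k) lincat" where
  "C_brauer B = quot (C_brauer' B) (negligible B)"


section \<open>The functor \<open>F\<close>\<close>

definition e0 :: "'a set \<Rightarrow> ('a, 'k::field) evaluation \<Rightarrow>
    ('a, 'k) lin set list \<Rightarrow> ('a, 'k) lin set list \<Rightarrow> sign \<Rightarrow> ('a, 'k) lin set" where
  "e0 S \<alpha> vs ws s = (case s of Pos \<Rightarrow> end_plus S \<alpha> (K_one S \<alpha> vs ws)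
                               | Neg \<Rightarrow> end_minus S \<alpha> (K_one S \<alpha> vs ws))"

fun e_tensor :: "'a set \<Rightarrow> ('a, 'k::field) evaluation \<Rightarrow>
    ('a, 'k) lin set list \<Rightarrow> ('a, 'k) lin set list \<Rightarrow> sign list \<Rightarrow> ('a, 'k) lin set" where
  "e_tensor S \<alpha> vs ws [] = Ide (C_alpha S \<alpha>) []"
| "e_tensor S \<alpha> vs ws (s # \<epsilon>) =
     tensor S \<alpha> [s] [s] \<epsilon> \<epsilon> (e0 S \<alpha> vs ws s) (e_tensor S \<alpha> vs ws \<epsilon>)"

definition word_prod :: "('k, 'b) trace_alg \<Rightarrow> 'b list \<Rightarrow> 'b" where
  "word_prod B w = foldr (mult B) w \<one>\<^bsub>B\<^esub>"

text \<open>On a diagram, \<open>F\<close> replaces every arc from \<open>t\<close> to \<open>h\<close> whose dots have product \<open>x\<close> in \<open>K\<close>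
  by (a linear combination representing) \<open>x\<close> itself, with head moved to \<open>h\<close> and tail to \<open>t\<close>,
  and every circle by the trace of the product of its dots.  An arc without dots carries
  the unit of \<open>K\<close>.\<close>

definition F_arc :: "('k::field, ('a, 'k) lin set) trace_alg \<Rightarrow>
    ('a, 'k) lin set seg \<Rightarrow> ('a, 'k) lin" where
  "F_arc B s = relabel (arc_to (the (seg_tail s)) (the (seg_head s)))
     (SOME f. f \<in> word_prod B (seg_word s))"

definition F_circle :: "('k::field, 'b) trace_alg \<Rightarrow> 'b cword \<Rightarrow> 'k" where
  "F_circle B c = trace B (word_prod B (SOME w. cyc w = c))"

definition F_diag :: "('k::field, ('a, 'k) lin set) trace_alg \<Rightarrow>
    ('a, 'k) lin set diag \<Rightarrow> ('a, 'k) lin" where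
  "F_diag B = (\<lambda>(A, U). scale (\<Prod>c\<in>#U. F_circle B c) (\<Prod>s\<in>#A. F_arc B s))"

definition F_functor :: "'a set \<Rightarrow> ('a, 'k::field) evaluation \<Rightarrow>
    ('a, 'k) lin set list \<Rightarrow> ('a, 'k) lin set list \<Rightarrow>
    (sign list, (('a, 'k) lin set, 'k) lin set set,
     sign list list \<times> ('a, 'k) lin set mat, ('a, 'k) lin set mat) ftr" where
  "F_functor S \<alpha> vs ws = \<lparr>
     FObj = (\<lambda>\<epsilon>. ([\<epsilon>], mat 1 1 (\<lambda>_. e_tensor S \<alpha> vs ws \<epsilon>))),
     FArr = (\<lambda>\<epsilon> \<epsilon>' X. mat 1 1 (\<lambda>_. \<Union>Y\<in>X. \<Union>f\<in>Y.
       cls S \<alpha> \<epsilon> \<epsilon>' (lin_ext (F_diag (K_alg S \<alpha> vs ws)) f)))\<rparr>"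

end

theory Submission imports Defs begin

text \<open>Both Karoubi envelopes are taken formally, as idempotent completions of additive completions, so
  it suffices that \<open>\<F>\<close> is full and faithful onto the arrows \<open>e\<^sub>\<epsilon>' \<circ> f \<circ> e\<^sub>\<epsilon>\<close>, where \<open>e\<^sub>\<epsilon>\<close> is the
  tensor product of the idempotents \<open>e\<^sub>0\<close>, and that the identity of every \<open>\<epsilon>\<close> is a sum of
  arrows factoring through some \<open>e\<^sub>\<delta>\<close>.

  Half-intervals are annihilated by \<open>e\<^sub>0\<close>, and modulo pairs of half-intervals an arc with word \<open>\<omega>\<close>
  is an arc labelled by an element of \<open>K\<close>. This gives fullness, and it shows that a morphism of the
  image pairs to zero with all cobordisms as soon as it does so with the image: negligibility means
  the same on both sides. Finally, expanding every strand by \<open>1 = 1\<^sub>K + (\<Sum>i. v\<^sup>i \<otimes> v\<^sub>i)\<close>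
  exhibits the identity of \<open>\<epsilon>\<close> as \<open>e\<^sub>\<epsilon>\<close> plus terms that factor through shorter sign sequences, to which
  induction applies.\<close>

section \<open>Equivalences of categories\<close>

text \<open>Forgetting the idempotents attached to the objects, F is the identity on sign sequences
  and respects composition, but it sends the identity of \<epsilon> to
  \<open>e\<^sub>\<epsilon>\<close>, because an arc without dots carries the unit of
  \<open>K\<close>. The categorical part is therefore formulated for such semifunctors; idempotent
  completion turns them back into functors.

  The obstacle on the diagram side is that F chooses representatives, so it respects gluing only
  modulo null combinations, and that elements of \<open>K\<close> have to be moved to all kinds of
  endpoints. Computations are therefore made with linear combinations of diagrams whose endpoints
  are arbitrary named points: disjoint union is a commutative product, composition is a product
  followed by gluing at the common points, and the null combinations \<open>nul\<close> are stable
  under products and partial gluings. Associativity, traces and ideal properties then reduce to two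
  facts: gluings at different points commute, and a factor that does not meet the glued points can
  be pulled out.\<close>

lemma is_equivalenceI:
  assumes F: "cat_functor C D F"
    and ff: "\<And>X Y. \<lbrakk>X \<in> Obj C; Y \<in> Obj C\<rbrakk>
      \<Longrightarrow> bij_betw (FArr F X Y) (Arr C X Y) (Arr D (FObj F X) (FObj F Y))"
    and es: "\<And>Y. Y \<in> Obj D \<Longrightarrow> \<exists>X\<in>Obj C. \<exists>f. is_iso D (FObj F X) Y f"
  shows "is_equivalence C D F"
proof -
  interpret F: cat_functor C D F by (rule F)
  note cl = F.FObj_closed F.FArr_closed F.C.Cmp_closed F.D.Cmp_closed F.C.Ide_closed F.D.Ide_closed
  \<comment> \<open>One tuple packs an object, an isomorphism \<open>p\<close> from its image onto
    \<open>Y\<close> and the inverse \<open>i\<close>, so that a single choice produces three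
    compatible functions of \<open>Y\<close>.\<close>
  define good where "good Y t \<longleftrightarrow> (case t of (X, p, i) \<Rightarrow> X \<in> Obj C \<and> p \<in> Arr D (FObj F X) Y
      \<and> i \<in> Arr D Y (FObj F X) \<and> Cmp D (FObj F X) Y (FObj F X) i p = Ide D (FObj F X)
      \<and> Cmp D Y (FObj F X) Y p i = Ide D Y)" for Y t
  have "\<forall>Y. \<exists>t. Y \<in> Obj D \<longrightarrow> good Y t"
  proof
    fix Y
    show "\<exists>t. Y \<in> Obj D \<longrightarrow> good Y t"
    proof (cases "Y \<in> Obj D")
      case True
      from es[OF this] obtain X p where "X \<in> Obj C" "is_iso D (FObj F X) Y p" by blast
      then show ?thesis unfolding is_iso_def good_def by (auto split: prod.splits)
    qed simp
  qed
  then obtain t where t: "\<And>Y. Y \<in> Obj D \<Longrightarrow> good Y (t Y)" by metis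
  define P where "P Y = fst (t Y)" for Y
  define p where "p Y = fst (snd (t Y))" for Y
  define i where "i Y = snd (snd (t Y))" for Y
  have P: "P Y \<in> Obj C" and p: "p Y \<in> Arr D (FObj F (P Y)) Y"
    and i: "i Y \<in> Arr D Y (FObj F (P Y))"
    and ip: "Cmp D (FObj F (P Y)) Y (FObj F (P Y)) (i Y) (p Y) = Ide D (FObj F (P Y))"
    and pi: "Cmp D Y (FObj F (P Y)) Y (p Y) (i Y) = Ide D Y" if "Y \<in> Obj D" for Y
    using t[OF that] unfolding good_def P_def p_def i_def by (auto split: prod.splits)
  define R where "R X Y = inv_into (Arr C X Y) (FArr F X Y)" for X Y
  have R: "R X Y g \<in> Arr C X Y" and FR: "FArr F X Y (R X Y g) = g"
    if "X \<in> Obj C" "Y \<in> Obj C" "g \<in> Arr D (FObj F X) (FObj F Y)" for X Y g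
    using ff[OF that(1,2)] that(3) unfolding R_def
    by (auto simp: bij_betw_def inv_into_into f_inv_into_f)
  have eqI: "f = g" if "X \<in> Obj C" "Y \<in> Obj C" "f \<in> Arr C X Y" "g \<in> Arr C X Y"
      "FArr F X Y f = FArr F X Y g" for X Y f g
    using ff[OF that(1,2)] that(3-5) by (auto simp: bij_betw_def inj_on_def)
  \<comment> \<open>The transport of \<open>g\<close> along the chosen isomorphisms; the
    quasi-inverse sends \<open>g\<close> to the unique preimage of this arrow under the bijection on
    hom-sets.\<close>
  define conj where "conj Y Z g = Cmp D (FObj F (P Y)) Y (FObj F (P Z))
      (Cmp D Y Z (FObj F (P Z)) (i Z) g) (p Y)" for Y Z g
  have conj: "conj Y Z g \<in> Arr D (FObj F (P Y)) (FObj F (P Z))"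
    if "Y \<in> Obj D" "Z \<in> Obj D" "g \<in> Arr D Y Z" for Y Z g
    unfolding conj_def using that by (intro cl P p i) auto
  define G where "G = \<lparr>FObj = P, FArr = (\<lambda>Y Z g. R (P Y) (P Z) (conj Y Z g))\<rparr>"
  have G: "FArr G Y Z g \<in> Arr C (P Y) (P Z)" and FG: "FArr F (P Y) (P Z) (FArr G Y Z g) = conj Y Z g"
    if "Y \<in> Obj D" "Z \<in> Obj D" "g \<in> Arr D Y Z" for Y Z g
    using R[OF P P conj] FR[OF P P conj] that by (auto simp: G_def)
  have [simp]: "FObj G Y = P Y" for Y by (simp add: G_def)
  have p_conj: "Cmp D (FObj F (P Y)) (FObj F (P Z)) Z (p Z) (conj Y Z g)
      = Cmp D (FObj F (P Y)) Y Z g (p Y)" if Y: "Y \<in> Obj D" and Z: "Z \<in> Obj D" and g: "g \<in> Arr D Y Z" for Y Z g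
  proof -
    note o = cl(1)[OF P[OF Y]] cl(1)[OF P[OF Z]]
    have "Cmp D (FObj F (P Y)) (FObj F (P Z)) Z (p Z) (conj Y Z g)
       = Cmp D (FObj F (P Y)) Y Z (Cmp D Y (FObj F (P Z)) Z (p Z) (Cmp D Y Z (FObj F (P Z)) (i Z) g)) (p Y)"
      unfolding conj_def by (rule F.D.Cmp_assoc) (use o Y Z g p i cl in auto)
    also have "Cmp D Y (FObj F (P Z)) Z (p Z) (Cmp D Y Z (FObj F (P Z)) (i Z) g)
        = Cmp D Y Z Z (Cmp D Z (FObj F (P Z)) Z (p Z) (i Z)) g"
      by (rule F.D.Cmp_assoc) (use o Y Z g p i cl in auto)
    also have "\<dots> = g" using pi[OF Z] F.D.Cmp_Ide_left[OF Y Z g] by simp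
    finally show ?thesis .
  qed
  have conj_Cmp: "conj X Z (Cmp D X Y Z g f)
      = Cmp D (FObj F (P X)) (FObj F (P Y)) (FObj F (P Z)) (conj Y Z g) (conj X Y f)"
    if X: "X \<in> Obj D" and Y: "Y \<in> Obj D" and Z: "Z \<in> Obj D"
      and f: "f \<in> Arr D X Y" and g: "g \<in> Arr D Y Z" for X Y Z f g
  proof -
    note o = cl(1)[OF P[OF X]] cl(1)[OF P[OF Y]] cl(1)[OF P[OF Z]]
    have "Cmp D (FObj F (P X)) (FObj F (P Y)) (FObj F (P Z)) (conj Y Z g) (conj X Y f)
      = Cmp D (FObj F (P X)) Y (FObj F (P Z)) (Cmp D Y Z (FObj F (P Z)) (i Z) g)
          (Cmp D (FObj F (P X)) (FObj F (P Y)) Y (p Y) (conj X Y f))"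
      unfolding conj_def[of Y] by (rule F.D.Cmp_assoc[symmetric]) (use o X Y Z f g p i cl conj in auto)
    also have "\<dots> = Cmp D (FObj F (P X)) Y (FObj F (P Z)) (Cmp D Y Z (FObj F (P Z)) (i Z) g)
          (Cmp D (FObj F (P X)) X Y f (p X))" by (simp add: p_conj[OF X Y f])
    also have "\<dots> = Cmp D (FObj F (P X)) X (FObj F (P Z))
        (Cmp D X Y (FObj F (P Z)) (Cmp D Y Z (FObj F (P Z)) (i Z) g) f) (p X)"
      by (rule F.D.Cmp_assoc) (use o X Y Z f g p i cl conj in auto)
    also have "Cmp D X Y (FObj F (P Z)) (Cmp D Y Z (FObj F (P Z)) (i Z) g) f
       = Cmp D X Z (FObj F (P Z)) (i Z) (Cmp D X Y Z g f)"
      by (rule F.D.Cmp_assoc[symmetric]) (use o X Y Z f g p i cl conj in auto)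
    finally show ?thesis by (simp add: conj_def)
  qed
  have conj_Ide: "conj Y Y (Ide D Y) = Ide D (FObj F (P Y))" if Y: "Y \<in> Obj D" for Y
    unfolding conj_def using F.D.Cmp_Ide_right[OF Y cl(1)[OF P[OF Y]] i[OF Y]] ip[OF Y] by simp
  have Gf: "cat_functor D C G"
  proof
    fix X Y f assume "X \<in> Obj D" "Y \<in> Obj D" "f \<in> Arr D X Y"
    then show "FArr G X Y f \<in> Arr C (FObj G X) (FObj G Y)" using G by simp
  next
    fix X assume X: "X \<in> Obj D"
    show "FArr G X X (Ide D X) = Ide C (FObj G X)"
      by (rule eqI[of "P X" "P X"])
        (use X P G FG F.D.Ide_closed F.C.Ide_closed F.FArr_Ide conj_Ide in auto)
  next
    fix X Y Z f g assume a: "X \<in> Obj D" "Y \<in> Obj D" "Z \<in> Obj D" "f \<in> Arr D X Y" "g \<in> Arr D Y Z"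
    show "FArr G X Z (Cmp D X Y Z g f)
      = Cmp C (FObj G X) (FObj G Y) (FObj G Z) (FArr G Y Z g) (FArr G X Y f)"
    proof (rule eqI[of "P X" "P Z"])
      show "FArr F (P X) (P Z) (FArr G X Z (Cmp D X Y Z g f)) = FArr F (P X) (P Z)
        (Cmp C (FObj G X) (FObj G Y) (FObj G Z) (FArr G Y Z g) (FArr G X Y f))"
        using a P G FG by (simp add: F.FArr_Cmp conj_Cmp F.D.Cmp_closed)
    qed (use a P G cl in auto)
  qed (use P in auto)
  \<comment> \<open>Fullness lifts the inverse and faithfulness lifts both inverse laws.\<close>
  have reflect: "is_iso C X Y f" if "X \<in> Obj C" "Y \<in> Obj C" "f \<in> Arr C X Y"
     "g \<in> Arr D (FObj F Y) (FObj F X)"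
     "Cmp D (FObj F X) (FObj F Y) (FObj F X) g (FArr F X Y f) = Ide D (FObj F X)"
     "Cmp D (FObj F Y) (FObj F X) (FObj F Y) (FArr F X Y f) g = Ide D (FObj F Y)" for X Y f g
    unfolding is_iso_def
  proof (intro conjI bexI[of _ "R Y X g"])
    show "Cmp C X Y X (R Y X g) f = Ide C X"
      by (rule eqI[of X X]) (use that R FR cl F.FArr_Cmp F.FArr_Ide in auto)
    show "Cmp C Y X Y f (R Y X g) = Ide C Y"
      by (rule eqI[of Y Y]) (use that R FR cl F.FArr_Cmp F.FArr_Ide in auto)
  qed (use that R in auto)
  define \<eta> where "\<eta> X = R X (P (FObj F X)) (i (FObj F X))" for X
  have \<eta>: "\<eta> X \<in> Arr C X (P (FObj F X))" "FArr F X (P (FObj F X)) (\<eta> X) = i (FObj F X)"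
    if "X \<in> Obj C" for X
    unfolding \<eta>_def using that by (auto intro!: R FR P i cl)
  have "naturally_isomorphic C C id_ftr (comp_ftr G F)"
    unfolding naturally_isomorphic_def
  proof (intro exI[of _ \<eta>] conjI ballI)
    fix X assume X: "X \<in> Obj C"
    show "is_iso C (FObj id_ftr X) (FObj (comp_ftr G F) X) (\<eta> X)"
      using reflect[OF X P[OF cl(1)[OF X]] \<eta>(1)[OF X] p[OF cl(1)[OF X]]]
        pi[OF cl(1)[OF X]] ip[OF cl(1)[OF X]] \<eta>(2)[OF X]
      by (simp add: id_ftr_def comp_ftr_def)
  next
    fix X Y f assume X: "X \<in> Obj C" and Y: "Y \<in> Obj C" and f: "f \<in> Arr C X Y"
    let ?X = "FObj F X" and ?Y = "FObj F Y" and ?f = "FArr F X Y f"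
    have o: "?X \<in> Obj D" "?Y \<in> Obj D" "?f \<in> Arr D ?X ?Y" "P ?X \<in> Obj C" "P ?Y \<in> Obj C"
      using X Y f cl P by auto
    have "Cmp D ?X (FObj F (P ?X)) (FObj F (P ?Y)) (conj ?X ?Y ?f) (i ?X) =
       Cmp D ?X ?X (FObj F (P ?Y)) (Cmp D ?X ?Y (FObj F (P ?Y)) (i ?Y) ?f)
        (Cmp D ?X (FObj F (P ?X)) ?X (p ?X) (i ?X))"
      unfolding conj_def by (rule F.D.Cmp_assoc[symmetric]) (use o cl p i in auto)
    also have "\<dots> = Cmp D ?X ?Y (FObj F (P ?Y)) (i ?Y) ?f"
      using pi[OF o(1)] o cl i F.D.Cmp_Ide_right by simp
    finally have *: "Cmp D ?X (FObj F (P ?X)) (FObj F (P ?Y)) (conj ?X ?Y ?f) (i ?X)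
       = Cmp D ?X ?Y (FObj F (P ?Y)) (i ?Y) ?f" .
    have "Cmp C X Y (P ?Y) (\<eta> Y) f = Cmp C X (P ?X) (P ?Y) (FArr G ?X ?Y ?f) (\<eta> X)"
      by (rule eqI[of X "P ?Y"]) (use X Y f o \<eta> G FG cl F.FArr_Cmp * in auto)
    then show "Cmp C (FObj id_ftr X) (FObj id_ftr Y) (FObj (comp_ftr G F) Y) (\<eta> Y) (FArr id_ftr X Y f)
      = Cmp C (FObj id_ftr X) (FObj (comp_ftr G F) X) (FObj (comp_ftr G F) Y)
        (FArr (comp_ftr G F) X Y f) (\<eta> X)"
      by (simp add: id_ftr_def comp_ftr_def)
  qed
  moreover have "naturally_isomorphic D D (comp_ftr F G) id_ftr"
    unfolding naturally_isomorphic_def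
  proof (intro exI[of _ p] conjI ballI)
    fix Y assume Y: "Y \<in> Obj D"
    show "is_iso D (FObj (comp_ftr F G) Y) (FObj id_ftr Y) (p Y)"
      using p[OF Y] i[OF Y] ip[OF Y] pi[OF Y] by (auto simp: is_iso_def id_ftr_def comp_ftr_def)
  next
    fix X Y g assume "X \<in> Obj D" "Y \<in> Obj D" "g \<in> Arr D X Y"
    then show "Cmp D (FObj (comp_ftr F G) X) (FObj (comp_ftr F G) Y) (FObj id_ftr Y) (p Y)
        (FArr (comp_ftr F G) X Y g)
      = Cmp D (FObj (comp_ftr F G) X) (FObj id_ftr X) (FObj id_ftr Y) (FArr id_ftr X Y g) (p X)"
      by (simp add: id_ftr_def comp_ftr_def FG p_conj)
  qed
  ultimately show ?thesis unfolding is_equivalence_def using F Gf by blast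
qed

section \<open>Idempotent completion\<close>

text \<open>Absorbing \<open>e\<close> or \<open>e'\<close> a second time changes nothing, since
  both are idempotent. The two one-sided conditions are easier to use than the sandwich that defines
  the arrows of \<open>idem_env\<close>, because each of them survives composition by associativity
  alone.\<close>

lemma (in category) idem_absorb:
  assumes "X \<in> Obj C" "Y \<in> Obj C" "e \<in> Arr C X X" "Cmp C X X X e e = e"
    "e' \<in> Arr C Y Y" "Cmp C Y Y Y e' e' = e'" "f \<in> Arr C X Y"
  shows "Cmp C X Y Y e' (Cmp C X X Y f e) = f \<longleftrightarrow> Cmp C X X Y f e = f \<and> Cmp C X Y Y e' f = f"
proof
  assume f: "Cmp C X Y Y e' (Cmp C X X Y f e) = f"
  have fe: "Cmp C X X Y f e \<in> Arr C X Y" using assms Cmp_closed by simp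
  have "Cmp C X Y Y e' f = Cmp C X Y Y (Cmp C Y Y Y e' e') (Cmp C X X Y f e)"
    using Cmp_assoc[of X Y Y Y "Cmp C X X Y f e" e' e'] assms fe f by simp
  then have 1: "Cmp C X Y Y e' f = f" using assms f by simp
  have "Cmp C X X Y f e = Cmp C X X Y (Cmp C X Y Y e' (Cmp C X X Y f e)) e" using f by simp
  also have "\<dots> = Cmp C X Y Y e' (Cmp C X X Y (Cmp C X X Y f e) e)"
    using Cmp_assoc[of X X Y Y e "Cmp C X X Y f e" e'] assms fe by simp
  also have "Cmp C X X Y (Cmp C X X Y f e) e = Cmp C X X Y f e"
    using Cmp_assoc[of X X X Y e e f] assms by simp
  finally show "Cmp C X X Y f e = f \<and> Cmp C X Y Y e' f = f" using f 1 by simp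
qed auto

lemma mem_Obj_idem_env:
  "(X, e) \<in> Obj (idem_env C) \<longleftrightarrow> X \<in> Obj C \<and> e \<in> Arr C X X \<and> Cmp C X X X e e = e"
  by (simp add: idem_env_def)

lemma mem_Arr_idem_env:
  fixes C :: "('o, 'm, 'k) lincat"
  assumes "category C" "(X, e) \<in> Obj (idem_env C)" "(Y, e') \<in> Obj (idem_env C)"
  shows "f \<in> Arr (idem_env C) (X, e) (Y, e') \<longleftrightarrow>
    f \<in> Arr C X Y \<and> Cmp C X X Y f e = f \<and> Cmp C X Y Y e' f = f"
  using category.idem_absorb[OF assms(1), of X Y e e' f] assms by (auto simp: idem_env_def)

lemma category_idem_env:
  fixes C :: "('o, 'm, 'k) lincat"
  assumes "category C"
  shows "category (idem_env C)"
proof -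
  interpret category C by fact
  note arr = mem_Arr_idem_env[OF assms]
  have cmp: "Cmp (idem_env C) (X, e) (Y, e') (Z, e'') = Cmp C X Y Z" for X Y Z e e' e''
    by (simp add: idem_env_def)
  show ?thesis
  proof
    fix P assume "P \<in> Obj (idem_env C)"
    then show "Ide (idem_env C) P \<in> Arr (idem_env C) P P"
      by (cases P) (auto simp: mem_Obj_idem_env arr idem_env_def)
  next
    fix P Q R f g assume a: "P \<in> Obj (idem_env C)" "Q \<in> Obj (idem_env C)" "R \<in> Obj (idem_env C)"
      "f \<in> Arr (idem_env C) P Q" "g \<in> Arr (idem_env C) Q R"
    obtain X e Y e' Z e'' where [simp]: "P = (X, e)" "Q = (Y, e')" "R = (Z, e'')"
      by (cases P; cases Q; cases R) auto
    show "Cmp (idem_env C) P Q R g f \<in> Arr (idem_env C) P R"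
      using a Cmp_assoc[of X X Y Z e f g] Cmp_assoc[of X Y Z Z f g e'']
      by (auto simp: arr cmp mem_Obj_idem_env Cmp_closed)
  next
    fix P Q R T f g h assume a: "P \<in> Obj (idem_env C)" "Q \<in> Obj (idem_env C)" "R \<in> Obj (idem_env C)"
      "T \<in> Obj (idem_env C)"
      "f \<in> Arr (idem_env C) P Q" "g \<in> Arr (idem_env C) Q R" "h \<in> Arr (idem_env C) R T"
    obtain X e Y e' Z e'' W e3 where [simp]: "P = (X, e)" "Q = (Y, e')" "R = (Z, e'')" "T = (W, e3)"
      by (cases P; cases Q; cases R; cases T) auto
    show "Cmp (idem_env C) P R T h (Cmp (idem_env C) P Q R g f)
      = Cmp (idem_env C) P Q T (Cmp (idem_env C) Q R T h g) f"
      using a by (auto simp: arr cmp mem_Obj_idem_env intro!: Cmp_assoc)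
  next
    fix P Q f assume a: "P \<in> Obj (idem_env C)" "Q \<in> Obj (idem_env C)" "f \<in> Arr (idem_env C) P Q"
    obtain X e Y e' where [simp]: "P = (X, e)" "Q = (Y, e')" by (cases P; cases Q) auto
    show "Cmp (idem_env C) P P Q f (Ide (idem_env C) P) = f"
        "Cmp (idem_env C) P Q Q (Ide (idem_env C) Q) f = f"
      using a by (simp_all add: arr cmp) (simp_all add: idem_env_def)
  qed
qed

text \<open>Think of a fully faithful functor into the idempotent completion that sends
  \<open>X\<close> to \<open>(obj X, \<phi> X X (Ide C X))\<close>, with the idempotent dropped from
  the object. Hence \<open>full\<close> asks only for the arrows that absorb these
  idempotents.\<close>

locale semifunctor = C: category C + D: category D
  for C :: "('o1, 'm1, 'k1) lincat" and D :: "('o2, 'm2, 'k2) lincat" +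
  fixes obj :: "'o1 \<Rightarrow> 'o2" and \<phi> :: "'o1 \<Rightarrow> 'o1 \<Rightarrow> 'm1 \<Rightarrow> 'm2"
  assumes obj_closed: "X \<in> Obj C \<Longrightarrow> obj X \<in> Obj D"
    and closed: "\<lbrakk>X \<in> Obj C; Y \<in> Obj C; f \<in> Arr C X Y\<rbrakk> \<Longrightarrow> \<phi> X Y f \<in> Arr D (obj X) (obj Y)"
    and Cmp: "\<lbrakk>X \<in> Obj C; Y \<in> Obj C; Z \<in> Obj C; f \<in> Arr C X Y; g \<in> Arr C Y Z\<rbrakk>
      \<Longrightarrow> \<phi> X Z (Cmp C X Y Z g f) = Cmp D (obj X) (obj Y) (obj Z) (\<phi> Y Z g) (\<phi> X Y f)"
    and faithful: "\<lbrakk>X \<in> Obj C; Y \<in> Obj C\<rbrakk> \<Longrightarrow> inj_on (\<phi> X Y) (Arr C X Y)"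
    and full: "\<lbrakk>X \<in> Obj C; Y \<in> Obj C; h \<in> Arr D (obj X) (obj Y);
        Cmp D (obj X) (obj X) (obj Y) h (\<phi> X X (Ide C X)) = h;
        Cmp D (obj X) (obj Y) (obj Y) (\<phi> Y Y (Ide C Y)) h = h\<rbrakk>
      \<Longrightarrow> h \<in> \<phi> X Y ` Arr C X Y"

text \<open>The functor induced by a semifunctor sends \<open>(X, e)\<close> to \<open>(obj X, \<phi> e)\<close>, which makes sense
  even though \<open>\<phi>\<close> need not preserve identities.\<close>

definition idem_functor ::
  "('o1 \<Rightarrow> 'o2) \<Rightarrow> ('o1 \<Rightarrow> 'o1 \<Rightarrow> 'm1 \<Rightarrow> 'm2) \<Rightarrow> ('o1 \<times> 'm1, 'm1, 'o2 \<times> 'm2, 'm2) ftr" where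
  "idem_functor obj \<phi> = \<lparr>FObj = (\<lambda>(X, e). (obj X, \<phi> X X e)), FArr = (\<lambda>(X, _) (Y, _) f. \<phi> X Y f)\<rparr>"

text \<open>Essential surjectivity is the point. By \<open>retract\<close> every object
  \<open>(Y, e)\<close> is a retract of some \<open>(obj Z, \<phi> Z Z (Ide C Z))\<close>, so it is
  split off by an idempotent on \<open>obj Z\<close>, which \<open>full\<close> lifts to
  \<open>Z\<close>; \<open>faithful\<close> makes the lift idempotent.\<close>

lemma (in semifunctor) is_equivalence_idem_functor:
  assumes retract: "\<And>Y. Y \<in> Obj D \<Longrightarrow> \<exists>Z\<in>Obj C. \<exists>a\<in>Arr D (obj Z) Y. \<exists>b\<in>Arr D Y (obj Z).
    Cmp D Y (obj Z) Y a (Cmp D Y (obj Z) (obj Z) (\<phi> Z Z (Ide C Z)) b) = Ide D Y"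
  shows "is_equivalence (idem_env C) (idem_env D) (idem_functor obj \<phi>)"
proof (rule is_equivalenceI)
  note Carr = mem_Arr_idem_env[OF C.category_axioms] and Darr = mem_Arr_idem_env[OF D.category_axioms]
  have FO: "FObj (idem_functor obj \<phi>) (X, e) = (obj X, \<phi> X X e)" for X e
    by (simp add: idem_functor_def)
  have FA: "FArr (idem_functor obj \<phi>) (X, e) (Y, e') f = \<phi> X Y f" for X e Y e' f
    by (simp add: idem_functor_def)
  have FO_closed: "(obj X, \<phi> X X e) \<in> Obj (idem_env D)" if "(X, e) \<in> Obj (idem_env C)" for X e
    using that closed[of X X e] Cmp[of X X X e e] by (auto simp: mem_Obj_idem_env obj_closed)
  have FA_closed: "\<phi> X Y f \<in> Arr (idem_env D) (obj X, \<phi> X X e) (obj Y, \<phi> Y Y e')"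
    if "(X, e) \<in> Obj (idem_env C)" "(Y, e') \<in> Obj (idem_env C)" "f \<in> Arr (idem_env C) (X, e) (Y, e')"
    for X e Y e' f
    using that Cmp[of X X Y e f] Cmp[of X Y Y f e'] closed[of X Y f]
    by (simp add: Carr Darr FO_closed) (simp add: mem_Obj_idem_env)
  have cmpC: "Cmp (idem_env C) (X, e) (Y, e') (Z, e'') = Cmp C X Y Z" for X Y Z e e' e''
    by (simp add: idem_env_def)
  have cmpD: "Cmp (idem_env D) (X, e) (Y, e') (Z, e'') = Cmp D X Y Z" for X Y Z e e' e''
    by (simp add: idem_env_def)
  have ideC: "Ide (idem_env C) (X, e) = e" and ideD: "Ide (idem_env D) (X', e2) = e2" for X e X' e2
    by (simp_all add: idem_env_def)
  show "cat_functor (idem_env C) (idem_env D) (idem_functor obj \<phi>)"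
  proof -
    interpret C': category "idem_env C" by (rule category_idem_env) unfold_locales
    interpret D': category "idem_env D" by (rule category_idem_env) unfold_locales
    show ?thesis
    proof
      fix P assume "P \<in> Obj (idem_env C)"
      then show "FObj (idem_functor obj \<phi>) P \<in> Obj (idem_env D)"
        "FArr (idem_functor obj \<phi>) P P (Ide (idem_env C) P) = Ide (idem_env D) (FObj (idem_functor obj \<phi>) P)"
        by (cases P; simp add: FO FO_closed FA ideC ideD)+
    next
      fix P Q f assume "P \<in> Obj (idem_env C)" "Q \<in> Obj (idem_env C)" "f \<in> Arr (idem_env C) P Q"
      then show "FArr (idem_functor obj \<phi>) P Q f
        \<in> Arr (idem_env D) (FObj (idem_functor obj \<phi>) P) (FObj (idem_functor obj \<phi>) Q)"
        by (cases P; cases Q) (simp add: FO FA FA_closed)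
    next
      fix P Q R f g assume "P \<in> Obj (idem_env C)" "Q \<in> Obj (idem_env C)" "R \<in> Obj (idem_env C)"
        "f \<in> Arr (idem_env C) P Q" "g \<in> Arr (idem_env C) Q R"
      then show "FArr (idem_functor obj \<phi>) P R (Cmp (idem_env C) P Q R g f) =
        Cmp (idem_env D) (FObj (idem_functor obj \<phi>) P) (FObj (idem_functor obj \<phi>) Q)
         (FObj (idem_functor obj \<phi>) R)
         (FArr (idem_functor obj \<phi>) Q R g) (FArr (idem_functor obj \<phi>) P Q f)"
        by (cases P; cases Q; cases R) (auto simp: FO FA cmpC cmpD Carr mem_Obj_idem_env Cmp)
    qed
  qed
  \<comment> \<open>The image of the identity is a unit for the whole image of \<phi>, so an arrow
    that absorbs \<open>\<phi> X X e\<close> also absorbs \<open>\<phi> X X (Ide C X)\<close>, and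
    \<open>full\<close> applies.\<close>
  have lift: "\<exists>f\<in>Arr C X Y. \<phi> X Y f = g"
    if X: "X \<in> Obj C" and Y: "Y \<in> Obj C" and e: "e \<in> Arr C X X" "e' \<in> Arr C Y Y"
      and g: "g \<in> Arr D (obj X) (obj Y)"
      "Cmp D (obj X) (obj X) (obj Y) g (\<phi> X X e) = g" "Cmp D (obj X) (obj Y) (obj Y) (\<phi> Y Y e') g = g"
    for X Y e e' g
  proof -
    note o = obj_closed[OF X] obj_closed[OF Y]
    have "Cmp D (obj X) (obj X) (obj Y) g (\<phi> X X (Ide C X))
      = Cmp D (obj X) (obj X) (obj Y) g (Cmp D (obj X) (obj X) (obj X) (\<phi> X X e) (\<phi> X X (Ide C X)))"
      using D.Cmp_assoc[of "obj X" "obj X" "obj X" "obj Y" "\<phi> X X (Ide C X)" "\<phi> X X e" g] o g(1,2)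
        closed[OF X X e(1)] closed[OF X X C.Ide_closed[OF X]] by simp
    also have "\<dots> = g"
      using Cmp[OF X X X C.Ide_closed[OF X] e(1)] C.Cmp_Ide_right[OF X X e(1)] g(2) by simp
    finally have 1: "Cmp D (obj X) (obj X) (obj Y) g (\<phi> X X (Ide C X)) = g" .
    have "Cmp D (obj X) (obj Y) (obj Y) (\<phi> Y Y (Ide C Y)) g
      = Cmp D (obj X) (obj Y) (obj Y) (Cmp D (obj Y) (obj Y) (obj Y) (\<phi> Y Y (Ide C Y)) (\<phi> Y Y e')) g"
      using D.Cmp_assoc[of "obj X" "obj Y" "obj Y" "obj Y" g "\<phi> Y Y e'" "\<phi> Y Y (Ide C Y)"] o g(1,3)
        closed[OF Y Y e(2)] closed[OF Y Y C.Ide_closed[OF Y]] by simp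
    also have "\<dots> = g"
      using Cmp[OF Y Y Y e(2) C.Ide_closed[OF Y]] C.Cmp_Ide_left[OF Y Y e(2)] g(3) by simp
    finally have 2: "Cmp D (obj X) (obj Y) (obj Y) (\<phi> Y Y (Ide C Y)) g = g" .
    from full[OF X Y g(1) 1 2] show ?thesis by auto
  qed
  show "bij_betw (FArr (idem_functor obj \<phi>) P Q) (Arr (idem_env C) P Q)
      (Arr (idem_env D) (FObj (idem_functor obj \<phi>) P) (FObj (idem_functor obj \<phi>) Q))"
    if PQ: "P \<in> Obj (idem_env C)" "Q \<in> Obj (idem_env C)" for P Q
  proof -
    obtain X e Y e' where [simp]: "P = (X, e)" "Q = (Y, e')" by (cases P; cases Q) auto
    have o: "X \<in> Obj C" "Y \<in> Obj C" "e \<in> Arr C X X" "e' \<in> Arr C Y Y"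
      using PQ by (auto simp: mem_Obj_idem_env)
    have "\<exists>f\<in>Arr (idem_env C) P Q. \<phi> X Y f = g"
      if "g \<in> Arr (idem_env D) (obj X, \<phi> X X e) (obj Y, \<phi> Y Y e')" for g
    proof -
      have g: "g \<in> Arr D (obj X) (obj Y)" "Cmp D (obj X) (obj X) (obj Y) g (\<phi> X X e) = g"
        "Cmp D (obj X) (obj Y) (obj Y) (\<phi> Y Y e') g = g"
        using that PQ by (auto simp: Darr FO_closed)
      from lift[OF o g] obtain f where f: "f \<in> Arr C X Y" "\<phi> X Y f = g" by blast
      have "Cmp C X X Y f e = f"
        by (rule inj_onD[OF faithful[of X Y]])
          (use o f g Cmp[of X X Y e f] C.Cmp_closed[of X X Y e f] in auto)
      moreover have "Cmp C X Y Y e' f = f"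
        by (rule inj_onD[OF faithful[of X Y]])
          (use o f g Cmp[of X Y Y f e'] C.Cmp_closed[of X Y Y f e'] in auto)
      ultimately show ?thesis using f PQ by (auto simp: Carr)
    qed
    moreover have "inj_on (\<phi> X Y) (Arr (idem_env C) P Q)"
      using faithful[OF o(1,2)] PQ by (auto simp: inj_on_def Carr)
    ultimately show ?thesis
      using FA_closed PQ by (auto simp: bij_betw_def FO FA[abs_def] FA inj_on_def image_iff)
  qed
  show "\<exists>P\<in>Obj (idem_env C). \<exists>f. is_iso (idem_env D) (FObj (idem_functor obj \<phi>) P) Q f"
    if Q: "Q \<in> Obj (idem_env D)" for Q
  proof -
    obtain Y e where [simp]: "Q = (Y, e)" by (cases Q)
    have Y: "Y \<in> Obj D" and e: "e \<in> Arr D Y Y" "Cmp D Y Y Y e e = e"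
      using Q by (auto simp: mem_Obj_idem_env)
    obtain Z a b where Z: "Z \<in> Obj C" and a: "a \<in> Arr D (obj Z) Y" and b: "b \<in> Arr D Y (obj Z)"
      and ab: "Cmp D Y (obj Z) Y a (Cmp D Y (obj Z) (obj Z) (\<phi> Z Z (Ide C Z)) b) = Ide D Y"
      using retract[OF Y] by blast
    let ?Z = "obj Z" and ?i = "\<phi> Z Z (Ide C Z)"
    note oZ = obj_closed[OF Z]
    have i: "?i \<in> Arr D ?Z ?Z" by (rule closed[OF Z Z C.Ide_closed[OF Z]])
    have ii: "Cmp D ?Z ?Z ?Z ?i ?i = ?i"
      using Cmp[OF Z Z Z C.Ide_closed C.Ide_closed] C.Cmp_Ide_left[OF Z Z C.Ide_closed] Z by simp
    \<comment> \<open>The retraction data are cut down by \<open>e\<close> on one side and by the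
      image of the identity on the other. Then \<open>a'\<close> after \<open>b'\<close> is
      \<open>e\<close>, and \<open>b'\<close> after \<open>a'\<close> is the idempotent on
      \<open>obj Z\<close> that represents \<open>(Y, e)\<close>.\<close>
    define a' where "a' = Cmp D ?Z Y Y e (Cmp D ?Z ?Z Y a ?i)"
    define b' where "b' = Cmp D Y Y ?Z (Cmp D Y ?Z ?Z ?i b) e"
    note cl = D.Cmp_closed
    have ai: "Cmp D ?Z ?Z Y a ?i \<in> Arr D ?Z Y" and ib: "Cmp D Y ?Z ?Z ?i b \<in> Arr D Y ?Z"
      using a b i oZ Y cl by auto
    have a': "a' \<in> Arr D ?Z Y" and b': "b' \<in> Arr D Y ?Z"
      unfolding a'_def b'_def using ai ib e Y oZ cl by auto
    have ea': "Cmp D ?Z Y Y e a' = a'"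
      unfolding a'_def using D.Cmp_assoc[of ?Z Y Y Y _ e e] ai e Y oZ by simp
    have a'i: "Cmp D ?Z ?Z Y a' ?i = a'"
      unfolding a'_def using D.Cmp_assoc[of ?Z ?Z Y Y ?i "Cmp D ?Z ?Z Y a ?i" e]
        D.Cmp_assoc[of ?Z ?Z ?Z Y ?i ?i a] ii ai a i e Y oZ by simp
    have b'e: "Cmp D Y Y ?Z b' e = b'"
      unfolding b'_def using D.Cmp_assoc[of Y Y Y ?Z e e] ib e Y oZ by simp
    have ib': "Cmp D Y ?Z ?Z ?i b' = b'"
      unfolding b'_def using D.Cmp_assoc[of Y Y ?Z ?Z e "Cmp D Y ?Z ?Z ?i b" ?i]
        D.Cmp_assoc[of Y ?Z ?Z ?Z b ?i ?i] ii ib b i e Y oZ by simp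
    have "Cmp D Y ?Z Y a' b' = Cmp D Y ?Z Y (Cmp D ?Z Y Y e a) b'"
    proof -
      have "a' = Cmp D ?Z ?Z Y (Cmp D ?Z Y Y e a) ?i"
        unfolding a'_def by (rule D.Cmp_assoc) (use a i e Y oZ in auto)
      then show ?thesis
        using D.Cmp_assoc[of Y ?Z ?Z Y b' ?i "Cmp D ?Z Y Y e a"] b' i ib' a e Y oZ cl by simp
    qed
    also have "\<dots> = Cmp D Y Y Y e (Cmp D Y ?Z Y a b')"
      by (rule D.Cmp_assoc[symmetric]) (use a b' e Y oZ in auto)
    also have "Cmp D Y ?Z Y a b' = Cmp D Y Y Y (Ide D Y) e"
      unfolding b'_def using D.Cmp_assoc[of Y Y ?Z Y e "Cmp D Y ?Z ?Z ?i b" a] ab a ib e Y oZ by simp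
    also have "Cmp D Y Y Y e \<dots> = e" using D.Cmp_Ide_left[OF Y Y e(1)] e by simp
    finally have a'b': "Cmp D Y ?Z Y a' b' = e" .
    let ?f = "Cmp D ?Z Y ?Z b' a'"
    have f: "?f \<in> Arr D ?Z ?Z" using a' b' Y oZ cl by auto
    have "Cmp D ?Z ?Z ?Z ?f ?i = ?f" "Cmp D ?Z ?Z ?Z ?i ?f = ?f"
      using D.Cmp_assoc[of ?Z ?Z Y ?Z ?i a' b'] D.Cmp_assoc[of ?Z Y ?Z ?Z a' b' ?i]
        a'i ib' a' b' i Y oZ by auto
    then obtain g where g: "g \<in> Arr C Z Z" and fg: "\<phi> Z Z g = ?f"
      using full[OF Z Z f] by auto
    have ff: "Cmp D ?Z ?Z ?Z ?f ?f = ?f"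
    proof -
      have "Cmp D ?Z ?Z ?Z ?f ?f = Cmp D ?Z Y ?Z b' (Cmp D ?Z ?Z Y a' ?f)"
        by (rule D.Cmp_assoc[symmetric]) (use a' b' f Y oZ in auto)
      also have "Cmp D ?Z ?Z Y a' ?f = Cmp D ?Z Y Y (Cmp D Y ?Z Y a' b') a'"
        by (rule D.Cmp_assoc) (use a' b' f Y oZ in auto)
      finally show ?thesis using a'b' ea' by simp
    qed
    have gg: "Cmp C Z Z Z g g = g"
      by (rule inj_onD[OF faithful[OF Z Z]])
        (use Cmp[OF Z Z Z g g] fg ff C.Cmp_closed[OF Z Z Z g g] g in auto)
    have P: "(Z, g) \<in> Obj (idem_env C)" using Z g gg by (simp add: mem_Obj_idem_env)
    have P': "(?Z, ?f) \<in> Obj (idem_env D)" using FO_closed[OF P] fg by simp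
    have a'f: "Cmp D ?Z ?Z Y a' ?f = a'"
      using D.Cmp_assoc[of ?Z Y ?Z Y a' b' a'] a'b' ea' a' b' Y oZ by simp
    have fb': "Cmp D Y ?Z ?Z ?f b' = b'"
      using D.Cmp_assoc[of Y ?Z Y ?Z b' a' b'] a'b' b'e a' b' Y oZ by simp
    have "is_iso (idem_env D) (?Z, ?f) (Y, e) a'"
      unfolding is_iso_def using Q P'
      by (auto simp: Darr cmpD ideD a' b' ea' a'f fb' b'e a'b' intro!: bexI[of _ b'])
    then show ?thesis using P fg by (intro bexI[of _ "(Z, g)"] exI[of _ a']) (auto simp: FO)
  qed
qed

section \<open>Preadditive categories and matrices\<close>

locale preadditive = category C for C :: "('o, 'm, 'k) lincat" +
  assumes Zer_closed: "\<lbrakk>X \<in> Obj C; Y \<in> Obj C\<rbrakk> \<Longrightarrow> Zer C X Y \<in> Arr C X Y"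
    and Add_closed: "\<lbrakk>X \<in> Obj C; Y \<in> Obj C; f \<in> Arr C X Y; g \<in> Arr C X Y\<rbrakk>
      \<Longrightarrow> Add C X Y f g \<in> Arr C X Y"
    and Add_assoc: "\<lbrakk>X \<in> Obj C; Y \<in> Obj C; f \<in> Arr C X Y; g \<in> Arr C X Y; h \<in> Arr C X Y\<rbrakk>
      \<Longrightarrow> Add C X Y (Add C X Y f g) h = Add C X Y f (Add C X Y g h)"
    and Add_commute: "\<lbrakk>X \<in> Obj C; Y \<in> Obj C; f \<in> Arr C X Y; g \<in> Arr C X Y\<rbrakk>
      \<Longrightarrow> Add C X Y f g = Add C X Y g f"
    and Add_Zer: "\<lbrakk>X \<in> Obj C; Y \<in> Obj C; f \<in> Arr C X Y\<rbrakk> \<Longrightarrow> Add C X Y f (Zer C X Y) = f"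
    and Add_inverse: "\<lbrakk>X \<in> Obj C; Y \<in> Obj C; f \<in> Arr C X Y\<rbrakk>
      \<Longrightarrow> \<exists>g\<in>Arr C X Y. Add C X Y f g = Zer C X Y"
    and Cmp_Add_right: "\<lbrakk>X \<in> Obj C; Y \<in> Obj C; Z \<in> Obj C; f \<in> Arr C X Y; f' \<in> Arr C X Y; g \<in> Arr C Y Z\<rbrakk>
      \<Longrightarrow> Cmp C X Y Z g (Add C X Y f f') = Add C X Z (Cmp C X Y Z g f) (Cmp C X Y Z g f')"
    and Cmp_Add_left: "\<lbrakk>X \<in> Obj C; Y \<in> Obj C; Z \<in> Obj C; f \<in> Arr C X Y; g \<in> Arr C Y Z; g' \<in> Arr C Y Z\<rbrakk>
      \<Longrightarrow> Cmp C X Y Z (Add C Y Z g g') f = Add C X Z (Cmp C X Y Z g f) (Cmp C X Y Z g' f)"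
begin

lemma Zer_Add: "\<lbrakk>X \<in> Obj C; Y \<in> Obj C; f \<in> Arr C X Y\<rbrakk> \<Longrightarrow> Add C X Y (Zer C X Y) f = f"
  using Add_Zer Add_commute Zer_closed by metis

lemma Add_left_commute:
  "\<lbrakk>X \<in> Obj C; Y \<in> Obj C; f \<in> Arr C X Y; g \<in> Arr C X Y; h \<in> Arr C X Y\<rbrakk>
    \<Longrightarrow> Add C X Y f (Add C X Y g h) = Add C X Y g (Add C X Y f h)"
  using Add_assoc Add_commute by metis

text \<open>The records carry no subtraction. This cancellation yields absorption by zero and, for
  an additive assignment, the preservation of zero.\<close>

lemma Zer_if_Add_self:
  assumes "X \<in> Obj C" "Y \<in> Obj C" "f \<in> Arr C X Y" "Add C X Y f f = f"
  shows "f = Zer C X Y"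
proof -
  obtain g where g: "g \<in> Arr C X Y" "Add C X Y f g = Zer C X Y"
    using Add_inverse assms by blast
  have "f = Add C X Y f (Add C X Y f g)" using g Add_Zer assms by simp
  also have "\<dots> = Add C X Y f g" using Add_assoc[of X Y f f g] g assms by simp
  finally show ?thesis using g by simp
qed

lemma Cmp_Zer_right:
  assumes "X \<in> Obj C" "Y \<in> Obj C" "Z \<in> Obj C" "g \<in> Arr C Y Z"
  shows "Cmp C X Y Z g (Zer C X Y) = Zer C X Z"
  using Cmp_Add_right[of X Y Z "Zer C X Y" "Zer C X Y" g] assms
  by (intro Zer_if_Add_self) (auto simp: Add_Zer Zer_closed Cmp_closed)

lemma Cmp_Zer_left:
  assumes "X \<in> Obj C" "Y \<in> Obj C" "Z \<in> Obj C" "f \<in> Arr C X Y"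
  shows "Cmp C X Y Z (Zer C Y Z) f = Zer C X Z"
  using Cmp_Add_left[of X Y Z f "Zer C Y Z" "Zer C Y Z"] assms
  by (intro Zer_if_Add_self) (auto simp: Add_Zer Zer_closed Cmp_closed)

lemma Sum_Nil: "Sum C X Y [] = Zer C X Y"
  and Sum_Cons: "Sum C X Y (f # fs) = Add C X Y f (Sum C X Y fs)"
  by (simp_all add: Sum_def)

lemma Sum_closed:
  "\<lbrakk>X \<in> Obj C; Y \<in> Obj C; \<And>l. l \<in> set ls \<Longrightarrow> t l \<in> Arr C X Y\<rbrakk> \<Longrightarrow> Sum C X Y (map t ls) \<in> Arr C X Y"
  by (induction ls) (auto simp: Sum_Nil Sum_Cons Zer_closed Add_closed)

lemma Sum_cong: "(\<And>l. l \<in> set ls \<Longrightarrow> t l = t' l) \<Longrightarrow> Sum C X Y (map t ls) = Sum C X Y (map t' ls)"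
  by (rule arg_cong[of _ _ "Sum C X Y"]) simp

lemma Sum_Zer: "\<lbrakk>X \<in> Obj C; Y \<in> Obj C; \<And>l. l \<in> set ls \<Longrightarrow> t l = Zer C X Y\<rbrakk>
    \<Longrightarrow> Sum C X Y (map t ls) = Zer C X Y"
  by (induction ls) (auto simp: Sum_Nil Sum_Cons Zer_closed Add_Zer)

lemma Sum_Add:
  assumes "X \<in> Obj C" "Y \<in> Obj C" "\<And>l. l \<in> set ls \<Longrightarrow> t l \<in> Arr C X Y" "\<And>l. l \<in> set ls \<Longrightarrow> u l \<in> Arr C X Y"
  shows "Sum C X Y (map (\<lambda>l. Add C X Y (t l) (u l)) ls)
    = Add C X Y (Sum C X Y (map t ls)) (Sum C X Y (map u ls))"
  using assms(3,4)
proof (induction ls)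
  case (Cons l ls)
  have "Sum C X Y (map t ls) \<in> Arr C X Y" "Sum C X Y (map u ls) \<in> Arr C X Y"
    using assms(1,2) Cons.prems by (auto intro!: Sum_closed)
  then show ?case using Cons assms(1,2)
    by (simp add: Sum_Cons Add_assoc Add_closed Add_left_commute)
qed (use assms in \<open>simp add: Sum_Nil Add_Zer Zer_closed\<close>)

lemma Sum_append:
  assumes "X \<in> Obj C" "Y \<in> Obj C" "set fs \<subseteq> Arr C X Y" "set gs \<subseteq> Arr C X Y"
  shows "Sum C X Y (fs @ gs) = Add C X Y (Sum C X Y fs) (Sum C X Y gs)"
proof -
  have g: "Sum C X Y gs \<in> Arr C X Y" using Sum_closed[of X Y gs "\<lambda>f. f"] assms by auto
  show ?thesis using assms(3)
  proof (induction fs)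
    case (Cons f fs)
    have "Sum C X Y fs \<in> Arr C X Y" using Sum_closed[of X Y fs "\<lambda>f. f"] assms Cons.prems by auto
    then show ?case using Cons assms(1,2) g by (simp add: Sum_Cons Add_assoc)
  qed (use assms g in \<open>simp add: Sum_Nil Zer_Add\<close>)
qed

lemma Sum_concat:
  assumes "X \<in> Obj C" "Y \<in> Obj C" "\<And>l. l \<in> set ls \<Longrightarrow> set (t l) \<subseteq> Arr C X Y"
  shows "Sum C X Y (concat (map t ls)) = Sum C X Y (map (\<lambda>l. Sum C X Y (t l)) ls)"
  using assms(3)
proof (induction ls)
  case (Cons l ls)
  have "set (concat (map t ls)) \<subseteq> Arr C X Y" using Cons.prems by auto
  then show ?case using Cons assms(1,2) by (simp add: Sum_Cons Sum_append)
qed (simp add: Sum_Nil)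

lemma Sum_delta:
  assumes "X \<in> Obj C" "Y \<in> Obj C" "distinct ls" "j \<in> set ls" "t j \<in> Arr C X Y"
    "\<And>l. l \<in> set ls \<Longrightarrow> l \<noteq> j \<Longrightarrow> t l = Zer C X Y"
  shows "Sum C X Y (map t ls) = t j"
  using assms(3,4,6)
proof (induction ls)
  case (Cons l ls)
  show ?case
  proof (cases "l = j")
    case True
    then have "Sum C X Y (map t ls) = Zer C X Y" using Cons.prems assms by (intro Sum_Zer) auto
    then show ?thesis using True assms by (simp add: Sum_Cons Add_Zer)
  next
    case False
    then have "t l = Zer C X Y" "Sum C X Y (map t ls) = t j" using Cons by auto
    then show ?thesis using assms by (simp add: Sum_Cons Zer_Add)
  qed
qed simp

lemma Sum_swap:
  assumes "X \<in> Obj C" "Y \<in> Obj C" "\<And>l m. \<lbrakk>l \<in> set ls; m \<in> set ms\<rbrakk> \<Longrightarrow> t l m \<in> Arr C X Y"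
  shows "Sum C X Y (map (\<lambda>l. Sum C X Y (map (t l) ms)) ls)
    = Sum C X Y (map (\<lambda>m. Sum C X Y (map (\<lambda>l. t l m) ls)) ms)"
  using assms(3)
proof (induction ls)
  case Nil
  then show ?case using Sum_Zer[OF assms(1,2), of ms "\<lambda>_. Zer C X Y"] by (simp add: Sum_Nil)
next
  case (Cons l ls)
  have "Sum C X Y (map (\<lambda>m. Add C X Y (t l m) (Sum C X Y (map (\<lambda>l. t l m) ls))) ms)
     = Add C X Y (Sum C X Y (map (t l) ms)) (Sum C X Y (map (\<lambda>m. Sum C X Y (map (\<lambda>l. t l m) ls)) ms))"
    using Cons.prems assms(1,2) by (intro Sum_Add Sum_closed) auto
  then show ?case using Cons by (simp add: Sum_Cons)
qed

lemma Cmp_Sum_right: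
  assumes "X \<in> Obj C" "Y \<in> Obj C" "Z \<in> Obj C" "\<And>l. l \<in> set ls \<Longrightarrow> t l \<in> Arr C X Y" "g \<in> Arr C Y Z"
  shows "Cmp C X Y Z g (Sum C X Y (map t ls)) = Sum C X Z (map (\<lambda>l. Cmp C X Y Z g (t l)) ls)"
  using assms(4)
proof (induction ls)
  case (Cons l ls)
  then have "Sum C X Y (map t ls) \<in> Arr C X Y" using assms by (intro Sum_closed) auto
  then show ?case using Cons assms by (simp add: Sum_Cons Cmp_Add_right)
qed (use assms in \<open>simp add: Sum_Nil Cmp_Zer_right\<close>)

lemma Cmp_Sum_left:
  assumes "X \<in> Obj C" "Y \<in> Obj C" "Z \<in> Obj C" "\<And>l. l \<in> set ls \<Longrightarrow> t l \<in> Arr C Y Z" "f \<in> Arr C X Y"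
  shows "Cmp C X Y Z (Sum C Y Z (map t ls)) f = Sum C X Z (map (\<lambda>l. Cmp C X Y Z (t l) f) ls)"
  using assms(4)
proof (induction ls)
  case (Cons l ls)
  then have "Sum C Y Z (map t ls) \<in> Arr C Y Z" using assms by (intro Sum_closed) auto
  then show ?case using Cons assms by (simp add: Sum_Cons Cmp_Add_left)
qed (use assms in \<open>simp add: Sum_Nil Cmp_Zer_left\<close>)

lemma add_env_simps:
  "Obj (add_env C) = {Xs. set Xs \<subseteq> Obj C}"
  "Arr (add_env C) Xs Ys = {M \<in> carrier_mat (length Ys) (length Xs).
     \<forall>i<length Ys. \<forall>j<length Xs. M $$ (i, j) \<in> Arr C (Xs ! j) (Ys ! i)}"
  "Cmp (add_env C) Xs Ys Zs N M = mat (length Zs) (length Xs) (\<lambda>(i, j).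
     Sum C (Xs ! j) (Zs ! i)
       (map (\<lambda>l. Cmp C (Xs ! j) (Ys ! l) (Zs ! i) (N $$ (i, l)) (M $$ (l, j))) [0..<length Ys]))"
  "Ide (add_env C) Xs = mat (length Xs) (length Xs) (\<lambda>(i, j).
     if i = j then Ide C (Xs ! i) else Zer C (Xs ! j) (Xs ! i))"
  by (simp_all add: add_env_def)

lemma nth_Obj: "\<lbrakk>Xs \<in> Obj (add_env C); i < length Xs\<rbrakk> \<Longrightarrow> Xs ! i \<in> Obj C"
  by (auto simp: add_env_simps)

lemma category_add_env: "category (add_env C)"
proof
  fix Xs assume "Xs \<in> Obj (add_env C)"
  then show "Ide (add_env C) Xs \<in> Arr (add_env C) Xs Xs"
    using nth_Obj[of Xs] by (auto simp: add_env_simps(2,4) Ide_closed Zer_closed)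
next
  fix Xs Ys Zs f g
  assume "Xs \<in> Obj (add_env C)" "Ys \<in> Obj (add_env C)" "Zs \<in> Obj (add_env C)"
    "f \<in> Arr (add_env C) Xs Ys" "g \<in> Arr (add_env C) Ys Zs"
  then show "Cmp (add_env C) Xs Ys Zs g f \<in> Arr (add_env C) Xs Zs"
    using nth_Obj by (auto simp: add_env_simps(2,3) intro!: Sum_closed Cmp_closed)
next
  fix Ws Xs Ys Zs f g h
  assume o: "Ws \<in> Obj (add_env C)" "Xs \<in> Obj (add_env C)" "Ys \<in> Obj (add_env C)" "Zs \<in> Obj (add_env C)"
    and f: "f \<in> Arr (add_env C) Ws Xs" and g: "g \<in> Arr (add_env C) Xs Ys" and h: "h \<in> Arr (add_env C) Ys Zs"
  show "Cmp (add_env C) Ws Ys Zs h (Cmp (add_env C) Ws Xs Ys g f)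
    = Cmp (add_env C) Ws Xs Zs (Cmp (add_env C) Xs Ys Zs h g) f"
  proof (rule eq_matI, goal_cases)
    case (1 i j)
    then have ij: "i < length Zs" "j < length Ws" by (simp_all add: add_env_simps(3))
    let ?W = "Ws ! j" and ?Z = "Zs ! i" and ?X = "\<lambda>m. Xs ! m" and ?Y = "\<lambda>l. Ys ! l"
    let ?f = "\<lambda>m. f $$ (m, j)" and ?g = "\<lambda>l m. g $$ (l, m)" and ?h = "\<lambda>l. h $$ (i, l)"
    have ob: "?W \<in> Obj C" "?Z \<in> Obj C" "\<And>m. m < length Xs \<Longrightarrow> ?X m \<in> Obj C"
       "\<And>l. l < length Ys \<Longrightarrow> ?Y l \<in> Obj C"
      using o ij nth_Obj by auto
    have ar: "\<And>m. m < length Xs \<Longrightarrow> ?f m \<in> Arr C ?W (?X m)" "\<And>l. l < length Ys \<Longrightarrow> ?h l \<in> Arr C (?Y l) ?Z"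
      "\<And>l m. l < length Ys \<Longrightarrow> m < length Xs \<Longrightarrow> ?g l m \<in> Arr C (?X m) (?Y l)"
      using f g h ij by (auto simp: add_env_simps(2))
    have "Cmp (add_env C) Ws Ys Zs h (Cmp (add_env C) Ws Xs Ys g f) $$ (i, j)
      = Sum C ?W ?Z (map (\<lambda>l. Cmp C ?W (?Y l) ?Z (?h l)
          (Sum C ?W (?Y l) (map (\<lambda>m. Cmp C ?W (?X m) (?Y l) (?g l m) (?f m)) [0..<length Xs]))) [0..<length Ys])"
      using ij by (simp add: add_env_simps(3)) (rule Sum_cong, simp)
    also have "\<dots> = Sum C ?W ?Z (map (\<lambda>l. Sum C ?W ?Z (map (\<lambda>m. Cmp C ?W (?Y l) ?Z (?h l)
          (Cmp C ?W (?X m) (?Y l) (?g l m) (?f m))) [0..<length Xs])) [0..<length Ys])"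
      by (intro Sum_cong Cmp_Sum_right) (use ob ar Cmp_closed in auto)
    also have "\<dots> = Sum C ?W ?Z (map (\<lambda>m. Sum C ?W ?Z (map (\<lambda>l. Cmp C ?W (?Y l) ?Z (?h l)
          (Cmp C ?W (?X m) (?Y l) (?g l m) (?f m))) [0..<length Ys])) [0..<length Xs])"
      by (intro Sum_swap) (use ob ar Cmp_closed in auto)
    also have "\<dots> = Sum C ?W ?Z (map (\<lambda>m. Sum C ?W ?Z (map (\<lambda>l. Cmp C ?W (?X m) ?Z 
          (Cmp C (?X m) (?Y l) ?Z (?h l) (?g l m)) (?f m)) [0..<length Ys])) [0..<length Xs])"
      by (intro Sum_cong Cmp_assoc) (use ob ar Cmp_closed in auto)
    also have "\<dots> = Sum C ?W ?Z (map (\<lambda>m. Cmp C ?W (?X m) ?Z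
         (Sum C (?X m) ?Z (map (\<lambda>l. Cmp C (?X m) (?Y l) ?Z (?h l) (?g l m)) [0..<length Ys])) (?f m)) [0..<length Xs])"
      by (intro Sum_cong Cmp_Sum_left[symmetric]) (use ob ar Cmp_closed in auto)
    also have "\<dots> = Cmp (add_env C) Ws Xs Zs (Cmp (add_env C) Xs Ys Zs h g) f $$ (i, j)"
      using ij by (simp add: add_env_simps(3)) (rule Sum_cong, simp)
    finally show ?case .
  qed (simp_all add: add_env_simps(3))
next
  fix Xs Ys f assume o: "Xs \<in> Obj (add_env C)" "Ys \<in> Obj (add_env C)" and f: "f \<in> Arr (add_env C) Xs Ys"
  have ar: "f $$ (i, j) \<in> Arr C (Xs ! j) (Ys ! i)" and ob: "Xs ! j \<in> Obj C" "Ys ! i \<in> Obj C"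
    if "i < length Ys" "j < length Xs" for i j
    using o f that nth_Obj by (auto simp: add_env_simps(2))
  have ob': "Xs ! j \<in> Obj C" if "j < length Xs" for j using nth_Obj o that by blast
  have ob2: "Ys ! j \<in> Obj C" if "j < length Ys" for j using nth_Obj o that by blast
  show "Cmp (add_env C) Xs Xs Ys f (Ide (add_env C) Xs) = f"
  proof (rule eq_matI, goal_cases)
    case (1 i j)
    then have ij: "i < length Ys" "j < length Xs" using f by (auto simp: add_env_simps(2))
    have "Sum C (Xs ! j) (Ys ! i) (map (\<lambda>l. Cmp C (Xs ! j) (Xs ! l) (Ys ! i) (f $$ (i, l))
       (Ide (add_env C) Xs $$ (l, j))) [0..<length Xs])
       = Cmp C (Xs ! j) (Xs ! j) (Ys ! i) (f $$ (i, j)) (Ide (add_env C) Xs $$ (j, j))"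
      by (rule Sum_delta) (use ij ar ob ob' in \<open>auto simp: add_env_simps(4) Cmp_Zer_right Cmp_closed Ide_closed\<close>)
    then show ?case using ij ar ob by (simp add: add_env_simps(3)) (simp add: add_env_simps(4) Cmp_Ide_right)
  qed (use f in \<open>auto simp: add_env_simps(2,3)\<close>)
  show "Cmp (add_env C) Xs Ys Ys (Ide (add_env C) Ys) f = f"
  proof (rule eq_matI, goal_cases)
    case (1 i j)
    then have ij: "i < length Ys" "j < length Xs" using f by (auto simp: add_env_simps(2))
    have "Sum C (Xs ! j) (Ys ! i) (map (\<lambda>l. Cmp C (Xs ! j) (Ys ! l) (Ys ! i) 
       (Ide (add_env C) Ys $$ (i, l)) (f $$ (l, j))) [0..<length Ys])
       = Cmp C (Xs ! j) (Ys ! i) (Ys ! i) (Ide (add_env C) Ys $$ (i, i)) (f $$ (i, j))"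
      by (rule Sum_delta) (use ij ar ob ob2 in \<open>auto simp: add_env_simps(4) Cmp_Zer_left Cmp_closed Ide_closed\<close>)
    then show ?case using ij ar ob by (simp add: add_env_simps(3)) (simp add: add_env_simps(4) Cmp_Ide_left)
  qed (use f in \<open>auto simp: add_env_simps(2,3)\<close>)
qed

end

section \<open>Semifunctors applied entrywise to matrices\<close>

definition map_entries ::
  "('o \<Rightarrow> 'o \<Rightarrow> 'm1 \<Rightarrow> 'm2) \<Rightarrow> 'o list \<Rightarrow> 'o list \<Rightarrow> 'm1 mat \<Rightarrow> 'm2 mat" where
  "map_entries \<phi> Xs Ys M = mat (length Ys) (length Xs) (\<lambda>(i, j). \<phi> (Xs ! j) (Ys ! i) (M $$ (i, j)))"

text \<open>Both \<open>C_brauer\<close> and \<open>C_alpha\<close> have the finite sign sequences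
  as objects and F does not move them, so the object map is the identity here.\<close>

locale additive_semifunctor = semifunctor C D "\<lambda>X. X" \<phi> + C: preadditive C + D: preadditive D
  for C :: "('o, 'm1, 'k1) lincat" and D :: "('o, 'm2, 'k2) lincat"
    and \<phi> :: "'o \<Rightarrow> 'o \<Rightarrow> 'm1 \<Rightarrow> 'm2" +
  assumes Add: "\<lbrakk>X \<in> Obj C; Y \<in> Obj C; f \<in> Arr C X Y; g \<in> Arr C X Y\<rbrakk>
      \<Longrightarrow> \<phi> X Y (Add C X Y f g) = Add D X Y (\<phi> X Y f) (\<phi> X Y g)"
begin

lemma Zer: "\<lbrakk>X \<in> Obj C; Y \<in> Obj C\<rbrakk> \<Longrightarrow> \<phi> X Y (Zer C X Y) = Zer D X Y"
  using Add[of X Y "Zer C X Y" "Zer C X Y"]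
  by (intro D.Zer_if_Add_self) (auto simp: C.Zer_closed C.Add_Zer closed obj_closed)

lemma Sum:
  assumes "X \<in> Obj C" "Y \<in> Obj C" "\<And>l. l \<in> set ls \<Longrightarrow> t l \<in> Arr C X Y"
  shows "\<phi> X Y (Sum C X Y (map t ls)) = Sum D X Y (map (\<lambda>l. \<phi> X Y (t l)) ls)"
  using assms(3)
proof (induction ls)
  case (Cons l ls)
  have "Sum C X Y (map t ls) \<in> Arr C X Y" using Cons.prems assms by (intro C.Sum_closed) auto
  then show ?case using Cons assms by (simp add: C.Sum_Cons D.Sum_Cons Add)
qed (use assms in \<open>simp add: C.Sum_Nil D.Sum_Nil Zer\<close>)

text \<open>For fullness: the image of the identity of \<open>Xs\<close> is the diagonal matrix of
  the idempotents \<open>\<phi> X X (Ide C X)\<close>. In a matrix that absorbs it, every entry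
  absorbs the idempotent belonging to its own row or column, so the entries can be lifted
  separately.\<close>

lemma semifunctor_map_entries: "semifunctor (add_env C) (add_env D) (\<lambda>Xs. Xs) (map_entries \<phi>)"
proof -
  interpret AC: category "add_env C" by (rule C.category_add_env)
  interpret AD: category "add_env D" by (rule D.category_add_env)
  note nth = C.nth_Obj
  show ?thesis
  proof
    fix Xs assume "Xs \<in> Obj (add_env C)" then show "Xs \<in> Obj (add_env D)"
      using obj_closed by (auto simp: C.add_env_simps D.add_env_simps)
  next
    fix Xs Ys f assume "Xs \<in> Obj (add_env C)" "Ys \<in> Obj (add_env C)" "f \<in> Arr (add_env C) Xs Ys"
    then show "map_entries \<phi> Xs Ys f \<in> Arr (add_env D) Xs Ys"
      using nth by (auto simp: C.add_env_simps(2) D.add_env_simps(2) map_entries_def intro!: closed)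
  next
    fix Xs Ys Zs f g
    assume o: "Xs \<in> Obj (add_env C)" "Ys \<in> Obj (add_env C)" "Zs \<in> Obj (add_env C)"
     and f: "f \<in> Arr (add_env C) Xs Ys" and g: "g \<in> Arr (add_env C) Ys Zs"
    have ar: "f $$ (l, j) \<in> Arr C (Xs ! j) (Ys ! l)" if "l < length Ys" "j < length Xs" for l j
      using f that by (auto simp: C.add_env_simps(2))
    have ar2: "g $$ (i, l) \<in> Arr C (Ys ! l) (Zs ! i)" if "i < length Zs" "l < length Ys" for l i
      using g that by (auto simp: C.add_env_simps(2))
    show "map_entries \<phi> Xs Zs (Cmp (add_env C) Xs Ys Zs g f) =
      Cmp (add_env D) Xs Ys Zs (map_entries \<phi> Ys Zs g) (map_entries \<phi> Xs Ys f)"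
    proof (rule eq_matI, goal_cases)
      case (1 i j)
      then have ij: "i < length Zs" "j < length Xs" by (simp_all add: D.add_env_simps(3))
      have ob: "Xs ! j \<in> Obj C" "Zs ! i \<in> Obj C" "\<And>l. l < length Ys \<Longrightarrow> Ys ! l \<in> Obj C"
        using ij o nth by auto
      have "\<phi> (Xs ! j) (Zs ! i) (Sum C (Xs ! j) (Zs ! i)
           (map (\<lambda>l. Cmp C (Xs ! j) (Ys ! l) (Zs ! i) (g $$ (i, l)) (f $$ (l, j))) [0..<length Ys]))
        = Sum D (Xs ! j) (Zs ! i) (map (\<lambda>l. \<phi> (Xs ! j) (Zs ! i)
            (Cmp C (Xs ! j) (Ys ! l) (Zs ! i) (g $$ (i, l)) (f $$ (l, j)))) [0..<length Ys])"
        by (rule Sum) (use ob ij ar ar2 C.Cmp_closed in auto)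
      also have "\<dots> = Sum D (Xs ! j) (Zs ! i) (map (\<lambda>l. Cmp D (Xs ! j) (Ys ! l) (Zs ! i)
           (map_entries \<phi> Ys Zs g $$ (i, l)) (map_entries \<phi> Xs Ys f $$ (l, j))) [0..<length Ys])"
        by (rule D.Sum_cong) (use ob ij ar ar2 in \<open>auto simp: map_entries_def Cmp\<close>)
      finally show ?case using ij by (simp add: C.add_env_simps(3) D.add_env_simps(3) map_entries_def)
    qed (simp_all add: map_entries_def D.add_env_simps(3))
  next
    fix Xs Ys assume o: "Xs \<in> Obj (add_env C)" "Ys \<in> Obj (add_env C)"
    show "inj_on (map_entries \<phi> Xs Ys) (Arr (add_env C) Xs Ys)"
    proof (rule inj_onI, rule eq_matI, goal_cases)
      case (1 f g i j)
      then have ij: "i < length Ys" "j < length Xs" by (auto simp: C.add_env_simps(2))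
      have "map_entries \<phi> Xs Ys f $$ (i, j) = map_entries \<phi> Xs Ys g $$ (i, j)" using 1 by simp
      then have "\<phi> (Xs ! j) (Ys ! i) (f $$ (i, j)) = \<phi> (Xs ! j) (Ys ! i) (g $$ (i, j))"
        using ij by (simp add: map_entries_def)
      then show ?case
        by (rule inj_onD[OF faithful[OF nth[OF o(1) ij(2)] nth[OF o(2) ij(1)]]])
          (use 1 ij in \<open>auto simp: C.add_env_simps(2)\<close>)
    qed (auto simp: C.add_env_simps(2))
  next
    fix Xs Ys h
    assume o: "Xs \<in> Obj (add_env C)" "Ys \<in> Obj (add_env C)" and h: "h \<in> Arr (add_env D) Xs Ys"
      and r: "Cmp (add_env D) Xs Xs Ys h (map_entries \<phi> Xs Xs (Ide (add_env C) Xs)) = h"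
      and l: "Cmp (add_env D) Xs Ys Ys (map_entries \<phi> Ys Ys (Ide (add_env C) Ys)) h = h"
    have ide: "map_entries \<phi> Zs Zs (Ide (add_env C) Zs) $$ (i, j)
       = (if i = j then \<phi> (Zs ! i) (Zs ! i) (Ide C (Zs ! i)) else Zer D (Zs ! j) (Zs ! i))"
      if "i < length Zs" "j < length Zs" "Zs \<in> Obj (add_env C)" for Zs i j
      using that Zer nth by (simp add: map_entries_def C.add_env_simps(4))
    have ar: "h $$ (i, j) \<in> Arr D (Xs ! j) (Ys ! i)" if "i < length Ys" "j < length Xs" for i j
      using h that by (auto simp: D.add_env_simps(2))
    have "\<forall>i<length Ys. \<forall>j<length Xs. h $$ (i, j) \<in> \<phi> (Xs ! j) (Ys ! i) ` Arr C (Xs ! j) (Ys ! i)"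
    proof (intro allI impI)
      fix i j assume ij: "i < length Ys" "j < length Xs"
      have ob: "\<And>j. j < length Xs \<Longrightarrow> Xs ! j \<in> Obj C" "\<And>i. i < length Ys \<Longrightarrow> Ys ! i \<in> Obj C"
        using o nth by auto
      have cl: "\<phi> Z Z (Ide C Z) \<in> Arr D Z Z" if "Z \<in> Obj C" for Z
        using that closed C.Ide_closed by blast
      have "h $$ (i, j) = Sum D (Xs ! j) (Ys ! i) (map (\<lambda>l. Cmp D (Xs ! j) (Xs ! l) (Ys ! i) (h $$ (i, l))
           (map_entries \<phi> Xs Xs (Ide (add_env C) Xs) $$ (l, j))) [0..<length Xs])"
        by (subst r[symmetric]) (use ij in \<open>simp add: D.add_env_simps(3)\<close>)
      also have "\<dots> = Cmp D (Xs ! j) (Xs ! j) (Ys ! i) (h $$ (i, j))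
           (map_entries \<phi> Xs Xs (Ide (add_env C) Xs) $$ (j, j))"
        by (rule D.Sum_delta)
          (use ij ar ob obj_closed cl in \<open>auto simp: ide o D.Cmp_Zer_right intro!: D.Cmp_closed\<close>)
      finally have 1: "Cmp D (Xs ! j) (Xs ! j) (Ys ! i) (h $$ (i, j)) (\<phi> (Xs ! j) (Xs ! j) (Ide C (Xs ! j))) = h $$ (i, j)"
        using ij o by (simp add: ide)
      have "h $$ (i, j) = Sum D (Xs ! j) (Ys ! i) (map (\<lambda>l. Cmp D (Xs ! j) (Ys ! l) (Ys ! i)
           (map_entries \<phi> Ys Ys (Ide (add_env C) Ys) $$ (i, l)) (h $$ (l, j))) [0..<length Ys])"
        by (subst l[symmetric]) (use ij in \<open>simp add: D.add_env_simps(3)\<close>)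
      also have "\<dots> = Cmp D (Xs ! j) (Ys ! i) (Ys ! i)
           (map_entries \<phi> Ys Ys (Ide (add_env C) Ys) $$ (i, i)) (h $$ (i, j))"
        by (rule D.Sum_delta)
          (use ij ar ob obj_closed cl in \<open>auto simp: ide o D.Cmp_Zer_left intro!: D.Cmp_closed\<close>)
      finally have 2: "Cmp D (Xs ! j) (Ys ! i) (Ys ! i) (\<phi> (Ys ! i) (Ys ! i) (Ide C (Ys ! i))) (h $$ (i, j)) = h $$ (i, j)"
        using ij o by (simp add: ide)
      show "h $$ (i, j) \<in> \<phi> (Xs ! j) (Ys ! i) ` Arr C (Xs ! j) (Ys ! i)"
        by (rule full) (use 1 2 ij ob ar in auto)
    qed
    then have "\<forall>i j. \<exists>f. i < length Ys \<longrightarrow> j < length Xs \<longrightarrow>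
        f \<in> Arr C (Xs ! j) (Ys ! i) \<and> h $$ (i, j) = \<phi> (Xs ! j) (Ys ! i) f"
      by (metis imageE)
    then obtain f where f: "\<And>i j. i < length Ys \<Longrightarrow> j < length Xs \<Longrightarrow>
        f i j \<in> Arr C (Xs ! j) (Ys ! i) \<and> h $$ (i, j) = \<phi> (Xs ! j) (Ys ! i) (f i j)" by metis
    have "h = map_entries \<phi> Xs Ys (mat (length Ys) (length Xs) (\<lambda>(i, j). f i j))"
      by (rule eq_matI) (use f h in \<open>auto simp: map_entries_def D.add_env_simps(2)\<close>)
    moreover have "mat (length Ys) (length Xs) (\<lambda>(i, j). f i j) \<in> Arr (add_env C) Xs Ys"
      using f by (auto simp: C.add_env_simps(2))
    ultimately show "h \<in> map_entries \<phi> Xs Ys ` Arr (add_env C) Xs Ys" by blast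
  qed
qed

text \<open>The arrows \<open>a\<close> form a row and the arrows \<open>b\<close> a column, and
  together they exhibit \<open>Y\<close> as a retract of the direct sum of the objects
  \<open>(Z, \<phi> Z Z (Ide C Z))\<close> in the Karoubi envelope of \<open>D\<close>.\<close>

definition dominates :: "'o \<Rightarrow> ('o \<times> 'm2 \<times> 'm2) list \<Rightarrow> bool" where
  "dominates Y L \<longleftrightarrow> (\<forall>(Z, a, b)\<in>set L. Z \<in> Obj C \<and> a \<in> Arr D Z Y \<and> b \<in> Arr D Y Z) \<and>
     Sum D Y Y (map (\<lambda>(Z, a, b). Cmp D Y Z Y a (Cmp D Y Z Z (\<phi> Z Z (Ide C Z)) b)) L) = Ide D Y"

theorem is_equivalence_Kar:
  assumes dom: "\<And>Y. Y \<in> Obj D \<Longrightarrow> \<exists>L. dominates Y L"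
  shows "is_equivalence (Kar C) (Kar D) (idem_functor (\<lambda>Xs. Xs) (map_entries \<phi>))"
proof -
  interpret M: semifunctor "add_env C" "add_env D" "\<lambda>Xs. Xs" "map_entries \<phi>"
    by (rule semifunctor_map_entries)
  show ?thesis unfolding Kar_def
  proof (rule M.is_equivalence_idem_functor)
    fix Ys assume Ys: "Ys \<in> Obj (add_env D)"
    have Yo: "Ys ! i \<in> Obj D" if "i < length Ys" for i using D.nth_Obj[OF Ys that] .
    have "\<forall>i. \<exists>L. i < length Ys \<longrightarrow> dominates (Ys ! i) L" using dom Yo by blast
    then obtain L where L: "\<And>i. i < length Ys \<Longrightarrow> dominates (Ys ! i) (L i)" by metis
    \<comment> \<open>All decompositions are concatenated, each term tagged with the index of the
      object of \<open>Ys\<close> that it belongs to. The matrices \<open>A\<close> and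
      \<open>B\<close> below are block diagonal with respect to these tags.\<close>
    define Q where "Q = concat (map (\<lambda>i. map (Pair i) (L i)) [0..<length Ys])"
    define Z where "Z q = fst (snd q)" for q :: "nat \<times> 'o \<times> 'm2 \<times> 'm2"
    define a where "a q = fst (snd (snd q))" for q :: "nat \<times> 'o \<times> 'm2 \<times> 'm2"
    define b where "b q = snd (snd (snd q))" for q :: "nat \<times> 'o \<times> 'm2 \<times> 'm2"
    let ?e = "\<lambda>Z. \<phi> Z Z (Ide C Z)"
    have Q: "fst q < length Ys" "Z q \<in> Obj C" "a q \<in> Arr D (Z q) (Ys ! fst q)" "b q \<in> Arr D (Ys ! fst q) (Z q)"
      if "q \<in> set Q" for q
    proof -
      from that obtain i p where i: "i < length Ys" and p: "p \<in> set (L i)" and q: "q = (i, p)"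
        by (auto simp: Q_def)
      have "\<forall>(Z, a, b)\<in>set (L i). Z \<in> Obj C \<and> a \<in> Arr D Z (Ys ! i) \<and> b \<in> Arr D (Ys ! i) Z"
        using L[OF i] unfolding dominates_def by (rule conjunct1)
      from bspec[OF this p] i show "fst q < length Ys" "Z q \<in> Obj C"
        "a q \<in> Arr D (Z q) (Ys ! fst q)" "b q \<in> Arr D (Ys ! fst q) (Z q)"
        by (auto simp: q Z_def a_def b_def split: prod.splits)
    qed
    have e: "?e (Z q) \<in> Arr D (Z q) (Z q)" "Z q \<in> Obj D" if "q \<in> set Q" for q
      using Q[OF that] closed C.Ide_closed obj_closed by auto
    note Qn = Q[OF nth_mem] and en = e[OF nth_mem]
    define A where "A = mat (length Ys) (length Q) (\<lambda>(i, k).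
      if fst (Q ! k) = i then a (Q ! k) else Zer D (Z (Q ! k)) (Ys ! i))"
    define B where "B = mat (length Q) (length Ys) (\<lambda>(k, j).
      if fst (Q ! k) = j then b (Q ! k) else Zer D (Ys ! j) (Z (Q ! k)))"
    let ?Zs = "map Z Q"
    have Zs: "?Zs \<in> Obj (add_env C)" 
      unfolding C.add_env_simps by (rule CollectI, unfold set_map, rule image_subsetI) (rule Q(2))
    have A: "A \<in> Arr (add_env D) ?Zs Ys" and B: "B \<in> Arr (add_env D) Ys ?Zs"
      using Qn en Yo by (auto simp: D.add_env_simps(2) A_def B_def D.Zer_closed)
    let ?E = "map_entries \<phi> ?Zs ?Zs (Ide (add_env C) ?Zs)"
    have "Cmp (add_env D) Ys ?Zs Ys A (Cmp (add_env D) Ys ?Zs ?Zs ?E B) = Ide (add_env D) Ys"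
    proof (rule eq_matI, goal_cases)
      case (1 i j)
      then have ij: "i < length Ys" "j < length Ys" by (simp_all add: D.add_env_simps(4))
      note Yi = Yo[OF ij(1)] and Yj = Yo[OF ij(2)]
      \<comment> \<open>The contribution of the term \<open>q\<close> to the entry
        \<open>(i, j)\<close>. It vanishes unless \<open>q\<close> carries the tag \<open>i\<close>
        and \<open>i = j\<close>, and on the diagonal the sum over all of \<open>Q\<close> becomes
        the decomposition of \<open>Ys ! i\<close>.\<close>
      define x where "x q = (if fst q = i \<and> fst q = j
        then Cmp D (Ys ! j) (Z q) (Ys ! i) (a q) (Cmp D (Ys ! j) (Z q) (Z q) (?e (Z q)) (b q))
        else Zer D (Ys ! j) (Ys ! i))" for q
      have x: "x q \<in> Arr D (Ys ! j) (Ys ! i)" if "q \<in> set Q" for q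
        using Q[OF that] e[OF that] Yi Yj by (auto simp: x_def D.Zer_closed intro!: D.Cmp_closed)
      have EB: "Cmp (add_env D) Ys ?Zs ?Zs ?E B $$ (k, j)
         = (if fst (Q ! k) = j then Cmp D (Ys ! j) (Z (Q ! k)) (Z (Q ! k)) (?e (Z (Q ! k))) (b (Q ! k))
            else Zer D (Ys ! j) (Z (Q ! k)))" if k: "k < length Q" for k
      proof -
        have "Cmp (add_env D) Ys ?Zs ?Zs ?E B $$ (k, j) =
          Sum D (Ys ! j) (Z (Q ! k)) (map (\<lambda>l. Cmp D (Ys ! j) (?Zs ! l) (Z (Q ! k)) (?E $$ (k, l)) (B $$ (l, j))) [0..<length Q])"
          using k ij by (simp add: D.add_env_simps(3))
        also have "\<dots> = Cmp D (Ys ! j) (?Zs ! k) (Z (Q ! k)) (?E $$ (k, k)) (B $$ (k, j))"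
          by (rule D.Sum_delta)
            (use k ij Qn en Yj in \<open>auto simp: map_entries_def C.add_env_simps(4) B_def Zer
              D.Cmp_Zer_left D.Zer_closed intro!: D.Cmp_closed\<close>)
        also have "\<dots> = (if fst (Q ! k) = j then Cmp D (Ys ! j) (Z (Q ! k)) (Z (Q ! k)) (?e (Z (Q ! k))) (b (Q ! k))
            else Zer D (Ys ! j) (Z (Q ! k)))"
          using k ij Qn[OF k] en[OF k] Yj by (simp add: map_entries_def C.add_env_simps(4) B_def D.Cmp_Zer_right)
        finally show ?thesis .
      qed
      have "Cmp (add_env D) Ys ?Zs Ys A (Cmp (add_env D) Ys ?Zs ?Zs ?E B) $$ (i, j)
        = Sum D (Ys ! j) (Ys ! i) (map (\<lambda>k. Cmp D (Ys ! j) (?Zs ! k) (Ys ! i) (A $$ (i, k))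
            (Cmp (add_env D) Ys ?Zs ?Zs ?E B $$ (k, j))) [0..<length Q])"
        using ij by (simp add: D.add_env_simps(3)[of Ys ?Zs Ys])
      also have "\<dots> = Sum D (Ys ! j) (Ys ! i) (map (\<lambda>k. x (Q ! k)) [0..<length Q])"
        by (rule D.Sum_cong)
          (use ij Qn en Yi Yj in \<open>auto simp: EB A_def x_def D.Cmp_Zer_left D.Cmp_Zer_right D.Zer_closed D.Cmp_closed\<close>)
      also have "map (\<lambda>k. x (Q ! k)) [0..<length Q] = map x Q"
        by (rule nth_equalityI) auto
      also have "\<dots> = concat (map (\<lambda>i'. map (\<lambda>q. x (i', q)) (L i')) [0..<length Ys])"
        by (simp add: Q_def map_concat comp_def)
      also have "Sum D (Ys ! j) (Ys ! i) \<dots>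
        = Sum D (Ys ! j) (Ys ! i) (map (\<lambda>i'. Sum D (Ys ! j) (Ys ! i) (map (\<lambda>q. x (i', q)) (L i'))) [0..<length Ys])"
      proof (rule D.Sum_concat)
        fix i' assume "i' \<in> set [0..<length Ys]"
        then have "(i', q) \<in> set Q" if "q \<in> set (L i')" for q using that by (auto simp: Q_def)
        then show "set (map (\<lambda>q. x (i', q)) (L i')) \<subseteq> Arr D (Ys ! j) (Ys ! i)"
          using x by auto
      qed (use Yi Yj in auto)
      also have "\<dots> = Sum D (Ys ! j) (Ys ! i) (map (\<lambda>q. x (i, q)) (L i))"
      proof (rule D.Sum_delta)
        have "(i, q) \<in> set Q" if "q \<in> set (L i)" for q using that ij by (auto simp: Q_def)
        then show "Sum D (Ys ! j) (Ys ! i) (map (\<lambda>q. x (i, q)) (L i)) \<in> Arr D (Ys ! j) (Ys ! i)"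
          using x Yi Yj by (intro D.Sum_closed) auto
        fix i' assume "i' \<noteq> i"
        then show "Sum D (Ys ! j) (Ys ! i) (map (\<lambda>q. x (i', q)) (L i')) = Zer D (Ys ! j) (Ys ! i)"
          using Yi Yj by (intro D.Sum_Zer) (auto simp: x_def)
      qed (use ij Yi Yj in auto)
      also have "\<dots> = (if i = j then Ide D (Ys ! i) else Zer D (Ys ! j) (Ys ! i))"
      proof (cases "i = j")
        case True
        have "map (\<lambda>q. x (i, q)) (L i)
          = map (\<lambda>(Z, a, b). Cmp D (Ys ! i) Z (Ys ! i) a (Cmp D (Ys ! i) Z Z (?e Z) b)) (L i)"
          using True by (auto simp: x_def Z_def a_def b_def)
        then have "Sum D (Ys ! i) (Ys ! i) (map (\<lambda>q. x (i, q)) (L i)) = Ide D (Ys ! i)"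
          using L[OF ij(1)] unfolding dominates_def by (simp only:)
        then show ?thesis using True by simp
      next
        case False
        then show ?thesis using Yi Yj by (auto intro!: D.Sum_Zer simp: x_def)
      qed
      finally show ?case using ij by (simp add: D.add_env_simps(4))
    qed (simp_all add: D.add_env_simps(3,4))
    then show "\<exists>Zs\<in>Obj (add_env C). \<exists>a\<in>Arr (add_env D) Zs Ys. \<exists>b\<in>Arr (add_env D) Ys Zs.
      Cmp (add_env D) Ys Zs Ys a (Cmp (add_env D) Ys Zs Zs (map_entries \<phi> Zs Zs (Ide (add_env C) Zs)) b)
        = Ide (add_env D) Ys"
      using Zs A B by blast
  qed
qed

end

section \<open>Quotients by ideals\<close>

locale preadditive_ideal = preadditive C for C :: "('o, 'm, 'k) lincat" +
  fixes N :: "'o \<Rightarrow> 'o \<Rightarrow> 'm set"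
  assumes N_Arr: "\<lbrakk>X \<in> Obj C; Y \<in> Obj C; n \<in> N X Y\<rbrakk> \<Longrightarrow> n \<in> Arr C X Y"
    and N_Zer: "\<lbrakk>X \<in> Obj C; Y \<in> Obj C\<rbrakk> \<Longrightarrow> Zer C X Y \<in> N X Y"
    and N_Add: "\<lbrakk>X \<in> Obj C; Y \<in> Obj C; n \<in> N X Y; n' \<in> N X Y\<rbrakk> \<Longrightarrow> Add C X Y n n' \<in> N X Y"
    and N_inverse: "\<lbrakk>X \<in> Obj C; Y \<in> Obj C; n \<in> N X Y\<rbrakk> \<Longrightarrow> \<exists>n'\<in>N X Y. Add C X Y n n' = Zer C X Y"
    and N_Cmp_right: "\<lbrakk>X \<in> Obj C; Y \<in> Obj C; Z \<in> Obj C; n \<in> N X Y; g \<in> Arr C Y Z\<rbrakk> \<Longrightarrow> Cmp C X Y Z g n \<in> N X Z"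
    and N_Cmp_left: "\<lbrakk>X \<in> Obj C; Y \<in> Obj C; Z \<in> Obj C; f \<in> Arr C X Y; n \<in> N Y Z\<rbrakk> \<Longrightarrow> Cmp C X Y Z n f \<in> N X Z"
begin

lemma mem_coset: "g \<in> coset C N X Y f \<longleftrightarrow> (\<exists>n\<in>N X Y. g = Add C X Y f n)"
  by (auto simp: coset_def)

lemma coset_refl: "\<lbrakk>X \<in> Obj C; Y \<in> Obj C; f \<in> Arr C X Y\<rbrakk> \<Longrightarrow> f \<in> coset C N X Y f"
  unfolding mem_coset using N_Zer Add_Zer by metis

lemma coset_Arr: "\<lbrakk>X \<in> Obj C; Y \<in> Obj C; f \<in> Arr C X Y; g \<in> coset C N X Y f\<rbrakk> \<Longrightarrow> g \<in> Arr C X Y"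
  by (auto simp: mem_coset N_Arr Add_closed)

lemma coset_eq:
  assumes "X \<in> Obj C" "Y \<in> Obj C" "f \<in> Arr C X Y" "g \<in> coset C N X Y f"
  shows "coset C N X Y g = coset C N X Y f"
proof -
  obtain n where n: "n \<in> N X Y" "g = Add C X Y f n" using assms by (auto simp: mem_coset)
  obtain n' where n': "n' \<in> N X Y" "Add C X Y n n' = Zer C X Y" using N_inverse n assms by blast
  have ar: "n \<in> Arr C X Y" "n' \<in> Arr C X Y" using n n' N_Arr assms by auto
  have f: "f = Add C X Y g n'" using n n' assms ar by (simp add: Add_assoc Add_Zer)
  have g: "g \<in> Arr C X Y" using assms coset_Arr by blast
  have "Add C X Y g m \<in> coset C N X Y f" if "m \<in> N X Y" for m
    using n that assms by (auto simp: mem_coset Add_assoc N_Arr intro!: bexI[of _ "Add C X Y n m"] N_Add)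
  moreover have "Add C X Y f m \<in> coset C N X Y g" if "m \<in> N X Y" for m
    unfolding mem_coset using n' that assms g ar
    by (intro bexI[of _ "Add C X Y n' m"]) (subst f, auto simp: Add_assoc N_Arr intro!: N_Add)
  ultimately show ?thesis by (auto simp: mem_coset)
qed

lemma coset_Cmp:
  assumes o: "X \<in> Obj C" "Y \<in> Obj C" "Z \<in> Obj C" and fg: "f \<in> Arr C X Y" "g \<in> Arr C Y Z"
    "f' \<in> coset C N X Y f" "g' \<in> coset C N Y Z g"
  shows "Cmp C X Y Z g' f' \<in> coset C N X Z (Cmp C X Y Z g f)"
proof -
  obtain n m where n: "n \<in> N X Y" "f' = Add C X Y f n" and m: "m \<in> N Y Z" "g' = Add C Y Z g m"
    using fg by (auto simp: mem_coset)
  have ar: "n \<in> Arr C X Y" "m \<in> Arr C Y Z" "f' \<in> Arr C X Y" "g' \<in> Arr C Y Z"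
    using n m N_Arr o fg Add_closed by auto
  have "Cmp C X Y Z g' f' = Add C X Z (Cmp C X Y Z g f') (Cmp C X Y Z m f')"
    using m ar fg o by (simp add: Cmp_Add_left)
  also have "Cmp C X Y Z g f' = Add C X Z (Cmp C X Y Z g f) (Cmp C X Y Z g n)"
    unfolding n(2) using ar fg o by (simp add: Cmp_Add_right)
  also have "Add C X Z \<dots> (Cmp C X Y Z m f')
      = Add C X Z (Cmp C X Y Z g f) (Add C X Z (Cmp C X Y Z g n) (Cmp C X Y Z m f'))"
    using ar fg o by (simp add: Add_assoc Cmp_closed)
  finally have "Cmp C X Y Z g' f'
      = Add C X Z (Cmp C X Y Z g f) (Add C X Z (Cmp C X Y Z g n) (Cmp C X Y Z m f'))" .
  moreover have "Add C X Z (Cmp C X Y Z g n) (Cmp C X Y Z m f') \<in> N X Z"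
    using n m o fg ar by (intro N_Add N_Cmp_left N_Cmp_right)
  ultimately show ?thesis unfolding mem_coset by blast
qed

lemma coset_Add:
  assumes o: "X \<in> Obj C" "Y \<in> Obj C" and fg: "f \<in> Arr C X Y" "g \<in> Arr C X Y"
    "f' \<in> coset C N X Y f" "g' \<in> coset C N X Y g"
  shows "Add C X Y f' g' \<in> coset C N X Y (Add C X Y f g)"
proof -
  obtain n m where n: "n \<in> N X Y" "f' = Add C X Y f n" and m: "m \<in> N X Y" "g' = Add C X Y g m"
    using fg by (auto simp: mem_coset)
  have ar: "n \<in> Arr C X Y" "m \<in> Arr C X Y" using n m N_Arr o by auto
  have "Add C X Y f' g' = Add C X Y (Add C X Y f g) (Add C X Y n m)"
    using n m o fg ar by (simp add: Add_assoc Add_closed Add_left_commute)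
  then show ?thesis using n m o N_Add by (auto simp: mem_coset)
qed

text \<open>\<open>quot\<close> defines its operations as unions over all representatives; since the
  cosets involved coincide, such a union is a single coset.\<close>

lemma UN_coset_eq:
  assumes "X \<in> Obj C" "Y \<in> Obj C" "f \<in> Arr C X Y" "A \<noteq> {}" "\<And>x. x \<in> A \<Longrightarrow> t x \<in> coset C N X Y f"
  shows "(\<Union>x\<in>A. coset C N X Y (t x)) = coset C N X Y f"
  using assms coset_eq by auto

lemma quot_simps:
  "Obj (quot C N) = Obj C"
  "Arr (quot C N) X Y = coset C N X Y ` Arr C X Y"
  "Ide (quot C N) X = coset C N X X (Ide C X)"
  "Zer (quot C N) X Y = coset C N X Y (Zer C X Y)"
  by (simp_all add: quot_def)

lemma Cmp_quot:
  assumes "X \<in> Obj C" "Y \<in> Obj C" "Z \<in> Obj C" "f \<in> Arr C X Y" "g \<in> Arr C Y Z"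
  shows "Cmp (quot C N) X Y Z (coset C N Y Z g) (coset C N X Y f) = coset C N X Z (Cmp C X Y Z g f)"
proof -
  have "(\<Union>f\<in>coset C N X Y f. coset C N X Z (Cmp C X Y Z g' f)) = coset C N X Z (Cmp C X Y Z g f)"
    if "g' \<in> coset C N Y Z g" for g'
    using that assms coset_refl[of X Y f] by (intro UN_coset_eq coset_Cmp) (auto simp: Cmp_closed)
  then show ?thesis using coset_refl[of Y Z g] assms by (auto simp: quot_def)
qed

lemma Add_quot:
  assumes "X \<in> Obj C" "Y \<in> Obj C" "f \<in> Arr C X Y" "g \<in> Arr C X Y"
  shows "Add (quot C N) X Y (coset C N X Y f) (coset C N X Y g) = coset C N X Y (Add C X Y f g)"
proof -
  have "(\<Union>g\<in>coset C N X Y g. coset C N X Y (Add C X Y f' g)) = coset C N X Y (Add C X Y f g)"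
    if "f' \<in> coset C N X Y f" for f'
    using that assms coset_refl[of X Y g] by (intro UN_coset_eq coset_Add) (auto simp: Add_closed)
  then show ?thesis using coset_refl[of X Y f] assms by (auto simp: quot_def)
qed

lemma preadditive_quot: "preadditive (quot C N)"
proof
  fix X Y f assume "X \<in> Obj (quot C N)" "Y \<in> Obj (quot C N)" "f \<in> Arr (quot C N) X Y"
  then obtain f0 where o: "X \<in> Obj C" "Y \<in> Obj C" and f: "f0 \<in> Arr C X Y" "f = coset C N X Y f0"
    by (auto simp: quot_simps)
  obtain g where g: "g \<in> Arr C X Y" "Add C X Y f0 g = Zer C X Y" using Add_inverse o f by blast
  show "\<exists>g\<in>Arr (quot C N) X Y. Add (quot C N) X Y f g = Zer (quot C N) X Y"
    using o f g by (intro bexI[of _ "coset C N X Y g"]) (auto simp: quot_simps Add_quot)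
next
  fix X Y f g assume "X \<in> Obj (quot C N)" "Y \<in> Obj (quot C N)" "f \<in> Arr (quot C N) X Y"
    "g \<in> Arr (quot C N) X Y"
  then obtain f0 g0 where "X \<in> Obj C" "Y \<in> Obj C" "f0 \<in> Arr C X Y" "f = coset C N X Y f0"
    "g0 \<in> Arr C X Y" "g = coset C N X Y g0"
    by (auto simp: quot_simps)
  then show "Add (quot C N) X Y f g = Add (quot C N) X Y g f"
    using Add_commute[of X Y f0 g0] by (simp add: Add_quot)
qed (auto simp: quot_simps Cmp_quot Add_quot Cmp_closed Add_closed Ide_closed Zer_closed
    Cmp_assoc Add_assoc Cmp_Ide_left Cmp_Ide_right Add_Zer Cmp_Add_left Cmp_Add_right)

end

section \<open>Gluing of diagrams\<close>

abbreviation sg :: "pt option \<Rightarrow> pt option \<Rightarrow> 'l list \<Rightarrow> 'l diag" where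
  "sg t h w \<equiv> ({#(t, h, w)#}, {#})"

abbreviation circ :: "'l list \<Rightarrow> 'l diag" where
  "circ w \<equiv> ({#}, {#cyc w#})"

definition tails :: "'l diag \<Rightarrow> pt multiset" where
  "tails D = image_mset the (filter_mset (\<lambda>p. p \<noteq> None) (image_mset seg_tail (fst D)))"

definition heads :: "'l diag \<Rightarrow> pt multiset" where
  "heads D = image_mset the (filter_mset (\<lambda>p. p \<noteq> None) (image_mset seg_head (fst D)))"

definition labels_in :: "'l set \<Rightarrow> 'l diag \<Rightarrow> bool" where
  "labels_in L D \<longleftrightarrow> (\<forall>s\<in>#fst D. set (seg_word s) \<subseteq> L) \<and> (\<forall>c\<in>#snd D. cword_set c \<subseteq> L)"

lemma cyc_surj: "\<exists>w. c = cyc w"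
  by (induction c rule: cword.abs_induct) blast

text \<open>Segments and circles generate all diagrams under disjoint union, so a statement
  compatible with disjoint union can be checked on one component at a time.\<close>

lemma diag_induct [case_names zero seg circ]:
  assumes "P 0" "\<And>t h w D. P D \<Longrightarrow> P (sg t h w + D)" "\<And>w D. P D \<Longrightarrow> P (circ w + D)"
  shows "P D"
proof (cases D)
  case (Pair A U)
  have U: "P ({#}, U)"
  proof (induction U)
    case empty then show ?case using assms(1) by (simp add: zero_prod_def)
  next
    case (add c U)
    obtain w where "c = cyc w" using cyc_surj by blast
    then show ?case using assms(3)[OF add] by simp
  qed
  have "P (A, U)"
  proof (induction A)
    case (add s A)
    then show ?case using assms(2)[OF add, of "fst s" "fst (snd s)" "snd (snd s)"] by simp
  qed (use U in simp)
  then show ?thesis using Pair by simp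
qed

lemma cyc_eq_iff: "cyc u = cyc v \<longleftrightarrow> (\<exists>x y. u = x @ y \<and> v = y @ x)"
  by (rule cword.abs_eq_iff)

lemma cyc_rotate: "cyc (u @ v) = cyc (v @ u)"
  unfolding cyc_eq_iff by blast

lemma cword_set_cyc [simp]: "cword_set (cyc w) = set w"
  by (rule cword_set.abs_eq)

lemma tails_simps [simp]:
  "tails 0 = {#}" "tails (D + E) = tails D + tails E"
  "tails (sg (Some p) h w) = {#p#}" "tails (sg None h w) = {#}" "tails (circ w) = {#}"
  by (simp_all add: tails_def zero_prod_def)

lemma heads_simps [simp]:
  "heads 0 = {#}" "heads (D + E) = heads D + heads E"
  "heads (sg t (Some p) w) = {#p#}" "heads (sg t None w) = {#}" "heads (circ w) = {#}"
  by (simp_all add: heads_def zero_prod_def)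

lemma mem_tails_sg [simp]: "p \<in># tails (sg t h w) \<longleftrightarrow> t = Some p"
  and mem_heads_sg [simp]: "p \<in># heads (sg t h w) \<longleftrightarrow> h = Some p"
  by (cases t; cases h; auto)+

lemma count_tails_sg: "count (tails (sg t h w)) p = (if t = Some p then 1 else 0)"
  and count_heads_sg: "count (heads (sg t h w)) p = (if h = Some p then 1 else 0)"
  by (cases t; cases h; auto)+

lemma labels_in_simps [simp]:
  "labels_in L 0" "labels_in L (D + E) \<longleftrightarrow> labels_in L D \<and> labels_in L E"
  "labels_in L (sg t h w) \<longleftrightarrow> set w \<subseteq> L" "labels_in L (circ w) \<longleftrightarrow> set w \<subseteq> L"
  by (auto simp: labels_in_def zero_prod_def)

lemma map_diag_simps [simp]:
  "map_diag \<rho> 0 = 0" "map_diag \<rho> (D + E) = map_diag \<rho> D + map_diag \<rho> E"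
  "map_diag \<rho> (sg t h w) = sg (map_option \<rho> t) (map_option \<rho> h) w" "map_diag \<rho> (circ w) = circ w"
  by (simp_all add: map_diag_def zero_prod_def split: prod.splits)

lemma tails_map_diag [simp]: "tails (map_diag \<rho> D) = image_mset \<rho> (tails D)"
  and heads_map_diag [simp]: "heads (map_diag \<rho> D) = image_mset \<rho> (heads D)"
proof -
  have "tails (map_diag \<rho> D) = image_mset \<rho> (tails D) \<and> heads (map_diag \<rho> D) = image_mset \<rho> (heads D)"
  proof (induction D rule: diag_induct)
    case (seg t h w D)
    then show ?case by (cases t; cases h; simp)
  qed auto
  then show "tails (map_diag \<rho> D) = image_mset \<rho> (tails D)"
    "heads (map_diag \<rho> D) = image_mset \<rho> (heads D)" by auto
qed

lemma labels_in_map_diag [simp]: "labels_in L (map_diag \<rho> D) = labels_in L D"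
  by (induction D rule: diag_induct) auto

lemma map_diag_map_diag: "map_diag \<rho> (map_diag \<sigma> D) = map_diag (\<rho> \<circ> \<sigma>) D"
  by (induction D rule: diag_induct) (auto simp: option.map_comp comp_def)

lemma map_diag_cong:
  "(\<And>p. p \<in># tails D \<Longrightarrow> \<rho> p = \<sigma> p) \<Longrightarrow> (\<And>p. p \<in># heads D \<Longrightarrow> \<rho> p = \<sigma> p) \<Longrightarrow> map_diag \<rho> D = map_diag \<sigma> D"
proof (induction D rule: diag_induct)
  case (seg t h w D)
  then show ?case by (cases t; cases h; simp)
qed auto

lemma map_diag_ident:
  "(\<And>p. p \<in># tails D \<Longrightarrow> \<rho> p = p) \<Longrightarrow> (\<And>p. p \<in># heads D \<Longrightarrow> \<rho> p = p) \<Longrightarrow> map_diag \<rho> D = D"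
proof (induction D rule: diag_induct)
  case (seg t h w D)
  then show ?case by (cases t; cases h; simp)
qed auto

lemma split_tail:
  assumes "p \<in># tails D"
  obtains x w D' where "D = sg (Some p) x w + D'"
proof -
  have "\<exists>x w D'. D = sg (Some p) x w + D'" using assms
  proof (induction D rule: diag_induct)
    case (seg t h w D)
    show ?case
    proof (cases "t = Some p")
      case False
      then have "p \<in># tails D" using seg by simp
      then obtain x v D' where D: "D = sg (Some p) x v + D'" using seg by blast
      have "sg t h w + D = sg (Some p) x v + (sg t h w + D')" unfolding D by (rule add.left_commute)
      then show ?thesis by blast
    qed blast
  next
    case (circ w D)
    then have "p \<in># tails D" by simp
    then obtain x v D' where D: "D = sg (Some p) x v + D'" using circ by blast
    have "circ w + D = sg (Some p) x v + (circ w + D')" unfolding D by (rule add.left_commute)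
    then show ?case by blast
  qed simp
  then show ?thesis using that by blast
qed

lemma split_head:
  assumes "p \<in># heads D"
  obtains x w D' where "D = sg x (Some p) w + D'"
proof -
  have "\<exists>x w D'. D = sg x (Some p) w + D'" using assms
  proof (induction D rule: diag_induct)
    case (seg t h w D)
    show ?case
    proof (cases "h = Some p")
      case False
      then have "p \<in># heads D" using seg by simp
      then obtain x v D' where D: "D = sg x (Some p) v + D'" using seg by blast
      have "sg t h w + D = sg x (Some p) v + (sg t h w + D')" unfolding D by (rule add.left_commute)
      then show ?thesis by blast
    qed blast
  next
    case (circ w D)
    then have "p \<in># heads D" by simp
    then obtain x v D' where D: "D = sg x (Some p) v + D'" using circ by blast
    have "circ w + D = sg x (Some p) v + (circ w + D')" unfolding D by (rule add.left_commute)
    then show ?case by blast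
  qed simp
  then show ?thesis using that by blast
qed

section \<open>Gluing at one point\<close>

definition gluable :: "pt \<Rightarrow> 'l diag \<Rightarrow> bool" where
  "gluable p D \<longleftrightarrow> count (tails D) p = 1 \<and> count (heads D) p = 1"

definition fresh :: "pt \<Rightarrow> 'l diag \<Rightarrow> bool" where
  "fresh p D \<longleftrightarrow> p \<notin># tails D \<and> p \<notin># heads D"

lemma fresh_simps [simp]:
  "fresh p 0" "fresh p (D + E) \<longleftrightarrow> fresh p D \<and> fresh p E"
  "fresh p (sg t h w) \<longleftrightarrow> t \<noteq> Some p \<and> h \<noteq> Some p" "fresh p (circ w)"
  by (auto simp: fresh_def)

lemma gluable_add_fresh [simp]:
  "fresh p E \<Longrightarrow> gluable p (D + E) \<longleftrightarrow> gluable p D"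
  "fresh p E \<Longrightarrow> gluable p (E + D) \<longleftrightarrow> gluable p D"
  by (auto simp: fresh_def gluable_def not_in_iff)

text \<open>Gluing at an arbitrary point; it is made total by doing nothing at a point that cannot be
  glued, so that gluings at different points always commute.\<close>

definition glue_at :: "pt \<Rightarrow> 'l diag \<Rightarrow> 'l diag" where
  "glue_at p D = (if gluable p D then (case D of (A, U) \<Rightarrow>
     let s = (THE s. s \<in># A \<and> seg_head s = Some p);
         r = (THE r. r \<in># A \<and> seg_tail r = Some p)
     in if s = r then (A - {#s#}, add_mset (cyc (seg_word s)) U)
        else (add_mset (seg_tail s, seg_head r, seg_word r @ seg_word s) (A - {#s#} - {#r#}), U)) else D)"

lemma fresh_tailD: "fresh p D \<Longrightarrow> s \<in># fst D \<Longrightarrow> seg_tail s \<noteq> Some p"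
  and fresh_headD: "fresh p D \<Longrightarrow> s \<in># fst D \<Longrightarrow> seg_head s \<noteq> Some p"
  by (force simp: fresh_def tails_def heads_def)+

text \<open>This rule and \<open>glue_at_join\<close> evaluate the definite descriptions once and
  for all. By \<open>gluable_cases\<close> every later statement about gluing reduces to these two
  shapes: a segment that closes up to a circle, or two distinct segments that are joined.\<close>

lemma glue_at_circle:
  assumes "fresh p D"
  shows "glue_at p (sg (Some p) (Some p) w + D) = circ w + D"
proof -
  obtain A U where D: "D = (A, U)" by (cases D)
  have f: "seg_tail s \<noteq> Some p" "seg_head s \<noteq> Some p" if "s \<in># A" for s
    using fresh_tailD[OF assms] fresh_headD[OF assms] that D by auto
  have g: "gluable p (add_mset (Some p, Some p, w) A, U)"
    using gluable_add_fresh(1)[OF assms, of "sg (Some p) (Some p) w"] D by (simp add: gluable_def)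
  have 1: "(THE s. (s = (Some p, Some p, w) \<or> s \<in># A) \<and> seg_head s = Some p) = (Some p, Some p, w)"
    by (rule the_equality) (use f in auto)
  have 2: "(THE s. (s = (Some p, Some p, w) \<or> s \<in># A) \<and> seg_tail s = Some p) = (Some p, Some p, w)"
    by (rule the_equality) (use f in auto)
  show ?thesis using g by (simp add: D glue_at_def Let_def 1 2)
qed

lemma glue_at_join:
  assumes "fresh p D" "t \<noteq> Some p" "h \<noteq> Some p"
  shows "glue_at p (sg t (Some p) w + (sg (Some p) h v + D)) = sg t h (v @ w) + D"
proof -
  obtain A U where D: "D = (A, U)" by (cases D)
  have f: "seg_tail s \<noteq> Some p" "seg_head s \<noteq> Some p" if "s \<in># A" for s
    using fresh_tailD[OF assms(1)] fresh_headD[OF assms(1)] that D by auto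
  define A0 where "A0 = add_mset (t, Some p, w) (add_mset (Some p, h, v) A)"
  have A0: "x \<in># A0 \<longleftrightarrow> x = (t, Some p, w) \<or> x = (Some p, h, v) \<or> x \<in># A"
    "A0 - {#(t, Some p, w)#} - {#(Some p, h, v)#} = A" for x
    by (auto simp: A0_def)
  have e: "sg t (Some p) w + (sg (Some p) h v + D) = (A0, U)"
    by (simp add: D A0_def)
  have g: "gluable p (A0, U)"
    unfolding e[symmetric]
    using assms by (simp add: gluable_def count_tails_sg count_heads_sg fresh_def not_in_iff)
  have 1: "(THE s. s \<in># A0 \<and> seg_head s = Some p) = (t, Some p, w)"
    by (rule the_equality) (use f assms in \<open>auto simp: A0\<close>)
  have 2: "(THE s. s \<in># A0 \<and> seg_tail s = Some p) = (Some p, h, v)"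
    by (rule the_equality) (use f assms in \<open>auto simp: A0\<close>)
  have "A0 - {#(Some p, h, v), (t, Some p, w)#} = A" by (simp add: A0_def)
  then show ?thesis unfolding e using g assms by (simp add: D glue_at_def Let_def 1 2)
qed

lemma gluableD: "gluable p D \<Longrightarrow> p \<in># tails D" "gluable p D \<Longrightarrow> p \<in># heads D"
  by (auto simp: gluable_def simp flip: count_greater_zero_iff)

lemma gluable_cases:
  assumes "gluable p D"
  obtains (circle) w D' where "D = sg (Some p) (Some p) w + D'" "fresh p D'"
  | (join) t h w v D' where "D = sg t (Some p) w + (sg (Some p) h v + D')" "fresh p D'"
      "t \<noteq> Some p" "h \<noteq> Some p"
proof -
  have "p \<in># heads D" using assms by (rule gluableD)
  then obtain t w E where E: "D = sg t (Some p) w + E" by (rule split_head)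
  show thesis
  proof (cases "t = Some p")
    case True
    then have "fresh p E" using assms E by (auto simp: gluable_def fresh_def not_in_iff)
    then show ?thesis using circle E True by blast
  next
    case False
    then have "p \<in># tails E" using assms E by (auto simp: gluable_def count_tails_sg intro: count_inI)
    then obtain h v D' where D': "E = sg (Some p) h v + D'" by (rule split_tail)
    have "fresh p D'" "h \<noteq> Some p"
      using assms False by (auto simp: gluable_def fresh_def not_in_iff E D' count_tails_sg count_heads_sg split: if_splits)
    then show ?thesis using join E D' False by blast
  qed
qed

lemma glue_at_not_gluable [simp]: "\<not> gluable p D \<Longrightarrow> glue_at p D = D"
  by (auto simp: glue_at_def)

text \<open>Gluing is local: a part that does not meet \<open>p\<close> is a bystander in both
  shapes of \<open>gluable_cases\<close>. In linear form this becomes \<open>glue_lin_mult\<close>,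
  the rule for pulling factors out of a gluing.\<close>

lemma glue_at_add:
  assumes "fresh p E"
  shows "glue_at p (D + E) = glue_at p D + E"
proof (cases "gluable p D")
  case True
  then show ?thesis
  proof (cases rule: gluable_cases)
    case (circle w D')
    then show ?thesis using assms glue_at_circle[of p "D' + E" w]
      by (simp add: glue_at_circle add.assoc)
  next
    case (join t h w v D')
    then show ?thesis using assms glue_at_join[of p "D' + E" t h w v]
      by (simp add: glue_at_join add.assoc)
  qed
next
  case False
  then show ?thesis using assms by simp
qed

lemma tails_glue_at: "gluable p D \<Longrightarrow> tails (glue_at p D) = tails D - {#p#}"
  and heads_glue_at: "gluable p D \<Longrightarrow> heads (glue_at p D) = heads D - {#p#}"
proof -
  have "tails (glue_at p D) = tails D - {#p#} \<and> heads (glue_at p D) = heads D - {#p#}" if "gluable p D"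
    using that
  proof (cases rule: gluable_cases)
    case (join t h w v D')
    then show ?thesis by (cases t; cases h; simp add: glue_at_join)
  qed (simp add: glue_at_circle)
  then show "gluable p D \<Longrightarrow> tails (glue_at p D) = tails D - {#p#}"
    "gluable p D \<Longrightarrow> heads (glue_at p D) = heads D - {#p#}" by auto
qed

text \<open>A gluing removes one occurrence of its own point from the tails and one from the heads,
  so the counts at all other points are unchanged.\<close>

lemma gluable_glue_at: "p \<noteq> q \<Longrightarrow> gluable p (glue_at q D) \<longleftrightarrow> gluable p D"
  by (cases "gluable q D") (auto simp: gluable_def tails_glue_at heads_glue_at)

lemma fresh_glue_at: "fresh p D \<Longrightarrow> fresh p (glue_at q D)"
  by (cases "gluable q D") (auto simp: fresh_def tails_glue_at heads_glue_at dest: in_diffD)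

lemma labels_in_glue_at: "labels_in L D \<Longrightarrow> labels_in L (glue_at p D)"
proof (cases "gluable p D")
  case True
  then show "labels_in L D \<Longrightarrow> labels_in L (glue_at p D)"
    by (cases rule: gluable_cases) (auto simp: glue_at_circle glue_at_join)
qed simp

text \<open>If another endpoint were sent to \<open>\<rho> p\<close>, that point would occur too
  often and the relabelled diagram could not be glued there; the second assumption excludes
  this.\<close>

lemma glue_at_map_diag:
  assumes "gluable p D" "\<And>q. q \<in># tails D + heads D \<Longrightarrow> \<rho> q = \<rho> p \<Longrightarrow> q = p"
  shows "glue_at (\<rho> p) (map_diag \<rho> D) = map_diag \<rho> (glue_at p D)"
proof -
  have fr: "fresh (\<rho> p) (map_diag \<rho> D')"
    if f: "fresh p D'" and sub: "\<And>q. q \<in># tails D' + heads D' \<Longrightarrow> q \<in># tails D + heads D" for D'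
  proof -
    have "\<rho> q \<noteq> \<rho> p" if q: "q \<in># tails D' + heads D'" for q
    proof
      assume "\<rho> q = \<rho> p"
      then have "q = p" using assms(2)[OF sub[OF q]] by blast
      then show False using f q by (auto simp: fresh_def)
    qed
    then have "\<rho> p \<notin> \<rho> ` set_mset (tails D')" "\<rho> p \<notin> \<rho> ` set_mset (heads D')"
      by (metis imageE union_iff)+
    then show ?thesis by (simp add: fresh_def)
  qed
  from assms(1) show ?thesis
  proof (cases rule: gluable_cases)
    case (circle w D')
    then show ?thesis using fr[of D'] by (simp add: glue_at_circle)
  next
    case (join t h w v D')
    have "fresh (\<rho> p) (map_diag \<rho> D')" using fr[of D'] join by auto
    moreover have "\<rho> q \<noteq> \<rho> p" if "t = Some q \<or> h = Some q" for q
    proof -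
      have "q \<in># tails D + heads D" using that join(1) by auto
      then show ?thesis using assms(2)[of q] that join(3,4) by blast
    qed
    then have "map_option \<rho> t \<noteq> Some (\<rho> p)" "map_option \<rho> h \<noteq> Some (\<rho> p)"
      by auto
    ultimately show ?thesis using join by (simp add: glue_at_join)
  qed
qed

text \<open>The source of associativity. The segments meeting \<open>p\<close> are isolated first;
  after they are joined, \<open>q\<close> can touch the result at its tail, at its head, at both or
  not at all.\<close>

lemma glue_at_commute: "glue_at p (glue_at q D) = glue_at q (glue_at p D)"
proof -
  consider "p = q" | "\<not> gluable p D \<or> \<not> gluable q D" "p \<noteq> q" | "gluable p D" "gluable q D" "p \<noteq> q" by blast
  then show ?thesis
  proof cases
    case 2
    then show ?thesis by (auto simp: gluable_glue_at)
  next
    case 3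
    from 3(1) show ?thesis
    proof (cases rule: gluable_cases)
      case (circle w D')
      have "glue_at q D = sg (Some p) (Some p) w + glue_at q D'"
        using glue_at_add[of q "sg (Some p) (Some p) w" D'] 3 circle by (simp add: add.commute)
      moreover have "glue_at q (circ w + D') = circ w + glue_at q D'"
        using glue_at_add[of q "circ w" D'] by (simp add: add.commute)
      ultimately show ?thesis using circle by (simp add: glue_at_circle fresh_glue_at)
    next
      case (join t h w v D')
      consider "t = Some q" "h = Some q" | "t = Some q" "h \<noteq> Some q" | "t \<noteq> Some q" "h = Some q"
        | "t \<noteq> Some q" "h \<noteq> Some q" by blast
      then show ?thesis
      proof cases
        case 1
        \<comment> \<open>The two segments form one circle that is cut at \<open>p\<close> and at
          \<open>q\<close>. The two orders of gluing read its word from different starting points,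
          and \<open>cyc_rotate\<close> identifies the results.\<close>
        have fq: "fresh q D'" using 3(2) join 1 by (auto simp: gluable_def fresh_def not_in_iff)
        have "glue_at q D = sg (Some p) (Some p) (w @ v) + D'"
          using glue_at_join[OF fq, of "Some p" "Some p" v w] join 1 3 by (simp add: add.left_commute)
        then show ?thesis using join 1 3 fq by (simp add: glue_at_join glue_at_circle cyc_rotate)
      next
        case 2
        have "q \<in># heads D'" using 3(2) join 2 3(3)
          by (auto simp: gluable_def count_tails_sg count_heads_sg intro!: count_inI)
        then obtain t' u D'' where D'': "D' = sg t' (Some q) u + D''" by (rule split_head)
        have fq: "fresh q D''" "t' \<noteq> Some q" using 3(2) join 2 D''
          by (auto simp: gluable_def fresh_def not_in_iff count_tails_sg count_heads_sg split: if_splits)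
        have fp: "fresh p D''" "t' \<noteq> Some p" using join D'' by auto
        have "glue_at q D = sg t' (Some p) (w @ u) + (sg (Some p) h v + D'')"
          using glue_at_join[of q "sg (Some p) h v + D''" t' "Some p" u w] join 2 3 fq
          by (simp add: D'' add.left_commute)
        moreover have "glue_at p D = sg t' (Some q) u + (sg (Some q) h (v @ w) + D'')"
          unfolding join(1) using glue_at_join[OF join(2), of t h w v] join(3,4) 2
          by (simp add: D'' add.left_commute)
        ultimately show ?thesis using fp fq join 2 by (simp add: glue_at_join)
      next
        case 3
        have "q \<in># tails D'" using \<open>gluable q D\<close> join 3 \<open>p \<noteq> q\<close>
          by (auto simp: gluable_def count_tails_sg count_heads_sg intro!: count_inI)
        then obtain h' u D'' where D'': "D' = sg (Some q) h' u + D''" by (rule split_tail)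
        have fq: "fresh q D''" "h' \<noteq> Some q" using \<open>gluable q D\<close> join 3 D''
          by (auto simp: gluable_def fresh_def not_in_iff count_tails_sg count_heads_sg split: if_splits)
        have fp: "fresh p D''" "h' \<noteq> Some p" using join D'' by auto
        have "glue_at q D = sg t (Some p) w + (sg (Some p) h' (u @ v) + D'')"
          using glue_at_join[of q "sg t (Some p) w + D''" "Some p" h' v u] join 3 \<open>p \<noteq> q\<close> fq
          by (simp add: D'' add.left_commute)
        moreover have "glue_at p D = sg t (Some q) (v @ w) + (sg (Some q) h' u + D'')"
          unfolding join(1) using glue_at_join[OF join(2), of t h w v] join(3,4) 3
          by (simp add: D'' add.left_commute)
        ultimately show ?thesis using fp fq join 3 by (simp add: glue_at_join)
      next
        case 4
        have g: "glue_at q D = sg t (Some p) w + (sg (Some p) h v + glue_at q D')"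
        proof -
          have "fresh q (sg t (Some p) w + sg (Some p) h v)"
            unfolding fresh_simps using 4 3 by auto
          from glue_at_add[OF this, of D'] show ?thesis
            unfolding join(1) by (simp only: add_ac)
        qed
        have "glue_at q (sg t h (v @ w) + D') = sg t h (v @ w) + glue_at q D'"
          using glue_at_add[of q "sg t h (v @ w)" D'] 4 by (simp add: add.commute)
        then show ?thesis unfolding g using join by (simp add: glue_at_join fresh_glue_at)
      qed
    qed
  qed simp
qed

interpretation glue_at: comp_fun_commute glue_at
  by standard (auto simp: fun_eq_iff glue_at_commute)

section \<open>Gluing at a finite set of points\<close>

definition glue_set :: "pt set \<Rightarrow> 'l diag \<Rightarrow> 'l diag" where
  "glue_set P D = Finite_Set.fold glue_at D P"

lemma glue_set_empty [simp]: "glue_set {} D = D"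
  by (simp add: glue_set_def)

lemma glue_set_insert: "finite P \<Longrightarrow> p \<notin> P \<Longrightarrow> glue_set (insert p P) D = glue_at p (glue_set P D)"
  by (simp add: glue_set_def)

lemma glue_set_insert2: "finite P \<Longrightarrow> p \<notin> P \<Longrightarrow> glue_set (insert p P) D = glue_set P (glue_at p D)"
  by (simp add: glue_set_def glue_at.fold_fun_left_comm)

lemma glue_set_Un:
  assumes "finite P" "finite Q" "P \<inter> Q = {}"
  shows "glue_set (P \<union> Q) D = glue_set P (glue_set Q D)"
  using assms by (induction P) (auto simp: glue_set_insert)

lemma gluable_glue_set: "finite P \<Longrightarrow> p \<notin> P \<Longrightarrow> gluable p (glue_set P D) \<longleftrightarrow> gluable p D"
  by (induction P rule: finite_induct) (auto simp: glue_set_insert gluable_glue_at)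

lemma labels_in_glue_set: "finite P \<Longrightarrow> labels_in L D \<Longrightarrow> labels_in L (glue_set P D)"
  by (induction P rule: finite_induct) (auto simp: glue_set_insert labels_in_glue_at)

lemma glue_set_add:
  assumes "finite P" "\<And>p. p \<in> P \<Longrightarrow> fresh p E"
  shows "glue_set P (D + E) = glue_set P D + E"
  using assms by (induction P rule: finite_induct) (auto simp: glue_set_insert glue_at_add)

lemma tails_glue_set:
    "finite P \<Longrightarrow> (\<And>p. p \<in> P \<Longrightarrow> gluable p D) \<Longrightarrow> tails (glue_set P D) = tails D - mset_set P"
  and heads_glue_set:
    "finite P \<Longrightarrow> (\<And>p. p \<in> P \<Longrightarrow> gluable p D) \<Longrightarrow> heads (glue_set P D) = heads D - mset_set P"
  by (induction P rule: finite_induct)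
    (auto simp: glue_set_insert tails_glue_at heads_glue_at gluable_glue_set)

lemma glue_set_map_diag:
  assumes "finite P" "inj_on \<rho> P" "\<And>p. p \<in> P \<Longrightarrow> gluable p D"
    "\<And>p q. p \<in> P \<Longrightarrow> q \<in># tails D + heads D \<Longrightarrow> \<rho> q = \<rho> p \<Longrightarrow> q = p"
  shows "glue_set (\<rho> ` P) (map_diag \<rho> D) = map_diag \<rho> (glue_set P D)"
  using assms
proof (induction P rule: finite_induct)
  case (insert p P)
  have "glue_set (\<rho> ` insert p P) (map_diag \<rho> D) = glue_at (\<rho> p) (glue_set (\<rho> ` P) (map_diag \<rho> D))"
    using insert.hyps insert.prems(1) by (auto simp: glue_set_insert)
  also have "\<dots> = glue_at (\<rho> p) (map_diag \<rho> (glue_set P D))"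
    using insert by simp
  also have "\<dots> = map_diag \<rho> (glue_at p (glue_set P D))"
  proof (rule glue_at_map_diag)
    show "gluable p (glue_set P D)" using insert by (simp add: gluable_glue_set)
    fix q assume q: "q \<in># tails (glue_set P D) + heads (glue_set P D)" "\<rho> q = \<rho> p"
    have g: "\<And>p. p \<in> P \<Longrightarrow> gluable p D" using insert.prems by simp
    from q(1) have "q \<in># tails D + heads D"
      by (auto simp: tails_glue_set[OF insert.hyps(1) g] heads_glue_set[OF insert.hyps(1) g] dest: in_diffD)
    then show "q = p" using insert.prems q(2) by blast
  qed
  finally show ?case using insert.hyps by (simp add: glue_set_insert)
qed simp

lemma glue_eq_glue_at: "gluable (Mid m) D \<Longrightarrow> glue m D = glue_at (Mid m) D"
  by (simp add: glue_def glue_at_def)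

text \<open>The original \<open>glue\<close> is meaningful only at a point that occurs once as a
  head and once as a tail. Gluing at other points preserves this, so the ordered iteration agrees
  with the order-free \<open>glue_set\<close>.\<close>

lemma glue_all_eq:
  assumes "\<And>i. i < n \<Longrightarrow> gluable (Mid i) D"
  shows "glue_all n D = glue_set (Mid ` {..<n}) D"
  using assms
proof (induction n)
  case (Suc n)
  have "gluable (Mid n) (glue_set (Mid ` {..<n}) D)" using Suc.prems by (subst gluable_glue_set) auto
  moreover have "glue_set (insert (Mid n) (Mid ` {..<n})) D = glue_at (Mid n) (glue_set (Mid ` {..<n}) D)"
    by (rule glue_set_insert) auto
  ultimately show ?case using Suc by (simp add: glue_all_def glue_eq_glue_at lessThan_Suc)
qed (simp add: glue_all_def)

text \<open>An undecorated strand adds the empty word to the segment that it is joined to, so only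
  the name of the endpoint changes. The unit laws below rest on this and on its mirror image for
  heads.\<close>

lemma glue_at_strand_tail:
  assumes "count (tails D) p = 1" "p \<notin># heads D" "q \<noteq> p"
  shows "glue_at p (D + sg (Some q) (Some p) []) = map_diag (id(p := q)) D"
proof -
  have "p \<in># tails D" using assms by (simp add: count_inI)
  then obtain h w D' where D: "D = sg (Some p) h w + D'" by (rule split_tail)
  then have f: "fresh p D'" "h \<noteq> Some p"
    using assms by (auto simp: fresh_def not_in_iff count_heads_sg split: if_splits)
  have "map_diag (id(p := q)) D' = D'" by (rule map_diag_ident) (use f in \<open>auto simp: fresh_def\<close>)
  moreover have "map_option (id(p := q)) h = h" using f by (cases h) auto
  ultimately show ?thesis using glue_at_join[OF f(1), of "Some q" h "[]" w] f assms D
    by (simp add: add_ac)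
qed

lemma glue_at_strand_head:
  assumes "count (heads D) p = 1" "p \<notin># tails D" "q \<noteq> p"
  shows "glue_at p (D + sg (Some p) (Some q) []) = map_diag (id(p := q)) D"
proof -
  have "p \<in># heads D" using assms by (simp add: count_inI)
  then obtain t w D' where D: "D = sg t (Some p) w + D'" by (rule split_head)
  then have f: "fresh p D'" "t \<noteq> Some p"
    using assms by (auto simp: fresh_def not_in_iff count_tails_sg split: if_splits)
  have "map_diag (id(p := q)) D' = D'" by (rule map_diag_ident) (use f in \<open>auto simp: fresh_def\<close>)
  moreover have "map_option (id(p := q)) t = t" using f by (cases t) auto
  ultimately show ?thesis using glue_at_join[OF f(1), of t "Some q" w "[]"] f assms D
    by (simp add: add_ac)
qed

definition strand :: "sign \<Rightarrow> pt \<Rightarrow> pt \<Rightarrow> 'l diag" where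
  "strand s p q = (if s = Pos then sg (Some p) (Some q) [] else sg (Some q) (Some p) [])"

lemma fresh_strand [simp]: "fresh r (strand s p q) \<longleftrightarrow> r \<noteq> p \<and> r \<noteq> q"
  by (auto simp: strand_def)

lemma map_diag_strand [simp]: "map_diag \<rho> (strand s p q) = strand s (\<rho> p) (\<rho> q)"
  by (auto simp: strand_def)

lemma fresh_sum: "finite I \<Longrightarrow> (\<And>i. i \<in> I \<Longrightarrow> fresh p (d i)) \<Longrightarrow> fresh p (sum d I)"
  by (induction I rule: finite_induct) auto

lemma map_diag_sum: "finite I \<Longrightarrow> map_diag \<rho> (sum d I) = (\<Sum>i\<in>I. map_diag \<rho> (d i))"
  by (induction I rule: finite_induct) auto

lemma glue_set_strands:
  assumes "finite P" "\<And>p. p \<in> P \<Longrightarrow> \<rho> p \<notin> P"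
    and "\<And>p. p \<in> P \<Longrightarrow> if \<sigma> p = Pos then count (heads D) p = 1 \<and> p \<notin># tails D
           else count (tails D) p = 1 \<and> p \<notin># heads D"
  shows "glue_set P (D + (\<Sum>p\<in>P. strand (\<sigma> p) p (\<rho> p))) = map_diag (\<lambda>p. if p \<in> P then \<rho> p else p) D"
  using assms
proof (induction P arbitrary: D rule: finite_induct)
  case empty
  then show ?case by (simp add: map_diag_ident)
next
  case (insert p P)
  let ?S = "\<Sum>p\<in>P. strand (\<sigma> p) p (\<rho> p)"
  have ne: "\<rho> p \<noteq> p" "\<rho> p \<notin> P" "\<And>q. q \<in> P \<Longrightarrow> \<rho> q \<noteq> p" using insert.prems(1) by auto
  have "glue_at p ((D + strand (\<sigma> p) p (\<rho> p)) + ?S) = glue_at p (D + strand (\<sigma> p) p (\<rho> p)) + ?S"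
    by (rule glue_at_add, rule fresh_sum) (use insert.hyps ne in auto)
  also have "glue_at p (D + strand (\<sigma> p) p (\<rho> p)) = map_diag (id(p := \<rho> p)) D"
    using insert.prems(2)[of p] ne
    by (auto simp: strand_def glue_at_strand_head glue_at_strand_tail split: if_splits)
  finally have 1: "glue_set (insert p P) (D + (\<Sum>p\<in>insert p P. strand (\<sigma> p) p (\<rho> p)))
     = glue_set P (map_diag (id(p := \<rho> p)) D + ?S)"
    using insert.hyps by (simp add: glue_set_insert2 add.assoc)
  \<comment> \<open>Renaming \<open>p\<close> to \<open>\<rho> p\<close> does not disturb the other
    points of \<open>P\<close>, because \<open>\<rho> p\<close> lies outside
    \<open>insert p P\<close>; hence the assumptions survive the induction step.\<close>
  have c: "count (image_mset (id(p := \<rho> p)) M) q = count M q" if "q \<in> P" for q M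
  proof -
    have "(id(p := \<rho> p)) -` {q} \<inter> set_mset M = {q} \<inter> set_mset M"
      using ne that insert.hyps by (auto split: if_splits)
    then show ?thesis by (cases "q \<in># M") (auto simp: count_image_mset not_in_iff Int_insert_left)
  qed
  have "glue_set P (map_diag (id(p := \<rho> p)) D + ?S)
     = map_diag (\<lambda>p. if p \<in> P then \<rho> p else p) (map_diag (id(p := \<rho> p)) D)"
  proof (rule insert.IH)
    show "\<And>q. q \<in> P \<Longrightarrow> \<rho> q \<notin> P" using insert.prems(1) by auto
    fix q assume q: "q \<in> P"
    show "if \<sigma> q = Pos then count (heads (map_diag (id(p := \<rho> p)) D)) q = 1 \<and> q \<notin># tails (map_diag (id(p := \<rho> p)) D)
      else count (tails (map_diag (id(p := \<rho> p)) D)) q = 1 \<and> q \<notin># heads (map_diag (id(p := \<rho> p)) D)"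
      using insert.prems(2)[of q] q ne by (auto simp: c[OF q] not_in_iff split: if_splits)
  qed
  then show ?case using 1 ne by (auto simp: map_diag_map_diag insert.hyps intro!: map_diag_cong)
qed

section \<open>Linear combinations\<close>

lemma lookup_scale [simp]: "Poly_Mapping.lookup (scale c f) d = c * Poly_Mapping.lookup f d"
  by (simp add: scale_def Poly_Mapping.map.rep_eq when_def)

lemma scale_simps [simp]:
  "scale c 0 = 0" "scale 0 f = 0" "scale 1 f = f" "scale c (scale d f) = scale (c * d) f"
  "scale c (Poly_Mapping.single x a) = Poly_Mapping.single x (c * a)"
  by (rule poly_mapping_eqI, simp add: lookup_single when_def)+

lemma scale_add: "scale c (f + g) = scale c f + scale c g"
  and scale_add_left: "scale (c + d) f = scale c f + scale d f"
  and scale_diff: "scale c (f - g) = scale c f - scale c g"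
  and scale_uminus: "scale (- c) f = - scale c f"
  by (rule poly_mapping_eqI, simp add: lookup_add lookup_minus algebra_simps)+

lemma scale_sum: "scale c (\<Sum>i\<in>I. f i) = (\<Sum>i\<in>I. scale c (f i))"
  by (induction I rule: infinite_finite_induct) (auto simp: scale_add)

lemma keys_scale: "Poly_Mapping.keys (scale c f) \<subseteq> Poly_Mapping.keys f"
  by (auto simp: in_keys_iff)

abbreviation span :: "'x set \<Rightarrow> ('x \<Rightarrow>\<^sub>0 'k::field) set" where
  "span X \<equiv> {f. Poly_Mapping.keys f \<subseteq> X}"

lemma span_add: "f \<in> span X \<Longrightarrow> g \<in> span X \<Longrightarrow> f + g \<in> span X"
  using keys_add[of f g] by auto

lemma span_scale: "f \<in> span X \<Longrightarrow> scale c f \<in> span X"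
  using keys_scale[of c f] by auto

lemma span_uminus: "f \<in> span X \<Longrightarrow> - f \<in> span X"
  by simp

lemma span_diff: "f \<in> span X \<Longrightarrow> g \<in> span X \<Longrightarrow> f - g \<in> span X"
  using keys_diff[of f g] by auto

lemma span_sum: "(\<And>i. i \<in> I \<Longrightarrow> f i \<in> span X) \<Longrightarrow> sum f I \<in> span X"
proof (induction I rule: infinite_finite_induct)
  case (insert i I)
  then have "f i \<in> span X" "sum f I \<in> span X" by auto
  then show ?case using insert.hyps by (simp add: span_add[unfolded mem_Collect_eq])
qed auto

lemma span_gen: "d \<in> X \<Longrightarrow> gen d \<in> span X"
  by simp

lemma sum_keys: "(\<Sum>d\<in>Poly_Mapping.keys f. Poly_Mapping.single d (Poly_Mapping.lookup f d)) = f"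
proof (rule poly_mapping_eqI)
  fix x
  have "Poly_Mapping.lookup (\<Sum>d\<in>Poly_Mapping.keys f. Poly_Mapping.single d (Poly_Mapping.lookup f d)) x
    = (\<Sum>d\<in>Poly_Mapping.keys f. if d = x then Poly_Mapping.lookup f x else 0)"
    by (simp add: lookup_sum lookup_single when_def if_distrib cong: if_cong)
  also have "\<dots> = Poly_Mapping.lookup f x" by (simp add: in_keys_iff)
  finally show "Poly_Mapping.lookup (\<Sum>d\<in>Poly_Mapping.keys f. Poly_Mapping.single d (Poly_Mapping.lookup f d)) x
    = Poly_Mapping.lookup f x" .
qed

lemma span_induct [consumes 1, case_names zero add]:
  fixes f :: "'x \<Rightarrow>\<^sub>0 'k::field"
  assumes "f \<in> span X" "P 0"
    and "\<And>f d c. f \<in> span X \<Longrightarrow> d \<in> X \<Longrightarrow> P f \<Longrightarrow> P (f + scale c (gen d))"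
  shows "P f"
proof -
  have "P (\<Sum>d\<in>K. Poly_Mapping.single d (Poly_Mapping.lookup f d))
      \<and> (\<Sum>d\<in>K. Poly_Mapping.single d (Poly_Mapping.lookup f d)) \<in> span X" if "finite K" "K \<subseteq> X" for K
    using that
  proof (induction K rule: finite_induct)
    case (insert d K)
    let ?s = "\<Sum>d\<in>K. Poly_Mapping.single d (Poly_Mapping.lookup f d)"
    have "P (?s + scale (Poly_Mapping.lookup f d) (gen d))" using insert by (intro assms(3)) auto
    moreover have "Poly_Mapping.single d (Poly_Mapping.lookup f d) + ?s \<in> span X"
      using insert by (intro span_add) auto
    ultimately show ?case using insert.hyps by (simp add: add.commute)
  qed (use assms(2) in auto)
  from this[of "Poly_Mapping.keys f"] show ?thesis using assms(1) by (simp add: sum_keys)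
qed

lemma lin_induct [case_names zero add]:
  fixes f :: "'x \<Rightarrow>\<^sub>0 'k::field"
  assumes "P 0" "\<And>f d c. P f \<Longrightarrow> P (f + scale c (gen d))"
  shows "P f"
proof -
  have "f \<in> span UNIV" by simp
  then show ?thesis by (induction f rule: span_induct) (use assms in auto)
qed

text \<open>The empty diagram is the unit of the convolution algebra, so scalars are multiples of it
  and move through products by commutativity.\<close>

lemma scale_eq_mult: "scale c f = Poly_Mapping.single 0 c * (f :: 'x::comm_monoid_add \<Rightarrow>\<^sub>0 'k::field)"
  by (induction f rule: lin_induct) (simp_all add: scale_add distrib_left mult_single)

lemma scale_mult_left: "scale c f * g = scale c (f * (g :: 'x::comm_monoid_add \<Rightarrow>\<^sub>0 'k::field))"
  and scale_mult_right: "f * scale c g = scale c (f * (g :: 'x::comm_monoid_add \<Rightarrow>\<^sub>0 'k::field))"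
  by (simp_all add: scale_eq_mult mult_ac)

lemma gen_mult_gen: "gen (d :: 'x::comm_monoid_add) * (gen e :: 'x \<Rightarrow>\<^sub>0 'k::field) = gen (d + e)"
  by (simp add: mult_single)

lemma gen_zero: "(gen (0 :: 'x::comm_monoid_add) :: 'x \<Rightarrow>\<^sub>0 'k::field) = 1"
  by simp

lemma lin_ext_superset:
  assumes "finite K" "Poly_Mapping.keys f \<subseteq> K"
  shows "lin_ext \<phi> f = (\<Sum>d\<in>K. scale (Poly_Mapping.lookup f d) (\<phi> d))"
  unfolding lin_ext_def by (rule sum.mono_neutral_left) (use assms in \<open>auto simp: in_keys_iff\<close>)

lemma lin_eval_superset:
  assumes "finite K" "Poly_Mapping.keys f \<subseteq> K"
  shows "lin_eval \<phi> f = (\<Sum>d\<in>K. Poly_Mapping.lookup f d * \<phi> d)"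
  unfolding lin_eval_def by (rule sum.mono_neutral_left) (use assms in \<open>auto simp: in_keys_iff\<close>)

lemma lin_ext_zero [simp]: "lin_ext \<phi> 0 = 0"
  by (simp add: lin_ext_def)

lemma lin_eval_zero [simp]: "lin_eval \<phi> 0 = 0"
  by (simp add: lin_eval_def)

lemma lin_ext_add: "lin_ext \<phi> (f + g) = lin_ext \<phi> f + lin_ext \<phi> g"
proof -
  let ?K = "Poly_Mapping.keys f \<union> Poly_Mapping.keys g"
  have "lin_ext \<phi> (f + g) = (\<Sum>d\<in>?K. scale (Poly_Mapping.lookup (f + g) d) (\<phi> d))"
    by (rule lin_ext_superset) (use keys_add[of f g] in auto)
  also have "\<dots> = (\<Sum>d\<in>?K. scale (Poly_Mapping.lookup f d) (\<phi> d)) + (\<Sum>d\<in>?K. scale (Poly_Mapping.lookup g d) (\<phi> d))"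
    by (simp add: lookup_add scale_add_left sum.distrib)
  also have "\<dots> = lin_ext \<phi> f + lin_ext \<phi> g" by (simp add: lin_ext_superset[of ?K])
  finally show ?thesis .
qed

lemma lin_eval_add: "lin_eval \<phi> (f + g) = lin_eval \<phi> f + lin_eval \<phi> g"
proof -
  let ?K = "Poly_Mapping.keys f \<union> Poly_Mapping.keys g"
  have "lin_eval \<phi> (f + g) = (\<Sum>d\<in>?K. Poly_Mapping.lookup (f + g) d * \<phi> d)"
    by (rule lin_eval_superset) (use keys_add[of f g] in auto)
  also have "\<dots> = (\<Sum>d\<in>?K. Poly_Mapping.lookup f d * \<phi> d) + (\<Sum>d\<in>?K. Poly_Mapping.lookup g d * \<phi> d)"
    by (simp add: lookup_add distrib_right sum.distrib)
  also have "\<dots> = lin_eval \<phi> f + lin_eval \<phi> g" by (simp add: lin_eval_superset[of ?K])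
  finally show ?thesis .
qed

lemma lin_ext_scale: "lin_ext \<phi> (scale c f) = scale c (lin_ext \<phi> f)"
  using lin_ext_superset[OF finite_keys keys_scale, of \<phi> c f]
  by (simp add: lin_ext_def scale_sum)

lemma lin_eval_scale: "lin_eval \<phi> (scale c f) = c * lin_eval \<phi> f"
  using lin_eval_superset[OF finite_keys keys_scale, of \<phi> c f]
  by (simp add: lin_eval_def sum_distrib_left mult.assoc)

lemma lin_ext_uminus: "lin_ext \<phi> (- f) = - lin_ext \<phi> f"
  using lin_ext_scale[of \<phi> "- 1" f] by (simp add: scale_uminus)

lemma lin_ext_diff: "lin_ext \<phi> (f - g) = lin_ext \<phi> f - lin_ext \<phi> g"
  using lin_ext_add[of \<phi> f "- g"] by (simp add: lin_ext_uminus)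

lemma lin_eval_diff: "lin_eval \<phi> (f - g) = lin_eval \<phi> f - lin_eval \<phi> g"
  using lin_eval_add[of \<phi> f "- g"] lin_eval_scale[of \<phi> "- 1" g] by (simp add: scale_uminus)

lemma lin_ext_single [simp]: "lin_ext \<phi> (Poly_Mapping.single d c) = scale c (\<phi> d)"
  by (cases "c = 0") (simp_all add: lin_ext_def)

lemma lin_eval_single [simp]: "lin_eval \<phi> (Poly_Mapping.single d c) = c * \<phi> d"
  by (cases "c = 0") (simp_all add: lin_eval_def)

lemma lin_ext_sum: "lin_ext \<phi> (\<Sum>i\<in>I. f i) = (\<Sum>i\<in>I. lin_ext \<phi> (f i))"
  by (induction I rule: infinite_finite_induct) (auto simp: lin_ext_add)

lemma lin_eval_sum: "lin_eval \<phi> (\<Sum>i\<in>I. f i) = (\<Sum>i\<in>I. lin_eval \<phi> (f i))"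
  by (induction I rule: infinite_finite_induct) (auto simp: lin_eval_add)

lemma lin_ext_cong: "(\<And>d. d \<in> Poly_Mapping.keys f \<Longrightarrow> \<phi> d = \<psi> d) \<Longrightarrow> lin_ext \<phi> f = lin_ext \<psi> f"
  unfolding lin_ext_def by (rule sum.cong) auto

lemma lin_ext_lin_ext: "lin_ext \<psi> (lin_ext \<phi> f) = lin_ext (\<lambda>d. lin_ext \<psi> (\<phi> d)) f"
  by (simp add: lin_ext_def[of _ f] lin_ext_sum lin_ext_scale)

lemma lin_eval_lin_ext: "lin_eval \<psi> (lin_ext \<phi> f) = lin_eval (\<lambda>d. lin_eval \<psi> (\<phi> d)) f"
  by (simp add: lin_ext_def lin_eval_def[of _ f] lin_eval_sum lin_eval_scale)

lemma lin_ext_gen [simp]: "lin_ext gen f = f"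
  using sum_keys[of f] by (simp add: lin_ext_def)

lemma lin_ext_span: "f \<in> span X \<Longrightarrow> (\<And>d. d \<in> X \<Longrightarrow> \<phi> d \<in> span Y) \<Longrightarrow> lin_ext \<phi> f \<in> span Y"
  unfolding lin_ext_def by (intro span_sum span_scale) auto

lemma mult_lin_ext:
  "f * (g :: 'x::comm_monoid_add \<Rightarrow>\<^sub>0 'k::field) = lin_ext (\<lambda>d. lin_ext (\<lambda>e. gen (d + e)) g) f"
proof -
  have "gen d * g = lin_ext (\<lambda>e. gen (d + e)) g" for d
  proof (induction g rule: lin_induct)
    case (add f e c)
    then show ?case by (simp add: distrib_left lin_ext_add mult_single)
  qed simp
  then have "lin_ext (\<lambda>d. lin_ext (\<lambda>e. gen (d + e)) g) f = lin_ext (\<lambda>d. gen d * g) f" by simp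
  also have "\<dots> = f * g"
  proof (induction f rule: lin_induct)
    case (add f e c)
    have "Poly_Mapping.single e c * g = scale c (gen e * g)"
      using scale_mult_left[of c "gen e" g] by simp
    with add show ?case by (simp add: distrib_right lin_ext_add)
  qed auto
  finally show ?thesis by simp
qed

lemma mult_span:
  assumes "f \<in> span X" "g \<in> span Y" "\<And>d e. d \<in> X \<Longrightarrow> e \<in> Y \<Longrightarrow> d + e \<in> Z"
  shows "f * (g :: 'x::comm_monoid_add \<Rightarrow>\<^sub>0 'k::field) \<in> span Z"
  unfolding mult_lin_ext using assms by (intro lin_ext_span[of f X] lin_ext_span[of g Y]) auto

text \<open>Multiplicativity is asked for only on \<open>X\<close> and \<open>Y\<close>: gluing, the
  main application, is compatible with a disjoint union when the second diagram avoids the glued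
  points.\<close>

lemma lin_ext_mult:
  assumes "f \<in> span X" "g \<in> span Y" "\<And>d e. d \<in> X \<Longrightarrow> e \<in> Y \<Longrightarrow> \<phi> (d + e) = \<psi> d * \<chi> e"
  shows "lin_ext \<phi> (f * (g :: 'x::comm_monoid_add \<Rightarrow>\<^sub>0 'k::field)) =
    lin_ext \<psi> f * (lin_ext \<chi> g :: 'y::comm_monoid_add \<Rightarrow>\<^sub>0 'k)"
  using assms(1)
proof (induction rule: span_induct)
  case (add f d c)
  have "lin_ext \<phi> (gen d * g) = \<psi> d * lin_ext \<chi> g"
    using assms(2)
  proof (induction rule: span_induct)
    case (add g e b)
    then show ?case
      using assms(3)[OF \<open>d \<in> X\<close> \<open>e \<in> Y\<close>] scale_mult_right[of "\<psi> d" b "\<chi> e"]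
      by (simp add: distrib_left lin_ext_add mult_single)
  qed simp
  moreover have "scale c (gen d) * g = scale c (gen d * g)" by (rule scale_mult_left)
  ultimately show ?case using add
    by (simp only: distrib_right lin_ext_add lin_ext_scale lin_ext_single scale_simps scale_mult_left scale_mult_right mult_1_right)
qed simp

section \<open>The free category of cobordisms\<close>

definition no_inner :: "'l diag \<Rightarrow> bool" where
  "no_inner D \<longleftrightarrow> (\<forall>s\<in>#fst D. seg_tail s \<noteq> None \<and> seg_head s \<noteq> None)"

lemma no_inner_simps [simp]:
  "no_inner 0" "no_inner (D + E) \<longleftrightarrow> no_inner D \<and> no_inner E"
  "no_inner (sg t h w) \<longleftrightarrow> t \<noteq> None \<and> h \<noteq> None" "no_inner (circ w)"
  by (auto simp: no_inner_def zero_prod_def)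

lemma no_inner_map_diag [simp]: "no_inner (map_diag \<rho> D) = no_inner D"
  by (induction D rule: diag_induct) auto

lemma no_inner_glue_at: "no_inner D \<Longrightarrow> no_inner (glue_at p D)"
proof (cases "gluable p D")
  case True
  then show "no_inner D \<Longrightarrow> no_inner (glue_at p D)"
    by (cases rule: gluable_cases) (auto simp: glue_at_circle glue_at_join)
qed simp

lemma no_inner_glue_set: "finite P \<Longrightarrow> no_inner D \<Longrightarrow> no_inner (glue_set P D)"
  by (induction P rule: finite_induct) (auto simp: glue_set_insert no_inner_glue_at)

text \<open>\<open>T\<close> and \<open>H\<close> may overlap: a common point is the head of one segment and the tail of another,
  or both endpoints of the same one, and is still to be glued.\<close>

definition cob :: "bool \<Rightarrow> 'l set \<Rightarrow> pt set \<Rightarrow> pt set \<Rightarrow> 'l diag set" where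
  "cob i L T H = {D. tails D = mset_set T \<and> heads D = mset_set H \<and> labels_in L D \<and> (i \<or> no_inner D)}"

lemma filter_Some_eq_iff:
  "filter_mset (\<lambda>p. p \<noteq> None) X = image_mset Some M \<longleftrightarrow>
    image_mset the (filter_mset (\<lambda>p. p \<noteq> None) X) = M"
proof
  assume "image_mset the (filter_mset (\<lambda>p. p \<noteq> None) X) = M"
  then have "image_mset Some M = image_mset (Some \<circ> the) (filter_mset (\<lambda>p. p \<noteq> None) X)"
    by (auto simp: multiset.map_comp)
  also have "\<dots> = image_mset (\<lambda>p. p) (filter_mset (\<lambda>p. p \<noteq> None) X)"
    by (rule image_mset_cong) auto
  finally show "filter_mset (\<lambda>p. p \<noteq> None) X = image_mset Some M" by simp
qed (simp add: multiset.map_comp comp_def)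

lemma cobs_eq: "cobs L \<epsilon> \<epsilon>' = cob True L (tail_pts \<epsilon> \<epsilon>') (head_pts \<epsilon> \<epsilon>')"
  unfolding cobs_def cob_def filter_Some_eq_iff tails_def heads_def labels_in_def by auto

lemma cobs_no_inner_eq: "cobs_no_inner L \<epsilon> \<epsilon>' = cob False L (tail_pts \<epsilon> \<epsilon>') (head_pts \<epsilon> \<epsilon>')"
  by (auto simp: cobs_no_inner_def cobs_eq cob_def no_inner_def)

lemma cob_pts:
  assumes "D \<in> cob i L T H" "finite T" "finite H"
  shows "p \<in># tails D \<longleftrightarrow> p \<in> T" "p \<in># heads D \<longleftrightarrow> p \<in> H"
    "count (tails D) p = (if p \<in> T then 1 else 0)" "count (heads D) p = (if p \<in> H then 1 else 0)"
    "gluable p D \<longleftrightarrow> p \<in> T \<and> p \<in> H" "fresh p D \<longleftrightarrow> p \<notin> T \<and> p \<notin> H"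
  using assms by (auto simp: cob_def gluable_def fresh_def count_mset_set')

lemma cob_zero: "0 \<in> cob i L {} {}"
  by (simp add: cob_def)

lemma cob_add:
  assumes "D \<in> cob i L T H" "E \<in> cob i L T' H'" "T \<inter> T' = {}" "H \<inter> H' = {}"
    "finite T" "finite T'" "finite H" "finite H'"
  shows "D + E \<in> cob i L (T \<union> T') (H \<union> H')"
  using assms by (auto simp: cob_def mset_set_Union)

lemma cob_sum:
  assumes "finite I" "\<And>j. j \<in> I \<Longrightarrow> d j \<in> cob i L (T j) (H j)" "\<And>j. finite (T j)" "\<And>j. finite (H j)"
    "\<And>j k. j \<in> I \<Longrightarrow> k \<in> I \<Longrightarrow> j \<noteq> k \<Longrightarrow> T j \<inter> T k = {} \<and> H j \<inter> H k = {}"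
  shows "sum d I \<in> cob i L (\<Union>j\<in>I. T j) (\<Union>j\<in>I. H j)"
  using assms
proof (induction I rule: finite_induct)
  case (insert j I)
  have "d j + sum d I \<in> cob i L (T j \<union> (\<Union>k\<in>I. T k)) (H j \<union> (\<Union>k\<in>I. H k))"
    by (rule cob_add) (use insert in \<open>auto simp: disjoint_iff\<close>, metis, metis)
  then show ?case using insert.hyps by simp
qed (simp add: cob_zero)

lemma cob_map_diag:
  assumes "D \<in> cob i L T H" "inj_on \<rho> T" "inj_on \<rho> H"
  shows "map_diag \<rho> D \<in> cob i L (\<rho> ` T) (\<rho> ` H)"
  using assms by (simp add: cob_def image_mset_mset_set)

lemma cob_glue_set:
  assumes "D \<in> cob i L T H" "P \<subseteq> T \<inter> H" "finite T" "finite H"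
  shows "glue_set P D \<in> cob i L (T - P) (H - P)"
proof -
  have "finite P" using assms by (meson finite_Int finite_subset)
  moreover have "gluable p D" if "p \<in> P" for p using that assms cob_pts(5) by blast
  ultimately show ?thesis using assms
    by (auto simp: cob_def tails_glue_set heads_glue_set labels_in_glue_set no_inner_glue_set mset_set_Diff)
qed

lemma cob_strand: "strand s p q \<in> cob i L (if s = Pos then {p} else {q}) (if s = Pos then {q} else {p})"
  by (simp add: strand_def cob_def)

lemma sign_neq: "s \<noteq> Pos \<longleftrightarrow> s = Neg" "s \<noteq> Neg \<longleftrightarrow> s = Pos"
  by (cases s; simp)+

definition pos :: "sign list \<Rightarrow> nat set" where "pos \<epsilon> = {i. i < length \<epsilon> \<and> \<epsilon> ! i = Pos}"
definition neg :: "sign list \<Rightarrow> nat set" where "neg \<epsilon> = {i. i < length \<epsilon> \<and> \<epsilon> ! i = Neg}"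

lemma finite_pos [simp]: "finite (pos \<epsilon>)" and finite_neg [simp]: "finite (neg \<epsilon>)"
  by (simp_all add: pos_def neg_def)

lemma pos_neg: "pos \<epsilon> \<union> neg \<epsilon> = {..<length \<epsilon>}" "pos \<epsilon> \<inter> neg \<epsilon> = {}"
  by (auto simp: pos_def neg_def sign_neq)

lemma tail_pts_eq: "tail_pts \<epsilon> \<epsilon>' = Bot ` pos \<epsilon> \<union> Top ` neg \<epsilon>'"
  and head_pts_eq: "head_pts \<epsilon> \<epsilon>' = Bot ` neg \<epsilon> \<union> Top ` pos \<epsilon>'"
  by (simp_all add: tail_pts_def head_pts_def pos_def neg_def)

lemma finite_tail_pts [simp]: "finite (tail_pts \<epsilon> \<epsilon>')" and finite_head_pts [simp]: "finite (head_pts \<epsilon> \<epsilon>')"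
  by (simp_all add: tail_pts_eq head_pts_eq)

text \<open>Bottom and top points are renamed independently, and points already waiting to be glued
  keep their names. Stacking, closing and turning upside down are all described by such
  renamings.\<close>

definition relab :: "(nat \<Rightarrow> pt) \<Rightarrow> (nat \<Rightarrow> pt) \<Rightarrow> pt \<Rightarrow> pt" where
  "relab b t p = (case p of Bot i \<Rightarrow> b i | Mid i \<Rightarrow> Mid i | Top i \<Rightarrow> t i)"

lemma relab_simps [simp]: "relab b t (Bot i) = b i" "relab b t (Mid i) = Mid i" "relab b t (Top i) = t i"
  by (simp_all add: relab_def)

lemma relab_Bot_Top: "relab Bot Top = id"
  by (rule ext) (simp add: relab_def split: pt.split)

lemma top_to_mid_eq: "top_to_mid = relab Bot Mid"
proof
  fix p show "top_to_mid p = relab Bot Mid p" by (cases p) auto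
qed

lemma bot_to_mid_eq: "bot_to_mid = relab Mid Top"
proof
  fix p show "bot_to_mid p = relab Mid Top p" by (cases p) auto
qed

lemma map_diag_relab_cong:
  assumes "D \<in> cob i L (tail_pts \<epsilon> \<epsilon>') (head_pts \<epsilon> \<epsilon>')"
    "\<And>j. j < length \<epsilon> \<Longrightarrow> \<rho> (Bot j) = \<sigma> (Bot j)" "\<And>j. j < length \<epsilon>' \<Longrightarrow> \<rho> (Top j) = \<sigma> (Top j)"
  shows "map_diag \<rho> D = map_diag \<sigma> D"
  by (rule map_diag_cong)
    (use assms cob_pts[OF assms(1)] in \<open>auto simp: tail_pts_eq head_pts_eq pos_def neg_def\<close>)

lemma inj_on_relab:
  assumes "inj_on b P" "inj_on t Q" "\<And>i j. i \<in> P \<Longrightarrow> j \<in> Q \<Longrightarrow> b i \<noteq> t j"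
  shows "inj_on (relab b t) (Bot ` P \<union> Top ` Q)"
proof -
  have "inj_on (relab b t) (Bot ` P)" "inj_on (relab b t) (Top ` Q)"
    using assms(1,2) by (simp_all add: inj_on_def)
  moreover have "relab b t ` (Bot ` P - Top ` Q) \<inter> relab b t ` (Top ` Q - Bot ` P) = {}"
    using assms(3) by fastforce
  ultimately show ?thesis unfolding inj_on_Un by blast
qed

text \<open>A bottom and a top point may receive the same name if their signs agree: one of them is
  then a tail and the other a head, which is the situation of a point still to be glued. With
  opposite signs both are tails or both are heads, and the names must differ.\<close>

lemma cob_relab:
  assumes "D \<in> cob i L (tail_pts \<epsilon> \<epsilon>') (head_pts \<epsilon> \<epsilon>')" "inj_on b {..<length \<epsilon>}" "inj_on t {..<length \<epsilon>'}"
    and "\<And>i j. i < length \<epsilon> \<Longrightarrow> j < length \<epsilon>' \<Longrightarrow> \<epsilon> ! i \<noteq> \<epsilon>' ! j \<Longrightarrow> b i \<noteq> t j"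
  shows "map_diag (relab b t) D \<in> cob i L (b ` pos \<epsilon> \<union> t ` neg \<epsilon>') (b ` neg \<epsilon> \<union> t ` pos \<epsilon>')"
proof -
  have "inj_on b (pos \<epsilon>)" "inj_on b (neg \<epsilon>)" "inj_on t (pos \<epsilon>')" "inj_on t (neg \<epsilon>')"
    using assms(2,3) by (auto intro: inj_on_subset simp: pos_def neg_def)
  then have "inj_on (relab b t) (tail_pts \<epsilon> \<epsilon>')" "inj_on (relab b t) (head_pts \<epsilon> \<epsilon>')"
    unfolding tail_pts_eq head_pts_eq using assms(4)
    by (auto intro!: inj_on_relab simp: pos_def neg_def)
  from cob_map_diag[OF assms(1) this] show ?thesis
    by (simp add: tail_pts_eq head_pts_eq image_Un image_image)
qed

text \<open>The middle points may be given any names \<open>m\<close> that avoid the outer ones.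
  This freedom makes it possible to carry out several stackings inside one disjoint union.\<close>

lemma stack_relab:
  assumes D: "D \<in> cob i L (tail_pts \<epsilon> \<epsilon>') (head_pts \<epsilon> \<epsilon>')"
    and E: "E \<in> cob i L (tail_pts \<epsilon>' \<epsilon>'') (head_pts \<epsilon>' \<epsilon>'')"
    and m: "inj_on m {..<length \<epsilon>'}"
      "\<And>i j. i < length \<epsilon>' \<Longrightarrow> j < length \<epsilon> \<Longrightarrow> m i \<noteq> b j"
      "\<And>i j. i < length \<epsilon>' \<Longrightarrow> j < length \<epsilon>'' \<Longrightarrow> m i \<noteq> t j"
  shows "map_diag (relab b t) (stack (length \<epsilon>') E D)
    = glue_set (m ` {..<length \<epsilon>'}) (map_diag (relab b m) D + map_diag (relab m t) E)"
proof -
  let ?n = "length \<epsilon>'"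
  let ?X = "map_diag top_to_mid D + map_diag bot_to_mid E"
  let ?T = "(Bot ` pos \<epsilon> \<union> Mid ` neg \<epsilon>') \<union> (Mid ` pos \<epsilon>' \<union> Top ` neg \<epsilon>'')"
  let ?H = "(Bot ` neg \<epsilon> \<union> Mid ` pos \<epsilon>') \<union> (Mid ` neg \<epsilon>' \<union> Top ` pos \<epsilon>'')"
  have X: "?X \<in> cob i L ?T ?H"
    unfolding top_to_mid_eq bot_to_mid_eq
    by (rule cob_add[OF cob_relab[OF D] cob_relab[OF E]]) (auto simp: inj_on_def pos_def neg_def)
  note pts = cob_pts[OF X, simplified]
  have g: "gluable (Mid i) ?X" if "i < ?n" for i
    using that pos_neg(1)[of \<epsilon>'] pts(5)[of "Mid i"] by auto
  have s: "stack ?n E D = glue_set (Mid ` {..<?n}) ?X"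
    unfolding stack_def by (rule glue_all_eq) (use g in auto)
  \<comment> \<open>Unlike \<open>relab\<close>, this renaming also moves the middle points; after
    the gluing they are gone, and it agrees with \<open>relab b t\<close>.\<close>
  let ?\<kappa> = "\<lambda>p. case p of Bot i \<Rightarrow> b i | Mid i \<Rightarrow> m i | Top i \<Rightarrow> t i"
  have "glue_set (?\<kappa> ` Mid ` {..<?n}) (map_diag ?\<kappa> ?X) = map_diag ?\<kappa> (stack ?n E D)"
    unfolding s
  proof (rule glue_set_map_diag)
    show "inj_on ?\<kappa> (Mid ` {..<?n})" using m(1) by (auto simp: inj_on_def)
    fix p q assume p: "p \<in> Mid ` {..<?n}" and q: "q \<in># tails ?X + heads ?X" and eq: "?\<kappa> q = ?\<kappa> p"
    obtain i where i: "i < ?n" "p = Mid i" using p by blast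
    have "q \<in> ?T \<union> ?H" using q pts(1,2)[of q] by auto
    then consider j where "q = Bot j" "j < length \<epsilon>" | j where "q = Mid j" "j < ?n" | j where "q = Top j" "j < length \<epsilon>''"
      by (auto simp: pos_def neg_def)
    then show "q = p"
    proof cases
      case 1
      then show ?thesis using m(2)[OF i(1), of j] eq i by simp
    next
      case 2
      then show ?thesis using inj_onD[OF m(1), of j i] eq i by simp
    next
      case 3
      then show ?thesis using m(3)[OF i(1), of j] eq i by simp
    qed
  qed (use g in auto)
  moreover have "map_diag ?\<kappa> (stack ?n E D) = map_diag (relab b t) (stack ?n E D)"
  proof -
    have "stack ?n E D \<in> cob i L (?T - Mid ` {..<?n}) (?H - Mid ` {..<?n})"
      unfolding s by (rule cob_glue_set[OF X]) (auto simp flip: pos_neg(1))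
    from cob_pts[OF this] show ?thesis
      by (intro map_diag_cong) (auto simp: pos_def neg_def)
  qed
  moreover have "map_diag ?\<kappa> ?X = map_diag (relab b m) D + map_diag (relab m t) E"
    by (auto simp: map_diag_map_diag top_to_mid_eq bot_to_mid_eq
        intro!: arg_cong2[of _ _ _ _ "(+)"] map_diag_relab_cong[OF D] map_diag_relab_cong[OF E])
  moreover have "?\<kappa> ` Mid ` {..<?n} = m ` {..<?n}" by (auto simp: image_image)
  ultimately show ?thesis by simp
qed

lemma stack_eq:
  assumes "D \<in> cob i L (tail_pts \<epsilon> \<epsilon>') (head_pts \<epsilon> \<epsilon>')"
    "E \<in> cob i L (tail_pts \<epsilon>' \<epsilon>'') (head_pts \<epsilon>' \<epsilon>'')"
  shows "stack (length \<epsilon>') E D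
    = glue_set (Mid ` {..<length \<epsilon>'}) (map_diag (relab Bot Mid) D + map_diag (relab Mid Top) E)"
  using stack_relab[OF assms, of Mid Bot Top] by (simp add: relab_Bot_Top map_diag_ident inj_on_def)

lemma stack_cob:
  assumes D: "D \<in> cob i L (tail_pts \<epsilon> \<epsilon>') (head_pts \<epsilon> \<epsilon>')"
    and E: "E \<in> cob i L (tail_pts \<epsilon>' \<epsilon>'') (head_pts \<epsilon>' \<epsilon>'')"
  shows "stack (length \<epsilon>') E D \<in> cob i L (tail_pts \<epsilon> \<epsilon>'') (head_pts \<epsilon> \<epsilon>'')"
proof -
  let ?T = "(Bot ` pos \<epsilon> \<union> Mid ` neg \<epsilon>') \<union> (Mid ` pos \<epsilon>' \<union> Top ` neg \<epsilon>'')"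
  let ?H = "(Bot ` neg \<epsilon> \<union> Mid ` pos \<epsilon>') \<union> (Mid ` neg \<epsilon>' \<union> Top ` pos \<epsilon>'')"
  let ?M = "Mid ` {..<length \<epsilon>'}"
  have "map_diag (relab Bot Mid) D + map_diag (relab Mid Top) E \<in> cob i L ?T ?H"
    by (rule cob_add[OF cob_relab[OF D] cob_relab[OF E]]) (auto simp: inj_on_def pos_def neg_def)
  then have "stack (length \<epsilon>') E D \<in> cob i L (?T - ?M) (?H - ?M)"
    unfolding stack_eq[OF assms] by (rule cob_glue_set) (auto simp flip: pos_neg(1))
  moreover have "?T - ?M = tail_pts \<epsilon> \<epsilon>''" "?H - ?M = head_pts \<epsilon> \<epsilon>''"
    by (auto simp: tail_pts_eq head_pts_eq pos_def neg_def)
  ultimately show ?thesis by simp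
qed

text \<open>Both sides glue the disjoint union of the three diagrams at the same set of points, and
  the order of gluing does not matter.\<close>

lemma stack_assoc:
  assumes D: "D \<in> cob i L (tail_pts \<epsilon> \<epsilon>') (head_pts \<epsilon> \<epsilon>')"
    and E: "E \<in> cob i L (tail_pts \<epsilon>' \<epsilon>'') (head_pts \<epsilon>' \<epsilon>'')"
    and F: "F \<in> cob i L (tail_pts \<epsilon>'' \<epsilon>\<^sub>3) (head_pts \<epsilon>'' \<epsilon>\<^sub>3)"
  shows "stack (length \<epsilon>'') F (stack (length \<epsilon>') E D) = stack (length \<epsilon>') (stack (length \<epsilon>'') F E) D"
proof -
  let ?a = "length \<epsilon>'" and ?b = "length \<epsilon>''"
  \<comment> \<open>The points between \<open>D\<close> and \<open>E\<close> are numbered after the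
    \<open>?b\<close> points between \<open>E\<close> and \<open>F\<close>, so that the two families
    are disjoint.\<close>
  define m where "m i = Mid (?b + i)" for i
  have m: "inj m" "\<And>i j. j < ?b \<Longrightarrow> m i \<noteq> Mid j" "\<And>i j. m i \<noteq> Bot j" "\<And>i j. m i \<noteq> Top j"
    by (auto simp: m_def inj_on_def)
  let ?D = "map_diag (relab Bot m) D" and ?E = "map_diag (relab m Mid) E" and ?F = "map_diag (relab Mid Top) F"
  have D': "?D \<in> cob i L (Bot ` pos \<epsilon> \<union> m ` neg \<epsilon>') (Bot ` neg \<epsilon> \<union> m ` pos \<epsilon>')"
    by (rule cob_relab[OF D]) (use m(1) m(3)[symmetric] in \<open>auto simp: inj_on_def\<close>)
  have F': "?F \<in> cob i L (Mid ` pos \<epsilon>'' \<union> Top ` neg \<epsilon>\<^sub>3) (Mid ` neg \<epsilon>'' \<union> Top ` pos \<epsilon>\<^sub>3)"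
    by (rule cob_relab[OF F]) (auto simp: inj_on_def)
  have freshD: "fresh (Mid j) ?D" if "j < ?b" for j
    using cob_pts(6)[OF D', of "Mid j"] m(2)[OF that] by (auto dest: sym)
  have freshF: "fresh (m j) ?F" if "j < ?a" for j
    using cob_pts(6)[OF F', of "m j"] m(2,4) by (auto simp: pos_def neg_def)
  have "stack ?b F (stack ?a E D) = glue_set (Mid ` {..<?b}) (map_diag (relab Bot Mid) (stack ?a E D) + ?F)"
    by (rule stack_eq[OF stack_cob[OF D E] F])
  also have "map_diag (relab Bot Mid) (stack ?a E D) = glue_set (m ` {..<?a}) (?D + ?E)"
    by (rule stack_relab[OF D E]) (use m in \<open>auto simp: inj_on_def\<close>)
  also have "glue_set (m ` {..<?a}) (?D + ?E) + ?F = glue_set (m ` {..<?a}) (?D + ?E + ?F)"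
    by (rule glue_set_add[symmetric]) (use freshF in auto)
  also have "glue_set (Mid ` {..<?b}) \<dots> = glue_set (Mid ` {..<?b} \<union> m ` {..<?a}) (?D + ?E + ?F)"
    by (rule glue_set_Un[symmetric]) (use m(2)[symmetric] in auto)
  also have "\<dots> = glue_set (m ` {..<?a} \<union> Mid ` {..<?b}) (?E + ?F + ?D)"
    by (simp add: Un_commute add_ac)
  also have "\<dots> = glue_set (m ` {..<?a}) (glue_set (Mid ` {..<?b}) (?E + ?F + ?D))"
    by (rule glue_set_Un) (use m(2) in auto)
  also have "glue_set (Mid ` {..<?b}) (?E + ?F + ?D) = glue_set (Mid ` {..<?b}) (?E + ?F) + ?D"
    by (rule glue_set_add) (use freshD in auto)
  also have "glue_set (Mid ` {..<?b}) (?E + ?F) = map_diag (relab m Top) (stack ?b F E)"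
    by (rule stack_relab[OF E F, symmetric]) (use m in \<open>auto simp: inj_on_def dest: sym\<close>)
  also have "glue_set (m ` {..<?a}) (map_diag (relab m Top) (stack ?b F E) + ?D) = stack ?a (stack ?b F E) D"
    using stack_relab[OF D stack_cob[OF E F], of m Bot Top] m
    by (simp add: relab_Bot_Top map_diag_ident inj_on_def add.commute)
  finally show ?thesis .
qed

lemma id_diag_eq: "id_diag \<epsilon> = (\<Sum>i<length \<epsilon>. strand (\<epsilon> ! i) (Bot i) (Top i))"
proof -
  have "(mset (map f [0..<n]), {#}) = (\<Sum>i<n. ({#f i#}, {#}))" for f :: "nat \<Rightarrow> 'l seg" and n
  proof (induction n)
    case (Suc n)
    have "(mset (map f [0..<Suc n]), {#}) = (mset (map f [0..<n]), {#}) + ({#f n#}, {#})" by simp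
    also note Suc
    finally show ?case by simp
  qed (simp add: zero_prod_def)
  then have "id_diag \<epsilon> = (\<Sum>i<length \<epsilon>. ({#if \<epsilon> ! i = Pos then (Some (Bot i), Some (Top i), [])
      else (Some (Top i), Some (Bot i), [])#}, {#}))"
    unfolding id_diag_def by this
  also have "\<dots> = (\<Sum>i<length \<epsilon>. strand (\<epsilon> ! i) (Bot i) (Top i))"
    by (rule sum.cong) (auto simp: strand_def)
  finally show ?thesis .
qed

lemma id_diag_cob: "id_diag \<epsilon> \<in> cob i L (tail_pts \<epsilon> \<epsilon>) (head_pts \<epsilon> \<epsilon>)"
proof -
  have "id_diag \<epsilon> \<in> cob i L (\<Union>j\<in>{..<length \<epsilon>}. if \<epsilon> ! j = Pos then {Bot j} else {Top j})
     (\<Union>j\<in>{..<length \<epsilon>}. if \<epsilon> ! j = Pos then {Top j} else {Bot j})"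
    unfolding id_diag_eq by (rule cob_sum, simp, rule cob_strand) (auto split: if_splits)
  moreover have "(\<Union>j\<in>{..<length \<epsilon>}. if \<epsilon> ! j = Pos then {Bot j} else {Top j}) = tail_pts \<epsilon> \<epsilon>"
    "(\<Union>j\<in>{..<length \<epsilon>}. if \<epsilon> ! j = Pos then {Top j} else {Bot j}) = head_pts \<epsilon> \<epsilon>"
    by (auto simp: tail_pts_eq head_pts_eq pos_def neg_def sign_neq split: if_splits)
  ultimately show ?thesis by simp
qed

lemma sum_image_Mid: "(\<Sum>p\<in>Mid ` {..<n}. f p) = (\<Sum>i<n. f (Mid i))"
  by (subst sum.reindex) (auto simp: inj_on_def)

lemma stack_id_left:
  assumes D: "D \<in> cob i L (tail_pts \<epsilon> \<epsilon>') (head_pts \<epsilon> \<epsilon>')"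
  shows "stack (length \<epsilon>') (id_diag \<epsilon>') D = D"
proof -
  let ?n = "length \<epsilon>'" and ?D = "map_diag (relab Bot Mid) D"
  define idx where "idx p = (case p of Mid i \<Rightarrow> i | _ \<Rightarrow> 0)" for p
  have D': "?D \<in> cob i L (Bot ` pos \<epsilon> \<union> Mid ` neg \<epsilon>') (Bot ` neg \<epsilon> \<union> Mid ` pos \<epsilon>')"
    by (rule cob_relab[OF D]) (auto simp: inj_on_def)
  note pts = cob_pts[OF D']
  have "stack ?n (id_diag \<epsilon>') D = glue_set (Mid ` {..<?n}) (?D + map_diag (relab Mid Top) (id_diag \<epsilon>'))"
    by (rule stack_eq[OF D id_diag_cob])
  also have "map_diag (relab Mid Top) (id_diag \<epsilon>')
      = (\<Sum>p\<in>Mid ` {..<?n}. strand (\<epsilon>' ! idx p) p (Top (idx p)))"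
    by (simp add: id_diag_eq map_diag_sum sum_image_Mid idx_def)
  also have "glue_set (Mid ` {..<?n}) (?D + \<dots>)
     = map_diag (\<lambda>p. if p \<in> Mid ` {..<?n} then Top (idx p) else p) ?D"
  proof (rule glue_set_strands)
    fix p assume "p \<in> Mid ` {..<?n}"
    then obtain i where i: "i < ?n" "p = Mid i" by blast
    then show "if \<epsilon>' ! idx p = Pos then count (heads ?D) p = 1 \<and> p \<notin># tails ?D
        else count (tails ?D) p = 1 \<and> p \<notin># heads ?D"
      by (cases "\<epsilon>' ! i") (simp_all add: pts idx_def pos_def neg_def image_iff del: tails_map_diag heads_map_diag)
  qed auto
  also have "\<dots> = map_diag id D"
    unfolding map_diag_map_diag by (rule map_diag_relab_cong[OF D]) (auto simp: idx_def)
  finally show ?thesis by (simp add: map_diag_ident)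
qed

definition flip :: "sign \<Rightarrow> sign" where "flip s = (if s = Pos then Neg else Pos)"

lemma strand_flip: "strand s p q = strand (flip s) q p"
  by (cases s) (auto simp: strand_def flip_def)

lemma stack_id_right:
  assumes D: "D \<in> cob i L (tail_pts \<epsilon> \<epsilon>') (head_pts \<epsilon> \<epsilon>')"
  shows "stack (length \<epsilon>) D (id_diag \<epsilon>) = D"
proof -
  let ?n = "length \<epsilon>" and ?D = "map_diag (relab Mid Top) D"
  define idx where "idx p = (case p of Mid i \<Rightarrow> i | _ \<Rightarrow> 0)" for p
  have D': "?D \<in> cob i L (Mid ` pos \<epsilon> \<union> Top ` neg \<epsilon>') (Mid ` neg \<epsilon> \<union> Top ` pos \<epsilon>')"
    by (rule cob_relab[OF D]) (auto simp: inj_on_def)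
  note pts = cob_pts[OF D']
  have "stack ?n D (id_diag \<epsilon>) = glue_set (Mid ` {..<?n}) (map_diag (relab Bot Mid) (id_diag \<epsilon>) + ?D)"
    by (rule stack_eq[OF id_diag_cob D])
  \<comment> \<open>\<open>glue_set_strands\<close> expects the glued point as the first end of each
    strand. Here the glued points are the second ends, so the strands are read from the other side,
    which reverses the sign.\<close>
  also have "map_diag (relab Bot Mid) (id_diag \<epsilon>)
      = (\<Sum>p\<in>Mid ` {..<?n}. strand (flip (\<epsilon> ! idx p)) p (Bot (idx p)))"
    by (simp add: id_diag_eq map_diag_sum sum_image_Mid idx_def strand_flip[of _ "Bot _"])
  also have "glue_set (Mid ` {..<?n}) (\<dots> + ?D)
     = map_diag (\<lambda>p. if p \<in> Mid ` {..<?n} then Bot (idx p) else p) ?D"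
    unfolding add.commute[of _ ?D]
  proof (rule glue_set_strands)
    fix p assume "p \<in> Mid ` {..<?n}"
    then obtain i where i: "i < ?n" "p = Mid i" by blast
    then show "if flip (\<epsilon> ! idx p) = Pos then count (heads ?D) p = 1 \<and> p \<notin># tails ?D
        else count (tails ?D) p = 1 \<and> p \<notin># heads ?D"
      by (cases "\<epsilon> ! i") (simp_all add: pts idx_def pos_def neg_def image_iff flip_def del: tails_map_diag heads_map_diag)
  qed auto
  also have "\<dots> = map_diag id D"
    unfolding map_diag_map_diag by (rule map_diag_relab_cong[OF D]) (auto simp: idx_def)
  finally show ?thesis by (simp add: map_diag_ident)
qed

lemma stack_lin_gen [simp]: "stack_lin n (gen E) (gen D) = gen (stack n E D)"
  by (simp add: stack_lin_def)

lemma stack_lin_add_left: "stack_lin n (g + g') f = stack_lin n g f + stack_lin n g' f"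
  and stack_lin_scale_left: "stack_lin n (scale c g) f = scale c (stack_lin n g f)"
  and stack_lin_zero_left [simp]: "stack_lin n 0 f = 0"
  by (simp_all add: stack_lin_def lin_ext_add lin_ext_scale)

lemma stack_lin_add_right: "stack_lin n g (f + f') = stack_lin n g f + stack_lin n g f'"
  and stack_lin_scale_right: "stack_lin n g (scale c f) = scale c (stack_lin n g f)"
  and stack_lin_zero_right [simp]: "stack_lin n g 0 = 0"
proof -
  show "stack_lin n g (f + f') = stack_lin n g f + stack_lin n g f'"
    by (induction g rule: lin_induct)
      (auto simp: stack_lin_add_left stack_lin_scale_left stack_lin_def lin_ext_add scale_add)
  show "stack_lin n g (scale c f) = scale c (stack_lin n g f)"
    by (induction g rule: lin_induct)
      (auto simp: stack_lin_add_left stack_lin_scale_left stack_lin_def lin_ext_add lin_ext_scale scale_add mult.commute)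
  show "stack_lin n g 0 = 0"
    by (induction g rule: lin_induct)
      (auto simp: stack_lin_def lin_ext_add)
qed

lemmas stack_lin_linear = stack_lin_add_left stack_lin_add_right stack_lin_scale_left stack_lin_scale_right

lemma stack_lin_span:
  assumes "f \<in> span (cob i L (tail_pts \<epsilon> \<epsilon>') (head_pts \<epsilon> \<epsilon>'))"
    "g \<in> span (cob i L (tail_pts \<epsilon>' \<epsilon>'') (head_pts \<epsilon>' \<epsilon>''))"
  shows "stack_lin (length \<epsilon>') g f \<in> span (cob i L (tail_pts \<epsilon> \<epsilon>'') (head_pts \<epsilon> \<epsilon>''))"
  unfolding stack_lin_def
  by (rule lin_ext_span[OF assms(2)], rule lin_ext_span[OF assms(1)]) (use stack_cob in auto)

lemma free_cat_simps:
  "Obj (free_cat c) = UNIV" "Arr (free_cat c) \<epsilon> \<epsilon>' = span (c \<epsilon> \<epsilon>')"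
  "Cmp (free_cat c) \<epsilon> \<epsilon>' \<epsilon>'' g f = stack_lin (length \<epsilon>') g f" "Ide (free_cat c) \<epsilon> = gen (id_diag \<epsilon>)"
  "Add (free_cat c) \<epsilon> \<epsilon>' f g = f + g" "Zer (free_cat c) \<epsilon> \<epsilon>' = 0" "Scl (free_cat c) \<epsilon> \<epsilon>' a f = scale a f"
  by (simp_all add: free_cat_def)

text \<open>Stated for all \<open>i\<close> and \<open>L\<close> at once, so that it serves both for
  cobordisms over the alphabet \<open>S\<close> and for diagrams without inner endpoints whose dots
  are labelled by \<open>K\<close>.\<close>

lemma preadditive_free_cat:
  assumes c: "\<And>\<epsilon> \<epsilon>'. c \<epsilon> \<epsilon>' = cob i L (tail_pts \<epsilon> \<epsilon>') (head_pts \<epsilon> \<epsilon>')"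
  shows "preadditive (free_cat c :: (sign list, ('l, 'k::field) lin, 'k) lincat)"
proof
  fix W X Y Z and f g h :: "('l, 'k) lin"
  assume f: "f \<in> Arr (free_cat c) W X" and g: "g \<in> Arr (free_cat c) X Y" and h: "h \<in> Arr (free_cat c) Y Z"
  from f g h show "Cmp (free_cat c) W Y Z h (Cmp (free_cat c) W X Y g f) = Cmp (free_cat c) W X Z (Cmp (free_cat c) X Y Z h g) f"
    unfolding free_cat_simps c
  proof (induction f rule: span_induct)
    case (add f D a)
    have "stack_lin (length Y) h (stack_lin (length X) g (gen D)) =
       stack_lin (length X) (stack_lin (length Y) h g) (gen D)"
      using g[unfolded free_cat_simps c]
    proof (induction g rule: span_induct)
      case (add g E b)
      have "stack_lin (length Y) h (stack_lin (length X) (gen E) (gen D)) =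
         stack_lin (length X) (stack_lin (length Y) h (gen E)) (gen D)"
        using h[unfolded free_cat_simps c]
      proof (induction h rule: span_induct)
        case (add h F b)
        then show ?case using stack_assoc[OF \<open>D \<in> _\<close> \<open>E \<in> _\<close> \<open>F \<in> _\<close>]
          by (simp add: stack_lin_linear del: scale_simps(5))
      qed simp
      then show ?case using add by (simp add: stack_lin_linear del: scale_simps(5))
    qed simp
    then show ?case using add f g h by (simp add: stack_lin_linear free_cat_simps c del: scale_simps(5))
  qed simp
next
  fix X Y f assume f: "f \<in> Arr (free_cat c) X Y"
  then show "Cmp (free_cat c) X X Y f (Ide (free_cat c) X) = f"
    unfolding free_cat_simps c
    by (induction f rule: span_induct)
      (simp_all add: stack_lin_linear stack_id_right del: scale_simps(5))
  from f show "Cmp (free_cat c) X Y Y (Ide (free_cat c) Y) f = f"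
    unfolding free_cat_simps c
    by (induction f rule: span_induct)
      (simp_all add: stack_lin_linear stack_id_left del: scale_simps(5))
next
  fix X Y f assume f: "f \<in> Arr (free_cat c) X Y"
  then show "\<exists>g\<in>Arr (free_cat c) X Y. Add (free_cat c) X Y f g = Zer (free_cat c) X Y"
    unfolding free_cat_simps by (intro bexI[of _ "- f"]) auto
qed (unfold free_cat_simps c, (intro stack_lin_span span_add span_gen id_diag_cob
    | simp add: stack_lin_linear add_ac)+)

section \<open>Linear gluing and the radical of an evaluation\<close>

definition glue_lin :: "pt set \<Rightarrow> ('l, 'k::field) lin \<Rightarrow> ('l, 'k) lin" where
  "glue_lin P = lin_ext (\<lambda>D. gen (glue_set P D))"

lemma glue_lin_gen [simp]: "glue_lin P (gen D) = gen (glue_set P D)"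
  by (simp add: glue_lin_def)

lemma glue_lin_linear:
  "glue_lin P 0 = 0" "glue_lin P (f + g) = glue_lin P f + glue_lin P g"
  "glue_lin P (scale c f) = scale c (glue_lin P f)" "glue_lin P (f - g) = glue_lin P f - glue_lin P g"
  by (simp_all add: glue_lin_def lin_ext_add lin_ext_scale lin_ext_diff)

lemma glue_lin_sum: "glue_lin P (\<Sum>i\<in>I. f i) = (\<Sum>i\<in>I. glue_lin P (f i))"
  by (simp add: glue_lin_def lin_ext_sum)

lemma glue_lin_empty [simp]: "glue_lin {} f = f"
  by (simp add: glue_lin_def)

lemma glue_lin_Un:
  assumes "finite P" "finite Q" "P \<inter> Q = {}"
  shows "glue_lin (P \<union> Q) f = glue_lin P (glue_lin Q f)"
  by (simp add: glue_lin_def lin_ext_lin_ext glue_set_Un[OF assms])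

lemma glue_lin_span:
  assumes "f \<in> span (cob i L T H)" "P \<subseteq> T \<inter> H" "finite T" "finite H"
  shows "glue_lin P f \<in> span (cob i L (T - P) (H - P))"
  unfolding glue_lin_def by (rule lin_ext_span[OF assms(1)]) (use cob_glue_set[OF _ assms(2-4)] in simp)

lemma mult_cob_span:
  assumes "f \<in> span (cob i L T H)" "g \<in> span (cob i L T' H')" "T \<inter> T' = {}" "H \<inter> H' = {}"
    "finite T" "finite T'" "finite H" "finite H'"
  shows "f * g \<in> span (cob i L (T \<union> T') (H \<union> H'))"
  by (rule mult_span[OF assms(1,2)]) (rule cob_add, use assms in auto)

text \<open>A factor whose endpoints avoid \<open>P\<close> behaves like a scalar for the gluing at
  \<open>P\<close>. Together with \<open>glue_lin_Un\<close> this replaces the interchange laws for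
  composition and tensor product.\<close>

lemma glue_lin_mult:
  assumes "g \<in> span (cob i L T' H')" "P \<inter> (T' \<union> H') = {}" "finite P" "finite T'" "finite H'"
  shows "glue_lin P (f * g) = glue_lin P f * g"
proof -
  have "lin_ext (\<lambda>D. gen (glue_set P D)) (f * g) = lin_ext (\<lambda>D. gen (glue_set P D)) f * lin_ext gen g"
  proof (rule lin_ext_mult[of f UNIV])
    fix D E assume "E \<in> cob i L T' H'"
    then have "fresh p E" if "p \<in> P" for p using that assms cob_pts(6) by blast
    then show "(gen (glue_set P (D + E)) :: (_, 'b) lin) = gen (glue_set P D) * gen E"
      using assms(3) by (simp add: glue_set_add mult_single)
  qed (use assms in auto)
  then show ?thesis by (simp add: glue_lin_def)
qed

lemma glue_lin_mult2:
  assumes "g \<in> span (cob i L T' H')" "P \<inter> (T' \<union> H') = {}" "finite P" "finite T'" "finite H'"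
  shows "glue_lin P (g * f) = g * glue_lin P f"
  using glue_lin_mult[OF assms, of f] by (simp add: mult.commute)

lemma relabel_gen [simp]: "relabel \<rho> (gen D) = gen (map_diag \<rho> D)"
  by (simp add: relabel_def)

lemma relabel_linear:
  "relabel \<rho> 0 = 0" "relabel \<rho> (f + g) = relabel \<rho> f + relabel \<rho> g"
  "relabel \<rho> (scale c f) = scale c (relabel \<rho> f)" "relabel \<rho> (f - g) = relabel \<rho> f - relabel \<rho> g"
  by (simp_all add: relabel_def lin_ext_add lin_ext_scale lin_ext_diff)

lemma relabel_sum: "relabel \<rho> (\<Sum>i\<in>I. f i) = (\<Sum>i\<in>I. relabel \<rho> (f i))"
  by (simp add: relabel_def lin_ext_sum)

lemma relabel_mult: "relabel \<rho> (f * g) = relabel \<rho> f * relabel \<rho> g"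
  unfolding relabel_def by (rule lin_ext_mult[of _ UNIV _ UNIV]) (auto simp: mult_single)

lemma relabel_relabel: "relabel \<rho> (relabel \<sigma> f) = relabel (\<rho> \<circ> \<sigma>) f"
  by (simp add: relabel_def lin_ext_lin_ext map_diag_map_diag)

lemma relabel_cong:
  assumes "f \<in> span (cob i L T H)" "finite T" "finite H" "\<And>p. p \<in> T \<union> H \<Longrightarrow> \<rho> p = \<sigma> p"
  shows "relabel \<rho> f = relabel \<sigma> f"
  unfolding relabel_def
proof (rule lin_ext_cong)
  fix D assume "D \<in> Poly_Mapping.keys f"
  then have D: "D \<in> cob i L T H" using assms(1) by auto
  have "map_diag \<rho> D = map_diag \<sigma> D"
    by (rule map_diag_cong) (use cob_pts[OF D assms(2,3)] assms(4) in auto)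
  then show "gen (map_diag \<rho> D) = (gen (map_diag \<sigma> D) :: (_, 'b) lin)" by simp
qed

lemma relabel_ident:
  assumes "f \<in> span (cob i L T H)" "finite T" "finite H" "\<And>p. p \<in> T \<union> H \<Longrightarrow> \<rho> p = p"
  shows "relabel \<rho> f = f"
proof -
  have "relabel \<rho> f = relabel (\<lambda>p. p) f" by (rule relabel_cong[OF assms(1-3)]) (use assms in auto)
  then show ?thesis by (simp add: relabel_def map_diag_ident)
qed

lemma relabel_span:
  assumes "f \<in> span (cob i L T H)" "inj_on \<rho> T" "inj_on \<rho> H"
  shows "relabel \<rho> f \<in> span (cob i L (\<rho> ` T) (\<rho> ` H))"
  unfolding relabel_def by (rule lin_ext_span[OF assms(1)]) (use cob_map_diag[OF _ assms(2,3)] in simp)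

lemma glue_lin_relabel:
  assumes "f \<in> span (cob i L T H)" "finite T" "finite H" "P \<subseteq> T \<inter> H" "inj_on \<rho> P"
    "\<And>p q. p \<in> P \<Longrightarrow> q \<in> T \<union> H \<Longrightarrow> \<rho> q = \<rho> p \<Longrightarrow> q = p"
  shows "glue_lin (\<rho> ` P) (relabel \<rho> f) = relabel \<rho> (glue_lin P f)"
  unfolding glue_lin_def relabel_def lin_ext_lin_ext
proof (rule lin_ext_cong)
  fix D assume "D \<in> Poly_Mapping.keys f"
  then have D: "D \<in> cob i L T H" using assms(1) by auto
  have P: "finite P" using assms(2-4) by (meson finite_Int finite_subset)
  have g: "gluable p D" if "p \<in> P" for p using cob_pts[OF D assms(2,3)] that assms(4) by blast
  have "glue_set (\<rho> ` P) (map_diag \<rho> D) = map_diag \<rho> (glue_set P D)"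
  proof (rule glue_set_map_diag[OF P assms(5) g])
    fix p q assume "p \<in> P" "q \<in># tails D + heads D" "\<rho> q = \<rho> p"
    moreover from this have "q \<in> T \<union> H" using cob_pts[OF D assms(2,3)] by auto
    ultimately show "q = p" using assms(6) by blast
  qed
  then show "lin_ext (\<lambda>D. gen (glue_set (\<rho> ` P) D)) (gen (map_diag \<rho> D))
    = (lin_ext (\<lambda>D. gen (map_diag \<rho> D)) (gen (glue_set P D)) :: (_, 'b) lin)" by simp
qed

lemma stack_lin_relabel:
  assumes f: "f \<in> span (cob i L (tail_pts \<epsilon> \<epsilon>') (head_pts \<epsilon> \<epsilon>'))"
    and g: "g \<in> span (cob i L (tail_pts \<epsilon>' \<epsilon>'') (head_pts \<epsilon>' \<epsilon>''))"
    and m: "inj_on m {..<length \<epsilon>'}"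
      "\<And>i j. i < length \<epsilon>' \<Longrightarrow> j < length \<epsilon> \<Longrightarrow> m i \<noteq> b j"
      "\<And>i j. i < length \<epsilon>' \<Longrightarrow> j < length \<epsilon>'' \<Longrightarrow> m i \<noteq> t j"
  shows "relabel (relab b t) (stack_lin (length \<epsilon>') g f)
    = glue_lin (m ` {..<length \<epsilon>'}) (relabel (relab b m) f * relabel (relab m t) g)"
  using f
proof (induction f rule: span_induct)
  case (add f D c)
  have "relabel (relab b t) (stack_lin (length \<epsilon>') g (gen D))
    = glue_lin (m ` {..<length \<epsilon>'}) (relabel (relab b m) (gen D) * relabel (relab m t) g)"
    using g
  proof (induction g rule: span_induct)
    case (add g E d)
    then show ?case using stack_relab[OF \<open>D \<in> _\<close> \<open>E \<in> _\<close> m]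
      by (simp add: stack_lin_linear relabel_linear glue_lin_linear distrib_left scale_mult_right mult_single del: scale_simps(5))
  qed (simp add: relabel_linear glue_lin_linear)
  then show ?case using add
    by (simp add: stack_lin_linear relabel_linear glue_lin_linear distrib_right scale_mult_left del: scale_simps(5))
qed (simp add: relabel_linear glue_lin_linear)

lemma stack_lin_eq:
  assumes f: "f \<in> span (cob i L (tail_pts \<epsilon> \<epsilon>') (head_pts \<epsilon> \<epsilon>'))"
    and g: "g \<in> span (cob i L (tail_pts \<epsilon>' \<epsilon>'') (head_pts \<epsilon>' \<epsilon>''))"
  shows "stack_lin (length \<epsilon>') g f
    = glue_lin (Mid ` {..<length \<epsilon>'}) (relabel (relab Bot Mid) f * relabel (relab Mid Top) g)"
  using stack_lin_relabel[OF f g, of Mid Bot Top]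
  by (simp add: relab_Bot_Top relabel_ident[OF stack_lin_span[OF f g]] inj_on_def)

section \<open>Evaluation of closed diagrams and null combinations\<close>

lemma eval_diag_add: "eval_diag \<alpha> (D + E) = eval_diag \<alpha> D * eval_diag \<alpha> E"
  by (simp add: eval_diag_def split: prod.splits)

lemma eval_diag_simps [simp]:
  "eval_diag \<alpha> 0 = 1" "eval_diag \<alpha> (sg t h w) = fst \<alpha> w" "eval_diag \<alpha> (circ w) = snd \<alpha> (cyc w)"
  by (simp_all add: eval_diag_def zero_prod_def)

lemma eval_diag_map_diag [simp]: "eval_diag \<alpha> (map_diag \<rho> D) = eval_diag \<alpha> D"
  by (induction D rule: diag_induct) (auto simp: eval_diag_add)

lemma eval_lin_gen [simp]: "eval_lin \<alpha> (gen D) = eval_diag \<alpha> D"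
  by (simp add: eval_lin_def)

lemma eval_lin_one [simp]: "eval_lin \<alpha> 1 = 1"
  using eval_lin_gen[of \<alpha> 0] by (simp del: eval_lin_gen)

lemma eval_lin_linear:
  "eval_lin \<alpha> 0 = 0" "eval_lin \<alpha> (f + g) = eval_lin \<alpha> f + eval_lin \<alpha> g"
  "eval_lin \<alpha> (scale c f) = c * eval_lin \<alpha> f" "eval_lin \<alpha> (f - g) = eval_lin \<alpha> f - eval_lin \<alpha> g"
  by (simp_all add: eval_lin_def lin_eval_add lin_eval_scale lin_eval_diff)

lemma eval_lin_relabel [simp]: "eval_lin \<alpha> (relabel \<rho> f) = eval_lin \<alpha> f"
  by (simp add: eval_lin_def relabel_def lin_eval_lin_ext)

lemma eval_lin_mult: "eval_lin \<alpha> (f * g) = eval_lin \<alpha> f * eval_lin \<alpha> g"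
proof (induction f rule: lin_induct)
  case (add f d c)
  have "eval_lin \<alpha> (gen d * g) = eval_diag \<alpha> d * eval_lin \<alpha> g"
  proof (induction g rule: lin_induct)
    case (add g e b)
    have "eval_lin \<alpha> (gen d * (g + scale b (gen e))) = eval_lin \<alpha> (gen d * g) + b * eval_diag \<alpha> (d + e)"
      by (simp add: eval_lin_linear distrib_left scale_mult_right mult_single del: scale_simps(5))
    with add show ?case by (simp add: eval_lin_linear eval_diag_add distrib_left del: scale_simps(5))
  qed (simp add: eval_lin_linear)
  moreover have "eval_lin \<alpha> ((f + scale c (gen d)) * g) = eval_lin \<alpha> (f * g) + c * eval_lin \<alpha> (gen d * g)"
    by (simp add: eval_lin_linear distrib_right scale_mult_left del: scale_simps(5))
  ultimately show ?case using add by (simp add: eval_lin_linear distrib_right del: scale_simps(5))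
qed (simp add: eval_lin_linear)

text \<open>A point in both \<open>T\<close> and \<open>H\<close> is glued to itself in the closure.\<close>

definition nul :: "'a set \<Rightarrow> ('a, 'k::field) evaluation \<Rightarrow> pt set \<Rightarrow> pt set \<Rightarrow> ('a, 'k) lin set" where
  "nul S \<alpha> T H = {x \<in> span (cob True S T H). \<forall>y\<in>cob True S (H - T) (T - H).
     eval_lin \<alpha> (glue_lin (T \<union> H) (x * gen y)) = 0}"

lemma nul_span: "x \<in> nul S \<alpha> T H \<Longrightarrow> x \<in> span (cob True S T H)"
  by (simp add: nul_def)

lemma nul_zero [simp]: "0 \<in> nul S \<alpha> T H"
  by (simp add: nul_def glue_lin_linear eval_lin_linear)

lemma nul_add: "x \<in> nul S \<alpha> T H \<Longrightarrow> y \<in> nul S \<alpha> T H \<Longrightarrow> x + y \<in> nul S \<alpha> T H"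
  using span_add[of x _ y] by (simp add: nul_def glue_lin_linear eval_lin_linear distrib_right)

lemma nul_scale: "x \<in> nul S \<alpha> T H \<Longrightarrow> scale c x \<in> nul S \<alpha> T H"
  using span_scale[of x _ c] by (simp add: nul_def glue_lin_linear eval_lin_linear scale_mult_left)

lemma nul_uminus: "x \<in> nul S \<alpha> T H \<Longrightarrow> - x \<in> nul S \<alpha> T H"
  using nul_scale[of x S \<alpha> T H "- 1"] by (simp add: scale_uminus)

lemma nul_diff: "x \<in> nul S \<alpha> T H \<Longrightarrow> y \<in> nul S \<alpha> T H \<Longrightarrow> x - y \<in> nul S \<alpha> T H"
  using nul_add[of x S \<alpha> T H "- y"] nul_uminus[of y] by simp

lemma nul_sum: "(\<And>i. i \<in> I \<Longrightarrow> f i \<in> nul S \<alpha> T H) \<Longrightarrow> sum f I \<in> nul S \<alpha> T H"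
  by (induction I rule: infinite_finite_induct) (auto intro: nul_add)

lemma nul_trans: "x - y \<in> nul S \<alpha> T H \<Longrightarrow> y - z \<in> nul S \<alpha> T H \<Longrightarrow> x - z \<in> nul S \<alpha> T H"
  using nul_add[of "x - y" S \<alpha> T H "y - z"] by simp

lemma nul_sym: "x - y \<in> nul S \<alpha> T H \<Longrightarrow> y - x \<in> nul S \<alpha> T H"
  using nul_uminus[of "x - y"] by simp

lemma nul_test:
  assumes "x \<in> nul S \<alpha> T H" "z \<in> span (cob True S (H - T) (T - H))"
  shows "eval_lin \<alpha> (glue_lin (T \<union> H) (x * z)) = 0"
  using assms(2)
proof (induction z rule: span_induct)
  case (add z D c)
  have "eval_lin \<alpha> (glue_lin (T \<union> H) (x * gen D)) = 0" using assms(1) add by (simp add: nul_def)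
  with add show ?case
    by (simp add: distrib_left glue_lin_linear eval_lin_linear scale_mult_right del: scale_simps(5))
qed (simp add: glue_lin_linear eval_lin_linear)

text \<open>A test \<open>y\<close> of the glued product amounts to a test of \<open>x\<close> alone
  against \<open>z * gen y\<close>, glued at the points that \<open>x\<close> does not meet.
  Stability under composition on either side, under tensor products and under partial closure are
  special cases.\<close>

lemma nul_ideal:
  assumes x: "x \<in> nul S \<alpha> T H" and z: "z \<in> span (cob True S T' H')"
    and d: "T \<inter> T' = {}" "H \<inter> H' = {}" and P: "P \<subseteq> (T \<union> T') \<inter> (H \<union> H')"
    and f: "finite T" "finite T'" "finite H" "finite H'"
    and T'': "T'' = T \<union> T' - P" and H'': "H'' = H \<union> H' - P"
  shows "glue_lin P (x * z) \<in> nul S \<alpha> T'' H''"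
proof -
  have fP: "finite P" using P f by (meson finite_Int finite_Un finite_subset)
  have ff: "finite T''" "finite H''" unfolding T'' H'' using f by auto
  note xz = mult_cob_span[OF nul_span[OF x] z d f(1,2,3,4)]
  have 1: "glue_lin P (x * z) \<in> span (cob True S T'' H'')"
    unfolding T'' H'' by (rule glue_lin_span[OF xz P]) (use f in auto)
  have "eval_lin \<alpha> (glue_lin (T'' \<union> H'') (glue_lin P (x * z) * gen y)) = 0"
    if y: "y \<in> cob True S (H'' - T'') (T'' - H'')" for y
  proof -
    let ?A = "T'' \<union> H'' \<union> P"
    \<comment> \<open>The points of the closed picture that are not endpoints of \<open>x\<close>;
      gluing at them involves only the other factor.\<close>
    let ?R = "?A - (T \<union> H)"
    have gy: "gen y \<in> span (cob True S (H'' - T'') (T'' - H''))" using y by simp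
    have "glue_lin P (x * z) * gen y = glue_lin P (x * z * gen y)"
      by (rule glue_lin_mult[OF gy, symmetric]) (use T'' H'' ff fP in auto)
    then have "glue_lin (T'' \<union> H'') (glue_lin P (x * z) * gen y) = glue_lin ?A (x * (z * gen y))"
      using ff fP T'' H'' by (subst glue_lin_Un) (auto simp: mult.assoc)
    also have "?A = (T \<union> H) \<union> ?R" unfolding T'' H'' by blast
    also have "glue_lin ((T \<union> H) \<union> ?R) (x * (z * gen y)) = glue_lin (T \<union> H) (glue_lin ?R (x * (z * gen y)))"
      by (rule glue_lin_Un) (use f ff fP in auto)
    also have "glue_lin ?R (x * (z * gen y)) = x * glue_lin ?R (z * gen y)"
      by (rule glue_lin_mult2[OF nul_span[OF x]]) (use f ff fP in auto)
    finally have e: "glue_lin (T'' \<union> H'') (glue_lin P (x * z) * gen y)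
      = glue_lin (T \<union> H) (x * glue_lin ?R (z * gen y))" .
    have zy: "z * gen y \<in> span (cob True S (T' \<union> (H'' - T'')) (H' \<union> (T'' - H'')))"
    proof (rule mult_cob_span[OF z gy])
      show "T' \<inter> (H'' - T'') = {}" "H' \<inter> (T'' - H'') = {}" using P unfolding T'' H'' by blast+
    qed (use f ff in auto)
    have "glue_lin ?R (z * gen y) \<in> span (cob True S (T' \<union> (H'' - T'') - ?R) (H' \<union> (T'' - H'') - ?R))"
    proof (rule glue_lin_span[OF zy])
      show "?R \<subseteq> (T' \<union> (H'' - T'')) \<inter> (H' \<union> (T'' - H''))" using P unfolding T'' H'' by blast
    qed (use f ff in auto)
    moreover have "T' \<union> (H'' - T'') - ?R = H - T" using P d unfolding T'' H'' by blast
    moreover have "H' \<union> (T'' - H'') - ?R = T - H" using P d unfolding T'' H'' by blast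
    ultimately show ?thesis unfolding e by (intro nul_test[OF x]) simp
  qed
  with 1 show ?thesis unfolding nul_def by blast
qed

lemma nul_mult:
  assumes "x \<in> nul S \<alpha> T H" "z \<in> span (cob True S T' H')" "T \<inter> T' = {}" "H \<inter> H' = {}"
    "finite T" "finite T'" "finite H" "finite H'"
  shows "x * z \<in> nul S \<alpha> (T \<union> T') (H \<union> H')"
  using nul_ideal[OF assms(1-4), of "{}"] assms(5-8) by simp

lemma nul_glue:
  assumes "x \<in> nul S \<alpha> T H" "P \<subseteq> T \<inter> H" "finite T" "finite H"
  shows "glue_lin P x \<in> nul S \<alpha> (T - P) (H - P)"
  using nul_ideal[OF assms(1), of "gen 0" "{}" "{}" P] cob_zero[of True S] assms(2-4) by simp

text \<open>Tests are pulled back along the inverse renaming, which is why injectivity is required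
  on tails and heads together. The renaming that identifies the two ends of an arc is treated in
  \<open>nul_arc\<close>.\<close>

lemma nul_relabel:
  assumes x: "x \<in> nul S \<alpha> T H" and \<rho>: "inj_on \<rho> (T \<union> H)" and f: "finite T" "finite H"
  shows "relabel \<rho> x \<in> nul S \<alpha> (\<rho> ` T) (\<rho> ` H)"
proof -
  have inj: "inj_on \<rho> T" "inj_on \<rho> H" using \<rho> by (auto intro: inj_on_subset)
  let ?\<rho>' = "inv_into (T \<union> H) \<rho>"
  have inv: "?\<rho>' (\<rho> p) = p" if "p \<in> T \<union> H" for p using inv_into_f_f[OF \<rho> that] .
  have "eval_lin \<alpha> (glue_lin (\<rho> ` T \<union> \<rho> ` H) (relabel \<rho> x * gen y)) = 0"
    if y: "y \<in> cob True S (\<rho> ` H - \<rho> ` T) (\<rho> ` T - \<rho> ` H)" for y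
  proof -
    let ?y = "map_diag ?\<rho>' y"
    have "?y \<in> cob True S (?\<rho>' ` (\<rho> ` H - \<rho> ` T)) (?\<rho>' ` (\<rho> ` T - \<rho> ` H))"
      by (rule cob_map_diag[OF y]) (auto intro: inj_on_inv_into)
    moreover have "?\<rho>' ` (\<rho> ` H - \<rho> ` T) = H - T"
    proof -
      have "\<rho> ` H - \<rho> ` T = \<rho> ` (H - T)" using \<rho> by (auto dest: inj_onD)
      then show ?thesis using inv by (auto simp: image_image)
    qed
    moreover have "?\<rho>' ` (\<rho> ` T - \<rho> ` H) = T - H"
    proof -
      have "\<rho> ` T - \<rho> ` H = \<rho> ` (T - H)" using \<rho> by (auto dest: inj_onD)
      then show ?thesis using inv by (auto simp: image_image)
    qed
    ultimately have y': "?y \<in> cob True S (H - T) (T - H)" by simp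
    have "map_diag \<rho> ?y = y"
      unfolding map_diag_map_diag
      by (rule map_diag_ident) (use cob_pts[OF y] f in \<open>auto simp: inv f_inv_into_f\<close>)
    then have "relabel \<rho> x * gen y = relabel \<rho> (x * gen ?y)" by (simp add: relabel_mult)
    moreover have "x * gen ?y \<in> span (cob True S (T \<union> (H - T)) (H \<union> (T - H)))"
      by (rule mult_cob_span[OF nul_span[OF x]]) (use y' f in auto)
    then have "glue_lin (\<rho> ` (T \<union> H)) (relabel \<rho> (x * gen ?y)) = relabel \<rho> (glue_lin (T \<union> H) (x * gen ?y))"
      by (rule glue_lin_relabel) (use f \<rho> in \<open>auto dest: inj_onD\<close>)
    ultimately show ?thesis using x y' by (simp add: nul_def image_Un)
  qed
  moreover have "relabel \<rho> x \<in> span (cob True S (\<rho> ` T) (\<rho> ` H))"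
    by (rule relabel_span[OF nul_span[OF x] inj])
  ultimately show ?thesis by (simp add: nul_def)
qed

text \<open>A closed combination is tested against closed diagrams only and evaluation is
  multiplicative, so the empty diagram is already a sufficient test.\<close>

lemma nul_closed_iff: "x \<in> span (cob True S {} {}) \<Longrightarrow> x \<in> nul S \<alpha> {} {} \<longleftrightarrow> eval_lin \<alpha> x = 0"
proof -
  assume x: "x \<in> span (cob True S {} {})"
  have "eval_lin \<alpha> (x * gen 0) = eval_lin \<alpha> x" by (subst gen_zero) simp
  moreover have "(0 :: 'a diag) \<in> cob True S {} {}" by (rule cob_zero)
  ultimately show ?thesis using x by (auto simp: nul_def eval_lin_mult)
qed

section \<open>The category of an evaluation as a quotient by an ideal\<close>

lemma Mid_lessThan: "Mid ` {..<length \<epsilon>} = Mid ` pos \<epsilon> \<union> Mid ` neg \<epsilon>"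
  unfolding pos_neg(1)[symmetric] by (rule image_Un)

lemma neg_iff: "i \<in> neg \<epsilon> \<longleftrightarrow> i < length \<epsilon> \<and> i \<notin> pos \<epsilon>"
  by (auto simp: pos_def neg_def sign_neq)

lemma tail_head_disjoint: "tail_pts \<epsilon> \<epsilon>' \<inter> head_pts \<epsilon> \<epsilon>' = {}"
  by (auto simp: tail_pts_eq head_pts_eq pos_def neg_def)

lemma tail_head_pts: "tail_pts \<epsilon> \<epsilon>' \<union> head_pts \<epsilon> \<epsilon>' = Bot ` {..<length \<epsilon>} \<union> Top ` {..<length \<epsilon>'}"
  unfolding tail_pts_eq head_pts_eq pos_neg(1)[symmetric] by blast

lemma cob_swap:
  assumes "y \<in> cob i L (tail_pts \<epsilon>' \<epsilon>) (head_pts \<epsilon>' \<epsilon>)"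
  shows "map_diag (relab Top Bot) y \<in> cob i L (head_pts \<epsilon> \<epsilon>') (tail_pts \<epsilon> \<epsilon>')"
  using cob_relab[OF assms, of Top Bot] by (simp add: tail_pts_eq head_pts_eq inj_on_def Un_commute)

lemma closure_lin_linear:
  "closure_lin n 0 = 0" "closure_lin n (f + g) = closure_lin n f + closure_lin n g"
  "closure_lin n (scale c f) = scale c (closure_lin n f)"
  by (simp_all add: closure_lin_def lin_ext_add lin_ext_scale)

lemma closure_diag_eq:
  assumes Z: "Z \<in> cob i L (tail_pts \<epsilon> \<epsilon>) (head_pts \<epsilon> \<epsilon>)"
  shows "closure_diag (length \<epsilon>) Z = glue_set (Mid ` {..<length \<epsilon>}) (map_diag (relab Mid Mid) Z)"
    and "map_diag (relab Mid Mid) Z \<in> cob i L (Mid ` {..<length \<epsilon>}) (Mid ` {..<length \<epsilon>})"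
proof -
  have "map_diag (relab Mid Mid) Z \<in> cob i L (Mid ` pos \<epsilon> \<union> Mid ` neg \<epsilon>) (Mid ` neg \<epsilon> \<union> Mid ` pos \<epsilon>)"
    by (rule cob_relab[OF Z]) (auto simp: inj_on_def)
  then show m: "map_diag (relab Mid Mid) Z \<in> cob i L (Mid ` {..<length \<epsilon>}) (Mid ` {..<length \<epsilon>})"
    by (simp only: Mid_lessThan Un_commute)
  have "map_diag (top_to_mid \<circ> bot_to_mid) Z = map_diag (relab Mid Mid) Z"
    by (rule map_diag_relab_cong[OF Z]) auto
  then show "closure_diag (length \<epsilon>) Z = glue_set (Mid ` {..<length \<epsilon>}) (map_diag (relab Mid Mid) Z)"
    unfolding closure_diag_def using cob_pts(5)[OF m] by (simp add: glue_all_eq)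
qed

text \<open>Closing up \<open>y\<close> on top of \<open>D\<close> glues every outer point of
  \<open>D\<close> to the corresponding point of \<open>y\<close>; exchanging \<open>Bot\<close> and
  \<open>Top\<close> in \<open>y\<close> gives corresponding points the same name.\<close>

lemma eval_closure_stack:
  assumes D: "D \<in> cob True S (tail_pts \<epsilon> \<epsilon>') (head_pts \<epsilon> \<epsilon>')"
    and y: "y \<in> cob True S (tail_pts \<epsilon>' \<epsilon>) (head_pts \<epsilon>' \<epsilon>)"
  shows "eval_diag \<alpha> (closure_diag (length \<epsilon>) (stack (length \<epsilon>') y D))
    = eval_diag \<alpha> (glue_set (tail_pts \<epsilon> \<epsilon>' \<union> head_pts \<epsilon> \<epsilon>') (D + map_diag (relab Top Bot) y))"
proof -
  let ?n = "length \<epsilon>" and ?n' = "length \<epsilon>'" and ?A = "tail_pts \<epsilon> \<epsilon>' \<union> head_pts \<epsilon> \<epsilon>'"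
  \<comment> \<open>In the closure the \<open>?n\<close> points of \<epsilon> are called
    \<open>Mid i\<close>. The points of \<epsilon>' are numbered after them, and
    \<open>?\<kappa>\<close> carries the outer points of \<open>D\<close> to these names.\<close>
  define m where "m i = Mid (?n + i)" for i
  let ?W = "D + map_diag (relab Top Bot) y" and ?\<kappa> = "relab Mid m"
  have W: "?W \<in> cob True S ?A ?A"
    using cob_add[OF D cob_swap[OF y]] tail_head_disjoint by (auto simp: Un_commute)
  have \<kappa>: "inj_on ?\<kappa> ?A" unfolding tail_head_pts
    by (rule inj_on_relab) (auto simp: inj_on_def m_def)
  have "closure_diag ?n (stack ?n' y D) = glue_set (Mid ` {..<?n}) (map_diag (relab Mid Mid) (stack ?n' y D))"
    by (rule closure_diag_eq[OF stack_cob[OF D y]])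
  also have "map_diag (relab Mid Mid) (stack ?n' y D)
      = glue_set (m ` {..<?n'}) (map_diag (relab Mid m) D + map_diag (relab m Mid) y)"
    by (rule stack_relab[OF D y]) (auto simp: m_def inj_on_def)
  also have "map_diag (relab m Mid) y = map_diag ?\<kappa> (map_diag (relab Top Bot) y)"
    unfolding map_diag_map_diag by (rule map_diag_relab_cong[OF y]) auto
  also have "glue_set (Mid ` {..<?n}) (glue_set (m ` {..<?n'}) (map_diag ?\<kappa> D + map_diag ?\<kappa> (map_diag (relab Top Bot) y)))
     = glue_set (Mid ` {..<?n} \<union> m ` {..<?n'}) (map_diag ?\<kappa> ?W)"
    by (subst glue_set_Un) (auto simp: m_def)
  also have "Mid ` {..<?n} \<union> m ` {..<?n'} = ?\<kappa> ` ?A"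
    unfolding tail_head_pts by (simp add: image_Un image_image)
  also have "glue_set (?\<kappa> ` ?A) (map_diag ?\<kappa> ?W) = map_diag ?\<kappa> (glue_set ?A ?W)"
    by (rule glue_set_map_diag) (use \<kappa> cob_pts[OF W] in \<open>auto dest: inj_onD\<close>)
  finally show ?thesis by simp
qed

text \<open>From here on bottom and top are treated alike: whether a combination is null is decided
  by the sets of its tails and heads alone, and bending strands becomes a renaming of
  points.\<close>

lemma null_eq: "null S \<alpha> \<epsilon> \<epsilon>' = nul S \<alpha> (tail_pts \<epsilon> \<epsilon>') (head_pts \<epsilon> \<epsilon>')"
proof -
  let ?T = "tail_pts \<epsilon> \<epsilon>'" and ?H = "head_pts \<epsilon> \<epsilon>'"
  have e: "eval_lin \<alpha> (closure_lin (length \<epsilon>) (stack_lin (length \<epsilon>') (gen y) x))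
      = eval_lin \<alpha> (glue_lin (?T \<union> ?H) (x * gen (map_diag (relab Top Bot) y)))"
    if "x \<in> span (cob True S ?T ?H)" and y: "y \<in> cob True S (tail_pts \<epsilon>' \<epsilon>) (head_pts \<epsilon>' \<epsilon>)" for x y
    using that(1)
  proof (induction x rule: span_induct)
    case (add x D c)
    then show ?case using eval_closure_stack[OF \<open>D \<in> _\<close> y, of \<alpha>]
      by (simp add: stack_lin_linear closure_lin_linear eval_lin_linear glue_lin_linear distrib_right
          scale_mult_left mult_single del: scale_simps(5)) (simp add: closure_lin_def)
  qed (simp add: closure_lin_linear eval_lin_linear glue_lin_linear)
  \<comment> \<open>Exchanging bottom and top is an involution, so every test on the swapped
    endpoints comes from a cobordism in the opposite direction.\<close>
  have surj: "\<exists>y'\<in>cob True S (tail_pts \<epsilon>' \<epsilon>) (head_pts \<epsilon>' \<epsilon>). y = map_diag (relab Top Bot) y'"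
    if y: "y \<in> cob True S ?H ?T" for y
  proof
    have "map_diag (relab Top Bot) y \<in> cob True S (relab Top Bot ` ?H) (relab Top Bot ` ?T)"
      by (rule cob_map_diag[OF y]) (auto simp: inj_on_def tail_pts_eq head_pts_eq)
    then show "map_diag (relab Top Bot) y \<in> cob True S (tail_pts \<epsilon>' \<epsilon>) (head_pts \<epsilon>' \<epsilon>)"
      by (simp add: tail_pts_eq head_pts_eq image_Un image_image Un_commute)
    show "y = map_diag (relab Top Bot) (map_diag (relab Top Bot) y)"
      unfolding map_diag_map_diag by (rule map_diag_ident[symmetric])
        (use cob_pts[OF y] in \<open>auto simp: tail_pts_eq head_pts_eq\<close>)
  qed
  have d: "?H - ?T = ?H" "?T - ?H = ?T" using tail_head_disjoint[of \<epsilon> \<epsilon>'] by auto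
  show ?thesis
    unfolding null_def nul_def d cobs_eq free_cat_simps
  proof (intro Collect_cong conj_cong refl iffI ballI)
    fix x y assume x: "x \<in> span (cob True S ?T ?H)" and y: "y \<in> cob True S ?H ?T"
      and *: "\<forall>y\<in>cob True S (tail_pts \<epsilon>' \<epsilon>) (head_pts \<epsilon>' \<epsilon>).
        eval_lin \<alpha> (closure_lin (length \<epsilon>) (stack_lin (length \<epsilon>') (gen y) x)) = 0"
    obtain y' where y': "y' \<in> cob True S (tail_pts \<epsilon>' \<epsilon>) (head_pts \<epsilon>' \<epsilon>)" "y = map_diag (relab Top Bot) y'"
      using surj[OF y] by blast
    show "eval_lin \<alpha> (glue_lin (?T \<union> ?H) (x * gen y)) = 0"
      using bspec[OF * y'(1)] e[OF x y'(1)] y'(2) by simp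
  next
    fix x y assume x: "x \<in> span (cob True S ?T ?H)" and y: "y \<in> cob True S (tail_pts \<epsilon>' \<epsilon>) (head_pts \<epsilon>' \<epsilon>)"
      and *: "\<forall>y\<in>cob True S ?H ?T. eval_lin \<alpha> (glue_lin (?T \<union> ?H) (x * gen y)) = 0"
    show "eval_lin \<alpha> (closure_lin (length \<epsilon>) (stack_lin (length \<epsilon>') (gen y) x)) = 0"
      using bspec[OF * cob_swap[OF y]] e[OF x y] by simp
  qed
qed

lemma relab_inj:
  assumes "inj b" "inj t" "\<And>i j. b i \<noteq> t j"
  shows "inj_on (relab b t) (tail_pts \<epsilon> \<epsilon>' \<union> head_pts \<epsilon> \<epsilon>')"
  unfolding tail_head_pts by (rule inj_on_relab) (use assms in \<open>auto intro: inj_on_subset\<close>)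

lemma relab_image_tail: "relab b t ` tail_pts \<epsilon> \<epsilon>' = b ` pos \<epsilon> \<union> t ` neg \<epsilon>'"
  and relab_image_head: "relab b t ` head_pts \<epsilon> \<epsilon>' = b ` neg \<epsilon> \<union> t ` pos \<epsilon>'"
  by (simp_all add: tail_pts_eq head_pts_eq image_Un image_image)

lemma relabel_relab_span:
  assumes "f \<in> span (cob i L (tail_pts \<epsilon> \<epsilon>') (head_pts \<epsilon> \<epsilon>'))" "inj b" "inj t" "\<And>i j. b i \<noteq> t j"
  shows "relabel (relab b t) f \<in> span (cob i L (b ` pos \<epsilon> \<union> t ` neg \<epsilon>') (b ` neg \<epsilon> \<union> t ` pos \<epsilon>'))"
  using relabel_span[OF assms(1), of "relab b t"] relab_inj[OF assms(2-4), of \<epsilon> \<epsilon>']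
  by (auto simp: relab_image_tail relab_image_head intro: inj_on_subset)

lemma inj_pt [simp]: "inj Bot" "inj Mid" "inj Top"
  by (auto simp: inj_on_def)

lemma stack_null_left:
  assumes x: "x \<in> null S \<alpha> \<epsilon> \<epsilon>'" and g: "g \<in> span (cobs S \<epsilon>' \<epsilon>'')"
  shows "stack_lin (length \<epsilon>') g x \<in> null S \<alpha> \<epsilon> \<epsilon>''"
  unfolding null_eq
proof (subst stack_lin_eq)
  note x' = x[unfolded null_eq] and g' = g[unfolded cobs_eq]
  show "glue_lin (Mid ` {..<length \<epsilon>'}) (relabel (relab Bot Mid) x * relabel (relab Mid Top) g)
    \<in> nul S \<alpha> (tail_pts \<epsilon> \<epsilon>'') (head_pts \<epsilon> \<epsilon>'')"
  proof (rule nul_ideal)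
    show "relabel (relab Bot Mid) x \<in> nul S \<alpha> (Bot ` pos \<epsilon> \<union> Mid ` neg \<epsilon>') (Bot ` neg \<epsilon> \<union> Mid ` pos \<epsilon>')"
      using nul_relabel[OF x', of "relab Bot Mid"] by (simp add: relab_inj relab_image_tail relab_image_head)
    show "relabel (relab Mid Top) g \<in> span (cob True S (Mid ` pos \<epsilon>' \<union> Top ` neg \<epsilon>'') (Mid ` neg \<epsilon>' \<union> Top ` pos \<epsilon>''))"
      by (rule relabel_relab_span[OF g']) auto
  qed (auto simp: neg_iff Mid_lessThan tail_pts_eq head_pts_eq)
qed (use x g in \<open>auto simp: null_eq cobs_eq dest: nul_span\<close>)

lemma stack_null_right:
  assumes f: "f \<in> span (cobs S \<epsilon> \<epsilon>')" and x: "x \<in> null S \<alpha> \<epsilon>' \<epsilon>''"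
  shows "stack_lin (length \<epsilon>') x f \<in> null S \<alpha> \<epsilon> \<epsilon>''"
  unfolding null_eq
proof (subst stack_lin_eq)
  note x' = x[unfolded null_eq] and f' = f[unfolded cobs_eq]
  show "glue_lin (Mid ` {..<length \<epsilon>'}) (relabel (relab Bot Mid) f * relabel (relab Mid Top) x)
    \<in> nul S \<alpha> (tail_pts \<epsilon> \<epsilon>'') (head_pts \<epsilon> \<epsilon>'')"
    unfolding mult.commute[of "relabel (relab Bot Mid) f"]
  proof (rule nul_ideal)
    show "relabel (relab Mid Top) x \<in> nul S \<alpha> (Mid ` pos \<epsilon>' \<union> Top ` neg \<epsilon>'') (Mid ` neg \<epsilon>' \<union> Top ` pos \<epsilon>'')"
      using nul_relabel[OF x', of "relab Mid Top"] by (simp add: relab_inj relab_image_tail relab_image_head)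
    show "relabel (relab Bot Mid) f \<in> span (cob True S (Bot ` pos \<epsilon> \<union> Mid ` neg \<epsilon>') (Bot ` neg \<epsilon> \<union> Mid ` pos \<epsilon>'))"
      by (rule relabel_relab_span[OF f']) auto
  qed (auto simp: neg_iff Mid_lessThan tail_pts_eq head_pts_eq)
qed (use x f in \<open>auto simp: null_eq cobs_eq dest: nul_span\<close>)

lemma preadditive_ideal_null: "preadditive_ideal (free_cat (cobs S)) (null S \<alpha>)"
proof -
  interpret preadditive "free_cat (cobs S) :: (sign list, ('a, 'b::field) lin, 'b) lincat"
    by (rule preadditive_free_cat) (rule cobs_eq)
  show ?thesis
  proof
    fix X Y n assume "n \<in> null S \<alpha> X Y"
    then show "n \<in> Arr (free_cat (cobs S)) X Y" by (simp add: null_def)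
  next
    fix X Y n assume "n \<in> null S \<alpha> X Y"
    then show "\<exists>n'\<in>null S \<alpha> X Y. Add (free_cat (cobs S)) X Y n n' = Zer (free_cat (cobs S)) X Y"
      unfolding null_eq free_cat_simps by (intro bexI[of _ "- n"] nul_uminus) auto
  qed (simp_all only: free_cat_simps stack_null_left stack_null_right, simp_all add: null_eq nul_add)
qed

section \<open>Classes of cobordisms\<close>

lemma mem_pos_Cons: "i \<in> pos (s # \<epsilon>) \<longleftrightarrow> i = 0 \<and> s = Pos \<or> (\<exists>j\<in>pos \<epsilon>. i = Suc j)"
  and mem_neg_Cons: "i \<in> neg (s # \<epsilon>) \<longleftrightarrow> i = 0 \<and> s = Neg \<or> (\<exists>j\<in>neg \<epsilon>. i = Suc j)"
  by (cases i; auto simp: pos_def neg_def)+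

lemma pos_neg_simps [simp]:
  "pos [] = {}" "neg [] = {}"
  "pos (Pos # \<epsilon>) = insert 0 (Suc ` pos \<epsilon>)" "neg (Pos # \<epsilon>) = Suc ` neg \<epsilon>"
  "pos (Neg # \<epsilon>) = Suc ` pos \<epsilon>" "neg (Neg # \<epsilon>) = insert 0 (Suc ` neg \<epsilon>)"
  unfolding set_eq_iff by (auto simp: mem_pos_Cons mem_neg_Cons) (auto simp: pos_def neg_def)

lemma mem_cls: "g \<in> cls S \<alpha> \<epsilon> \<epsilon>' f \<longleftrightarrow> g - f \<in> null S \<alpha> \<epsilon> \<epsilon>'"
  by (auto simp: coset_def free_cat_simps image_iff algebra_simps intro: bexI[of _ "g - f"])

lemma cls_eq_iff: "cls S \<alpha> \<epsilon> \<epsilon>' f = cls S \<alpha> \<epsilon> \<epsilon>' g \<longleftrightarrow> f - g \<in> null S \<alpha> \<epsilon> \<epsilon>'"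
proof
  assume "cls S \<alpha> \<epsilon> \<epsilon>' f = cls S \<alpha> \<epsilon> \<epsilon>' g"
  moreover have "f \<in> cls S \<alpha> \<epsilon> \<epsilon>' f" unfolding mem_cls null_eq by simp
  ultimately show "f - g \<in> null S \<alpha> \<epsilon> \<epsilon>'" by (simp add: mem_cls)
next
  assume fg: "f - g \<in> null S \<alpha> \<epsilon> \<epsilon>'"
  have "h - f \<in> null S \<alpha> \<epsilon> \<epsilon>' \<longleftrightarrow> h - g \<in> null S \<alpha> \<epsilon> \<epsilon>'" for h
    using fg nul_trans nul_sym unfolding null_eq by metis
  then show "cls S \<alpha> \<epsilon> \<epsilon>' f = cls S \<alpha> \<epsilon> \<epsilon>' g"
    unfolding set_eq_iff mem_cls by blast
qed

lemma cls_refl: "f \<in> cls S \<alpha> \<epsilon> \<epsilon>' f"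
  unfolding mem_cls null_eq by simp

lemma UN_cls:
  assumes "A \<noteq> {}" "\<And>x. x \<in> A \<Longrightarrow> t x - f \<in> null S \<alpha> \<epsilon> \<epsilon>'"
  shows "(\<Union>x\<in>A. cls S \<alpha> \<epsilon> \<epsilon>' (t x)) = cls S \<alpha> \<epsilon> \<epsilon>' f"
  using assms cls_eq_iff by fastforce

lemma Obj_C_alpha: "Obj (C_alpha S \<alpha>) = UNIV"
  by (simp add: C_alpha_def quot_def free_cat_simps)

lemma Arr_C_alpha: "Arr (C_alpha S \<alpha>) \<epsilon> \<epsilon>' = cls S \<alpha> \<epsilon> \<epsilon>' ` span (cobs S \<epsilon> \<epsilon>')"
  by (simp add: C_alpha_def quot_def free_cat_simps)

lemma preadditive_C_alpha: "preadditive (C_alpha S \<alpha>)"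
  unfolding C_alpha_def by (rule preadditive_ideal.preadditive_quot[OF preadditive_ideal_null])

lemma Cmp_C_alpha:
  "f \<in> span (cobs S \<epsilon> \<epsilon>') \<Longrightarrow> g \<in> span (cobs S \<epsilon>' \<epsilon>'') \<Longrightarrow>
    Cmp (C_alpha S \<alpha>) \<epsilon> \<epsilon>' \<epsilon>'' (cls S \<alpha> \<epsilon>' \<epsilon>'' g) (cls S \<alpha> \<epsilon> \<epsilon>' f)
      = cls S \<alpha> \<epsilon> \<epsilon>'' (stack_lin (length \<epsilon>') g f)"
  using preadditive_ideal.Cmp_quot[OF preadditive_ideal_null, where X = \<epsilon> and Y = \<epsilon>' and Z = \<epsilon>'' and f = f and g = g]
  by (simp add: C_alpha_def free_cat_simps)

lemma Add_C_alpha: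
  "f \<in> span (cobs S \<epsilon> \<epsilon>') \<Longrightarrow> g \<in> span (cobs S \<epsilon> \<epsilon>') \<Longrightarrow>
    Add (C_alpha S \<alpha>) \<epsilon> \<epsilon>' (cls S \<alpha> \<epsilon> \<epsilon>' f) (cls S \<alpha> \<epsilon> \<epsilon>' g) = cls S \<alpha> \<epsilon> \<epsilon>' (f + g)"
  using preadditive_ideal.Add_quot[OF preadditive_ideal_null, where X = \<epsilon> and Y = \<epsilon>' and f = f and g = g]
  by (simp add: C_alpha_def free_cat_simps)

lemma Zer_C_alpha: "Zer (C_alpha S \<alpha>) \<epsilon> \<epsilon>' = cls S \<alpha> \<epsilon> \<epsilon>' 0"
  by (simp add: C_alpha_def quot_def free_cat_simps)

lemma Ide_C_alpha: "Ide (C_alpha S \<alpha>) \<epsilon> = cls S \<alpha> \<epsilon> \<epsilon> (gen (id_diag \<epsilon>))"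
  by (simp add: C_alpha_def quot_def free_cat_simps)

lemma Scl_C_alpha: "Scl (C_alpha S \<alpha>) \<epsilon> \<epsilon>' c (cls S \<alpha> \<epsilon> \<epsilon>' f) = cls S \<alpha> \<epsilon> \<epsilon>' (scale c f)"
proof -
  have "Scl (C_alpha S \<alpha>) \<epsilon> \<epsilon>' c (cls S \<alpha> \<epsilon> \<epsilon>' f)
    = (\<Union>g\<in>cls S \<alpha> \<epsilon> \<epsilon>' f. cls S \<alpha> \<epsilon> \<epsilon>' (scale c g))"
    by (simp add: C_alpha_def quot_def free_cat_simps)
  also have "\<dots> = cls S \<alpha> \<epsilon> \<epsilon>' (scale c f)"
  proof (rule UN_cls)
    fix g assume "g \<in> cls S \<alpha> \<epsilon> \<epsilon>' f"
    then show "scale c g - scale c f \<in> null S \<alpha> \<epsilon> \<epsilon>'"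
      unfolding mem_cls null_eq scale_diff[symmetric] by (rule nul_scale)
  qed (use cls_refl in blast)
  finally show ?thesis .
qed

lemma span_sum_list: "(\<And>l. l \<in> set ls \<Longrightarrow> t l \<in> span X) \<Longrightarrow> sum_list (map t ls) \<in> span X"
proof (induction ls)
  case (Cons l ls)
  have "t l + sum_list (map t ls) \<in> span X" by (rule span_add) (use Cons in auto)
  then show ?case by simp
qed simp

lemma Sum_C_alpha:
  assumes "\<And>l. l \<in> set ls \<Longrightarrow> t l \<in> span (cobs S \<epsilon> \<epsilon>')"
  shows "Sum (C_alpha S \<alpha>) \<epsilon> \<epsilon>' (map (\<lambda>l. cls S \<alpha> \<epsilon> \<epsilon>' (t l)) ls) = cls S \<alpha> \<epsilon> \<epsilon>' (sum_list (map t ls))"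
  using assms
proof (induction ls)
  case (Cons l ls)
  have "sum_list (map t ls) \<in> span (cobs S \<epsilon> \<epsilon>')"
    using Cons.prems by (intro span_sum_list) auto
  then show ?case using Cons by (simp add: Sum_def Add_C_alpha)
qed (simp add: Sum_def Zer_C_alpha)

text \<open>The same choice of representative as in \<open>F_arc\<close>, so that the value of
  \<open>F_diag\<close> on an arc is literally a relabelled \<open>rep\<close>.\<close>

definition rep :: "'x set \<Rightarrow> 'x" where "rep X = (SOME f. f \<in> X)"

lemma rep_cls: "rep (cls S \<alpha> \<epsilon> \<epsilon>' f) - f \<in> null S \<alpha> \<epsilon> \<epsilon>'"
  unfolding mem_cls[symmetric] rep_def by (rule someI_ex) (use cls_refl in blast)

lemma null_span: "x \<in> null S \<alpha> \<epsilon> \<epsilon>' \<Longrightarrow> x \<in> span (cobs S \<epsilon> \<epsilon>')"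
  unfolding null_eq cobs_eq by (rule nul_span)

lemma rep_span: "X \<in> Arr (C_alpha S \<alpha>) \<epsilon> \<epsilon>' \<Longrightarrow> rep X \<in> span (cobs S \<epsilon> \<epsilon>')"
  and cls_rep: "X \<in> Arr (C_alpha S \<alpha>) \<epsilon> \<epsilon>' \<Longrightarrow> cls S \<alpha> \<epsilon> \<epsilon>' (rep X) = X"
proof -
  assume "X \<in> Arr (C_alpha S \<alpha>) \<epsilon> \<epsilon>'"
  then obtain f where f: "f \<in> span (cobs S \<epsilon> \<epsilon>')" "X = cls S \<alpha> \<epsilon> \<epsilon>' f" by (auto simp: Arr_C_alpha)
  have n: "rep X - f \<in> null S \<alpha> \<epsilon> \<epsilon>'" using rep_cls[of S \<alpha> \<epsilon> \<epsilon>' f] f by simp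
  show "rep X \<in> span (cobs S \<epsilon> \<epsilon>')" using span_add[OF null_span[OF n] f(1)] by simp
  show "cls S \<alpha> \<epsilon> \<epsilon>' (rep X) = X" using n f by (simp add: cls_eq_iff)
qed

text \<open>An injective renaming preserves null combinations, so the union over the representatives
  is one class, provided that the renaming carries tails to tails and heads to heads.\<close>

lemma bend_cls:
  assumes "inj_on \<rho> (tail_pts \<epsilon> \<epsilon>' \<union> head_pts \<epsilon> \<epsilon>')"
    "\<rho> ` tail_pts \<epsilon> \<epsilon>' = tail_pts \<delta> \<delta>'" "\<rho> ` head_pts \<epsilon> \<epsilon>' = head_pts \<delta> \<delta>'"
  shows "bend S \<alpha> \<rho> \<delta> \<delta>' (cls S \<alpha> \<epsilon> \<epsilon>' f) = cls S \<alpha> \<delta> \<delta>' (relabel \<rho> f)"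
  unfolding bend_def
proof (rule UN_cls)
  fix g assume "g \<in> cls S \<alpha> \<epsilon> \<epsilon>' f"
  then have "relabel \<rho> (g - f) \<in> nul S \<alpha> (\<rho> ` tail_pts \<epsilon> \<epsilon>') (\<rho> ` head_pts \<epsilon> \<epsilon>')"
    unfolding mem_cls null_eq using assms(1) by (intro nul_relabel) auto
  then show "relabel \<rho> g - relabel \<rho> f \<in> null S \<alpha> \<delta> \<delta>'"
    unfolding null_eq assms(2,3) relabel_linear .
qed (use cls_refl in blast)

lemma pos_append: "pos (\<epsilon> @ \<delta>) = pos \<epsilon> \<union> (+) (length \<epsilon>) ` pos \<delta>"
  and neg_append: "neg (\<epsilon> @ \<delta>) = neg \<epsilon> \<union> (+) (length \<epsilon>) ` neg \<delta>"
proof -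
  have *: "{i. i < length (\<epsilon> @ \<delta>) \<and> (\<epsilon> @ \<delta>) ! i = s} = {i. i < length \<epsilon> \<and> \<epsilon> ! i = s} \<union>
    (+) (length \<epsilon>) ` {i. i < length \<delta> \<and> \<delta> ! i = s}" (is "?A = ?B \<union> ?C") for s
  proof (unfold set_eq_iff, intro allI iffI)
    fix i assume i: "i \<in> ?A"
    show "i \<in> ?B \<union> ?C"
    proof (cases "i < length \<epsilon>")
      case False
      then have "i = length \<epsilon> + (i - length \<epsilon>)" "i - length \<epsilon> < length \<delta>" "\<delta> ! (i - length \<epsilon>) = s"
        using i by (auto simp: nth_append)
      then show ?thesis by blast
    qed (use i in \<open>auto simp: nth_append\<close>)
  qed (auto simp: nth_append)
  show "pos (\<epsilon> @ \<delta>) = pos \<epsilon> \<union> (+) (length \<epsilon>) ` pos \<delta>" "neg (\<epsilon> @ \<delta>) = neg \<epsilon> \<union> (+) (length \<epsilon>) ` neg \<delta>"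
    unfolding pos_def neg_def by (rule *)+
qed

lemma shift_image:
  "tail_pts \<epsilon> \<epsilon>' \<union> shift (length \<epsilon>) (length \<epsilon>') ` tail_pts \<delta> \<delta>' = tail_pts (\<epsilon> @ \<delta>) (\<epsilon>' @ \<delta>')"
  "head_pts \<epsilon> \<epsilon>' \<union> shift (length \<epsilon>) (length \<epsilon>') ` head_pts \<delta> \<delta>' = head_pts (\<epsilon> @ \<delta>) (\<epsilon>' @ \<delta>')"
  by (auto simp: tail_pts_eq head_pts_eq pos_append neg_append image_Un image_image)

lemma inj_shift: "inj (shift m n)"
proof (rule injI)
  fix x y show "shift m n x = shift m n y \<Longrightarrow> x = y" by (cases x; cases y) auto
qed

lemma shift_disjoint:
  "tail_pts \<epsilon> \<epsilon>' \<inter> shift (length \<epsilon>) (length \<epsilon>') ` tail_pts \<delta> \<delta>' = {}"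
  "head_pts \<epsilon> \<epsilon>' \<inter> shift (length \<epsilon>) (length \<epsilon>') ` head_pts \<delta> \<delta>' = {}"
  by (auto simp: tail_pts_eq head_pts_eq pos_def neg_def)

lemma tensor_cls:
  assumes f: "f \<in> span (cobs S \<epsilon> \<epsilon>')" and g: "g \<in> span (cobs S \<delta> \<delta>')"
  shows "tensor S \<alpha> \<epsilon> \<epsilon>' \<delta> \<delta>' (cls S \<alpha> \<epsilon> \<epsilon>' f) (cls S \<alpha> \<delta> \<delta>' g)
    = cls S \<alpha> (\<epsilon> @ \<delta>) (\<epsilon>' @ \<delta>') (f * relabel (shift (length \<epsilon>) (length \<epsilon>')) g)"
proof -
  let ?\<rho> = "shift (length \<epsilon>) (length \<epsilon>')"
  have 1: "a * relabel ?\<rho> b \<in> null S \<alpha> (\<epsilon> @ \<delta>) (\<epsilon>' @ \<delta>')"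
    if "a \<in> null S \<alpha> \<epsilon> \<epsilon>'" "b \<in> span (cobs S \<delta> \<delta>')" for a b
    using nul_mult[OF that(1)[unfolded null_eq] relabel_span[OF that(2)[unfolded cobs_eq], of ?\<rho>]]
      shift_disjoint[of \<epsilon> \<epsilon>' \<delta> \<delta>']
    by (simp add: inj_on_subset[OF inj_shift] shift_image null_eq)
  have 2: "a * relabel ?\<rho> b \<in> null S \<alpha> (\<epsilon> @ \<delta>) (\<epsilon>' @ \<delta>')"
    if "a \<in> span (cobs S \<epsilon> \<epsilon>')" "b \<in> null S \<alpha> \<delta> \<delta>'" for a b
    using nul_mult[OF nul_relabel[OF that(2)[unfolded null_eq], of ?\<rho>] that(1)[unfolded cobs_eq]]
      shift_disjoint[of \<epsilon> \<epsilon>' \<delta> \<delta>']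
    by (simp add: inj_on_subset[OF inj_shift] shift_image null_eq mult.commute Int_commute Un_commute[of "shift _ _ ` _"])
  have "(\<Union>g'\<in>cls S \<alpha> \<delta> \<delta>' g. cls S \<alpha> (\<epsilon> @ \<delta>) (\<epsilon>' @ \<delta>') (f' * relabel ?\<rho> g'))
    = cls S \<alpha> (\<epsilon> @ \<delta>) (\<epsilon>' @ \<delta>') (f * relabel ?\<rho> g)" if f': "f' \<in> cls S \<alpha> \<epsilon> \<epsilon>' f" for f'
  proof (rule UN_cls)
    fix g' assume g': "g' \<in> cls S \<alpha> \<delta> \<delta>' g"
    have n: "g' - g \<in> null S \<alpha> \<delta> \<delta>'" "f' - f \<in> null S \<alpha> \<epsilon> \<epsilon>'" using f' g' by (simp_all add: mem_cls)
    have "f' \<in> span (cobs S \<epsilon> \<epsilon>')" using span_add[OF null_span[OF n(2)] f] by simp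
    \<comment> \<open>Up to the shift of the second factor, the difference of the two products is
      \<open>(f' - f) * g + f' * (g' - g)\<close>, and each summand has a null factor.\<close>
    then have "(f' - f) * relabel ?\<rho> g + f' * relabel ?\<rho> (g' - g) \<in> null S \<alpha> (\<epsilon> @ \<delta>) (\<epsilon>' @ \<delta>')"
      using 1[OF n(2) g] 2[OF _ n(1)] unfolding null_eq by (intro nul_add) auto
    then show "f' * relabel ?\<rho> g' - f * relabel ?\<rho> g \<in> null S \<alpha> (\<epsilon> @ \<delta>) (\<epsilon>' @ \<delta>')"
      by (simp add: relabel_linear algebra_simps)
  qed (use cls_refl in blast)
  then have "tensor S \<alpha> \<epsilon> \<epsilon>' \<delta> \<delta>' (cls S \<alpha> \<epsilon> \<epsilon>' f) (cls S \<alpha> \<delta> \<delta>' g)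
    = (\<Union>f'\<in>cls S \<alpha> \<epsilon> \<epsilon>' f. cls S \<alpha> (\<epsilon> @ \<delta>) (\<epsilon>' @ \<delta>') (f * relabel ?\<rho> g))"
    unfolding tensor_def by (rule SUP_cong[OF refl])
  also have "\<dots> = cls S \<alpha> (\<epsilon> @ \<delta>) (\<epsilon>' @ \<delta>') (f * relabel ?\<rho> g)"
    by (rule SUP_const) (use cls_refl in blast)
  finally show ?thesis .
qed

section \<open>Arcs and half-intervals\<close>

text \<open>An element of \<open>A(+-)\<close> with its tail moved to \<open>t\<close> and its head to \<open>h\<close>.\<close>

abbreviation arc :: "pt \<Rightarrow> pt \<Rightarrow> ('l, 'k::field) lin \<Rightarrow> ('l, 'k) lin" where
  "arc t h \<equiv> relabel (arc_to t h)"

text \<open>Meant for half-intervals: they have a single outer point, on which a constant map is an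
  injective renaming.\<close>

abbreviation put :: "pt \<Rightarrow> ('l, 'k::field) lin \<Rightarrow> ('l, 'k) lin" where
  "put p \<equiv> relabel (\<lambda>_. p)"

abbreviation Apm :: "'a set \<Rightarrow> ('a, 'k::field) lin set" where
  "Apm S \<equiv> span (cob True S {Top (Suc 0)} {Top 0})"

lemma pts_simps:
  "tail_pts [] [Pos, Neg] = {Top (Suc 0)}" "head_pts [] [Pos, Neg] = {Top 0}"
  "tail_pts [] [Pos] = {}" "head_pts [] [Pos] = {Top 0}"
  "tail_pts [] [Neg] = {Top 0}" "head_pts [] [Neg] = {}"
  "tail_pts [Pos] [Pos] = {Bot 0}" "head_pts [Pos] [Pos] = {Top 0}"
  "tail_pts [Neg] [Neg] = {Top 0}" "head_pts [Neg] [Neg] = {Bot 0}"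
  "tail_pts [] [] = {}" "head_pts [] [] = {}"
  by (auto simp: tail_pts_eq head_pts_eq)

lemma arc_to_simps [simp]: "arc_to t h (Top 0) = h" "arc_to t h (Top (Suc 0)) = t"
  by (simp_all add: arc_to_def)

lemma relabel_arc:
  assumes "x \<in> Apm S" shows "relabel \<rho> (arc t h x) = arc (\<rho> t) (\<rho> h) x"
  unfolding relabel_relabel by (rule relabel_cong[OF assms]) auto

lemma arc_span: "x \<in> Apm S \<Longrightarrow> arc t h x \<in> span (cob True S {t} {h})"
  using relabel_span[of x True S "{Top (Suc 0)}" "{Top 0}" "arc_to t h"] by simp

lemma arc_ident: "x \<in> Apm S \<Longrightarrow> arc (Top (Suc 0)) (Top 0) x = x"
  by (rule relabel_ident[of x True S "{Top (Suc 0)}" "{Top 0}"]) auto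

lemma relabel_put: "relabel \<rho> (put p x) = put (\<rho> p) x"
  by (simp add: relabel_relabel comp_def)

lemma put_span_head: "x \<in> span (cob i L {} {q}) \<Longrightarrow> put p x \<in> span (cob i L {} {p})"
  and put_span_tail: "x \<in> span (cob i L {q} {}) \<Longrightarrow> put p x \<in> span (cob i L {p} {})"
  using relabel_span[of x i L "{}" "{q}" "\<lambda>_. p"] relabel_span[of x i L "{q}" "{}" "\<lambda>_. p"] by auto

lemma put_ident: "x \<in> span (cob i L {} {p}) \<Longrightarrow> put p x = x" "x \<in> span (cob i L {p} {}) \<Longrightarrow> put p x = x"
  by (auto intro: relabel_ident)

lemma glue_lin_strand_head:
  assumes x: "x \<in> span (cob i L T H)" and p: "p \<in> H" "p \<notin> T" "q \<noteq> p" and f: "finite T" "finite H"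
  shows "glue_lin {p} (x * gen (sg (Some p) (Some q) [])) = relabel (id(p := q)) x"
proof -
  define \<rho> where "\<rho> = id(p := q)"
  show ?thesis unfolding \<rho>_def[symmetric] using x
proof (induction x rule: span_induct)
  case (add x D c)
  have "glue_set {p} (D + sg (Some p) (Some q) []) = map_diag \<rho> D"
    using glue_at_strand_head[of D p q] cob_pts[OF add(2) f] p by (simp add: glue_set_insert \<rho>_def)
  with add show ?case
    by (simp add: glue_lin_linear relabel_linear distrib_right scale_mult_left mult_single del: scale_simps(5))
qed (simp add: glue_lin_linear relabel_linear)
qed

lemma glue_lin_strand_tail:
  assumes x: "x \<in> span (cob i L T H)" and p: "p \<in> T" "p \<notin> H" "q \<noteq> p" and f: "finite T" "finite H"
  shows "glue_lin {p} (x * gen (sg (Some q) (Some p) [])) = relabel (id(p := q)) x"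
proof -
  define \<rho> where "\<rho> = id(p := q)"
  show ?thesis unfolding \<rho>_def[symmetric] using x
proof (induction x rule: span_induct)
  case (add x D c)
  have "glue_set {p} (D + sg (Some q) (Some p) []) = map_diag \<rho> D"
    using glue_at_strand_tail[of D p q] cob_pts[OF add(2) f] p by (simp add: glue_set_insert \<rho>_def)
  with add show ?case
    by (simp add: glue_lin_linear relabel_linear distrib_right scale_mult_left mult_single del: scale_simps(5))
qed (simp add: glue_lin_linear relabel_linear)
qed

lemma sg_cob: "set w \<subseteq> L \<Longrightarrow> gen (sg (Some t) (Some h) w) \<in> span (cob i L {t} {h})"
  by (simp add: cob_def)

text \<open>For \<open>t = h\<close> the renaming is not injective. The head is first moved to an
  auxiliary point \<open>q\<close>, and an undecorated strand glued at \<open>q\<close> then brings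
  it to \<open>h\<close>; \<open>nul_ideal\<close> covers this second step.\<close>

lemma nul_arc:
  assumes x: "x \<in> nul S \<alpha> {Top (Suc 0)} {Top 0}"
  shows "arc t h x \<in> nul S \<alpha> {t} {h}"
proof -
  have ne: "arc t h x \<in> nul S \<alpha> {t} {h}" if "t \<noteq> h" for t h
    using nul_relabel[OF x, of "arc_to t h"] that by (auto simp: inj_on_def)
  show ?thesis
  proof (cases "t = h")
    case True
    obtain q where q: "q \<noteq> h" by (metis pt.distinct(1))
    have "glue_lin {q} (arc h q x * gen (sg (Some q) (Some h) [])) \<in> nul S \<alpha> {h} {h}"
      by (rule nul_ideal[OF ne sg_cob]) (use q in auto)
    moreover have "glue_lin {q} (arc h q x * gen (sg (Some q) (Some h) [])) = relabel (id(q := h)) (arc h q x)"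
      by (rule glue_lin_strand_head[OF arc_span[OF nul_span[OF x]]]) (use q in auto)
    ultimately show ?thesis using q True relabel_arc[OF nul_span[OF x], of "id(q := h)" h q] by simp
  qed (use ne in auto)
qed

text \<open>By \<open>nul_closed_iff\<close> only the value of a closed combination matters. Inside
  any diagram closed components can thus be traded for numbers, as in
  \<open>closed_mult\<close>.\<close>

lemma closed_scalar:
  assumes "x \<in> span (cob True S {} {})"
  shows "x - scale (eval_lin \<alpha> x) 1 \<in> nul S \<alpha> {} {}"
proof -
  have "(1 :: ('a, 'b) lin) \<in> span (cob True S {} {})"
    using cob_zero[of True S] by simp
  then have "x - scale (eval_lin \<alpha> x) 1 \<in> span (cob True S {} {})"
    using assms by (intro span_diff span_scale)
  then show ?thesis by (simp add: nul_closed_iff eval_lin_linear del: scale_simps(5))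
qed

lemma closed_mult:
  assumes "x \<in> span (cob True S {} {})" "y \<in> span (cob True S T H)" "finite T" "finite H"
  shows "x * y - scale (eval_lin \<alpha> x) y \<in> nul S \<alpha> T H"
  using nul_mult[OF closed_scalar[OF assms(1), of \<alpha>] assms(2)] assms(3,4)
  by (simp add: left_diff_distrib scale_mult_left)

section \<open>The algebra \<open>K\<close>\<close>

locale evaluation_basis =
  fixes S :: "'a set" and \<alpha> :: "('a, 'k::field) evaluation" and vs ws :: "('a, 'k) lin set list"
  assumes vs_spans: "spans (C_alpha S \<alpha>) [] [Pos] vs"
    and dual: "dual_basis S \<alpha> vs ws"
begin

abbreviation "N \<equiv> nul S \<alpha>"
abbreviation "C \<equiv> C_alpha S \<alpha>"
abbreviation "K \<equiv> K_alg S \<alpha> vs ws"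
abbreviation "n \<equiv> length vs"
abbreviation Sp :: "pt set \<Rightarrow> pt set \<Rightarrow> ('a, 'k) lin set" where "Sp T H \<equiv> span (cob True S T H)"
abbreviation A :: "('a, 'k) lin set" where "A \<equiv> Apm S"

definition "V i = rep (vs ! i)"
definition "W i = rep (ws ! i)"

lemma length_ws: "length ws = n"
  using dual by (simp add: dual_basis_def)

lemma V: assumes "i < n" shows V_span: "V i \<in> Sp {} {Top 0}" and cls_V: "cls S \<alpha> [] [Pos] (V i) = vs ! i"
proof -
  have "vs ! i \<in> Arr C [] [Pos]" using vs_spans assms by (auto simp: spans_def)
  from rep_span[OF this] cls_rep[OF this]
  show "V i \<in> Sp {} {Top 0}" "cls S \<alpha> [] [Pos] (V i) = vs ! i"
    by (simp_all add: V_def cobs_eq pts_simps)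
qed

lemma W: assumes "i < n" shows W_span: "W i \<in> Sp {Top 0} {}" and cls_W: "cls S \<alpha> [] [Neg] (W i) = ws ! i"
proof -
  have "ws ! i \<in> Arr C [] [Neg]" using dual assms by (auto simp: dual_basis_def)
  from rep_span[OF this] cls_rep[OF this]
  show "W i \<in> Sp {Top 0} {}" "cls S \<alpha> [] [Neg] (W i) = ws ! i"
    by (simp_all add: W_def cobs_eq pts_simps)
qed

section \<open>The pairing of half-intervals and the expansion in dual bases\<close>

definition pr :: "('a, 'k) lin \<Rightarrow> ('a, 'k) lin \<Rightarrow> 'k" where
  "pr w v = eval_lin \<alpha> (glue_lin {Mid 0} (put (Mid 0) w * put (Mid 0) v))"

lemma pr_linear:
  "pr w 0 = 0" "pr w (v + v') = pr w v + pr w v'" "pr w (scale c v) = c * pr w v"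
  "pr 0 v = 0" "pr (w + w') v = pr w v + pr w' v" "pr (scale c w) v = c * pr w v"
  "pr w (v - v') = pr w v - pr w v'" "pr (w - w') v = pr w v - pr w' v"
  by (simp_all add: pr_def relabel_linear glue_lin_linear eval_lin_linear distrib_left distrib_right
      scale_mult_left scale_mult_right left_diff_distrib right_diff_distrib)

lemma pr_sum: "pr w (\<Sum>i\<in>I. f i) = (\<Sum>i\<in>I. pr w (f i))" "pr (\<Sum>i\<in>I. f i) v = (\<Sum>i\<in>I. pr (f i) v)"
  by (induction I rule: infinite_finite_induct; simp add: pr_linear)+

lemma pr_put [simp]: "pr (put p w) v = pr w v" "pr w (put p v) = pr w v"
  by (simp_all add: pr_def relabel_put)

lemma halves_span: "w \<in> Sp {q} {} \<Longrightarrow> v \<in> Sp {} {q'} \<Longrightarrow> put p w * put p v \<in> Sp {p} {p}"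
  using mult_cob_span[OF put_span_tail put_span_head, of w True S q v q' p p] by simp

lemma eval_glue_halves:
  assumes "w \<in> Sp {q} {}" "v \<in> Sp {} {q'}"
  shows "eval_lin \<alpha> (glue_lin {p} (put p w * put p v)) = pr w v"
proof -
  have "glue_lin ((\<lambda>_. p) ` {Mid 0}) (relabel (\<lambda>_. p) (put (Mid 0) w * put (Mid 0) v))
    = relabel (\<lambda>_. p) (glue_lin {Mid 0} (put (Mid 0) w * put (Mid 0) v))"
    by (rule glue_lin_relabel[OF halves_span[OF assms]]) auto
  then have "glue_lin {p} (put p w * put p v) = relabel (\<lambda>_. p) (glue_lin {Mid 0} (put (Mid 0) w * put (Mid 0) v))"
    by (simp add: relabel_mult relabel_put)
  then show ?thesis by (simp add: pr_def)
qed

lemma eval_glue_halves':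
  assumes "w \<in> Sp {p} {}" "v \<in> Sp {} {p}"
  shows "eval_lin \<alpha> (glue_lin {p} (w * v)) = pr w v"
  using eval_glue_halves[OF assms, of p] assms by (simp add: put_ident[of _ True S])

lemma pr_nul_right: assumes "v \<in> N {} {p}" "w \<in> Sp {q} {}" shows "pr w v = 0"
proof -
  have "put (Mid 0) v \<in> N {} {Mid 0}" using nul_relabel[OF assms(1), of "\<lambda>_. Mid 0"] by simp
  from nul_test[OF this, of "put (Mid 0) w"] put_span_tail[OF assms(2), of "Mid 0"] show ?thesis
    by (simp add: pr_def mult.commute)
qed

lemma pr_nul_left: assumes "w \<in> N {p} {}" "v \<in> Sp {} {q}" shows "pr w v = 0"
proof -
  have "put (Mid 0) w \<in> N {Mid 0} {}" using nul_relabel[OF assms(1), of "\<lambda>_. Mid 0"] by simp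
  from nul_test[OF this, of "put (Mid 0) v"] put_span_head[OF assms(2), of "Mid 0"] show ?thesis
    by (simp add: pr_def)
qed

lemma glue_all_1:
  fixes x :: "('a, 'k) lin"
  assumes "x \<in> span (cob i L {Mid 0} {Mid 0})"
  shows "lin_ext (\<lambda>D. gen (glue_all 1 D)) x = glue_lin {Mid 0} x"
  unfolding glue_lin_def
proof (rule lin_ext_cong)
  fix D assume "D \<in> Poly_Mapping.keys x"
  then have "D \<in> cob i L {Mid 0} {Mid 0}" using assms by auto
  then have "glue_all 1 D = glue_set (Mid ` {..<1}) D"
    using cob_pts(5)[of D i L "{Mid 0}" "{Mid 0}"] by (intro glue_all_eq) auto
  then show "gen (glue_all 1 D) = (gen (glue_set {Mid 0} D) :: ('a, 'k) lin)"
    by (simp add: lessThan_Suc)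
qed

text \<open>This justifies the \<open>THE\<close> in \<open>pairing\<close>: by
  \<open>pr_nul_left\<close> and \<open>pr_nul_right\<close> the value does not depend on the
  representatives.\<close>

lemma pairing_cls:
  assumes w: "w \<in> Sp {Top 0} {}" and v: "v \<in> Sp {} {Top 0}"
  shows "pairing \<alpha> (cls S \<alpha> [] [Neg] w) (cls S \<alpha> [] [Pos] v) = pr w v"
proof -
  have *: "eval_lin \<alpha> (lin_ext (\<lambda>D. gen (glue_all 1 D)) (relabel top_to_mid w' * relabel top_to_mid v')) = pr w v"
    if w': "w' \<in> cls S \<alpha> [] [Neg] w" and v': "v' \<in> cls S \<alpha> [] [Pos] v" for w' v'
  proof -
    have nw: "w' - w \<in> N {Top 0} {}" and nv: "v' - v \<in> N {} {Top 0}"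
      using w' v' by (simp_all add: mem_cls null_eq pts_simps)
    have sw: "w' \<in> Sp {Top 0} {}" using span_add[OF nul_span[OF nw] w] by simp
    have sv: "v' \<in> Sp {} {Top 0}" using span_add[OF nul_span[OF nv] v] by simp
    have "relabel top_to_mid w' = put (Mid 0) w'" "relabel top_to_mid v' = put (Mid 0) v'"
      by (rule relabel_cong[OF sw], auto) (rule relabel_cong[OF sv], auto)
    then have "eval_lin \<alpha> (lin_ext (\<lambda>D. gen (glue_all 1 D)) (relabel top_to_mid w' * relabel top_to_mid v')) = pr w' v'"
      using glue_all_1[OF halves_span[OF sw sv]] by (simp add: pr_def)
    moreover have "pr w' v' = pr w v"
      using pr_nul_left[OF nw sv] pr_nul_right[OF nv w] by (simp add: pr_linear)
    ultimately show ?thesis by simp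
  qed
  show ?thesis unfolding pairing_def
  proof (rule the_equality)
    show "\<exists>w'\<in>cls S \<alpha> [] [Neg] w. \<exists>v'\<in>cls S \<alpha> [] [Pos] v. pr w v
      = eval_lin \<alpha> (lin_ext (\<lambda>D. gen (glue_all 1 D)) (relabel top_to_mid w' * relabel top_to_mid v'))"
      by (intro bexI[OF _ cls_refl]) (rule *[OF cls_refl cls_refl, symmetric])
  qed (use * in blast)
qed

lemma pr_dual: "i < n \<Longrightarrow> j < n \<Longrightarrow> pr (W j) (V i) = (if i = j then 1 else 0)"
  using dual pairing_cls[OF W_span V_span, of j i] cls_V cls_W by (simp add: dual_basis_def)

lemma lincomb_vs:
  assumes "length cs = n"
  shows "lincomb C [] [Pos] cs vs = cls S \<alpha> [] [Pos] (\<Sum>i<n. scale (cs ! i) (V i))"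
proof -
  have "map2 (Scl C [] [Pos]) cs vs = map (\<lambda>i. cls S \<alpha> [] [Pos] (scale (cs ! i) (V i))) [0..<n]"
    by (rule nth_equalityI) (use assms in \<open>auto simp: Scl_C_alpha cls_V[symmetric]\<close>)
  moreover have "scale (cs ! i) (V i) \<in> span (cobs S [] [Pos])" if "i < n" for i
    using span_scale[OF V_span[OF that]] by (simp add: cobs_eq pts_simps)
  ultimately show ?thesis
    using Sum_C_alpha[of "[0..<n]" "\<lambda>i. scale (cs ! i) (V i)" S "[]" "[Pos]" \<alpha>]
    by (simp add: lincomb_def interv_sum_list_conv_sum_set_nat atLeast0LessThan)
qed

text \<open>Some expansion exists because the \<open>vs\<close> span. Pairing it with
  \<open>W j\<close> extracts the \<open>j\<close>-th coefficient by duality, and null combinations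
  do not affect the pairing.\<close>

lemma expand_V:
  assumes v: "v \<in> Sp {} {p}"
  shows "v - (\<Sum>i<n. scale (pr (W i) v) (put p (V i))) \<in> N {} {p}"
proof -
  let ?v = "put (Top 0) v"
  have v0: "?v \<in> Sp {} {Top 0}" by (rule put_span_head[OF v])
  then have "cls S \<alpha> [] [Pos] ?v \<in> Arr C [] [Pos]" by (simp add: Arr_C_alpha cobs_eq pts_simps)
  then obtain cs where cs: "length cs = n" "cls S \<alpha> [] [Pos] ?v = lincomb C [] [Pos] cs vs"
    using vs_spans by (auto simp: spans_def)
  then have nu: "?v - (\<Sum>i<n. scale (cs ! i) (V i)) \<in> N {} {Top 0}"
    by (simp add: lincomb_vs cls_eq_iff null_eq pts_simps)
  have c: "cs ! j = pr (W j) v" if j: "j < n" for j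
  proof -
    have "pr (W j) ?v = (\<Sum>i<n. cs ! i * pr (W j) (V i))"
      using pr_nul_right[OF nu W_span[OF j]] by (simp add: pr_linear pr_sum)
    also have "\<dots> = (\<Sum>i<n. if i = j then cs ! j else 0)"
      by (rule sum.cong) (use j in \<open>auto simp: pr_dual\<close>)
    finally show ?thesis using j by simp
  qed
  have "relabel (\<lambda>_. p) (?v - (\<Sum>i<n. scale (cs ! i) (V i))) \<in> N {} {p}"
    using nul_relabel[OF nu, of "\<lambda>_. p"] by simp
  also have "relabel (\<lambda>_. p) (?v - (\<Sum>i<n. scale (cs ! i) (V i))) = v - (\<Sum>i<n. scale (pr (W i) v) (put p (V i)))"
    using put_ident(1)[OF v] c by (simp add: relabel_linear relabel_sum relabel_put)
  finally show ?thesis .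
qed

text \<open>A representative of \<open>1 - (\<Sum>i. v\<^sup>i \<otimes> v\<^sub>i)\<close>;
  \<open>K_one_eq\<close> identifies its class with the unit of \<open>K\<close>.\<close>

definition oneL :: "('a, 'k) lin" where
  "oneL = gen (sg (Some (Top (Suc 0))) (Some (Top 0)) []) - (\<Sum>i<n. V i * put (Top (Suc 0)) (W i))"

lemma VW_span: "i < n \<Longrightarrow> put h (V i) * put t (W i) \<in> Sp {t} {h}"
  using mult_cob_span[OF put_span_head[OF V_span] put_span_tail[OF W_span], of i i t h] by simp

lemma put_V: "i < n \<Longrightarrow> put (Top 0) (V i) = V i"
  by (rule put_ident(1)[OF V_span])

lemma oneL_A: "oneL \<in> A"
  unfolding oneL_def using VW_span[of _ "Top 0" "Top (Suc 0)"] put_V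
  by (intro span_diff span_sum sg_cob) auto

lemma arc_oneL: "arc t h oneL = gen (sg (Some t) (Some h) []) - (\<Sum>i<n. put h (V i) * put t (W i))"
proof -
  have "relabel (arc_to t h) (V i) = put h (V i)" if "i < n" for i
    by (rule relabel_cong[OF V_span[OF that]]) auto
  moreover have "relabel (arc_to t h) (put (Top (Suc 0)) (W i)) = put t (W i)" for i
    by (simp add: relabel_put)
  ultimately show ?thesis
    by (simp add: oneL_def relabel_linear relabel_sum relabel_mult del: One_nat_def)
qed

lemma K_one_eq: "K_one S \<alpha> vs ws = cls S \<alpha> [] [Pos, Neg] oneL"
proof -
  let ?u = "\<lambda>i. V i * put (Top (Suc 0)) (W i)"
  have t: "tensor S \<alpha> [] [Pos] [] [Neg] (vs ! i) (ws ! i) = cls S \<alpha> [] [Pos, Neg] (?u i)"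
    and u: "?u i \<in> span (cobs S [] [Pos, Neg])" if i: "i < n" for i
  proof -
    have "relabel (shift 0 (Suc 0)) (W i) = put (Top (Suc 0)) (W i)"
      by (rule relabel_cong[OF W_span[OF i]]) auto
    then show "tensor S \<alpha> [] [Pos] [] [Neg] (vs ! i) (ws ! i) = cls S \<alpha> [] [Pos, Neg] (?u i)"
      using tensor_cls[of "V i" S "[]" "[Pos]" "W i" "[]" "[Neg]" \<alpha>] V_span[OF i] W_span[OF i] cls_V[OF i] cls_W[OF i]
      by (simp add: cobs_eq pts_simps)
    show "?u i \<in> span (cobs S [] [Pos, Neg])"
      using VW_span[OF i, of "Top 0" "Top (Suc 0)"] put_V[OF i] by (simp add: cobs_eq pts_simps)
  qed
  have "map2 (tensor S \<alpha> [] [Pos] [] [Neg]) vs ws = map (\<lambda>i. cls S \<alpha> [] [Pos, Neg] (?u i)) [0..<n]"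
    by (rule nth_equalityI) (use length_ws t in auto)
  then have s: "Sum C [] [Pos, Neg] (map2 (tensor S \<alpha> [] [Pos] [] [Neg]) vs ws)
      = cls S \<alpha> [] [Pos, Neg] (\<Sum>i<n. ?u i)"
    using u Sum_C_alpha[of "[0..<n]" ?u S "[]" "[Pos, Neg]" \<alpha>]
    by (simp add: interv_sum_list_conv_sum_set_nat atLeast0LessThan)
  have us: "(\<Sum>i<n. ?u i) \<in> span (cobs S [] [Pos, Neg])" by (intro span_sum u) auto
  have g: "gen (sg (Some (Top (Suc 0))) (Some (Top 0)) []) \<in> span (cobs S [] [Pos, Neg])"
    using sg_cob[of "[]" S "Top (Suc 0)" "Top 0" True] by (simp add: cobs_eq pts_simps)
  show ?thesis
    unfolding K_one_def s Scl_C_alpha one_arc_def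
    using Add_C_alpha[OF g span_scale[OF us], of \<alpha> "- 1"]
    by (simp add: oneL_def scale_uminus)
qed

text \<open>The representatives of the elements of the ideal \<open>K\<close>, see
  \<open>clA_K_iff\<close>. Acting on \<open>A(+)\<close> means gluing the head of a half-interval
  to the tail of the arc.\<close>

definition KK :: "('a, 'k) lin set" where
  "KK = {f \<in> A. \<forall>v\<in>Sp {} {Mid 0}. glue_lin {Mid 0} (v * arc (Mid 0) (Top 0) f) \<in> N {} {Top 0}}"

abbreviation "clA \<equiv> cls S \<alpha> [] [Pos, Neg]"

lemma Arr_A: "Arr C [] [Pos, Neg] = clA ` A"
  by (simp add: Arr_C_alpha cobs_eq pts_simps)

lemma end_plus_clA: "end_plus S \<alpha> (clA f) = cls S \<alpha> [Pos] [Pos] (arc (Bot 0) (Top 0) f)"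
  unfolding end_plus_def by (rule bend_cls) (auto simp: pts_simps inj_on_def)

lemma clA_K_iff:
  assumes f: "f \<in> A"
  shows "clA f \<in> K_carrier S \<alpha> \<longleftrightarrow> f \<in> KK"
proof -
  have st: "stack_lin (Suc 0) (arc (Bot 0) (Top 0) f) v = glue_lin {Mid 0} (put (Mid 0) v * arc (Mid 0) (Top 0) f)"
    if v: "v \<in> Sp {} {Top 0}" for v
  proof -
    have "stack_lin (length [Pos]) (arc (Bot 0) (Top 0) f) v
       = glue_lin (Mid ` {..<length [Pos]}) (relabel (relab Bot Mid) v * relabel (relab Mid Top) (arc (Bot 0) (Top 0) f))"
      by (rule stack_lin_eq[of _ True S "[]" "[Pos]" _ "[Pos]"])
        (use v arc_span[OF f, of "Bot 0" "Top 0"] in \<open>simp_all add: pts_simps\<close>)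
    moreover have "relabel (relab Bot Mid) v = put (Mid 0) v"
      by (rule relabel_cong[OF v]) auto
    ultimately show ?thesis using relabel_arc[OF f] by (simp add: lessThan_Suc)
  qed
  have "clA f \<in> K_carrier S \<alpha> \<longleftrightarrow> (\<forall>v\<in>Sp {} {Top 0}. stack_lin (Suc 0) (arc (Bot 0) (Top 0) f) v \<in> N {} {Top 0})"
  proof -
    have "Cmp C [] [Pos] [Pos] (end_plus S \<alpha> (clA f)) (cls S \<alpha> [] [Pos] v) = Zer C [] [Pos] \<longleftrightarrow>
      stack_lin (Suc 0) (arc (Bot 0) (Top 0) f) v \<in> N {} {Top 0}" if v: "v \<in> Sp {} {Top 0}" for v
      unfolding end_plus_clA
      using Cmp_C_alpha[of v S "[]" "[Pos]" "arc (Bot 0) (Top 0) f" "[Pos]" \<alpha>] v arc_span[OF f, of "Bot 0" "Top 0"]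
      by (simp add: cobs_eq pts_simps Zer_C_alpha cls_eq_iff null_eq)
    then show ?thesis using f unfolding K_carrier_def Arr_A
      by (simp add: Arr_C_alpha cobs_eq pts_simps)
  qed
  also have "\<dots> \<longleftrightarrow> (\<forall>v\<in>Sp {} {Mid 0}. glue_lin {Mid 0} (v * arc (Mid 0) (Top 0) f) \<in> N {} {Top 0})"
  proof (intro iffI ballI)
    fix v assume *: "\<forall>v\<in>Sp {} {Top 0}. stack_lin (Suc 0) (arc (Bot 0) (Top 0) f) v \<in> N {} {Top 0}"
      and v: "v \<in> Sp {} {Mid 0}"
    have v': "put (Top 0) v \<in> Sp {} {Top 0}" by (rule put_span_head[OF v])
    show "glue_lin {Mid 0} (v * arc (Mid 0) (Top 0) f) \<in> N {} {Top 0}"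
      using bspec[OF * v'] st[OF v'] put_ident(1)[OF v] by (simp add: relabel_put)
  next
    fix v assume *: "\<forall>v\<in>Sp {} {Mid 0}. glue_lin {Mid 0} (v * arc (Mid 0) (Top 0) f) \<in> N {} {Top 0}"
      and v: "v \<in> Sp {} {Top 0}"
    show "stack_lin (Suc 0) (arc (Bot 0) (Top 0) f) v \<in> N {} {Top 0}"
      using bspec[OF * put_span_head[OF v]] st[OF v] by simp
  qed
  finally show ?thesis using f by (simp add: KK_def)
qed

lemma KK_A: "f \<in> KK \<Longrightarrow> f \<in> A"
  by (simp add: KK_def)

lemma K_carrier_eq: "carrier K = clA ` KK"
proof -
  have "K_carrier S \<alpha> \<subseteq> clA ` A" unfolding K_carrier_def Arr_A by blast
  then show ?thesis using clA_K_iff KK_A by (auto simp: K_alg_def)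
qed

lemma kill_tail:
  assumes f: "f \<in> KK" and v: "v \<in> Sp {} {p}" and p: "p \<noteq> h"
  shows "glue_lin {p} (v * arc p h f) \<in> N {} {h}"
proof -
  have v': "put (Mid 0) v \<in> Sp {} {Mid 0}" by (rule put_span_head[OF v])
  let ?x = "put (Mid 0) v * arc (Mid 0) (Top 0) f" and ?\<rho> = "\<lambda>q. if q = Mid 0 then p else h"
  have x: "?x \<in> Sp {Mid 0} {Mid 0, Top 0}"
    using mult_cob_span[OF v' arc_span[OF KK_A[OF f]], of "Mid 0" "Top 0"] by (simp add: insert_commute)
  have "relabel ?\<rho> (glue_lin {Mid 0} ?x) \<in> N (?\<rho> ` {}) (?\<rho> ` {Top 0})"
    by (rule nul_relabel) (use f v' in \<open>auto simp: KK_def\<close>)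
  moreover have "glue_lin (?\<rho> ` {Mid 0}) (relabel ?\<rho> ?x) = relabel ?\<rho> (glue_lin {Mid 0} ?x)"
    by (rule glue_lin_relabel[OF x]) (use p in auto)
  ultimately show ?thesis
    using relabel_arc[OF KK_A[OF f], of ?\<rho> "Mid 0" "Top 0"] put_ident(1)[OF v]
    by (simp add: relabel_mult relabel_put)
qed

text \<open>\<open>KK\<close> is defined through the action on \<open>A(+)\<close>, but its elements
  annihilate \<open>A(-)\<close> as well: testing \<open>w\<close> glued to the head of
  \<open>f\<close> against \<open>y\<close> produces the same closed picture as testing
  \<open>y\<close> glued to the tail of \<open>f\<close> against \<open>w\<close>, and the latter
  vanishes by \<open>kill_tail\<close>.\<close>

lemma kill_head:
  assumes f: "f \<in> KK" and w: "w \<in> Sp {p} {}" and p: "p \<noteq> t"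
  shows "glue_lin {p} (w * arc t p f) \<in> N {t} {}"
proof -
  note f' = arc_span[OF KK_A[OF f]]
  have wf: "w * arc t p f \<in> Sp {p, t} {p}"
    using mult_cob_span[OF w f'[of t p]] p by (simp add: insert_commute)
  have g: "glue_lin {p} (w * arc t p f) \<in> Sp {t} {}"
    using glue_lin_span[OF wf, of "{p}"] p by (simp add: insert_Diff_if)
  have "eval_lin \<alpha> (glue_lin ({t} \<union> {}) (glue_lin {p} (w * arc t p f) * gen y)) = 0"
    if y: "y \<in> cob True S ({} - {t}) ({t} - {})" for y
  proof -
    have y': "gen y \<in> Sp {} {t}" using y by simp
    have "glue_lin {t} (glue_lin {p} (w * arc t p f) * gen y) = glue_lin {t} (glue_lin {p} (w * arc t p f * gen y))"
      by (subst glue_lin_mult[OF y']) (use p in auto)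
    also have "\<dots> = glue_lin ({p} \<union> {t}) (gen y * arc t p f * w)"
      using p by (subst Un_commute, subst glue_lin_Un) (auto simp: mult_ac)
    also have "\<dots> = glue_lin {p} (glue_lin {t} (gen y * arc t p f * w))"
      by (rule glue_lin_Un) (use p in auto)
    also have "glue_lin {t} (gen y * arc t p f * w) = glue_lin {t} (gen y * arc t p f) * w"
      by (rule glue_lin_mult[OF w]) (use p in auto)
    finally have "glue_lin {t} (glue_lin {p} (w * arc t p f) * gen y)
      = glue_lin {p} (glue_lin {t} (gen y * arc t p f) * w)" .
    moreover have "eval_lin \<alpha> (glue_lin ({} \<union> {p}) (glue_lin {t} (gen y * arc t p f) * w)) = 0"
      by (rule nul_test[OF kill_tail[OF f y']]) (use w p in auto)
    ultimately show ?thesis by simp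
  qed
  then show ?thesis using g by (simp add: nul_def)
qed

lemma put_strand_tail: "v \<in> Sp {} {p} \<Longrightarrow> p \<noteq> h \<Longrightarrow> glue_lin {p} (v * gen (sg (Some p) (Some h) [])) = put h v"
  using glue_lin_strand_head[of v True S "{}" "{p}" p h] relabel_cong[of v True S "{}" "{p}" "id(p := h)" "\<lambda>_. h"]
  by auto

text \<open>Acting on \<open>v\<close>, the undecorated arc returns \<open>v\<close> and the pairs
  of half-intervals subtract its expansion in the dual bases, so the result is null by
  \<open>expand_V\<close>.\<close>

lemma oneL_KK: "oneL \<in> KK"
proof -
  have "glue_lin {Mid 0} (v * arc (Mid 0) (Top 0) oneL) \<in> N {} {Top 0}" if v: "v \<in> Sp {} {Mid 0}" for v
  proof -
    have 1: "glue_lin {Mid 0} (v * (put (Top 0) (V i) * put (Mid 0) (W i)))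
        = glue_lin {Mid 0} (put (Mid 0) (W i) * v) * put (Top 0) (V i)" if i: "i < n" for i
    proof -
      have "glue_lin {Mid 0} ((put (Mid 0) (W i) * v) * put (Top 0) (V i))
         = glue_lin {Mid 0} (put (Mid 0) (W i) * v) * put (Top 0) (V i)"
        by (rule glue_lin_mult[OF put_span_head[OF V_span[OF i]]]) auto
      then show ?thesis by (simp add: mult_ac)
    qed
    have 2: "glue_lin {Mid 0} (put (Mid 0) (W i) * v) * put (Top 0) (V i) - scale (pr (W i) v) (put (Top 0) (V i))
        \<in> N {} {Top 0}" if i: "i < n" for i
    proof -
      have w: "put (Mid 0) (W i) \<in> Sp {Mid 0} {}" by (rule put_span_tail[OF W_span[OF i]])
      have "put (Mid 0) (W i) * v \<in> Sp {Mid 0} {Mid 0}" using mult_cob_span[OF w v] by simp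
      then have "glue_lin {Mid 0} (put (Mid 0) (W i) * v) \<in> Sp {} {}"
        using glue_lin_span[of _ True S "{Mid 0}" "{Mid 0}" "{Mid 0}"] by simp
      from closed_mult[OF this put_span_head[OF V_span[OF i]], of "Top 0" \<alpha>] eval_glue_halves'[OF w v]
      show ?thesis by simp
    qed
    have "glue_lin {Mid 0} (v * arc (Mid 0) (Top 0) oneL)
      = put (Top 0) v - (\<Sum>i<n. glue_lin {Mid 0} (put (Mid 0) (W i) * v) * put (Top 0) (V i))"
      using 1 by (simp add: arc_oneL right_diff_distrib sum_distrib_left glue_lin_linear glue_lin_sum put_strand_tail[OF v])
    also have "\<dots> = (put (Top 0) v - (\<Sum>i<n. scale (pr (W i) (put (Top 0) v)) (put (Top 0) (V i))))
      - (\<Sum>i<n. glue_lin {Mid 0} (put (Mid 0) (W i) * v) * put (Top 0) (V i) - scale (pr (W i) v) (put (Top 0) (V i)))"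
      by (simp add: sum_subtractf)
    also have "\<dots> \<in> N {} {Top 0}"
      by (intro nul_diff nul_sum expand_V put_span_head[OF v] 2) auto
    finally show ?thesis .
  qed
  then show ?thesis using oneL_A by (simp add: KK_def)
qed

text \<open>Composition in the endomorphisms of \<open>+\<close>, transported to
  \<open>A(+-)\<close>: the head of \<open>g\<close> is joined to the tail of
  \<open>f\<close>.\<close>

definition mulL :: "('a, 'k) lin \<Rightarrow> ('a, 'k) lin \<Rightarrow> ('a, 'k) lin" where
  "mulL f g = glue_lin {Mid 0} (arc (Mid 0) (Top 0) f * arc (Top (Suc 0)) (Mid 0) g)"

lemma mulL_linear:
  "mulL (f + f') g = mulL f g + mulL f' g" "mulL f (g + g') = mulL f g + mulL f g'"
  "mulL (f - f') g = mulL f g - mulL f' g" "mulL f (g - g') = mulL f g - mulL f g'"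
  "mulL (scale c f) g = scale c (mulL f g)" "mulL f (scale c g) = scale c (mulL f g)"
  by (simp_all add: mulL_def relabel_linear glue_lin_linear distrib_left distrib_right
      scale_mult_left scale_mult_right left_diff_distrib right_diff_distrib)

lemma arc_arc_span:
  assumes "f \<in> A" "g \<in> A" "p \<noteq> t" "p \<noteq> h"
  shows "arc p h f * arc t p g \<in> Sp {p, t} {h, p}"
  using mult_cob_span[OF arc_span[OF assms(1)] arc_span[OF assms(2)], of p t h p] assms(3,4) by (simp add: insert_commute)

lemma mulL_A: "f \<in> A \<Longrightarrow> g \<in> A \<Longrightarrow> mulL f g \<in> A"
proof -
  assume "f \<in> A" "g \<in> A"
  from glue_lin_span[OF arc_arc_span[OF this, of "Mid 0" "Top (Suc 0)" "Top 0"], of "{Mid 0}"]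
  show ?thesis by (simp add: mulL_def insert_Diff_if)
qed

text \<open>The auxiliary point disappears in the product, so it may be any \<open>p\<close> other
  than the final ends. This is what allows products to be nested.\<close>

lemma arc_mulL:
  assumes f: "f \<in> A" and g: "g \<in> A" and p: "p \<noteq> t" "p \<noteq> h"
  shows "arc t h (mulL f g) = glue_lin {p} (arc p h f * arc t p g)"
proof -
  let ?\<rho> = "\<lambda>q. if q = Mid 0 then p else arc_to t h q"
  let ?x = "arc (Mid 0) (Top 0) f * arc (Top (Suc 0)) (Mid 0) g"
  have "glue_lin (?\<rho> ` {Mid 0}) (relabel ?\<rho> ?x) = relabel ?\<rho> (glue_lin {Mid 0} ?x)"
    by (rule glue_lin_relabel[OF arc_arc_span[OF f g, of "Mid 0" "Top (Suc 0)" "Top 0"]]) (use p in auto)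
  moreover have "relabel ?\<rho> (mulL f g) = arc t h (mulL f g)"
    by (rule relabel_cong[OF mulL_A[OF f g]]) auto
  moreover have "relabel ?\<rho> ?x = arc p h f * arc t p g"
    by (simp add: relabel_mult relabel_arc[OF f] relabel_arc[OF g])
  ultimately show ?thesis by (simp add: mulL_def)
qed

definition eqv :: "('a, 'k) lin \<Rightarrow> ('a, 'k) lin \<Rightarrow> bool" (infix "\<approx>" 50) where
  "f \<approx> g \<longleftrightarrow> f - g \<in> N {Top (Suc 0)} {Top 0}"

lemma eqv_refl [simp]: "f \<approx> f" by (simp add: eqv_def)
lemma eqv_sym: "f \<approx> g \<Longrightarrow> g \<approx> f" unfolding eqv_def by (rule nul_sym)
lemma eqv_trans [trans]: "f \<approx> g \<Longrightarrow> g \<approx> h \<Longrightarrow> f \<approx> h" unfolding eqv_def by (rule nul_trans)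
lemma eqv_eq_trans [trans]: "f \<approx> g \<Longrightarrow> g = h \<Longrightarrow> f \<approx> h" "f = g \<Longrightarrow> g \<approx> h \<Longrightarrow> f \<approx> h" by simp_all

lemma eqv_iff: "f \<approx> g \<longleftrightarrow> clA f = clA g"
  by (simp add: eqv_def cls_eq_iff null_eq pts_simps)

lemma eqv_A: "f \<approx> g \<Longrightarrow> g \<in> A \<Longrightarrow> f \<in> A"
  unfolding eqv_def using span_add[OF nul_span, of "f - g"] by fastforce

lemma mulL_cong:
  assumes "f \<approx> f'" "g \<approx> g'" "f' \<in> A" "g' \<in> A"
  shows "mulL f g \<approx> mulL f' g'"
proof -
  have g: "g \<in> A" using eqv_A assms by blast
  have "glue_lin {Mid 0} (arc (Mid 0) (Top 0) (f - f') * arc (Top (Suc 0)) (Mid 0) g) \<in> N {Top (Suc 0)} {Top 0}"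
    by (rule nul_ideal[OF nul_arc arc_span]) (use assms g in \<open>auto simp: eqv_def\<close>)
  moreover have "glue_lin {Mid 0} (arc (Top (Suc 0)) (Mid 0) (g - g') * arc (Mid 0) (Top 0) f') \<in> N {Top (Suc 0)} {Top 0}"
    by (rule nul_ideal[OF nul_arc arc_span]) (use assms in \<open>auto simp: eqv_def\<close>)
  ultimately have "mulL (f - f') g + mulL f' (g - g') \<in> N {Top (Suc 0)} {Top 0}"
    unfolding mulL_def by (intro nul_add) (simp_all add: mult.commute)
  then show ?thesis by (simp add: eqv_def mulL_linear)
qed

text \<open>\<open>mulL\<close> always glues at \<open>Mid 0\<close>, so the inner product is first
  moved to a second point \<open>?q\<close> by \<open>arc_mulL\<close>. Both sides are then one
  gluing of three arcs at two points.\<close>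

lemma mulL_assoc:
  assumes "f \<in> A" "g \<in> A" "k \<in> A"
  shows "mulL (mulL f g) k = mulL f (mulL g k)"
proof -
  let ?q = "Mid (Suc 0)"
  have "mulL (mulL f g) k = glue_lin {Mid 0} (glue_lin {?q} (arc ?q (Top 0) f * arc (Mid 0) ?q g) * arc (Top (Suc 0)) (Mid 0) k)"
    unfolding mulL_def[of "mulL f g"] by (subst arc_mulL[OF assms(1,2), of ?q]) auto
  also have "\<dots> = glue_lin {Mid 0} (glue_lin {?q} (arc ?q (Top 0) f * arc (Mid 0) ?q g * arc (Top (Suc 0)) (Mid 0) k))"
    by (subst glue_lin_mult[OF arc_span[OF assms(3)]]) auto
  also have "\<dots> = glue_lin ({?q} \<union> {Mid 0}) (arc ?q (Top 0) f * (arc (Mid 0) ?q g * arc (Top (Suc 0)) (Mid 0) k))"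
    by (subst Un_commute, subst glue_lin_Un) (auto simp: mult.assoc)
  also have "\<dots> = glue_lin {?q} (glue_lin {Mid 0} (arc ?q (Top 0) f * (arc (Mid 0) ?q g * arc (Top (Suc 0)) (Mid 0) k)))"
    by (rule glue_lin_Un) auto
  also have "\<dots> = glue_lin {?q} (arc ?q (Top 0) f * glue_lin {Mid 0} (arc (Mid 0) ?q g * arc (Top (Suc 0)) (Mid 0) k))"
    by (subst glue_lin_mult2[OF arc_span[OF assms(1)]]) auto
  also have "\<dots> = glue_lin {?q} (arc ?q (Top 0) f * arc (Top (Suc 0)) ?q (mulL g k))"
    by (subst arc_mulL[OF assms(2,3), of "Mid 0" "Top (Suc 0)" ?q]) auto
  also have "\<dots> = mulL f (mulL g k)"
    using arc_mulL[OF assms(1) mulL_A[OF assms(2,3)], of ?q "Top (Suc 0)" "Top 0"]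
      arc_ident[OF mulL_A[OF assms(1) mulL_A[OF assms(2,3)]]] by simp
  finally show ?thesis .
qed

text \<open>The undecorated arc in \<open>oneL\<close> acts as the identity, and the terms with
  half-intervals vanish because \<open>g\<close> annihilates \<open>A(-)\<close>; in
  \<open>mulL_one_right\<close> it is the action on \<open>A(+)\<close> that makes them
  vanish.\<close>

lemma mulL_one_left:
  assumes g: "g \<in> KK" shows "mulL oneL g \<approx> g"
proof -
  note gA = KK_A[OF g]
  have 1: "glue_lin {Mid 0} (put (Top 0) (V i) * put (Mid 0) (W i) * arc (Top (Suc 0)) (Mid 0) g)
     \<in> N {Top (Suc 0)} {Top 0}" if i: "i < n" for i
  proof -
    have "glue_lin {Mid 0} (put (Top 0) (V i) * (put (Mid 0) (W i) * arc (Top (Suc 0)) (Mid 0) g))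
      = glue_lin {Mid 0} (put (Mid 0) (W i) * arc (Top (Suc 0)) (Mid 0) g) * put (Top 0) (V i)"
      by (subst glue_lin_mult2[OF put_span_head[OF V_span[OF i]]]) (auto simp: mult.commute)
    moreover have "\<dots> \<in> N ({Top (Suc 0)} \<union> {}) ({} \<union> {Top 0})"
      by (rule nul_mult[OF kill_head[OF g put_span_tail[OF W_span[OF i]]] put_span_head[OF V_span[OF i]]]) auto
    ultimately show ?thesis by (simp add: mult.assoc)
  qed
  have "glue_lin {Mid 0} (arc (Top (Suc 0)) (Mid 0) g * gen (sg (Some (Mid 0)) (Some (Top 0)) []))
     = relabel (id(Mid 0 := Top 0)) (arc (Top (Suc 0)) (Mid 0) g)"
    by (rule glue_lin_strand_head[OF arc_span[OF gA]]) auto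
  also have "\<dots> = g" using relabel_arc[OF gA, of "id(Mid 0 := Top 0)"] arc_ident[OF gA] by simp
  finally have "mulL oneL g - g = - (\<Sum>i<n. glue_lin {Mid 0} (put (Top 0) (V i) * put (Mid 0) (W i) * arc (Top (Suc 0)) (Mid 0) g))"
    unfolding mulL_def arc_oneL mult.commute[of _ "arc (Top (Suc 0)) (Mid 0) g"]
    by (simp add: right_diff_distrib sum_distrib_left glue_lin_linear glue_lin_sum)
  then show ?thesis unfolding eqv_def using 1 by (auto intro!: nul_uminus nul_sum)
qed

text \<open>An exact identity on all of \<open>A\<close>. For \<open>g\<close> in \<open>KK\<close>
  the correction terms are null, which gives the right unit law; for an arc with an arbitrary word
  they are the pairs of half-intervals in \<open>good_arc\<close>.\<close>

lemma mulL_oneL: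
  assumes g: "g \<in> A"
  shows "mulL g oneL = g - (\<Sum>i<n. glue_lin {Mid 0} (put (Mid 0) (V i) * arc (Mid 0) (Top 0) g) * put (Top (Suc 0)) (W i))"
proof -
  have 1: "glue_lin {Mid 0} (arc (Mid 0) (Top 0) g * (put (Mid 0) (V i) * put (Top (Suc 0)) (W i)))
     = glue_lin {Mid 0} (put (Mid 0) (V i) * arc (Mid 0) (Top 0) g) * put (Top (Suc 0)) (W i)" if i: "i < n" for i
  proof -
    have "glue_lin {Mid 0} ((put (Mid 0) (V i) * arc (Mid 0) (Top 0) g) * put (Top (Suc 0)) (W i))
      = glue_lin {Mid 0} (put (Mid 0) (V i) * arc (Mid 0) (Top 0) g) * put (Top (Suc 0)) (W i)"
      by (rule glue_lin_mult[OF put_span_tail[OF W_span[OF i]]]) auto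
    then show ?thesis by (simp add: mult_ac)
  qed
  have "glue_lin {Mid 0} (arc (Mid 0) (Top 0) g * gen (sg (Some (Top (Suc 0))) (Some (Mid 0)) []))
     = relabel (id(Mid 0 := Top (Suc 0))) (arc (Mid 0) (Top 0) g)"
    by (rule glue_lin_strand_tail[OF arc_span[OF g]]) auto
  also have "\<dots> = g" using relabel_arc[OF g, of "id(Mid 0 := Top (Suc 0))"] arc_ident[OF g] by simp
  finally show ?thesis using 1
    by (simp add: mulL_def arc_oneL right_diff_distrib sum_distrib_left glue_lin_linear glue_lin_sum)
qed

lemma mulL_one_right:
  assumes g: "g \<in> KK" shows "mulL g oneL \<approx> g"
proof -
  have "glue_lin {Mid 0} (put (Mid 0) (V i) * arc (Mid 0) (Top 0) g) * put (Top (Suc 0)) (W i)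
     \<in> N ({} \<union> {Top (Suc 0)}) ({Top 0} \<union> {})" if i: "i < n" for i
    by (rule nul_mult[OF kill_tail[OF g put_span_head[OF V_span[OF i]]] put_span_tail[OF W_span[OF i]]]) auto
  then show ?thesis
    unfolding eqv_def mulL_oneL[OF KK_A[OF g]] by (auto intro!: nul_uminus nul_sum)
qed

lemma KK_add: "f \<in> KK \<Longrightarrow> g \<in> KK \<Longrightarrow> f + g \<in> KK"
  using span_add[of f _ g] by (simp add: KK_def relabel_linear distrib_left glue_lin_linear nul_add)

lemma KK_scale: "f \<in> KK \<Longrightarrow> scale c f \<in> KK"
  using span_scale[of f _ c] by (simp add: KK_def relabel_linear scale_mult_right glue_lin_linear nul_scale)

text \<open>\<open>mulL f g\<close> acts on a half-interval first by \<open>g\<close>, and the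
  outcome of that is already null.\<close>

lemma KK_mulL_left:
  assumes f: "f \<in> A" and g: "g \<in> KK"
  shows "mulL f g \<in> KK"
proof -
  note gA = KK_A[OF g]
  let ?q = "Mid (Suc 0)"
  have "glue_lin {Mid 0} (v * arc (Mid 0) (Top 0) (mulL f g)) \<in> N {} {Top 0}" if v: "v \<in> Sp {} {Mid 0}" for v
  proof -
    have "glue_lin {Mid 0} (v * arc (Mid 0) (Top 0) (mulL f g))
      = glue_lin {Mid 0} (v * glue_lin {?q} (arc ?q (Top 0) f * arc (Mid 0) ?q g))"
      by (subst arc_mulL[OF f gA, of ?q]) auto
    also have "\<dots> = glue_lin {Mid 0} (glue_lin {?q} (v * (arc ?q (Top 0) f * arc (Mid 0) ?q g)))"
      by (subst glue_lin_mult2[OF v]) auto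
    also have "\<dots> = glue_lin ({?q} \<union> {Mid 0}) ((v * arc (Mid 0) ?q g) * arc ?q (Top 0) f)"
      by (subst Un_commute, subst glue_lin_Un) (auto simp: mult_ac)
    also have "\<dots> = glue_lin {?q} (glue_lin {Mid 0} ((v * arc (Mid 0) ?q g) * arc ?q (Top 0) f))"
      by (rule glue_lin_Un) auto
    also have "\<dots> = glue_lin {?q} (glue_lin {Mid 0} (v * arc (Mid 0) ?q g) * arc ?q (Top 0) f)"
      by (subst glue_lin_mult[OF arc_span[OF f]]) auto
    also have "\<dots> \<in> N {} {Top 0}"
      by (rule nul_ideal[OF kill_tail[OF g v] arc_span[OF f]]) auto
    finally show ?thesis .
  qed
  then show ?thesis using mulL_A[OF f gA] by (simp add: KK_def)
qed

lemma KK_cong: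
  assumes "f \<approx> g" "g \<in> KK" shows "f \<in> KK"
  using clA_K_iff[of f] clA_K_iff[of g] eqv_A[OF assms(1)] KK_A[OF assms(2)] assms by (simp add: eqv_iff)

text \<open>The product of \<open>K\<close> is bending, stacking and bending back. In terms of named
  points the three renamings collapse into a single gluing.\<close>

lemma mult_K: "f \<in> A \<Longrightarrow> g \<in> A \<Longrightarrow> clA f \<otimes>\<^bsub>K\<^esub> clA g = clA (mulL f g)"
proof -
  assume f: "f \<in> A" and g: "g \<in> A"
  let ?\<rho> = "\<lambda>p. if p = Bot 0 then Top (Suc 0) else p"
  let ?f = "arc (Bot 0) (Top 0) f" and ?g = "arc (Bot 0) (Top 0) g"
  have sf: "?f \<in> span (cob True S (tail_pts [Pos] [Pos]) (head_pts [Pos] [Pos]))"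
    and sg: "?g \<in> span (cob True S (tail_pts [Pos] [Pos]) (head_pts [Pos] [Pos]))"
    using arc_span f g by (simp_all add: pts_simps)
  have "clA f \<otimes>\<^bsub>K\<^esub> clA g = from_end_plus S \<alpha> (cls S \<alpha> [Pos] [Pos] (stack_lin (length [Pos]) ?f ?g))"
    unfolding K_alg_def using sf sg by (simp add: end_plus_clA Cmp_C_alpha cobs_eq)
  also have "\<dots> = clA (relabel ?\<rho> (stack_lin (length [Pos]) ?f ?g))"
    unfolding from_end_plus_def One_nat_def by (rule bend_cls) (auto simp: pts_simps inj_on_def)
  also have "relabel ?\<rho> (stack_lin (length [Pos]) ?f ?g) = relabel (relab (\<lambda>_. Top (Suc 0)) Top) (stack_lin (length [Pos]) ?f ?g)"
    by (rule relabel_cong[OF stack_lin_span[OF sg sf]]) (auto simp: pts_simps)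
  also have "\<dots> = glue_lin (Mid ` {..<length [Pos]}) (relabel (relab (\<lambda>_. Top (Suc 0)) Mid) ?g * relabel (relab Mid Top) ?f)"
    by (rule stack_lin_relabel[OF sg sf]) (auto simp: inj_on_def)
  also have "\<dots> = mulL f g"
    by (simp add: mulL_def lessThan_Suc relabel_arc[OF f] relabel_arc[OF g] mult.commute)
  finally show ?thesis .
qed

lemma add_K: "f \<in> A \<Longrightarrow> g \<in> A \<Longrightarrow> clA f \<oplus>\<^bsub>K\<^esub> clA g = clA (f + g)"
  using Add_C_alpha[of f S "[]" "[Pos, Neg]" g \<alpha>] by (simp add: K_alg_def cobs_eq pts_simps)

lemma smult_K: "c \<odot>\<^bsub>K\<^esub> clA f = clA (scale c f)"
  by (simp add: K_alg_def Scl_C_alpha)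

lemma one_K: "\<one>\<^bsub>K\<^esub> = clA oneL"
  by (simp add: K_alg_def K_one_eq)

section \<open>The circular closure as a symmetric trace\<close>

definition trL :: "('a, 'k) lin \<Rightarrow> 'k" where
  "trL f = eval_lin \<alpha> (glue_lin {Mid 0} (arc (Mid 0) (Mid 0) f))"

lemma trL_linear:
  "trL (f + g) = trL f + trL g" "trL (f - g) = trL f - trL g" "trL (scale c f) = c * trL f" "trL 0 = 0"
  by (simp_all add: trL_def relabel_linear glue_lin_linear eval_lin_linear)

lemma trL_cong: "f \<approx> g \<Longrightarrow> trL f = trL g"
  using nul_test[OF nul_arc[of "f - g" S \<alpha> "Mid 0" "Mid 0"], of 1] trL_linear(2)[of f g] cob_zero[of True S]
  by (simp add: eqv_def trL_def)

lemma trace_K: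
  assumes f: "f \<in> A"
  shows "trace K (clA f) = trL f"
proof -
  have *: "eval_lin \<alpha> (lin_ext (\<lambda>D. gen (glue_all 1 D)) (relabel (\<lambda>p. Mid 0) x)) = trL f"
    if "x \<in> clA f" for x
  proof -
    have e: "x \<approx> f" using that by (simp add: mem_cls eqv_def null_eq pts_simps)
    have x: "x \<in> A" by (rule eqv_A[OF e f])
    have "relabel (\<lambda>p. Mid 0) x = arc (Mid 0) (Mid 0) x"
      by (rule relabel_cong[OF x]) auto
    then show ?thesis using glue_all_1[OF arc_span[OF x]] trL_cong[OF e] by (simp add: trL_def)
  qed
  have "(THE c. \<exists>x\<in>clA f. c = eval_lin \<alpha> (lin_ext (\<lambda>D. gen (glue_all 1 D)) (relabel (\<lambda>p. Mid 0) x))) = trL f"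
  proof (rule the_equality)
    show "\<exists>x\<in>clA f. trL f = eval_lin \<alpha> (lin_ext (\<lambda>D. gen (glue_all 1 D)) (relabel (\<lambda>p. Mid 0) x))"
      by (intro bexI[OF _ cls_refl]) (rule *[OF cls_refl, symmetric])
  qed (use * in blast)
  then show ?thesis by (simp add: K_alg_def circular_closure_def)
qed

lemma trL_at:
  assumes f: "f \<in> A"
  shows "eval_lin \<alpha> (glue_lin {p} (arc p p f)) = trL f"
proof -
  have "glue_lin ((\<lambda>_. p) ` {Mid 0}) (relabel (\<lambda>_. p) (arc (Mid 0) (Mid 0) f)) = relabel (\<lambda>_. p) (glue_lin {Mid 0} (arc (Mid 0) (Mid 0) f))"
    by (rule glue_lin_relabel[OF arc_span[OF f]]) auto
  then show ?thesis by (simp add: trL_def relabel_arc[OF f])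
qed

text \<open>Both sides close two arcs up to one circle through \<open>?p\<close> and
  \<open>?q\<close>, and exchanging the points exchanges the factors. This symmetry makes the value
  of a decorated circle independent of where its word is cut.\<close>

lemma trL_commute:
  assumes f: "f \<in> A" and g: "g \<in> A"
  shows "trL (mulL f g) = trL (mulL g f)"
proof -
  let ?p = "Mid 0" and ?q = "Mid (Suc 0)"
  have *: "trL (mulL f g) = eval_lin \<alpha> (glue_lin ({p} \<union> {q}) (arc q p f * arc p q g))"
    if "f \<in> A" "g \<in> A" "p \<noteq> q" for f g p q
    unfolding trL_at[OF mulL_A[OF that(1,2)], symmetric, of p]
    by (subst arc_mulL[OF that(1,2), of q]) (use glue_lin_Un[of "{p}" "{q}" "arc q p f * arc p q g"] that in \<open>auto simp: insert_commute\<close>)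
  show ?thesis using *[OF f g, of ?p ?q] *[OF g f, of ?q ?p] by (simp add: mult.commute insert_commute)
qed

end

section \<open>Contexts and Brauer relations\<close>

lemma cob_sg_split:
  assumes "sg t h w + D \<in> cob i L T H" "finite T" "finite H"
  shows "set_option t \<subseteq> T" "set_option h \<subseteq> H" "set w \<subseteq> L" "i \<or> t \<noteq> None \<and> h \<noteq> None"
    "D \<in> cob i L (T - set_option t) (H - set_option h)"
proof -
  have t: "tails (sg t h w) + tails D = mset_set T" and h: "heads (sg t h w) + heads D = mset_set H"
    and l: "set w \<subseteq> L" "labels_in L D" and i: "i \<or> t \<noteq> None \<and> h \<noteq> None" "i \<or> no_inner D"
    using assms(1) by (auto simp: cob_def)
  have "p \<in> T" if "t = Some p" for p
    using t that assms(2) by (metis elem_mset_set mem_tails_sg union_iff)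
  then show T: "set_option t \<subseteq> T" by auto
  have "p \<in> H" if "h = Some p" for p
    using h that assms(3) by (metis elem_mset_set mem_heads_sg union_iff)
  then show H: "set_option h \<subseteq> H" by auto
  have "tails (sg t h w) = mset_set (set_option t)" "heads (sg t h w) = mset_set (set_option h)"
    by (cases t; cases h; simp)+
  then have "tails D = mset_set (T - set_option t)" "heads D = mset_set (H - set_option h)"
    using t h T H assms(2,3) by (simp_all add: mset_set_Diff) (metis add_diff_cancel_left')+
  then show "D \<in> cob i L (T - set_option t) (H - set_option h)" using l i by (simp add: cob_def)
  show "set w \<subseteq> L" "i \<or> t \<noteq> None \<and> h \<noteq> None" by fact+
qed

lemma cob_circ_iff: "circ w + D \<in> cob i L T H \<longleftrightarrow> set w \<subseteq> L \<and> D \<in> cob i L T H"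
  by (auto simp: cob_def)

lemma context_cases:
  assumes "\<Gamma> \<in> contexts"
  obtains (seg) t h a b D where "\<Gamma> = (\<lambda>u. sg t h (a @ u @ b) + D)"
  | (circ) a b D where "\<Gamma> = (\<lambda>u. circ (a @ u @ b) + D)"
  using assms unfolding contexts_def by blast

lemma context_seg: "(\<lambda>u. sg t h (a @ u @ b) + D) \<in> contexts"
  and context_circ: "(\<lambda>u. circ (a @ u @ b) + D) \<in> contexts"
  unfolding contexts_def by blast+

lemma context_add: "\<Gamma> \<in> contexts \<Longrightarrow> (\<lambda>u. \<Gamma> u + E) \<in> contexts"
  by (erule context_cases) (simp_all only: add.assoc context_seg context_circ)

lemma context_map_diag: "\<Gamma> \<in> contexts \<Longrightarrow> (\<lambda>u. map_diag \<rho> (\<Gamma> u)) \<in> contexts"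
  by (erule context_cases) (simp_all only: map_diag_simps context_seg context_circ)

lemma context_Cons: "\<Gamma> \<in> contexts \<Longrightarrow> (\<lambda>u. \<Gamma> (x # u)) \<in> contexts"
proof (erule context_cases)
  fix t h a b D assume "\<Gamma> = (\<lambda>u. sg t h (a @ u @ b) + D)"
  then show "(\<lambda>u. \<Gamma> (x # u)) \<in> contexts" using context_seg[of t h "a @ [x]" b D] by simp
next
  fix a b D assume "\<Gamma> = (\<lambda>u. circ (a @ u @ b) + D)"
  then show "(\<lambda>u. \<Gamma> (x # u)) \<in> contexts" using context_circ[of "a @ [x]" b D] by simp
qed

text \<open>Gluing never looks inside a word. Joining another segment only lengthens the part
  \<open>a\<close> or the part \<open>b\<close>, and closing up the distinguished segment turns it
  into a distinguished circle.\<close>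

lemma context_glue_at:
  assumes "\<Gamma> \<in> contexts"
  shows "(\<lambda>u. glue_at p (\<Gamma> u)) \<in> contexts"
  using assms
proof (cases rule: context_cases)
  case (seg t h a b D)
  show ?thesis
  proof (cases "gluable p (\<Gamma> [])")
    case False
    then have "\<not> gluable p (\<Gamma> u)" for u using seg by (auto simp: gluable_def count_tails_sg count_heads_sg)
    then show ?thesis using assms by simp
  next
    case True
    consider "t = Some p" "h = Some p" | "t = Some p" "h \<noteq> Some p" | "t \<noteq> Some p" "h = Some p"
      | "t \<noteq> Some p" "h \<noteq> Some p" by blast
    then show ?thesis
    proof cases
      case 1
      then have "fresh p D" using True seg by (auto simp: gluable_def fresh_def not_in_iff)
      then show ?thesis using 1 seg context_circ by (simp add: glue_at_circle)
    next
      case 2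
      then have "p \<in># heads D" using True seg by (auto simp: gluable_def count_heads_sg intro!: count_inI)
      then obtain t' w D' where D: "D = sg t' (Some p) w + D'" by (rule split_head)
      have f: "fresh p D'" "t' \<noteq> Some p"
        using True seg 2 D by (auto simp: gluable_def fresh_def not_in_iff count_tails_sg count_heads_sg split: if_splits)
      have "glue_at p (\<Gamma> u) = sg t' h (a @ u @ (b @ w)) + D'" for u
        using glue_at_join[OF f 2(2), of w "a @ u @ b"] seg 2 D by (simp add: add.left_commute)
      then show ?thesis using context_seg by simp
    next
      case 3
      then have "p \<in># tails D" using True seg by (auto simp: gluable_def count_tails_sg intro!: count_inI)
      then obtain h' w D' where D: "D = sg (Some p) h' w + D'" by (rule split_tail)
      have f: "fresh p D'" "h' \<noteq> Some p"
        using True seg 3 D by (auto simp: gluable_def fresh_def not_in_iff count_tails_sg count_heads_sg split: if_splits)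
      have "glue_at p (\<Gamma> u) = sg t h' ((w @ a) @ u @ b) + D'" for u
        using glue_at_join[OF f(1) 3(1) f(2), of "a @ u @ b" w] seg 3 D by simp
      then show ?thesis using context_seg by (simp del: append_assoc)
    next
      case 4
      have "glue_at p (\<Gamma> u) = sg t h (a @ u @ b) + glue_at p D" for u
        using glue_at_add[of p "sg t h (a @ u @ b)" D] 4 seg by (simp add: add.commute)
      then show ?thesis using context_seg by simp
    qed
  qed
next
  case (circ a b D)
  have "glue_at p (\<Gamma> u) = circ (a @ u @ b) + glue_at p D" for u
    using glue_at_add[of p "circ (a @ u @ b)" D] circ by (simp add: add.commute)
  then show ?thesis using context_circ by simp
qed

lemma context_glue_set: "finite P \<Longrightarrow> \<Gamma> \<in> contexts \<Longrightarrow> (\<lambda>u. glue_set P (\<Gamma> u)) \<in> contexts"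
  by (induction P rule: finite_induct) (auto simp: glue_set_insert intro: context_glue_at)

lemma context_cob:
  assumes "\<Gamma> \<in> contexts" "\<Gamma> [] \<in> cob i L T H" "set u \<subseteq> L"
  shows "\<Gamma> u \<in> cob i L T H"
  using assms(1)
proof (cases rule: context_cases)
  case (seg t h a b D)
  have "tails (sg t h v) = tails (sg t h w)" "heads (sg t h v) = heads (sg t h w)" for v w :: "'a list"
    by (cases t; cases h; simp)+
  from this[of "a @ u @ b" "a @ b"] show ?thesis using assms(2,3) seg by (simp add: cob_def)
next
  case (circ a b D)
  then show ?thesis using assms(2,3) by (simp add: cob_circ_iff)
qed

text \<open>The properties of an operation on diagrams that carry each generating relation to a
  relation of the same kind: the first two clauses serve the relations inside one component, the
  last one the evaluation of circles. Stacking from either side and closure are the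
  instances.\<close>

definition respects_contexts :: "'l set \<Rightarrow> sign list \<Rightarrow> sign list \<Rightarrow> sign list \<Rightarrow> sign list \<Rightarrow> ('l diag \<Rightarrow> 'l diag) \<Rightarrow> bool" where
  "respects_contexts L \<epsilon> \<epsilon>' \<delta> \<delta>' Q \<longleftrightarrow>
     (\<forall>D\<in>cobs_no_inner L \<epsilon> \<epsilon>'. Q D \<in> cobs_no_inner L \<delta> \<delta>') \<and>
     (\<forall>\<Gamma>\<in>contexts. \<Gamma> [] \<in> cobs_no_inner L \<epsilon> \<epsilon>' \<longrightarrow>
        (\<exists>\<Gamma>'\<in>contexts. \<forall>u. set u \<subseteq> L \<longrightarrow> Q (\<Gamma> u) = \<Gamma>' u)) \<and>
     (\<forall>D\<in>cobs_no_inner L \<epsilon> \<epsilon>'. \<forall>x\<in>L. Q (circ [x] + D) = circ [x] + Q D)"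

lemma brauer_rel_diff: "f \<in> brauer_rel B \<epsilon> \<epsilon>' \<Longrightarrow> g \<in> brauer_rel B \<epsilon> \<epsilon>' \<Longrightarrow> f - g \<in> brauer_rel B \<epsilon> \<epsilon>'"
  using brauer_rel.add[of f B \<epsilon> \<epsilon>' "scale (- 1) g"] brauer_rel.scale[of g B \<epsilon> \<epsilon>' "- 1"]
  by (simp add: scale_uminus)

lemma brauer_rel_respects:
  assumes Q: "respects_contexts (carrier B) \<epsilon> \<epsilon>' \<delta> \<delta>' Q"
    and closed: "\<And>x y. x \<in> carrier B \<Longrightarrow> y \<in> carrier B \<Longrightarrow> x \<oplus>\<^bsub>B\<^esub> y \<in> carrier B"
      "\<And>x y. x \<in> carrier B \<Longrightarrow> y \<in> carrier B \<Longrightarrow> x \<otimes>\<^bsub>B\<^esub> y \<in> carrier B"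
      "\<And>c x. x \<in> carrier B \<Longrightarrow> c \<odot>\<^bsub>B\<^esub> x \<in> carrier B" "\<one>\<^bsub>B\<^esub> \<in> carrier B"
    and r: "r \<in> brauer_rel B \<epsilon> \<epsilon>'"
  shows "lin_ext (\<lambda>D. gen (Q D)) r \<in> brauer_rel B \<delta> \<delta>'"
proof -
  have Q1: "Q D \<in> cobs_no_inner (carrier B) \<delta> \<delta>'" if "D \<in> cobs_no_inner (carrier B) \<epsilon> \<epsilon>'" for D
    using Q that by (simp add: respects_contexts_def)
  have Q2: "\<exists>\<Gamma>'\<in>contexts. \<Gamma>' [] \<in> cobs_no_inner (carrier B) \<delta> \<delta>' \<and> (\<forall>u. set u \<subseteq> carrier B \<longrightarrow> Q (\<Gamma> u) = \<Gamma>' u)"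
    if \<Gamma>: "\<Gamma> \<in> contexts" "\<Gamma> [] \<in> cobs_no_inner (carrier B) \<epsilon> \<epsilon>'" for \<Gamma>
  proof -
    obtain \<Gamma>' where *: "\<Gamma>' \<in> contexts" "\<forall>u. set u \<subseteq> carrier B \<longrightarrow> Q (\<Gamma> u) = \<Gamma>' u"
      using Q \<Gamma> unfolding respects_contexts_def by blast
    then have "\<Gamma>' [] = Q (\<Gamma> [])" by simp
    then show ?thesis using * Q1[OF \<Gamma>(2)] by auto
  qed
  from r show ?thesis
  proof (induction rule: brauer_rel.induct)
    case (dot_add \<Gamma> x y)
    then obtain \<Gamma>' where "\<Gamma>' \<in> contexts" "\<Gamma>' [] \<in> cobs_no_inner (carrier B) \<delta> \<delta>'"
      "\<forall>u. set u \<subseteq> carrier B \<longrightarrow> Q (\<Gamma> u) = \<Gamma>' u" using Q2 by blast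
    then show ?case using brauer_rel.dot_add[of \<Gamma>' B \<delta> \<delta>' x y] dot_add closed by (simp add: lin_ext_diff)
  next
    case (dot_smult \<Gamma> x c)
    then obtain \<Gamma>' where "\<Gamma>' \<in> contexts" "\<Gamma>' [] \<in> cobs_no_inner (carrier B) \<delta> \<delta>'"
      "\<forall>u. set u \<subseteq> carrier B \<longrightarrow> Q (\<Gamma> u) = \<Gamma>' u" using Q2 by blast
    then show ?case using brauer_rel.dot_smult[of \<Gamma>' B \<delta> \<delta>' x c] dot_smult closed by (simp add: lin_ext_diff)
  next
    case (dot_mult \<Gamma> x y)
    then obtain \<Gamma>' where "\<Gamma>' \<in> contexts" "\<Gamma>' [] \<in> cobs_no_inner (carrier B) \<delta> \<delta>'"
      "\<forall>u. set u \<subseteq> carrier B \<longrightarrow> Q (\<Gamma> u) = \<Gamma>' u" using Q2 by blast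
    then show ?case using brauer_rel.dot_mult[of \<Gamma>' B \<delta> \<delta>' x y] dot_mult closed by (simp add: lin_ext_diff)
  next
    case (dot_one \<Gamma>)
    then obtain \<Gamma>' where "\<Gamma>' \<in> contexts" "\<Gamma>' [] \<in> cobs_no_inner (carrier B) \<delta> \<delta>'"
      "\<forall>u. set u \<subseteq> carrier B \<longrightarrow> Q (\<Gamma> u) = \<Gamma>' u" using Q2 by blast
    then show ?case using brauer_rel.dot_one[of \<Gamma>' B \<delta> \<delta>'] dot_one closed by (simp add: lin_ext_diff)
  next
    case (circle D x)
    have "Q (circ [x] + D) = circ [x] + Q D" using Q circle unfolding respects_contexts_def by blast
    then show ?case using brauer_rel.circle[OF Q1[OF circle(1)] circle(2)] by (simp add: lin_ext_diff)
  qed (auto simp: lin_ext_add lin_ext_scale intro: brauer_rel.intros)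
qed

text \<open>Stacking with a fixed diagram and closing both have the form: rename, add a fixed
  diagram, glue. Each of these steps preserves contexts and leaves an additional circle
  alone.\<close>

lemma respects_glue:
  assumes Q: "\<And>D. D \<in> cobs_no_inner L \<epsilon> \<epsilon>' \<Longrightarrow> Q D \<in> cobs_no_inner L \<delta> \<delta>'"
    "\<And>D. D \<in> cobs_no_inner L \<epsilon> \<epsilon>' \<Longrightarrow> Q D = glue_set P (map_diag \<rho> D + E)" and P: "finite P"
  shows "respects_contexts L \<epsilon> \<epsilon>' \<delta> \<delta>' Q"
  unfolding respects_contexts_def
proof (intro conjI ballI impI)
  fix \<Gamma> :: "'a list \<Rightarrow> 'a diag" assume \<Gamma>: "\<Gamma> \<in> contexts" "\<Gamma> [] \<in> cobs_no_inner L \<epsilon> \<epsilon>'"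
  show "\<exists>\<Gamma>'\<in>contexts. \<forall>u. set u \<subseteq> L \<longrightarrow> Q (\<Gamma> u) = \<Gamma>' u"
  proof (intro bexI allI impI)
    show "(\<lambda>u. glue_set P (map_diag \<rho> (\<Gamma> u) + E)) \<in> contexts"
      by (intro context_glue_set context_add context_map_diag P \<Gamma>)
    fix u assume "set u \<subseteq> L"
    then have "\<Gamma> u \<in> cobs_no_inner L \<epsilon> \<epsilon>'" using context_cob \<Gamma> unfolding cobs_no_inner_eq by blast
    then show "Q (\<Gamma> u) = glue_set P (map_diag \<rho> (\<Gamma> u) + E)" by (rule Q(2))
  qed
next
  fix D x assume D: "D \<in> cobs_no_inner L \<epsilon> \<epsilon>'" and x: "x \<in> L"
  have "circ [x] + D \<in> cobs_no_inner L \<epsilon> \<epsilon>'" using D x unfolding cobs_no_inner_eq cob_circ_iff by simp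
  then have "Q (circ [x] + D) = glue_set P (map_diag \<rho> D + E + circ [x])"
    by (simp only: Q(2) map_diag_simps add_ac)
  also have "\<dots> = glue_set P (map_diag \<rho> D + E) + circ [x]"
    by (rule glue_set_add[OF P]) simp
  finally show "Q (circ [x] + D) = circ [x] + Q D" by (simp only: Q(2)[OF D] add.commute)
qed (use Q in auto)

lemma respects_stack_left:
  assumes E: "E \<in> cobs_no_inner L \<epsilon>' \<epsilon>''"
  shows "respects_contexts L \<epsilon> \<epsilon>' \<epsilon> \<epsilon>'' (stack (length \<epsilon>') E)"
proof (rule respects_glue)
  fix D assume D: "D \<in> cobs_no_inner L \<epsilon> \<epsilon>'"
  note DE = D[unfolded cobs_no_inner_eq] E[unfolded cobs_no_inner_eq]
  show "stack (length \<epsilon>') E D \<in> cobs_no_inner L \<epsilon> \<epsilon>''"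
    unfolding cobs_no_inner_eq by (rule stack_cob[OF DE])
  show "stack (length \<epsilon>') E D = glue_set (Mid ` {..<length \<epsilon>'})
      (map_diag (relab Bot Mid) D + map_diag (relab Mid Top) E)"
    by (rule stack_eq[OF DE])
qed simp

lemma respects_stack_right:
  assumes E: "E \<in> cobs_no_inner L \<epsilon> \<epsilon>'"
  shows "respects_contexts L \<epsilon>' \<epsilon>'' \<epsilon> \<epsilon>'' (\<lambda>D. stack (length \<epsilon>') D E)"
proof (rule respects_glue)
  fix D assume D: "D \<in> cobs_no_inner L \<epsilon>' \<epsilon>''"
  note ED = E[unfolded cobs_no_inner_eq] D[unfolded cobs_no_inner_eq]
  show "stack (length \<epsilon>') D E \<in> cobs_no_inner L \<epsilon> \<epsilon>''"
    unfolding cobs_no_inner_eq by (rule stack_cob[OF ED])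
  show "stack (length \<epsilon>') D E = glue_set (Mid ` {..<length \<epsilon>'})
      (map_diag (relab Mid Top) D + map_diag (relab Bot Mid) E)"
    unfolding add.commute[of "map_diag (relab Mid Top) D"] by (rule stack_eq[OF ED])
qed simp

lemma closure_diag_cob:
  assumes "Z \<in> cob i L (tail_pts \<epsilon> \<epsilon>) (head_pts \<epsilon> \<epsilon>)"
  shows "closure_diag (length \<epsilon>) Z \<in> cob i L {} {}"
  using cob_glue_set[OF closure_diag_eq(2)[OF assms], of "Mid ` {..<length \<epsilon>}"] closure_diag_eq(1)[OF assms]
  by simp

lemma respects_closure: "respects_contexts L \<epsilon> \<epsilon> [] [] (closure_diag (length \<epsilon>))"
proof (rule respects_glue)
  fix D :: "'a diag" assume D: "D \<in> cobs_no_inner L \<epsilon> \<epsilon>"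
  show "closure_diag (length \<epsilon>) D \<in> cobs_no_inner L [] []"
    using closure_diag_cob[OF D[unfolded cobs_no_inner_eq]] by (simp add: cobs_no_inner_eq pts_simps)
  show "closure_diag (length \<epsilon>) D = glue_set (Mid ` {..<length \<epsilon>}) (map_diag (relab Mid Mid) D + 0)"
    using closure_diag_eq(1)[OF D[unfolded cobs_no_inner_eq]] by (simp only: add_0_right)
qed simp

section \<open>The functor on diagrams\<close>

context evaluation_basis
begin

abbreviation "F \<equiv> F_diag K"
abbreviation "Psi \<equiv> lin_ext (F_diag K)"
abbreviation "L \<equiv> carrier K"

text \<open>The linear combination that \<open>F_arc\<close> attaches to the word \<open>w\<close>.
  As \<open>rep\<close> is a choice, its multiplicativity in \<open>w\<close> and the unit law hold
  only up to null combinations.\<close>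

definition "wpl w = rep (word_prod K w)"

lemma
  assumes "x \<in> L" shows rep_KK: "rep x \<in> KK" and clA_rep: "clA (rep x) = x"
proof -
  obtain f where f: "f \<in> KK" "x = clA f" using assms K_carrier_eq by auto
  have "rep x \<approx> f" using rep_cls[of S \<alpha> "[]" "[Pos, Neg]" f] f by (simp add: eqv_def null_eq pts_simps)
  then show "rep x \<in> KK" "clA (rep x) = x" using f KK_cong by (auto simp: eqv_iff)
qed

lemma rep_clA: "rep (clA f) \<approx> f"
  using rep_cls[of S \<alpha> "[]" "[Pos, Neg]" f] by (simp add: eqv_def null_eq pts_simps)

lemma mult_L: "x \<in> L \<Longrightarrow> y \<in> L \<Longrightarrow> x \<otimes>\<^bsub>K\<^esub> y = clA (mulL (rep x) (rep y))"
  using mult_K[OF KK_A[OF rep_KK] KK_A[OF rep_KK], of x y] clA_rep by simp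

lemma L_closed:
  "x \<in> L \<Longrightarrow> y \<in> L \<Longrightarrow> x \<oplus>\<^bsub>K\<^esub> y \<in> L" "x \<in> L \<Longrightarrow> y \<in> L \<Longrightarrow> x \<otimes>\<^bsub>K\<^esub> y \<in> L"
  "x \<in> L \<Longrightarrow> c \<odot>\<^bsub>K\<^esub> x \<in> L" "\<one>\<^bsub>K\<^esub> \<in> L"
proof -
  assume x: "x \<in> L" and y: "y \<in> L"
  show "x \<otimes>\<^bsub>K\<^esub> y \<in> L"
    unfolding mult_L[OF x y] K_carrier_eq using KK_mulL_left[OF KK_A] rep_KK x y by blast
  have "x \<oplus>\<^bsub>K\<^esub> y = clA (rep x + rep y)"
    using add_K[OF KK_A[OF rep_KK[OF x]] KK_A[OF rep_KK[OF y]]] clA_rep x y by simp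
  then show "x \<oplus>\<^bsub>K\<^esub> y \<in> L" unfolding K_carrier_eq using KK_add rep_KK x y by blast
next
  assume x: "x \<in> L"
  have "c \<odot>\<^bsub>K\<^esub> x = clA (scale c (rep x))" using smult_K[of c "rep x"] clA_rep[OF x] by simp
  then show "c \<odot>\<^bsub>K\<^esub> x \<in> L" unfolding K_carrier_eq using KK_scale rep_KK x by blast
next
  show "\<one>\<^bsub>K\<^esub> \<in> L" unfolding one_K K_carrier_eq using oneL_KK by blast
qed

lemma word_prod_L: "set w \<subseteq> L \<Longrightarrow> word_prod K w \<in> L"
  by (induction w) (auto simp: word_prod_def L_closed)

lemma wpl_KK: "set w \<subseteq> L \<Longrightarrow> wpl w \<in> KK"
  unfolding wpl_def by (intro rep_KK word_prod_L)

lemma wpl_A: "set w \<subseteq> L \<Longrightarrow> wpl w \<in> A"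
  by (intro KK_A wpl_KK)

lemma wpl_Nil: "wpl [] \<approx> oneL"
  using rep_clA[of oneL] by (simp add: wpl_def word_prod_def one_K)

lemma wpl_Cons: "x \<in> L \<Longrightarrow> set w \<subseteq> L \<Longrightarrow> wpl (x # w) \<approx> mulL (rep x) (wpl w)"
  using rep_clA mult_L[of x "word_prod K w"] word_prod_L[of w] by (simp add: wpl_def word_prod_def)

lemma rep_A: "x \<in> L \<Longrightarrow> rep x \<in> A"
  by (intro KK_A rep_KK)

lemma wpl_single: "x \<in> L \<Longrightarrow> wpl [x] \<approx> rep x"
proof -
  assume x: "x \<in> L"
  have "wpl [x] \<approx> mulL (rep x) (wpl [])" using wpl_Cons[OF x, of "[]"] by simp
  also have "mulL (rep x) (wpl []) \<approx> mulL (rep x) oneL"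
    by (rule mulL_cong[OF eqv_refl wpl_Nil rep_A[OF x] oneL_A])
  also have "\<dots> \<approx> rep x" by (rule mulL_one_right[OF rep_KK[OF x]])
  finally show ?thesis .
qed

lemma wpl_append: "set v \<subseteq> L \<Longrightarrow> set w \<subseteq> L \<Longrightarrow> wpl (v @ w) \<approx> mulL (wpl v) (wpl w)"
proof (induction v)
  case Nil
  have "mulL (wpl []) (wpl w) \<approx> mulL oneL (wpl w)"
    by (rule mulL_cong[OF wpl_Nil eqv_refl oneL_A wpl_A[OF Nil(2)]])
  also have "\<dots> \<approx> wpl w" by (rule mulL_one_left[OF wpl_KK[OF Nil(2)]])
  finally show ?case by (simp add: eqv_sym)
next
  case (Cons x v)
  then have x: "x \<in> L" and v: "set v \<subseteq> L" and w: "set w \<subseteq> L" by auto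
  have "wpl ((x # v) @ w) \<approx> mulL (rep x) (wpl (v @ w))" using wpl_Cons[OF x, of "v @ w"] v w by simp
  also have "\<dots> \<approx> mulL (rep x) (mulL (wpl v) (wpl w))"
    by (rule mulL_cong[OF eqv_refl Cons.IH[OF v w] rep_A[OF x] mulL_A[OF wpl_A[OF v] wpl_A[OF w]]])
  also have "\<dots> = mulL (mulL (rep x) (wpl v)) (wpl w)"
    by (rule mulL_assoc[OF rep_A[OF x] wpl_A[OF v] wpl_A[OF w], symmetric])
  also have "\<dots> \<approx> mulL (wpl (x # v)) (wpl w)"
    by (rule mulL_cong[OF eqv_sym[OF wpl_Cons[OF x v]] eqv_refl wpl_A[OF Cons.prems(1)] wpl_A[OF w]])
  finally show ?case .
qed

lemma wpl_context:
  assumes "set a \<subseteq> L" "set u \<subseteq> L" "set b \<subseteq> L"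
  shows "wpl (a @ u @ b) \<approx> mulL (wpl a) (mulL (wpl u) (wpl b))"
proof -
  have "wpl (a @ u @ b) \<approx> mulL (wpl a) (wpl (u @ b))" by (rule wpl_append) (use assms in auto)
  also have "\<dots> \<approx> mulL (wpl a) (mulL (wpl u) (wpl b))"
    by (rule mulL_cong[OF eqv_refl wpl_append[OF assms(2,3)] wpl_A[OF assms(1)]
        mulL_A[OF wpl_A[OF assms(2)] wpl_A[OF assms(3)]]])
  finally show ?thesis .
qed

lemma F_zero: "F 0 = 1"
  by (simp add: F_diag_def zero_prod_def)

lemma F_add: "F (D + E) = F D * F E"
  by (cases D; cases E) (simp add: F_diag_def scale_mult_left scale_mult_right mult_ac)

lemma F_sg: "F (sg (Some t) (Some h) w) = arc t h (wpl w)"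
  by (simp add: F_diag_def F_arc_def wpl_def rep_def)

lemma trace_word_prod: "set w \<subseteq> L \<Longrightarrow> trace K (word_prod K w) = trL (wpl w)"
  using trace_K[OF wpl_A] clA_rep[OF word_prod_L] by (simp add: wpl_def)

text \<open>\<open>F_circle\<close> reads the cyclic word from an arbitrary starting point. Another
  start multiplies the two parts in the other order, which \<open>trL_commute\<close> absorbs.
  Traces being scalars, this holds exactly and not only modulo null combinations.\<close>

lemma F_circ:
  assumes w: "set w \<subseteq> L"
  shows "F (circ w) = scale (trL (wpl w)) 1"
proof -
  have *: "trace K (word_prod K w') = trL (wpl w)" if "cyc w' = cyc w" for w'
  proof -
    have "\<exists>u v. w' = u @ v \<and> w = v @ u" using that by (simp only: cyc_eq_iff)
    then obtain u v where uv: "w' = u @ v" "w = v @ u" by (elim exE conjE)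
    then have s: "set u \<subseteq> L" "set v \<subseteq> L" using w by auto
    have "trL (wpl w') = trL (mulL (wpl u) (wpl v))" using trL_cong[OF wpl_append[OF s]] uv by simp
    also have "\<dots> = trL (mulL (wpl v) (wpl u))" by (rule trL_commute[OF wpl_A wpl_A]) (use s in auto)
    also have "\<dots> = trL (wpl w)" using trL_cong[OF wpl_append[OF s(2,1)]] uv by simp
    finally show ?thesis using trace_word_prod[of w'] s uv by simp
  qed
  have "cyc (SOME v. cyc v = cyc w) = cyc w" by (rule someI[of _ w]) (rule refl)
  then have "F_circle K (cyc w) = trL (wpl w)"
    unfolding F_circle_def by (rule *)
  then show ?thesis by (simp add: F_diag_def)
qed

lemma one_span: "1 \<in> Sp {} {}"
  using cob_zero[of True S] by simp

lemma F_span: "D \<in> cob False L T H \<Longrightarrow> finite T \<Longrightarrow> finite H \<Longrightarrow> F D \<in> Sp T H"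
proof (induction D arbitrary: T H rule: diag_induct)
  case zero
  then have "T = {}" "H = {}" by (auto simp: cob_def mset_set_empty_iff)
  then show ?case using one_span by (simp add: F_zero)
next
  case (seg t h w D)
  note sp = cob_sg_split[OF seg.prems]
  obtain p q where pq: "t = Some p" "h = Some q" using sp(4) by auto
  have "arc p q (wpl w) * F D \<in> Sp ({p} \<union> (T - {p})) ({q} \<union> (H - {q}))"
    by (rule mult_cob_span[OF arc_span[OF wpl_A[OF sp(3)]] seg.IH]) (use sp pq seg.prems in auto)
  moreover have "{p} \<union> (T - {p}) = T" "{q} \<union> (H - {q}) = H" using sp(1,2) pq by auto
  ultimately show ?case by (simp only: pq F_add F_sg)
next
  case (circ w D)
  then have w: "set w \<subseteq> L" and D: "D \<in> cob False L T H" by (simp_all add: cob_circ_iff)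
  have "F (circ w + D) = scale (trL (wpl w)) (F D)"
    by (simp only: F_add F_circ[OF w] scale_mult_left mult_1_left)
  then show ?case using span_scale[OF circ.IH[OF D circ.prems(2,3)]] by simp
qed

lemma F_map_diag: "labels_in L D \<Longrightarrow> no_inner D \<Longrightarrow> F (map_diag \<rho> D) = relabel \<rho> (F D)"
proof (induction D rule: diag_induct)
  case zero
  then show ?case using relabel_gen[of \<rho> 0] by (simp add: F_zero)
next
  case (seg t h w D)
  obtain p q where pq: "t = Some p" "h = Some q" using seg.prems by auto
  have w: "wpl w \<in> A" using seg.prems wpl_A by auto
  show ?case using seg by (simp only: pq map_diag_simps option.map F_add F_sg relabel_mult relabel_arc[OF w]) auto
next
  case (circ w D)
  then have w: "set w \<subseteq> L" by auto
  have "relabel \<rho> (1 :: ('a, 'k) lin) = 1" using relabel_gen[of \<rho> 0] by simp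
  then show ?case using circ
    by (simp only: map_diag_simps F_add F_circ[OF w] relabel_mult relabel_linear) auto
qed

text \<open>In the circle case the closed arc is a scalar, namely the trace that F assigns to the
  circle. In the join case the concatenated word corresponds to the product in \<open>K\<close> by
  \<open>wpl_append\<close>.\<close>

lemma F_glue_at:
  assumes D: "D \<in> cob False L T H" and p: "p \<in> T" "p \<in> H" and f: "finite T" "finite H"
  shows "F (glue_at p D) - glue_lin {p} (F D) \<in> N (T - {p}) (H - {p})"
proof -
  have "gluable p D" using cob_pts(5)[OF D f] p by simp
  then show ?thesis
  proof (cases rule: gluable_cases)
    case (circle w D')
    note sp = cob_sg_split[OF D[unfolded circle(1)] f]
    have D': "F D' \<in> Sp (T - {p}) (H - {p})" using F_span[OF sp(5)] f by simp
    have w: "wpl w \<in> A" by (rule wpl_A[OF sp(3)])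
    let ?x = "glue_lin {p} (arc p p (wpl w))"
    have x: "?x \<in> Sp {} {}" using glue_lin_span[OF arc_span[OF w, of p p], of "{p}"] by simp
    have "F (glue_at p D) = scale (trL (wpl w)) (F D')"
      using circle by (simp add: glue_at_circle) (simp only: F_add F_circ[OF sp(3)] scale_mult_left mult_1_left)
    moreover have "glue_lin {p} (F D) = ?x * F D'"
      unfolding circle(1) F_add F_sg by (rule glue_lin_mult[OF D']) (use f in auto)
    moreover have "?x * F D' - scale (trL (wpl w)) (F D') \<in> N (T - {p}) (H - {p})"
      using closed_mult[OF x D', of \<alpha>] f trL_at[OF w, of p] by simp
    ultimately show ?thesis using nul_sym by simp
  next
    case (join t h w v D')
    note sp1 = cob_sg_split[OF D[unfolded join(1)] f]
    note sp2 = cob_sg_split[OF sp1(5) finite_Diff[OF f(1)] finite_Diff[OF f(2)]]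
    obtain t' h' where th: "t = Some t'" "h = Some h'" using sp1(4) sp2(4) by auto
    have "T - set_option t - set_option (Some p) = T - {t', p}" "H - set_option (Some p) - set_option h = H - {p, h'}"
      using th by auto
    then have D'c: "D' \<in> cob False L (T - {t', p}) (H - {p, h'})"
      using sp2(5) by (simp only:)
    have D': "F D' \<in> Sp (T - {t', p}) (H - {p, h'})" by (rule F_span[OF D'c]) (use f in auto)
    have w: "set w \<subseteq> L" "wpl w \<in> A" and v: "set v \<subseteq> L" "wpl v \<in> A"
      using sp1(3) sp2(3) wpl_A by auto
    have ne: "p \<noteq> t'" "p \<noteq> h'" and m: "t' \<in> T" "h' \<in> H" using join(3,4) th sp1(1) sp2(2) by auto
    have "wpl (v @ w) - mulL (wpl v) (wpl w) \<in> N {Top (Suc 0)} {Top 0}"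
      using wpl_append[OF v(1) w(1)] by (simp add: eqv_def)
    then have "arc t' h' (wpl (v @ w) - mulL (wpl v) (wpl w)) * F D' \<in> N ({t'} \<union> (T - {t', p})) ({h'} \<union> (H - {p, h'}))"
      by (intro nul_mult[OF nul_arc D']) (use f in auto)
    moreover have "{t'} \<union> (T - {t', p}) = T - {p}" "{h'} \<union> (H - {p, h'}) = H - {p}" using ne m by auto
    moreover have "F (glue_at p D) = arc t' h' (wpl (v @ w)) * F D'"
      using join th by (simp add: glue_at_join) (simp only: F_add F_sg)
    moreover have "glue_lin {p} (F D) = arc t' h' (mulL (wpl v) (wpl w)) * F D'"
    proof -
      have "F D = (arc p h' (wpl v) * arc t' p (wpl w)) * F D'"
        unfolding join(1) th F_add F_sg by (simp add: mult_ac)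
      also have "glue_lin {p} \<dots> = glue_lin {p} (arc p h' (wpl v) * arc t' p (wpl w)) * F D'"
        by (rule glue_lin_mult[OF D']) (use f in auto)
      finally show ?thesis using arc_mulL[OF v(2) w(2) ne] by simp
    qed
    ultimately show ?thesis by (simp add: relabel_linear left_diff_distrib)
  qed
qed

lemma F_glue_set:
  assumes "finite P" "D \<in> cob False L T H" "P \<subseteq> T \<inter> H" "finite T" "finite H"
  shows "F (glue_set P D) - glue_lin P (F D) \<in> N (T - P) (H - P)"
  using assms
proof (induction P arbitrary: D T H rule: finite_induct)
  case (insert p P)
  have p: "p \<in> T" "p \<in> H" using insert.prems by auto
  have D1: "glue_at p D \<in> cob False L (T - {p}) (H - {p})"
    using cob_glue_set[OF insert.prems(1), of "{p}"] insert.prems p by (simp add: glue_set_insert)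
  have 1: "F (glue_set P (glue_at p D)) - glue_lin P (F (glue_at p D)) \<in> N (T - {p} - P) (H - {p} - P)"
    by (rule insert.IH[OF D1]) (use insert in auto)
  have "glue_lin P (F (glue_at p D) - glue_lin {p} (F D)) \<in> N (T - {p} - P) (H - {p} - P)"
    by (rule nul_glue[OF F_glue_at[OF insert.prems(1) p]]) (use insert in auto)
  moreover have "glue_lin (insert p P) (F D) = glue_lin P (glue_lin {p} (F D))"
    using glue_lin_Un[of P "{p}" "F D"] insert.hyps by simp
  moreover have "T - {p} - P = T - insert p P" "H - {p} - P = H - insert p P" by auto
  ultimately have "(F (glue_set P (glue_at p D)) - glue_lin P (F (glue_at p D)))
     + (glue_lin P (F (glue_at p D)) - glue_lin (insert p P) (F D)) \<in> N (T - insert p P) (H - insert p P)"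
    using 1 by (intro nul_add) (simp_all add: glue_lin_linear)
  then show ?case using insert.hyps by (simp add: glue_set_insert2)
qed simp

section \<open>The linear extension of F and its functoriality modulo null combinations\<close>

lemma Psi_span: "f \<in> span (cob False L T H) \<Longrightarrow> finite T \<Longrightarrow> finite H \<Longrightarrow> Psi f \<in> Sp T H"
  by (erule lin_ext_span) (rule F_span)

lemma Psi_relabel: "f \<in> span (cob False L T H) \<Longrightarrow> Psi (relabel \<rho> f) = relabel \<rho> (Psi f)"
proof (induction f rule: span_induct)
  case (add f D c)
  have "F (map_diag \<rho> D) = relabel \<rho> (F D)" by (rule F_map_diag) (use add in \<open>auto simp: cob_def\<close>)
  with add show ?case by (simp add: relabel_linear lin_ext_add lin_ext_scale del: scale_simps(5))
qed (simp add: relabel_linear)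

lemma Psi_mult: "Psi (f * g) = Psi f * Psi g"
  by (rule lin_ext_mult[of f UNIV g UNIV]) (auto simp: F_add)

lemma Psi_glue:
  assumes "f \<in> span (cob False L T H)" "P \<subseteq> T \<inter> H" "finite T" "finite H"
  shows "Psi (glue_lin P f) - glue_lin P (Psi f) \<in> N (T - P) (H - P)"
  using assms(1)
proof (induction f rule: span_induct)
  case (add f D c)
  have P: "finite P" using assms by (meson finite_Int finite_subset)
  have "scale c (F (glue_set P D) - glue_lin P (F D)) \<in> N (T - P) (H - P)"
    by (intro nul_scale F_glue_set[OF P add(2) assms(2-4)])
  then have "(Psi (glue_lin P f) - glue_lin P (Psi f)) + scale c (F (glue_set P D) - glue_lin P (F D)) \<in> N (T - P) (H - P)"
    by (intro nul_add add)
  then show ?case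
    by (simp add: glue_lin_linear lin_ext_add lin_ext_scale scale_diff add_diff_add del: scale_simps(5))
qed (simp add: glue_lin_linear)

abbreviation "br \<epsilon> \<epsilon>' \<equiv> cobs_no_inner L \<epsilon> \<epsilon>'"

lemma Psi_br: "f \<in> span (br \<epsilon> \<epsilon>') \<Longrightarrow> Psi f \<in> span (cobs S \<epsilon> \<epsilon>')"
  unfolding cobs_eq cobs_no_inner_eq by (rule Psi_span) auto

lemma Psi_stack:
  assumes f: "f \<in> span (br \<epsilon> \<epsilon>')" and g: "g \<in> span (br \<epsilon>' \<epsilon>'')"
  shows "Psi (stack_lin (length \<epsilon>') g f) - stack_lin (length \<epsilon>') (Psi g) (Psi f) \<in> null S \<alpha> \<epsilon> \<epsilon>''"
proof -
  note f' = f[unfolded cobs_no_inner_eq] and g' = g[unfolded cobs_no_inner_eq]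
  note Pf = Psi_br[OF f, unfolded cobs_eq] and Pg = Psi_br[OF g, unfolded cobs_eq]
  let ?x = "relabel (relab Bot Mid) f * relabel (relab Mid Top) g"
  have x: "?x \<in> span (cob False L ((Bot ` pos \<epsilon> \<union> Mid ` neg \<epsilon>') \<union> (Mid ` pos \<epsilon>' \<union> Top ` neg \<epsilon>''))
      ((Bot ` neg \<epsilon> \<union> Mid ` pos \<epsilon>') \<union> (Mid ` neg \<epsilon>' \<union> Top ` pos \<epsilon>'')))"
    by (rule mult_cob_span[OF relabel_relab_span[OF f'] relabel_relab_span[OF g']])
      (auto simp: neg_iff)
  have "Psi ?x = relabel (relab Bot Mid) (Psi f) * relabel (relab Mid Top) (Psi g)"
    by (simp only: Psi_mult Psi_relabel[OF f'] Psi_relabel[OF g'])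
  moreover have "Psi (glue_lin (Mid ` {..<length \<epsilon>'}) ?x) - glue_lin (Mid ` {..<length \<epsilon>'}) (Psi ?x)
    \<in> N (tail_pts \<epsilon> \<epsilon>'') (head_pts \<epsilon> \<epsilon>'')"
  proof -
    have e: "((Bot ` pos \<epsilon> \<union> Mid ` neg \<epsilon>') \<union> (Mid ` pos \<epsilon>' \<union> Top ` neg \<epsilon>'')) - Mid ` {..<length \<epsilon>'} = tail_pts \<epsilon> \<epsilon>''"
      "((Bot ` neg \<epsilon> \<union> Mid ` pos \<epsilon>') \<union> (Mid ` neg \<epsilon>' \<union> Top ` pos \<epsilon>'')) - Mid ` {..<length \<epsilon>'} = head_pts \<epsilon> \<epsilon>''"
      by (auto simp: Mid_lessThan tail_pts_eq head_pts_eq)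
    show ?thesis unfolding e[symmetric] by (rule Psi_glue[OF x]) (auto simp: Mid_lessThan)
  qed
  ultimately show ?thesis by (simp add: stack_lin_eq[OF f' g'] stack_lin_eq[OF Pf Pg] null_eq)
qed

text \<open>The map \<phi> surrounds its argument with the products of the fixed words
  \<open>a\<close> and \<open>b\<close>, and then either multiplies the resulting arc by the image
  of the rest of the diagram or takes its trace. It reduces each local Brauer relation to an
  identity between the elements \<open>wpl u\<close> for short words \<open>u\<close>.\<close>

lemma Psi_context:
  assumes \<Gamma>: "\<Gamma> \<in> contexts" "\<Gamma> [] \<in> cob False L T H" and f: "finite T" "finite H"
  obtains \<phi> where "\<And>x y. \<phi> (x - y) = \<phi> x - \<phi> y" "\<And>c x. \<phi> (scale c x) = scale c (\<phi> x)"
    "\<And>x. x \<approx> 0 \<Longrightarrow> \<phi> x \<in> N T H" "\<And>u. set u \<subseteq> L \<Longrightarrow> F (\<Gamma> u) - \<phi> (wpl u) \<in> N T H"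
  using \<Gamma>(1)
proof (cases rule: context_cases)
  case (seg t h a b D)
  note sp = cob_sg_split[OF \<Gamma>(2)[unfolded seg] f]
  obtain p q where pq: "t = Some p" "h = Some q" using sp(4) by auto
  have ab: "set a \<subseteq> L" "set b \<subseteq> L" using sp(3) by auto
  have D: "F D \<in> Sp (T - {p}) (H - {q})" using F_span[OF sp(5)] f pq by simp
  have e: "{p} \<union> (T - {p}) = T" "{q} \<union> (H - {q}) = H" using sp(1,2) pq by auto
  let ?m = "\<lambda>x. mulL (wpl a) (mulL x (wpl b))"
  let ?\<phi> = "\<lambda>x. arc p q (?m x) * F D"
  have arc0: "arc p q x * F D \<in> N T H" if "x \<in> N {Top (Suc 0)} {Top 0}" for x
    using nul_mult[OF nul_arc[OF that] D, of p q] f by (simp add: e[simplified])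
  show ?thesis
  proof (rule that[of ?\<phi>])
    fix x y c
    show "?\<phi> (x - y) = ?\<phi> x - ?\<phi> y" "?\<phi> (scale c x) = scale c (?\<phi> x)"
      by (simp_all add: mulL_linear relabel_linear left_diff_distrib scale_mult_left)
  next
    fix x assume "x \<approx> 0"
    then have "?m x \<approx> ?m 0"
      using ab by (intro mulL_cong eqv_refl mulL_A wpl_A) auto
    also have "?m 0 = 0" using mulL_linear(6)[of "wpl a" 0 0] mulL_linear(5)[of 0 0 "wpl b"] by simp
    finally show "?\<phi> x \<in> N T H" using arc0 by (simp add: eqv_def)
  next
    fix u assume "set u \<subseteq> L"
    then have "wpl (a @ u @ b) - ?m (wpl u) \<in> N {Top (Suc 0)} {Top 0}"
      using wpl_context ab by (simp add: eqv_def)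
    from arc0[OF this] show "F (\<Gamma> u) - ?\<phi> (wpl u) \<in> N T H"
      unfolding seg pq F_add F_sg by (simp add: relabel_linear left_diff_distrib)
  qed
next
  case (circ a b D)
  then have ab: "set a \<subseteq> L" "set b \<subseteq> L" and D: "D \<in> cob False L T H" using \<Gamma>(2) by (simp_all add: cob_circ_iff)
  let ?m = "\<lambda>x. mulL (wpl a) (mulL x (wpl b))"
  let ?\<phi> = "\<lambda>x. scale (trL (?m x)) (F D)"
  show ?thesis
  proof (rule that[of ?\<phi>])
    fix x y c
    show "?\<phi> (x - y) = ?\<phi> x - ?\<phi> y"
      using scale_add_left[of "trL (?m (x - y))" "trL (?m y)" "F D"] by (simp add: mulL_linear trL_linear)
    show "?\<phi> (scale c x) = scale c (?\<phi> x)" by (simp add: mulL_linear trL_linear)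
  next
    fix x assume "x \<approx> 0"
    then have "?m x \<approx> ?m 0"
      using ab by (intro mulL_cong eqv_refl mulL_A wpl_A) auto
    also have "?m 0 = 0" using mulL_linear(6)[of "wpl a" 0 0] mulL_linear(5)[of 0 0 "wpl b"] by simp
    finally show "?\<phi> x \<in> N T H" using trL_cong by (fastforce simp: trL_linear)
  next
    fix u assume u: "set u \<subseteq> L"
    then have "trL (wpl (a @ u @ b)) = trL (?m (wpl u))"
      using wpl_context[OF ab(1) u ab(2)] trL_cong by blast
    moreover have "set (a @ u @ b) \<subseteq> L" using u ab by auto
    from F_circ[OF this] have "F (\<Gamma> u) = scale (trL (wpl (a @ u @ b))) (F D)"
      unfolding circ F_add by (simp add: scale_mult_left)
    ultimately show "F (\<Gamma> u) - ?\<phi> (wpl u) \<in> N T H" by simp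
  qed
qed

text \<open>In each local case the relation is first verified for the words alone, where it is a law
  of \<open>K\<close>, and then transported by the map from \<open>Psi_context\<close>. The circle
  relation holds because F evaluates circles by the trace.\<close>

lemma Psi_rel: "r \<in> brauer_rel K \<epsilon> \<epsilon>' \<Longrightarrow> Psi r \<in> null S \<alpha> \<epsilon> \<epsilon>'"
  unfolding null_eq
proof (induction rule: brauer_rel.induct)
  case (dot_add \<Gamma> x y)
  let ?N = "N (tail_pts \<epsilon> \<epsilon>') (head_pts \<epsilon> \<epsilon>')"
  obtain \<phi> where \<phi>: "\<And>x y. \<phi> (x - y) = \<phi> x - \<phi> y" "\<And>c x. \<phi> (scale c x) = scale c (\<phi> x)"
    "\<And>x. x \<approx> 0 \<Longrightarrow> \<phi> x \<in> ?N" "\<And>u. set u \<subseteq> L \<Longrightarrow> F (\<Gamma> u) - \<phi> (wpl u) \<in> ?N"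
    using Psi_context[OF dot_add(1) dot_add(2)[unfolded cobs_no_inner_eq] finite_tail_pts finite_head_pts] by metis
  have l: "x \<oplus>\<^bsub>K\<^esub> y \<in> L" using L_closed dot_add by blast
  have e: "x \<oplus>\<^bsub>K\<^esub> y = clA (rep x + rep y)"
    using add_K[OF rep_A[OF dot_add(3)] rep_A[OF dot_add(4)]] dot_add(3,4) by (simp add: clA_rep)
  have "wpl [x \<oplus>\<^bsub>K\<^esub> y] \<approx> rep (x \<oplus>\<^bsub>K\<^esub> y)" by (rule wpl_single[OF l])
  also have "rep (x \<oplus>\<^bsub>K\<^esub> y) \<approx> rep x + rep y" unfolding e by (rule rep_clA)
  finally have "wpl [x \<oplus>\<^bsub>K\<^esub> y] - (rep x + rep y) \<in> N {Top (Suc 0)} {Top 0}" by (simp add: eqv_def)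
  moreover have "rep x - wpl [x] \<in> N {Top (Suc 0)} {Top 0}" "rep y - wpl [y] \<in> N {Top (Suc 0)} {Top 0}"
    using eqv_sym[OF wpl_single[OF dot_add(3)]] eqv_sym[OF wpl_single[OF dot_add(4)]] by (simp_all add: eqv_def)
  ultimately have "(wpl [x \<oplus>\<^bsub>K\<^esub> y] - (rep x + rep y)) + (rep x - wpl [x]) + (rep y - wpl [y]) \<in> N {Top (Suc 0)} {Top 0}"
    by (intro nul_add)
  then have "wpl [x \<oplus>\<^bsub>K\<^esub> y] - wpl [x] - wpl [y] \<approx> 0" by (simp add: eqv_def algebra_simps)
  from \<phi>(3)[OF this] have "\<phi> (wpl [x \<oplus>\<^bsub>K\<^esub> y]) - \<phi> (wpl [x]) - \<phi> (wpl [y]) \<in> ?N" by (simp add: \<phi>(1))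
  moreover have "F (\<Gamma> [x \<oplus>\<^bsub>K\<^esub> y]) - \<phi> (wpl [x \<oplus>\<^bsub>K\<^esub> y]) \<in> ?N" "F (\<Gamma> [x]) - \<phi> (wpl [x]) \<in> ?N"
    "F (\<Gamma> [y]) - \<phi> (wpl [y]) \<in> ?N"
    by (rule \<phi>(4), use dot_add l in simp)+
  ultimately have "(\<phi> (wpl [x \<oplus>\<^bsub>K\<^esub> y]) - \<phi> (wpl [x]) - \<phi> (wpl [y])) + (F (\<Gamma> [x \<oplus>\<^bsub>K\<^esub> y]) - \<phi> (wpl [x \<oplus>\<^bsub>K\<^esub> y]))
     - (F (\<Gamma> [x]) - \<phi> (wpl [x])) - (F (\<Gamma> [y]) - \<phi> (wpl [y])) \<in> ?N"
    by (blast intro: nul_diff nul_add)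
  then show ?case by (simp add: lin_ext_diff lin_ext_add algebra_simps)
next
  case (dot_smult \<Gamma> x c)
  let ?N = "N (tail_pts \<epsilon> \<epsilon>') (head_pts \<epsilon> \<epsilon>')"
  obtain \<phi> where \<phi>: "\<And>x y. \<phi> (x - y) = \<phi> x - \<phi> y" "\<And>c x. \<phi> (scale c x) = scale c (\<phi> x)"
    "\<And>x. x \<approx> 0 \<Longrightarrow> \<phi> x \<in> ?N" "\<And>u. set u \<subseteq> L \<Longrightarrow> F (\<Gamma> u) - \<phi> (wpl u) \<in> ?N"
    using Psi_context[OF dot_smult(1) dot_smult(2)[unfolded cobs_no_inner_eq] finite_tail_pts finite_head_pts] by metis
  have l: "c \<odot>\<^bsub>K\<^esub> x \<in> L" using L_closed dot_smult by blast
  have e: "c \<odot>\<^bsub>K\<^esub> x = clA (scale c (rep x))" using smult_K[of c "rep x"] dot_smult(3) by (simp add: clA_rep)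
  have "wpl [c \<odot>\<^bsub>K\<^esub> x] \<approx> rep (c \<odot>\<^bsub>K\<^esub> x)" by (rule wpl_single[OF l])
  also have "rep (c \<odot>\<^bsub>K\<^esub> x) \<approx> scale c (rep x)" unfolding e by (rule rep_clA)
  finally have "wpl [c \<odot>\<^bsub>K\<^esub> x] - scale c (rep x) \<in> N {Top (Suc 0)} {Top 0}" by (simp add: eqv_def)
  moreover have "scale c (rep x - wpl [x]) \<in> N {Top (Suc 0)} {Top 0}"
    using eqv_sym[OF wpl_single[OF dot_smult(3)]] by (intro nul_scale) (simp add: eqv_def)
  ultimately have "(wpl [c \<odot>\<^bsub>K\<^esub> x] - scale c (rep x)) + scale c (rep x - wpl [x]) \<in> N {Top (Suc 0)} {Top 0}"
    by (intro nul_add)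
  then have "wpl [c \<odot>\<^bsub>K\<^esub> x] - scale c (wpl [x]) \<approx> 0" by (simp add: eqv_def scale_diff)
  from \<phi>(3)[OF this] have "\<phi> (wpl [c \<odot>\<^bsub>K\<^esub> x]) - scale c (\<phi> (wpl [x])) \<in> ?N" by (simp add: \<phi>(1,2))
  moreover have "F (\<Gamma> [c \<odot>\<^bsub>K\<^esub> x]) - \<phi> (wpl [c \<odot>\<^bsub>K\<^esub> x]) \<in> ?N" "F (\<Gamma> [x]) - \<phi> (wpl [x]) \<in> ?N"
    by (rule \<phi>(4), use dot_smult l in simp)+
  ultimately have "(\<phi> (wpl [c \<odot>\<^bsub>K\<^esub> x]) - scale c (\<phi> (wpl [x]))) + (F (\<Gamma> [c \<odot>\<^bsub>K\<^esub> x]) - \<phi> (wpl [c \<odot>\<^bsub>K\<^esub> x]))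
     - scale c (F (\<Gamma> [x]) - \<phi> (wpl [x])) \<in> ?N"
    by (blast intro: nul_diff nul_add nul_scale)
  then show ?case by (simp add: lin_ext_diff lin_ext_scale scale_diff algebra_simps)
next
  case (dot_mult \<Gamma> x y)
  let ?N = "N (tail_pts \<epsilon> \<epsilon>') (head_pts \<epsilon> \<epsilon>')"
  obtain \<phi> where \<phi>: "\<And>x y. \<phi> (x - y) = \<phi> x - \<phi> y" "\<And>c x. \<phi> (scale c x) = scale c (\<phi> x)"
    "\<And>x. x \<approx> 0 \<Longrightarrow> \<phi> x \<in> ?N" "\<And>u. set u \<subseteq> L \<Longrightarrow> F (\<Gamma> u) - \<phi> (wpl u) \<in> ?N"
    using Psi_context[OF dot_mult(1) dot_mult(2)[unfolded cobs_no_inner_eq] finite_tail_pts finite_head_pts] by metis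
  have l: "x \<otimes>\<^bsub>K\<^esub> y \<in> L" using L_closed dot_mult by blast
  have "wpl ([x] @ [y]) \<approx> mulL (wpl [x]) (wpl [y])" by (rule wpl_append) (use dot_mult in auto)
  also have "\<dots> \<approx> mulL (rep x) (rep y)"
    by (rule mulL_cong[OF wpl_single[OF dot_mult(3)] wpl_single[OF dot_mult(4)] rep_A[OF dot_mult(3)] rep_A[OF dot_mult(4)]])
  also have "\<dots> \<approx> rep (x \<otimes>\<^bsub>K\<^esub> y)" unfolding mult_L[OF dot_mult(3,4)] by (rule eqv_sym[OF rep_clA])
  also have "\<dots> \<approx> wpl [x \<otimes>\<^bsub>K\<^esub> y]" by (rule eqv_sym[OF wpl_single[OF l]])
  finally have "wpl [x, y] - wpl [x \<otimes>\<^bsub>K\<^esub> y] \<approx> 0" by (simp add: eqv_def)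
  from \<phi>(3)[OF this] have "\<phi> (wpl [x, y]) - \<phi> (wpl [x \<otimes>\<^bsub>K\<^esub> y]) \<in> ?N" by (simp add: \<phi>(1))
  moreover have "F (\<Gamma> [x, y]) - \<phi> (wpl [x, y]) \<in> ?N"
    "F (\<Gamma> [x \<otimes>\<^bsub>K\<^esub> y]) - \<phi> (wpl [x \<otimes>\<^bsub>K\<^esub> y]) \<in> ?N"
    by (rule \<phi>(4), use dot_mult l in simp)+
  ultimately have "(\<phi> (wpl [x, y]) - \<phi> (wpl [x \<otimes>\<^bsub>K\<^esub> y])) + (F (\<Gamma> [x, y]) - \<phi> (wpl [x, y]))
     - (F (\<Gamma> [x \<otimes>\<^bsub>K\<^esub> y]) - \<phi> (wpl [x \<otimes>\<^bsub>K\<^esub> y])) \<in> ?N"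
    by (blast intro: nul_diff nul_add)
  then show ?case by (simp add: lin_ext_diff lin_ext_add algebra_simps)
next
  case (dot_one \<Gamma>)
  let ?N = "N (tail_pts \<epsilon> \<epsilon>') (head_pts \<epsilon> \<epsilon>')"
  obtain \<phi> where \<phi>: "\<And>x y. \<phi> (x - y) = \<phi> x - \<phi> y" "\<And>c x. \<phi> (scale c x) = scale c (\<phi> x)"
    "\<And>x. x \<approx> 0 \<Longrightarrow> \<phi> x \<in> ?N" "\<And>u. set u \<subseteq> L \<Longrightarrow> F (\<Gamma> u) - \<phi> (wpl u) \<in> ?N"
    using Psi_context[OF dot_one(1) dot_one(2)[unfolded cobs_no_inner_eq] finite_tail_pts finite_head_pts] by metis
  have "wpl [\<one>\<^bsub>K\<^esub>] \<approx> rep \<one>\<^bsub>K\<^esub>" by (rule wpl_single[OF L_closed(4)])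
  \<comment> \<open>An equality of representatives and not just of classes: the empty word has the
    unit of \<open>K\<close> as its product, so \<open>rep\<close> is applied to the same
    class.\<close>
  also have "\<dots> = wpl []" by (simp add: wpl_def word_prod_def)
  finally have "wpl [\<one>\<^bsub>K\<^esub>] - wpl [] \<approx> 0" by (simp add: eqv_def)
  from \<phi>(3)[OF this] have "\<phi> (wpl [\<one>\<^bsub>K\<^esub>]) - \<phi> (wpl []) \<in> ?N" by (simp add: \<phi>(1))
  moreover have "F (\<Gamma> [\<one>\<^bsub>K\<^esub>]) - \<phi> (wpl [\<one>\<^bsub>K\<^esub>]) \<in> ?N" "F (\<Gamma> []) - \<phi> (wpl []) \<in> ?N"
    by (rule \<phi>(4), use L_closed(4) in simp)+
  ultimately have "(\<phi> (wpl [\<one>\<^bsub>K\<^esub>]) - \<phi> (wpl [])) + (F (\<Gamma> [\<one>\<^bsub>K\<^esub>]) - \<phi> (wpl [\<one>\<^bsub>K\<^esub>]))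
     - (F (\<Gamma> []) - \<phi> (wpl [])) \<in> ?N"
    by (blast intro: nul_diff nul_add)
  then show ?case by (simp add: lin_ext_diff lin_ext_add algebra_simps)
next
  case (circle D x)
  have x: "set [x] \<subseteq> L" using circle by simp
  have "trL (wpl [x]) = trace K x"
    using trL_cong[OF wpl_single[OF circle(2)]] trace_K[OF rep_A[OF circle(2)]] clA_rep[OF circle(2)] by simp
  then have "F (circ [x] + D) = scale (trace K x) (F D)"
    by (simp only: F_add F_circ[OF x] scale_mult_left mult_1_left)
  then show ?case by (simp add: lin_ext_diff)
qed (auto simp: lin_ext_add lin_ext_scale intro: nul_add nul_scale)

lemma rel_span: "r \<in> brauer_rel K \<epsilon> \<epsilon>' \<Longrightarrow> r \<in> span (br \<epsilon> \<epsilon>')"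
proof (induction rule: brauer_rel.induct)
  case (dot_add \<Gamma> x y)
  then show ?case using L_closed(1)
    by (intro span_diff span_gen) (auto simp: cobs_no_inner_eq intro: context_cob)
next
  case (dot_smult \<Gamma> x c)
  then show ?case using L_closed(3)
    by (intro span_diff span_gen span_scale) (auto simp: cobs_no_inner_eq intro: context_cob)
next
  case (dot_mult \<Gamma> x y)
  then show ?case using L_closed(2)
    by (intro span_diff span_gen) (auto simp: cobs_no_inner_eq intro: context_cob)
next
  case (dot_one \<Gamma>)
  then show ?case using L_closed(4)
    by (intro span_diff span_gen) (auto simp: cobs_no_inner_eq intro: context_cob)
next
  case (circle D x)
  then have "circ [x] + D \<in> br \<epsilon> \<epsilon>'" by (simp add: cobs_no_inner_eq cob_circ_iff)
  then show ?case using circle by (intro span_diff span_gen span_scale)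
next
  case (add f g) then show ?case by (intro span_add)
next
  case (scale f c) then show ?case by (intro span_scale)
qed simp

lemma preadditive_br: "preadditive (free_cat br :: (sign list, (('a, 'k) lin set, 'k) lin, 'k) lincat)"
  by (rule preadditive_free_cat) (rule cobs_no_inner_eq)

lemma rel_respects: "respects_contexts L \<epsilon> \<epsilon>' \<delta> \<delta>' Q \<Longrightarrow> r \<in> brauer_rel K \<epsilon> \<epsilon>' \<Longrightarrow>
    lin_ext (\<lambda>D. gen (Q D)) r \<in> brauer_rel K \<delta> \<delta>'"
  by (rule brauer_rel_respects) (use L_closed in auto)

lemma stack_rel_left:
  assumes r: "r \<in> brauer_rel K \<epsilon> \<epsilon>'" and g: "g \<in> span (br \<epsilon>' \<epsilon>'')"
  shows "stack_lin (length \<epsilon>') g r \<in> brauer_rel K \<epsilon> \<epsilon>''"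
  using g
proof (induction g rule: span_induct)
  case (add g E c)
  have "stack_lin (length \<epsilon>') (gen E) r \<in> brauer_rel K \<epsilon> \<epsilon>''"
    using rel_respects[OF respects_stack_left[OF add(2)] r] by (simp add: stack_lin_def)
  with add show ?case by (simp add: stack_lin_linear brauer_rel.intros(2,3) del: scale_simps(5))
qed (simp add: brauer_rel.zero)

lemma stack_rel_right:
  assumes f: "f \<in> span (br \<epsilon> \<epsilon>')" and r: "r \<in> brauer_rel K \<epsilon>' \<epsilon>''"
  shows "stack_lin (length \<epsilon>') r f \<in> brauer_rel K \<epsilon> \<epsilon>''"
  using f
proof (induction f rule: span_induct)
  case (add f E c)
  have "stack_lin (length \<epsilon>') r (gen E) \<in> brauer_rel K \<epsilon> \<epsilon>''"
    using rel_respects[OF respects_stack_right[OF add(2)] r] by (simp add: stack_lin_def)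
  with add show ?case by (simp add: stack_lin_linear brauer_rel.intros(2,3) del: scale_simps(5))
qed (simp add: brauer_rel.zero)

lemma preadditive_ideal_rel: "preadditive_ideal (free_cat br) (brauer_rel K)"
proof -
  interpret preadditive "free_cat br :: (sign list, (('a, 'k) lin set, 'k) lin, 'k) lincat"
    by (rule preadditive_br)
  show ?thesis
  proof
    fix X Y r assume "r \<in> brauer_rel K X Y"
    then show "r \<in> Arr (free_cat br) X Y" using rel_span by (simp add: free_cat_simps)
  next
    fix X Y r assume "r \<in> brauer_rel K X Y"
    then show "\<exists>n'\<in>brauer_rel K X Y. Add (free_cat br) X Y r n' = Zer (free_cat br) X Y"
      unfolding free_cat_simps using brauer_rel_diff[OF brauer_rel.zero, of r]
      by (intro bexI[of _ "- r"]) auto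
  qed (simp_all only: free_cat_simps stack_rel_left stack_rel_right brauer_rel.intros(1,2))
qed

text \<open>The first letter is moved into the context by \<open>context_Cons\<close> while the
  remaining ones are merged, so the induction has to range over all contexts.\<close>

lemma rel_word:
  assumes "\<Gamma> \<in> contexts" "\<Gamma> [] \<in> br \<epsilon> \<epsilon>'" "set w \<subseteq> L"
  shows "gen (\<Gamma> w) - gen (\<Gamma> [word_prod K w]) \<in> brauer_rel K \<epsilon> \<epsilon>'"
  using assms
proof (induction w arbitrary: \<Gamma>)
  case Nil
  have "gen (\<Gamma> []) - gen (\<Gamma> [\<one>\<^bsub>K\<^esub>]) = scale (- 1) (gen (\<Gamma> [\<one>\<^bsub>K\<^esub>]) - gen (\<Gamma> []) :: (('a, 'k) lin set, 'k) lin)"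
    by (simp add: scale_uminus del: scale_simps(5))
  then show ?case using brauer_rel.scale[OF brauer_rel.dot_one[OF Nil(1,2)], of "- 1"] by (simp add: word_prod_def)
next
  case (Cons x w)
  have x: "x \<in> L" "set w \<subseteq> L" using Cons.prems by auto
  have G: "\<Gamma> [x] \<in> br \<epsilon> \<epsilon>'"
    using context_cob[OF Cons.prems(1) Cons.prems(2)[unfolded cobs_no_inner_eq], of "[x]"] x by (simp add: cobs_no_inner_eq)
  have "gen (\<Gamma> (x # w)) - gen (\<Gamma> (x # [word_prod K w])) \<in> brauer_rel K \<epsilon> \<epsilon>'"
    by (rule Cons.IH[OF context_Cons[OF Cons.prems(1)] G x(2)])
  moreover have "gen (\<Gamma> [x, word_prod K w]) - gen (\<Gamma> [x \<otimes>\<^bsub>K\<^esub> word_prod K w]) \<in> brauer_rel K \<epsilon> \<epsilon>'"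
    by (rule brauer_rel.dot_mult[OF Cons.prems(1,2) x(1) word_prod_L[OF x(2)]])
  ultimately have "(gen (\<Gamma> (x # w)) - gen (\<Gamma> (x # [word_prod K w]))) +
     (gen (\<Gamma> [x, word_prod K w]) - gen (\<Gamma> [x \<otimes>\<^bsub>K\<^esub> word_prod K w])) \<in> brauer_rel K \<epsilon> \<epsilon>'"
    by (rule brauer_rel.add)
  then show ?case by (simp add: word_prod_def)
qed

text \<open>A closed diagram without inner endpoints consists of circles only; each of them is
  reduced to a single dot and replaced by its trace.\<close>

lemma rel_closed_scalar:
  assumes "f \<in> span (br [] [])"
  shows "\<exists>c. f - scale c 1 \<in> brauer_rel K [] []"
proof -
  have g: "\<exists>c. gen D - scale c 1 \<in> brauer_rel K [] []" if "D \<in> cob False L {} {}" for D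
    using that
  proof (induction D rule: diag_induct)
    case zero
    then show ?case using brauer_rel.zero by (intro exI[of _ 1]) simp
  next
    case (seg t h w D)
    then show ?case using cob_sg_split[OF seg.prems] by auto
  next
    case (circ w D)
    then have w: "set w \<subseteq> L" and D: "D \<in> cob False L {} {}" by (simp_all add: cob_circ_iff)
    obtain c where c: "gen D - scale c 1 \<in> brauer_rel K [] []" using circ.IH[OF D] by blast
    let ?t = "trace K (word_prod K w)"
    have D': "D \<in> br [] []" using D by (simp add: cobs_no_inner_eq pts_simps)
    have ctx: "(\<lambda>u. circ u + D) \<in> contexts" using context_circ[of "[]" "[]" D] by simp
    have "circ [] + D \<in> br [] []" using D by (simp add: cobs_no_inner_eq pts_simps cob_circ_iff)
    from rel_word[OF ctx this w]
    have "gen (circ w + D) - gen (circ [word_prod K w] + D) \<in> brauer_rel K [] []" .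
    moreover have "gen (circ [word_prod K w] + D) - scale ?t (gen D) \<in> brauer_rel K [] []"
      by (rule brauer_rel.circle[OF D' word_prod_L[OF w]])
    moreover have "scale ?t (gen D - scale c 1) \<in> brauer_rel K [] []" by (rule brauer_rel.scale[OF c])
    ultimately have "(gen (circ w + D) - gen (circ [word_prod K w] + D)) + (gen (circ [word_prod K w] + D) - scale ?t (gen D))
       + scale ?t (gen D - scale c 1) \<in> brauer_rel K [] []" by (intro brauer_rel.add)
    then have "gen (circ w + D) - scale (?t * c) 1 \<in> brauer_rel K [] []"
      by (simp add: scale_diff del: scale_simps(5))
    then show ?case by blast
  qed
  show ?thesis using assms
  proof (induction f rule: span_induct)
    case zero
    then show ?case using brauer_rel.zero by (intro exI[of _ 0]) simp
  next
    case (add f D c)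
    obtain a where a: "f - scale a 1 \<in> brauer_rel K [] []" using add by blast
    obtain b where b: "gen D - scale b 1 \<in> brauer_rel K [] []"
      using g[of D] add(2) by (auto simp: cobs_no_inner_eq pts_simps)
    have "(f - scale a 1) + scale c (gen D - scale b 1) \<in> brauer_rel K [] []"
      by (intro brauer_rel.add brauer_rel.scale a b)
    then have "f + scale c (gen D) - scale (a + c * b) 1 \<in> brauer_rel K [] []"
      by (simp add: scale_diff scale_add_left algebra_simps del: scale_simps(5))
    then show ?case by blast
  qed
qed

lemma Psi_one: "Psi 1 = 1"
  using lin_ext_single[of F 0 1] by (simp add: F_zero)

text \<open>A closed combination is a scalar modulo the relations, and \<open>Psi\<close> keeps this
  scalar visible because it respects the relations and sends \<open>1\<close> to \<open>1\<close>.
  Vanishing in the Brauer category thus becomes vanishing of an evaluation by \<alpha>.\<close>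

lemma rel_closed_iff:
  assumes f: "f \<in> span (br [] [])"
  shows "f \<in> brauer_rel K [] [] \<longleftrightarrow> eval_lin \<alpha> (Psi f) = 0"
proof
  assume "f \<in> brauer_rel K [] []"
  from Psi_rel[OF this] have "Psi f \<in> N {} {}" by (simp add: null_eq pts_simps)
  then show "eval_lin \<alpha> (Psi f) = 0" using nul_closed_iff[OF nul_span] by blast
next
  assume 0: "eval_lin \<alpha> (Psi f) = 0"
  obtain c where c: "f - scale c 1 \<in> brauer_rel K [] []" using rel_closed_scalar[OF f] by blast
  from Psi_rel[OF this] have "Psi f - scale c 1 \<in> N {} {}"
    by (simp add: null_eq pts_simps lin_ext_diff lin_ext_scale Psi_one del: scale_simps(5))
  then have "eval_lin \<alpha> (Psi f - scale c 1) = 0" using nul_closed_iff[OF nul_span] by blast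
  then have "c = 0" using 0 by (simp add: eval_lin_linear del: scale_simps(5))
  then show "f \<in> brauer_rel K [] []" using c by simp
qed

end

section \<open>Half-intervals are annihilated by the image\<close>

definition half :: "pt \<Rightarrow> 'l diag \<Rightarrow> bool" where
  "half p D \<longleftrightarrow> (\<exists>w D'. D = sg None (Some p) w + D' \<or> D = sg (Some p) None w + D')"

lemma halfE:
  assumes "half p D"
  obtains (head) w D' where "D = sg None (Some p) w + D'" | (tail) w D' where "D = sg (Some p) None w + D'"
  using assms unfolding half_def by (elim exE disjE)

lemma half_add:
  assumes "half p D"
  shows "half p (E + D)"
  using assms
proof (cases rule: halfE)
  case (head w D')
  have "E + D = sg None (Some p) w + (E + D')" unfolding head by (rule add.left_commute)
  then show ?thesis unfolding half_def by (intro exI disjI1)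
next
  case (tail w D')
  have "E + D = sg (Some p) None w + (E + D')" unfolding tail by (rule add.left_commute)
  then show ?thesis unfolding half_def by (intro exI disjI2)
qed

lemma half_map_diag:
  assumes "half p D"
  shows "half (\<rho> p) (map_diag \<rho> D)"
  using assms
proof (cases rule: halfE)
  case (head w D')
  have "map_diag \<rho> D = sg None (Some (\<rho> p)) w + map_diag \<rho> D'"
    unfolding head by (simp only: map_diag_simps option.map)
  then show ?thesis unfolding half_def by (intro exI disjI1)
next
  case (tail w D')
  have "map_diag \<rho> D = sg (Some (\<rho> p)) None w + map_diag \<rho> D'"
    unfolding tail by (simp only: map_diag_simps option.map)
  then show ?thesis unfolding half_def by (intro exI disjI2)
qed

lemma half_pts:
  assumes "half p D" "D \<in> cob i L T H" "finite T" "finite H"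
  shows "p \<in> T \<union> H"
  using assms(1)
proof (cases rule: halfE)
  case (head w D')
  from cob_sg_split(2)[OF assms(2)[unfolded this] assms(3,4)] show ?thesis by simp
next
  case (tail w D')
  from cob_sg_split(1)[OF assms(2)[unfolded this] assms(3,4)] show ?thesis by simp
qed

lemma cob_head_half: "D \<in> cob i L {} {h} \<Longrightarrow> half h D"
proof -
  assume D: "D \<in> cob i L {} {h}"
  then have "h \<in># heads D" using cob_pts(2)[OF D] by simp
  then obtain x w D' where e: "D = sg x (Some h) w + D'" by (rule split_head)
  have "set_option x \<subseteq> {}" by (rule cob_sg_split(1)[OF D[unfolded e]]) auto
  then have "x = None" by (cases x) auto
  then show ?thesis using e unfolding half_def by blast
qed

context evaluation_basis
begin

abbreviation Hf :: "pt set \<Rightarrow> pt set \<Rightarrow> ('a, 'k) lin set" where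
  "Hf T H \<equiv> span {D \<in> cob True S T H. \<exists>p. half p D}"

lemma Hf_mult:
  assumes "x \<in> Sp T H" "y \<in> Hf T' H'" "T \<inter> T' = {}" "H \<inter> H' = {}"
    "finite T" "finite T'" "finite H" "finite H'"
  shows "x * y \<in> Hf (T \<union> T') (H \<union> H')"
proof (rule mult_span[OF assms(1,2)])
  fix d e assume d: "d \<in> cob True S T H" and e: "e \<in> {D \<in> cob True S T' H'. \<exists>p. half p D}"
  then obtain p where p: "half p e" by blast
  have "d + e \<in> cob True S (T \<union> T') (H \<union> H')" by (rule cob_add[OF d]) (use e assms in auto)
  then show "d + e \<in> {D \<in> cob True S (T \<union> T') (H \<union> H'). \<exists>p. half p D}" using half_add[OF p] by blast
qed

lemma Hf_halves:
  assumes v: "v \<in> Sp {} {h}" and w: "w \<in> Sp {t} {}"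
  shows "v * w \<in> Hf {t} {h}"
proof -
  have "v \<in> Hf {} {h}" using v cob_head_half by blast
  from Hf_mult[OF w this] show ?thesis by (simp add: mult.commute)
qed

text \<open>The arc of the image whose tail is \<open>p\<close> carries an element of
  \<open>K\<close>, so \<open>kill_tail\<close> applies to it; the other components only multiply
  the null result.\<close>

lemma kill_F_tail:
  assumes D: "D \<in> cob False L T H" and p: "p \<in> T" "p \<notin> H" and v: "v \<in> Sp {} {p}" and f: "finite T" "finite H"
  shows "glue_lin {p} (v * F D) \<in> N (T - {p}) H"
proof -
  have "p \<in># tails D" using cob_pts(1)[OF D f] p by simp
  then obtain x w D' where e: "D = sg (Some p) x w + D'" by (rule split_tail)
  note sp = cob_sg_split[OF D[unfolded e] f]
  obtain h where h: "x = Some h" "h \<in> H" using sp(2,4) by auto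
  have D': "F D' \<in> Sp (T - {p}) (H - {h})" using F_span[OF sp(5)] f h by simp
  have "glue_lin {p} (v * F D) = glue_lin {p} (v * arc p h (wpl w) * F D')"
    unfolding e h F_add F_sg by (simp add: mult.assoc)
  also have "\<dots> = glue_lin {p} (v * arc p h (wpl w)) * F D'"
    by (rule glue_lin_mult[OF D']) (use p f in auto)
  also have "\<dots> \<in> N ({} \<union> (T - {p})) ({h} \<union> (H - {h}))"
    by (rule nul_mult[OF kill_tail[OF wpl_KK[OF sp(3)] v] D']) (use p h f in auto)
  finally show ?thesis using h by (simp add: insert_absorb)
qed

lemma kill_F_head:
  assumes D: "D \<in> cob False L T H" and p: "p \<in> H" "p \<notin> T" and v: "v \<in> Sp {p} {}" and f: "finite T" "finite H"
  shows "glue_lin {p} (v * F D) \<in> N T (H - {p})"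
proof -
  have "p \<in># heads D" using cob_pts(2)[OF D f] p by simp
  then obtain x w D' where e: "D = sg x (Some p) w + D'" by (rule split_head)
  note sp = cob_sg_split[OF D[unfolded e] f]
  obtain t where t: "x = Some t" "t \<in> T" using sp(1,4) by auto
  have D': "F D' \<in> Sp (T - {t}) (H - {p})" using F_span[OF sp(5)] f t by simp
  have "glue_lin {p} (v * F D) = glue_lin {p} (v * arc t p (wpl w) * F D')"
    unfolding e t F_add F_sg by (simp add: mult.assoc)
  also have "\<dots> = glue_lin {p} (v * arc t p (wpl w)) * F D'"
    by (rule glue_lin_mult[OF D']) (use p f in auto)
  also have "\<dots> \<in> N ({t} \<union> (T - {t})) ({} \<union> (H - {p}))"
    by (rule nul_mult[OF kill_head[OF wpl_KK[OF sp(3)] v] D']) (use p t f in auto)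
  finally show ?thesis using t by (simp add: insert_absorb)
qed

lemma kill_Psi_tail:
  assumes "f \<in> span (cob False L T H)" and "p \<in> T" "p \<notin> H" "v \<in> Sp {} {p}" "finite T" "finite H"
  shows "glue_lin {p} (v * Psi f) \<in> N (T - {p}) H"
  using assms(1)
proof (induction f rule: span_induct)
  case (add f D c)
  have "glue_lin {p} (v * Psi f) + scale c (glue_lin {p} (v * F D)) \<in> N (T - {p}) H"
    by (rule nul_add[OF add(3) nul_scale[OF kill_F_tail[OF add(2) assms(2-6)]]])
  then show ?case
    by (simp add: lin_ext_add lin_ext_scale distrib_left scale_mult_right glue_lin_linear del: scale_simps(5))
qed (simp add: glue_lin_linear)

lemma kill_Psi_head:
  assumes "f \<in> span (cob False L T H)" and "p \<in> H" "p \<notin> T" "v \<in> Sp {p} {}" "finite T" "finite H"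
  shows "glue_lin {p} (v * Psi f) \<in> N T (H - {p})"
  using assms(1)
proof (induction f rule: span_induct)
  case (add f D c)
  have "glue_lin {p} (v * Psi f) + scale c (glue_lin {p} (v * F D)) \<in> N T (H - {p})"
    by (rule nul_add[OF add(3) nul_scale[OF kill_F_head[OF add(2) assms(2-6)]]])
  then show ?case
    by (simp add: lin_ext_add lin_ext_scale distrib_left scale_mult_right glue_lin_linear del: scale_simps(5))
qed (simp add: glue_lin_linear)

text \<open>The gluing at \<open>p\<close>, where the half-interval meets the image, is performed
  first and already gives a null combination; \<open>nul_ideal\<close> takes care of the remaining
  points of \<open>P\<close>.\<close>

lemma kill_glue:
  assumes f: "f \<in> span (cob False L T H)" and D: "D \<in> cob True S T' H'" and h: "half p D" and p: "p \<in> P"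
    and d: "T \<inter> T' = {}" "H \<inter> H' = {}" "T' \<inter> H' = {}" and P: "P \<subseteq> (T \<union> T') \<inter> (H \<union> H')"
    and fin: "finite T" "finite T'" "finite H" "finite H'"
    and T'': "T'' = T \<union> T' - P" and H'': "H'' = H \<union> H' - P"
  shows "glue_lin P (Psi f * gen D) \<in> N T'' H''"
proof -
  have fP: "finite P" using P fin by (meson finite_Int finite_Un finite_subset)
  have split: "glue_lin P x = glue_lin (P - {p}) (glue_lin {p} x)" for x :: "('a, 'k) lin"
    using glue_lin_Un[of "P - {p}" "{p}" x] fP p by (simp add: insert_absorb)
  from h show ?thesis
  proof (cases rule: halfE)
    case e: (head w D')
    note sp = cob_sg_split[OF D[unfolded e] fin(2,4)]
    have pp: "p \<in> T" "p \<notin> H" "p \<notin> T'" "p \<in> H'" using sp(2) d p P by auto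
    have v: "gen (sg None (Some p) w) \<in> Sp {} {p}" using sp(3) by (simp add: cob_def)
    have D': "gen D' \<in> Sp T' (H' - {p})" using sp(5) by simp
    have "Psi f * gen D = gen (sg None (Some p) w) * Psi f * gen D'"
      unfolding e gen_mult_gen[symmetric] by (simp only: mult_ac)
    then have "glue_lin P (Psi f * gen D) = glue_lin (P - {p}) (glue_lin {p} (gen (sg None (Some p) w) * Psi f) * gen D')"
      unfolding split by (subst glue_lin_mult[OF D', symmetric]) (use pp fin in auto)
    also have "\<dots> \<in> N T'' H''"
      by (rule nul_ideal[OF kill_Psi_tail[OF f pp(1,2) v fin(1,3)] D'])
        (use pp d P fin T'' H'' p in auto)
    finally show ?thesis .
  next
    case e: (tail w D')
    note sp = cob_sg_split[OF D[unfolded e] fin(2,4)]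
    have pp: "p \<in> H" "p \<notin> T" "p \<notin> H'" "p \<in> T'" using sp(1) d p P by auto
    have v: "gen (sg (Some p) None w) \<in> Sp {p} {}" using sp(3) by (simp add: cob_def)
    have D': "gen D' \<in> Sp (T' - {p}) H'" using sp(5) by simp
    have "Psi f * gen D = gen (sg (Some p) None w) * Psi f * gen D'"
      unfolding e gen_mult_gen[symmetric] by (simp only: mult_ac)
    then have "glue_lin P (Psi f * gen D) = glue_lin (P - {p}) (glue_lin {p} (gen (sg (Some p) None w) * Psi f) * gen D')"
      unfolding split by (subst glue_lin_mult[OF D', symmetric]) (use pp fin in auto)
    also have "\<dots> \<in> N T'' H''"
      by (rule nul_ideal[OF kill_Psi_head[OF f pp(1,2) v fin(1,3)] D'])
        (use pp d P fin T'' H'' p in auto)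
    finally show ?thesis .
  qed
qed

text \<open>In \<open>C_alpha\<close> this says that \<open>x\<close> lies in the image of the
  Brauer diagrams plus the span of the diagrams with a half-interval. By \<open>good_mult\<close> it
  suffices to prove it for single components.\<close>

definition good :: "pt set \<Rightarrow> pt set \<Rightarrow> ('a, 'k) lin \<Rightarrow> bool" where
  "good T H x \<longleftrightarrow> (\<exists>f\<in>span (cob False L T H). \<exists>y\<in>Hf T H. x - Psi f - y \<in> N T H)"

lemma goodI: "f \<in> span (cob False L T H) \<Longrightarrow> y \<in> Hf T H \<Longrightarrow> x - Psi f - y \<in> N T H \<Longrightarrow> good T H x"
  unfolding good_def by blast

lemma goodE:
  assumes "good T H x"
  obtains f y where "f \<in> span (cob False L T H)" "y \<in> Hf T H" "x - Psi f - y \<in> N T H"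
  using assms unfolding good_def by (elim bexE)

lemma good_add:
  assumes "good T H x" "good T H x'" shows "good T H (x + scale c x')"
proof -
  obtain f y where 1: "f \<in> span (cob False L T H)" "y \<in> Hf T H" "x - Psi f - y \<in> N T H"
    using assms(1) by (rule goodE)
  obtain f' y' where 2: "f' \<in> span (cob False L T H)" "y' \<in> Hf T H" "x' - Psi f' - y' \<in> N T H"
    using assms(2) by (rule goodE)
  have "(x - Psi f - y) + scale c (x' - Psi f' - y') \<in> N T H" by (rule nul_add[OF 1(3) nul_scale[OF 2(3)]])
  then have "(x + scale c x') - Psi (f + scale c f') - (y + scale c y') \<in> N T H"
    by (simp add: lin_ext_add lin_ext_scale scale_diff scale_add algebra_simps)
  moreover have "f + scale c f' \<in> span (cob False L T H)" by (rule span_add[OF 1(1) span_scale[OF 2(1)]])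
  moreover have "y + scale c y' \<in> Hf T H" by (rule span_add[OF 1(2) span_scale[OF 2(2)]])
  ultimately show ?thesis by (intro goodI)
qed

lemma good_mult:
  assumes "good T H x" "good T' H' x'" "x' \<in> Sp T' H'" and d: "T \<inter> T' = {}" "H \<inter> H' = {}"
    and fin: "finite T" "finite T'" "finite H" "finite H'"
  shows "good (T \<union> T') (H \<union> H') (x * x')"
proof -
  obtain f y where 1: "f \<in> span (cob False L T H)" "y \<in> Hf T H" "x - Psi f - y \<in> N T H"
    using assms(1) by (rule goodE)
  obtain f' y' where 2: "f' \<in> span (cob False L T' H')" "y' \<in> Hf T' H'" "x' - Psi f' - y' \<in> N T' H'"
    using assms(2) by (rule goodE)
  have Pf: "Psi f \<in> Sp T H" by (rule Psi_span[OF 1(1) fin(1,3)])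
  \<comment> \<open>The null errors are combined so that each remaining correction term has a factor
    with a half-interval: \<open>x' * y\<close> and \<open>Psi f * y'\<close>.\<close>
  have "(x - Psi f - y) * x' + (x' - Psi f' - y') * Psi f \<in> N (T \<union> T') (H \<union> H')"
    using nul_mult[OF 1(3) assms(3) d fin] nul_mult[OF 2(3) Pf] d fin by (intro nul_add) (auto simp: Un_commute Int_commute)
  also have "(x - Psi f - y) * x' + (x' - Psi f' - y') * Psi f = x * x' - Psi (f * f') - (x' * y + Psi f * y')"
    by (simp add: Psi_mult algebra_simps)
  finally show ?thesis
  proof (rule goodI[rotated 2])
    show "f * f' \<in> span (cob False L (T \<union> T') (H \<union> H'))" by (rule mult_cob_span[OF 1(1) 2(1) d fin])
    have "x' * y \<in> Hf (T' \<union> T) (H' \<union> H)" by (rule Hf_mult[OF assms(3) 1(2)]) (use d fin in auto)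
    then show "x' * y + Psi f * y' \<in> Hf (T \<union> T') (H \<union> H')"
      using Hf_mult[OF Pf 2(2) d fin] by (intro span_add) (simp_all add: Un_commute)
  qed
qed

lemma good_closed: "x \<in> Sp {} {} \<Longrightarrow> good {} {} x"
proof (rule goodI[of "scale (eval_lin \<alpha> x) 1" _ _ 0])
  show "scale (eval_lin \<alpha> x) 1 \<in> span (cob False L {} {})"
    by (rule span_scale) (use cob_zero in simp)
  show "x - Psi (scale (eval_lin \<alpha> x) 1) - 0 \<in> N {} {}" if "x \<in> Sp {} {}"
    using closed_scalar[OF that, of \<alpha>] by (simp only: lin_ext_scale Psi_one diff_0_right)
qed simp

text \<open>Multiplying the arc by the unit of \<open>K\<close> gives an element of
  \<open>K\<close>, and by \<open>mulL_oneL\<close> the difference is a sum of pairs: the arc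
  applied to \<open>V i\<close>, next to \<open>W i\<close>.\<close>

lemma good_arc:
  assumes w: "set w \<subseteq> S"
  shows "good {t} {h} (gen (sg (Some t) (Some h) w))"
proof -
  let ?x = "gen (sg (Some (Top (Suc 0))) (Some (Top 0)) w) :: ('a, 'k) lin"
  have x: "?x \<in> A" by (rule sg_cob[OF w])
  let ?m = "mulL ?x oneL"
  have m: "?m \<in> KK" by (rule KK_mulL_left[OF x oneL_KK])
  let ?k = "clA ?m"
  have k: "?k \<in> L" using m K_carrier_eq by blast
  define u where "u i = glue_lin {Mid 0} (put (Mid 0) (V i) * arc (Mid 0) (Top 0) ?x)" for i
  have u: "u i \<in> Sp {} {Top 0}" if i: "i < n" for i
  proof -
    have "put (Mid 0) (V i) * arc (Mid 0) (Top 0) ?x \<in> Sp ({} \<union> {Mid 0}) ({Mid 0} \<union> {Top 0})"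
      by (rule mult_cob_span[OF put_span_head[OF V_span[OF i]] arc_span[OF x]]) auto
    from glue_lin_span[OF this, of "{Mid 0}"] show ?thesis by (simp add: u_def insert_Diff_if)
  qed
  show ?thesis
  proof (rule goodI)
    show "gen (sg (Some t) (Some h) [?k]) \<in> span (cob False L {t} {h})" by (rule sg_cob) (use k in simp)
    show "(\<Sum>i<n. put h (u i) * put t (W i)) \<in> Hf {t} {h}"
      by (rule span_sum) (use Hf_halves put_span_head[OF u] put_span_tail[OF W_span] in blast)
    have "wpl [?k] \<approx> ?m" using eqv_trans[OF wpl_single[OF k] rep_clA] .
    then have "arc t h (?m - wpl [?k]) \<in> N {t} {h}"
      using eqv_sym by (intro nul_arc) (simp add: eqv_def)
    moreover have "arc t h ?m = gen (sg (Some t) (Some h) w) - (\<Sum>i<n. put h (u i) * put t (W i))"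
    proof -
      have "arc t h (u i) = put h (u i)" if "i < n" for i
        by (rule relabel_cong[OF u[OF that]]) auto
      then show ?thesis unfolding mulL_oneL[OF x] u_def[symmetric]
        by (simp add: relabel_linear relabel_sum relabel_mult relabel_put)
    qed
    ultimately show "gen (sg (Some t) (Some h) w) - Psi (gen (sg (Some t) (Some h) [?k]))
        - (\<Sum>i<n. put h (u i) * put t (W i)) \<in> N {t} {h}"
      by (simp add: relabel_linear F_sg algebra_simps)
  qed
qed

text \<open>Arcs are covered by \<open>good_arc\<close> and half-intervals lie in \<open>Hf\<close>.
  Floating intervals and circles are scalars, hence multiples of the image of the empty
  diagram.\<close>

lemma good_diag: "D \<in> cob True S T H \<Longrightarrow> finite T \<Longrightarrow> finite H \<Longrightarrow> good T H (gen D)"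
proof (induction D arbitrary: T H rule: diag_induct)
  case zero
  then have "T = {}" "H = {}" by (auto simp: cob_def mset_set_empty_iff)
  then show ?case using good_closed[OF one_span] by simp
next
  case (seg t h w D)
  note sp = cob_sg_split[OF seg.prems]
  have D: "gen D \<in> Sp (T - set_option t) (H - set_option h)" using sp(5) by simp
  have "good (set_option t) (set_option h) (gen (sg t h w))"
  proof (cases t; cases h)
    fix p q assume "t = Some p" "h = Some q"
    then show ?thesis using good_arc[OF sp(3)] by simp
  next
    fix q assume e: "t = None" "h = Some q"
    have "half q (sg None (Some q) w + 0)" unfolding half_def by blast
    then have "gen (sg t h w) \<in> Hf {} {q}" using sp(3) e by (auto simp: cob_def)
    then show ?thesis using e by (intro goodI[of 0 _ _ "gen (sg t h w)"]) simp_all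
  next
    fix p assume e: "t = Some p" "h = None"
    have "half p (sg (Some p) None w + 0)" unfolding half_def by blast
    then have "gen (sg t h w) \<in> Hf {p} {}" using sp(3) e by (auto simp: cob_def)
    then show ?thesis using e by (intro goodI[of 0 _ _ "gen (sg t h w)"]) simp_all
  next
    assume e: "t = None" "h = None"
    then show ?thesis using sp(3) by (simp, intro good_closed) (simp add: cob_def)
  qed
  then have "good (set_option t \<union> (T - set_option t)) (set_option h \<union> (H - set_option h)) (gen (sg t h w) * gen D)"
    by (rule good_mult[OF _ seg.IH[OF sp(5)] D]) (use seg.prems in auto)
  moreover have "set_option t \<union> (T - set_option t) = T" "set_option h \<union> (H - set_option h) = H" using sp(1,2) by auto
  ultimately show ?case by (simp only: gen_mult_gen)
next
  case (circ w D)
  then have w: "set w \<subseteq> S" and D: "D \<in> cob True S T H" by (simp_all add: cob_circ_iff)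
  have "good {} {} (gen (circ w))" by (rule good_closed) (use w in \<open>simp add: cob_def\<close>)
  then have "good ({} \<union> T) ({} \<union> H) (gen (circ w) * gen D)"
    by (rule good_mult[OF _ circ.IH[OF D circ.prems(2,3)]]) (use D circ.prems in auto)
  then show ?case by (simp only: gen_mult_gen Un_empty_left)
qed

lemma good_span: "x \<in> Sp T H \<Longrightarrow> finite T \<Longrightarrow> finite H \<Longrightarrow> good T H x"
proof (induction x rule: span_induct)
  case zero
  show ?case by (rule goodI[of 0 _ _ 0]) simp_all
next
  case (add x D c)
  then show ?case using good_add good_diag by blast
qed

section \<open>Negligible morphisms\<close>

lemma closure_lin_eq:
  fixes z :: "('l, 'f::field) lin"
  assumes z: "z \<in> span (cob i B (tail_pts \<epsilon> \<epsilon>) (head_pts \<epsilon> \<epsilon>))"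
  shows "closure_lin (length \<epsilon>) z = glue_lin (Mid ` {..<length \<epsilon>}) (relabel (relab Mid Mid) z)"
    and "relabel (relab Mid Mid) z \<in> span (cob i B (Mid ` {..<length \<epsilon>}) (Mid ` {..<length \<epsilon>}))"
proof -
  show "closure_lin (length \<epsilon>) z = glue_lin (Mid ` {..<length \<epsilon>}) (relabel (relab Mid Mid) z)"
    unfolding closure_lin_def glue_lin_def relabel_def lin_ext_lin_ext
  proof (rule lin_ext_cong)
    fix D assume "D \<in> Poly_Mapping.keys z"
    then have "D \<in> cob i B (tail_pts \<epsilon> \<epsilon>) (head_pts \<epsilon> \<epsilon>)" using z by blast
    from closure_diag_eq(1)[OF this] show "gen (closure_diag (length \<epsilon>) D)
      = (lin_ext (\<lambda>D. gen (glue_set (Mid ` {..<length \<epsilon>}) D)) (gen (map_diag (relab Mid Mid) D)) :: ('l, 'f) lin)"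
      by simp
  qed
  show "relabel (relab Mid Mid) z \<in> span (cob i B (Mid ` {..<length \<epsilon>}) (Mid ` {..<length \<epsilon>}))"
    unfolding relabel_def by (rule lin_ext_span[OF z]) (use closure_diag_eq(2) in simp)
qed

lemma eval_closure_stack_lin:
  assumes x: "x \<in> span (cobs S \<epsilon> \<epsilon>')" and z: "z \<in> span (cobs S \<epsilon>' \<epsilon>)"
  shows "eval_lin \<alpha> (closure_lin (length \<epsilon>) (stack_lin (length \<epsilon>') z x))
    = eval_lin \<alpha> (glue_lin (tail_pts \<epsilon> \<epsilon>' \<union> head_pts \<epsilon> \<epsilon>') (x * relabel (relab Top Bot) z))"
  using x
proof (induction x rule: span_induct)
  case (add x D c)
  have "eval_lin \<alpha> (closure_lin (length \<epsilon>) (stack_lin (length \<epsilon>') z (gen D)))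
    = eval_lin \<alpha> (glue_lin (tail_pts \<epsilon> \<epsilon>' \<union> head_pts \<epsilon> \<epsilon>') (gen D * relabel (relab Top Bot) z))"
    using z
  proof (induction z rule: span_induct)
    case (add z E b)
    then show ?case using eval_closure_stack[OF \<open>D \<in> _\<close>[unfolded cobs_eq] \<open>E \<in> _\<close>[unfolded cobs_eq], of \<alpha>]
      by (simp add: stack_lin_linear closure_lin_linear relabel_linear eval_lin_linear glue_lin_linear distrib_left
          scale_mult_right mult_single del: scale_simps(5)) (simp add: closure_lin_def)
  qed (simp add: closure_lin_linear eval_lin_linear glue_lin_linear relabel_linear)
  with add show ?case
    by (simp add: stack_lin_linear closure_lin_linear eval_lin_linear glue_lin_linear distrib_right
        scale_mult_left del: scale_simps(5))
qed (simp add: closure_lin_linear eval_lin_linear glue_lin_linear)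

text \<open>The identity is one of the tests in the definition of \<open>null\<close>.\<close>

lemma closure_null:
  assumes x: "x \<in> null S \<alpha> \<epsilon> \<epsilon>"
  shows "eval_lin \<alpha> (closure_lin (length \<epsilon>) x) = 0"
proof -
  have "stack_lin (length \<epsilon>) (gen (id_diag \<epsilon>)) x = x"
    using category.Cmp_Ide_left[OF preadditive.axioms(1)[OF preadditive_free_cat[OF cobs_eq]], where X = \<epsilon> and Y = \<epsilon> and f = x]
      null_span[OF x] by (simp add: free_cat_simps)
  moreover have "id_diag \<epsilon> \<in> cobs S \<epsilon> \<epsilon>" unfolding cobs_eq by (rule id_diag_cob)
  ultimately show ?thesis using x unfolding null_def by fastforce
qed

lemma Psi_closure:
  assumes z: "z \<in> span (br \<epsilon> \<epsilon>)"
  shows "eval_lin \<alpha> (Psi (closure_lin (length \<epsilon>) z)) = eval_lin \<alpha> (closure_lin (length \<epsilon>) (Psi z))"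
proof -
  note z' = z[unfolded cobs_no_inner_eq] and Pz = Psi_br[OF z, unfolded cobs_eq]
  have "Psi (glue_lin (Mid ` {..<length \<epsilon>}) (relabel (relab Mid Mid) z))
     - glue_lin (Mid ` {..<length \<epsilon>}) (Psi (relabel (relab Mid Mid) z)) \<in> N (Mid ` {..<length \<epsilon>} - Mid ` {..<length \<epsilon>}) (Mid ` {..<length \<epsilon>} - Mid ` {..<length \<epsilon>})"
    by (rule Psi_glue[OF closure_lin_eq(2)[OF z']]) auto
  then have "Psi (closure_lin (length \<epsilon>) z) - closure_lin (length \<epsilon>) (Psi z) \<in> N {} {}"
    by (simp add: closure_lin_eq(1)[OF z'] closure_lin_eq(1)[OF Pz] Psi_relabel[OF z'])
  then show ?thesis using nul_closed_iff[OF nul_span] by (fastforce simp: eval_lin_linear)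
qed

section \<open>Classes in the Frobenius-Brauer category\<close>

abbreviation "bcls \<equiv> coset (free_cat br) (brauer_rel K)"
abbreviation "CB' \<equiv> C_brauer' K"
abbreviation "CB \<equiv> C_brauer K"

lemma CB'_eq: "CB' = quot (free_cat br) (brauer_rel K)"
  by (simp add: C_brauer'_def)

lemma mem_bcls: "g \<in> bcls \<epsilon> \<epsilon>' f \<longleftrightarrow> g - f \<in> brauer_rel K \<epsilon> \<epsilon>'"
  by (auto simp: coset_def free_cat_simps image_iff algebra_simps intro: bexI[of _ "g - f"])

lemma bcls_refl: "f \<in> bcls \<epsilon> \<epsilon>' f"
  using brauer_rel.zero by (simp add: mem_bcls)

lemma bcls_eqI:
  assumes "f - g \<in> brauer_rel K \<epsilon> \<epsilon>'" shows "bcls \<epsilon> \<epsilon>' f = bcls \<epsilon> \<epsilon>' g"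
proof -
  have "h - f \<in> brauer_rel K \<epsilon> \<epsilon>' \<longleftrightarrow> h - g \<in> brauer_rel K \<epsilon> \<epsilon>'" for h
    using brauer_rel.add[OF _ assms, of "h - f"] brauer_rel_diff[OF _ assms, of "h - g"] by auto
  then show ?thesis unfolding set_eq_iff mem_bcls by blast
qed

lemma bcls_eq_iff: "bcls \<epsilon> \<epsilon>' f = bcls \<epsilon> \<epsilon>' g \<longleftrightarrow> f - g \<in> brauer_rel K \<epsilon> \<epsilon>'"
  using bcls_eqI bcls_refl mem_bcls by metis

lemma Obj_CB': "Obj CB' = UNIV"
  by (simp add: CB'_eq quot_def free_cat_simps)

lemma Arr_CB': "Arr CB' \<epsilon> \<epsilon>' = bcls \<epsilon> \<epsilon>' ` span (br \<epsilon> \<epsilon>')"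
  by (simp add: CB'_eq quot_def free_cat_simps)

lemma Zer_CB': "Zer CB' \<epsilon> \<epsilon>' = bcls \<epsilon> \<epsilon>' 0"
  by (simp add: CB'_eq quot_def free_cat_simps)

lemma Ide_CB': "Ide CB' \<epsilon> = bcls \<epsilon> \<epsilon> (gen (id_diag \<epsilon>))"
  by (simp add: CB'_eq quot_def free_cat_simps)

lemma Cmp_CB':
  "f \<in> span (br \<epsilon> \<epsilon>') \<Longrightarrow> g \<in> span (br \<epsilon>' \<epsilon>'') \<Longrightarrow>
    Cmp CB' \<epsilon> \<epsilon>' \<epsilon>'' (bcls \<epsilon>' \<epsilon>'' g) (bcls \<epsilon> \<epsilon>' f) = bcls \<epsilon> \<epsilon>'' (stack_lin (length \<epsilon>') g f)"
  using preadditive_ideal.Cmp_quot[OF preadditive_ideal_rel, where X = \<epsilon> and Y = \<epsilon>' and Z = \<epsilon>'' and f = f and g = g]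
  by (simp add: CB'_eq free_cat_simps)

lemma Add_CB':
  "f \<in> span (br \<epsilon> \<epsilon>') \<Longrightarrow> g \<in> span (br \<epsilon> \<epsilon>') \<Longrightarrow>
    Add CB' \<epsilon> \<epsilon>' (bcls \<epsilon> \<epsilon>' f) (bcls \<epsilon> \<epsilon>' g) = bcls \<epsilon> \<epsilon>' (f + g)"
  using preadditive_ideal.Add_quot[OF preadditive_ideal_rel, where X = \<epsilon> and Y = \<epsilon>' and f = f and g = g]
  by (simp add: CB'_eq free_cat_simps)

lemma preadditive_CB': "preadditive CB'"
  unfolding CB'_eq by (rule preadditive_ideal.preadditive_quot[OF preadditive_ideal_rel])

lemma brauer_closure_bcls:
  "brauer_closure K \<epsilon> (bcls \<epsilon> \<epsilon> f) = bcls [] [] (closure_lin (length \<epsilon>) f)"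
proof -
  have "bcls [] [] (closure_lin (length \<epsilon>) g) = bcls [] [] (closure_lin (length \<epsilon>) f)"
    if "g \<in> bcls \<epsilon> \<epsilon> f" for g
  proof (rule bcls_eqI)
    have "g - f \<in> brauer_rel K \<epsilon> \<epsilon>" using that by (simp add: mem_bcls)
    from rel_respects[OF respects_closure this]
    show "closure_lin (length \<epsilon>) g - closure_lin (length \<epsilon>) f \<in> brauer_rel K [] []"
      by (simp add: closure_lin_def lin_ext_diff)
  qed
  then have "brauer_closure K \<epsilon> (bcls \<epsilon> \<epsilon> f) = (\<Union>g\<in>bcls \<epsilon> \<epsilon> f. bcls [] [] (closure_lin (length \<epsilon>) f))"
    unfolding brauer_closure_def by (rule SUP_cong[OF refl])
  also have "\<dots> = bcls [] [] (closure_lin (length \<epsilon>) f)"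
    by (rule SUP_const) (use bcls_refl in blast)
  finally show ?thesis .
qed

lemma stack_br: "f \<in> span (br \<epsilon> \<epsilon>') \<Longrightarrow> g \<in> span (br \<epsilon>' \<epsilon>'') \<Longrightarrow> stack_lin (length \<epsilon>') g f \<in> span (br \<epsilon> \<epsilon>'')"
  unfolding cobs_no_inner_eq by (rule stack_lin_span)

lemma closure_br: "z \<in> span (br \<epsilon> \<epsilon>) \<Longrightarrow> closure_lin (length \<epsilon>) z \<in> span (br [] [])"
  unfolding cobs_no_inner_eq closure_lin_def pts_simps
  by (erule lin_ext_span) (rule span_gen, rule closure_diag_cob)

text \<open>By \<open>rel_closed_iff\<close> the closure in the Brauer category is detected by
  evaluating the closure of the images, and that closure is a gluing along all outer points.\<close>

lemma Psi_pairing: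
  assumes f: "f \<in> span (br \<epsilon> \<epsilon>')" and g: "g \<in> span (br \<epsilon>' \<epsilon>)"
  shows "closure_lin (length \<epsilon>) (stack_lin (length \<epsilon>') g f) \<in> brauer_rel K [] [] \<longleftrightarrow>
    eval_lin \<alpha> (glue_lin (tail_pts \<epsilon> \<epsilon>' \<union> head_pts \<epsilon> \<epsilon>') (Psi f * relabel (relab Top Bot) (Psi g))) = 0"
proof -
  note gf = stack_br[OF f g]
  have "eval_lin \<alpha> (Psi (closure_lin (length \<epsilon>) (stack_lin (length \<epsilon>') g f)))
    = eval_lin \<alpha> (closure_lin (length \<epsilon>) (Psi (stack_lin (length \<epsilon>') g f)))"
    by (rule Psi_closure[OF gf])
  also have "\<dots> = eval_lin \<alpha> (closure_lin (length \<epsilon>) (stack_lin (length \<epsilon>') (Psi g) (Psi f)))"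
    using closure_null[OF Psi_stack[OF f g]]
    by (simp add: closure_lin_def lin_ext_diff eval_lin_linear)
  also have "\<dots> = eval_lin \<alpha> (glue_lin (tail_pts \<epsilon> \<epsilon>' \<union> head_pts \<epsilon> \<epsilon>') (Psi f * relabel (relab Top Bot) (Psi g)))"
    by (rule eval_closure_stack_lin[OF Psi_br[OF f] Psi_br[OF g]])
  finally show ?thesis using rel_closed_iff[OF closure_br[OF gf]] by simp
qed

lemma swap_span:
  assumes "g \<in> span (cob i B (tail_pts \<epsilon>' \<epsilon>) (head_pts \<epsilon>' \<epsilon>))"
  shows "relabel (relab Top Bot) g \<in> span (cob i B (head_pts \<epsilon> \<epsilon>') (tail_pts \<epsilon> \<epsilon>'))"
  unfolding relabel_def by (rule lin_ext_span[OF assms]) (use cob_swap in simp)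

lemma swap_span2:
  fixes g :: "('l, 'f::field) lin"
  assumes "g \<in> span (cob i B (head_pts \<epsilon> \<epsilon>') (tail_pts \<epsilon> \<epsilon>'))"
  shows "relabel (relab Top Bot) g \<in> span (cob i B (tail_pts \<epsilon>' \<epsilon>) (head_pts \<epsilon>' \<epsilon>))"
    and "relabel (relab Top Bot) (relabel (relab Top Bot) g) = g"
proof -
  have "inj_on (relab Top Bot) (tail_pts \<epsilon> \<epsilon>' \<union> head_pts \<epsilon> \<epsilon>')" by (rule relab_inj) auto
  then have "inj_on (relab Top Bot) (head_pts \<epsilon> \<epsilon>')" "inj_on (relab Top Bot) (tail_pts \<epsilon> \<epsilon>')"
    by (auto intro: inj_on_subset)
  from relabel_span[OF assms this] show "relabel (relab Top Bot) g \<in> span (cob i B (tail_pts \<epsilon>' \<epsilon>) (head_pts \<epsilon>' \<epsilon>))"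
    unfolding relab_image_tail relab_image_head unfolding tail_pts_eq head_pts_eq by (simp only: Un_commute)
  show "relabel (relab Top Bot) (relabel (relab Top Bot) g) = g"
    unfolding relabel_relabel by (rule relabel_ident[OF assms]) (auto simp: tail_pts_eq head_pts_eq)
qed

text \<open>The tests on the right are all cobordisms, those on the left only Brauer diagrams.
  \<open>good_diag\<close> writes any test as the image of a Brauer combination, plus terms with
  half-intervals, plus a null term. The first is covered by the assumption, the second are
  annihilated by \<open>kill_glue\<close>, and the third pairs to zero with everything.\<close>

lemma negligible_iff:
  assumes f: "f \<in> span (br \<epsilon> \<epsilon>')"
  shows "bcls \<epsilon> \<epsilon>' f \<in> negligible K \<epsilon> \<epsilon>' \<longleftrightarrow> Psi f \<in> null S \<alpha> \<epsilon> \<epsilon>'"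
proof -
  let ?T = "tail_pts \<epsilon> \<epsilon>'" and ?H = "head_pts \<epsilon> \<epsilon>'"
  have "bcls \<epsilon> \<epsilon>' f \<in> negligible K \<epsilon> \<epsilon>' \<longleftrightarrow>
    (\<forall>g\<in>span (br \<epsilon>' \<epsilon>). closure_lin (length \<epsilon>) (stack_lin (length \<epsilon>') g f) \<in> brauer_rel K [] [])"
    using f imageI[OF f, of "bcls \<epsilon> \<epsilon>'"] by (simp add: negligible_def Arr_CB' Cmp_CB' brauer_closure_bcls Zer_CB' bcls_eq_iff)
  also have "\<dots> \<longleftrightarrow> (\<forall>g\<in>span (br \<epsilon>' \<epsilon>).
      eval_lin \<alpha> (glue_lin (?T \<union> ?H) (Psi f * relabel (relab Top Bot) (Psi g))) = 0)"
    by (rule ball_cong[OF refl]) (rule Psi_pairing[OF f])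
  also have "\<dots> \<longleftrightarrow> Psi f \<in> N ?T ?H"
  proof
    have d: "?H - ?T = ?H" "?T - ?H = ?T" using tail_head_disjoint[of \<epsilon> \<epsilon>'] by auto
    assume Pf: "Psi f \<in> N ?T ?H"
    show "\<forall>g\<in>span (br \<epsilon>' \<epsilon>). eval_lin \<alpha> (glue_lin (?T \<union> ?H) (Psi f * relabel (relab Top Bot) (Psi g))) = 0"
    proof
      fix g :: "(('a, 'k) lin set, 'k) lin" assume "g \<in> span (br \<epsilon>' \<epsilon>)"
      from swap_span[OF Psi_br[OF this, unfolded cobs_eq]]
      show "eval_lin \<alpha> (glue_lin (?T \<union> ?H) (Psi f * relabel (relab Top Bot) (Psi g))) = 0"
        by (intro nul_test[OF Pf]) (simp add: d)
    qed
  next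
    have d: "?H - ?T = ?H" "?T - ?H = ?T" using tail_head_disjoint[of \<epsilon> \<epsilon>'] by auto
    have PS: "Psi f \<in> Sp ?T ?H" using Psi_br[OF f] by (simp add: cobs_eq)
    assume *: "\<forall>g\<in>span (br \<epsilon>' \<epsilon>). eval_lin \<alpha> (glue_lin (?T \<union> ?H) (Psi f * relabel (relab Top Bot) (Psi g))) = 0"
    have "eval_lin \<alpha> (glue_lin (?T \<union> ?H) (Psi f * gen y)) = 0" if y: "y \<in> cob True S ?H ?T" for y
    proof -
      obtain g z where g: "g \<in> span (cob False L ?H ?T)" and z: "z \<in> Hf ?H ?T" and nu: "gen y - Psi g - z \<in> N ?H ?T"
        using good_diag[OF y finite_head_pts finite_tail_pts] by (rule goodE)
      have "eval_lin \<alpha> (glue_lin (?H \<union> ?T) ((gen y - Psi g - z) * Psi f)) = 0"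
        by (rule nul_test[OF nu]) (use PS in \<open>simp add: d\<close>)
      moreover have "eval_lin \<alpha> (glue_lin (?T \<union> ?H) (Psi f * z)) = 0"
        using z
      proof (induction z rule: span_induct)
        case (add z D c)
        then obtain p where p: "half p D" and D: "D \<in> cob True S ?H ?T" by blast
        have "glue_lin (?T \<union> ?H) (Psi f * gen D) \<in> N {} {}"
          by (rule kill_glue[OF f[unfolded cobs_no_inner_eq] D p])
            (use half_pts[OF p D] tail_head_disjoint[of \<epsilon> \<epsilon>'] in auto)
        then have "eval_lin \<alpha> (glue_lin (?T \<union> ?H) (Psi f * gen D)) = 0"
          using nul_closed_iff[OF nul_span] by blast
        with add show ?case
          by (simp add: distrib_left scale_mult_right glue_lin_linear eval_lin_linear del: scale_simps(5))
      qed (simp add: glue_lin_linear eval_lin_linear)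
      moreover have "eval_lin \<alpha> (glue_lin (?T \<union> ?H) (Psi f * Psi g)) = 0"
      proof -
        \<comment> \<open>Tests in \<open>negligible\<close> go from \<epsilon>' to \<epsilon>,
          while \<open>g\<close> has the endpoints already swapped; turning upside down is an
          involution that translates between the two.\<close>
        note g' = swap_span2[OF g]
        have "relabel (relab Top Bot) (Psi (relabel (relab Top Bot) g)) = Psi g"
          using Psi_relabel[OF g'(1), of "relab Top Bot"] g'(2) by simp
        then show ?thesis using bspec[OF *, of "relabel (relab Top Bot) g"] g'(1) by (simp add: cobs_no_inner_eq)
      qed
      ultimately show ?thesis
        by (simp add: Un_commute mult.commute right_diff_distrib glue_lin_linear eval_lin_linear)
    qed
    then show "Psi f \<in> N ?T ?H" using PS by (simp add: nul_def d)
  qed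
  finally show ?thesis by (simp add: null_eq)
qed

lemma negligible_eq: "negligible K \<epsilon> \<epsilon>' = bcls \<epsilon> \<epsilon>' ` {f \<in> span (br \<epsilon> \<epsilon>'). Psi f \<in> null S \<alpha> \<epsilon> \<epsilon>'}"
proof -
  have "negligible K \<epsilon> \<epsilon>' \<subseteq> bcls \<epsilon> \<epsilon>' ` span (br \<epsilon> \<epsilon>')" unfolding negligible_def Arr_CB' by blast
  then show ?thesis using negligible_iff by auto
qed

end

section \<open>The semifunctor from the Frobenius--Brauer category\<close>

lemma stack_lin_assoc:
  assumes "f \<in> span (cob i L (tail_pts \<epsilon> \<epsilon>') (head_pts \<epsilon> \<epsilon>'))"
    "g \<in> span (cob i L (tail_pts \<epsilon>' \<epsilon>'') (head_pts \<epsilon>' \<epsilon>''))"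
    "h \<in> span (cob i L (tail_pts \<epsilon>'' \<epsilon>\<^sub>3) (head_pts \<epsilon>'' \<epsilon>\<^sub>3))"
  shows "stack_lin (length \<epsilon>'') h (stack_lin (length \<epsilon>') g f) = stack_lin (length \<epsilon>') (stack_lin (length \<epsilon>'') h g) f"
  using category.Cmp_assoc[OF preadditive.axioms(1)[OF preadditive_free_cat[OF refl, of i L]],
      where W = \<epsilon> and X = \<epsilon>' and Y = \<epsilon>'' and Z = \<epsilon>\<^sub>3 and f = f and g = g and h = h] assms
  by (simp add: free_cat_simps)

lemma stack_lin_id:
  assumes "f \<in> span (cob i L (tail_pts \<epsilon> \<epsilon>') (head_pts \<epsilon> \<epsilon>'))"
  shows "stack_lin (length \<epsilon>') (gen (id_diag \<epsilon>')) f = f" "stack_lin (length \<epsilon>) f (gen (id_diag \<epsilon>)) = f"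
  using category.Cmp_Ide_left[OF preadditive.axioms(1)[OF preadditive_free_cat[OF refl, of i L]],
      where X = \<epsilon> and Y = \<epsilon>' and f = f]
    category.Cmp_Ide_right[OF preadditive.axioms(1)[OF preadditive_free_cat[OF refl, of i L]],
      where X = \<epsilon> and Y = \<epsilon>' and f = f] assms
  by (simp_all add: free_cat_simps)

context evaluation_basis
begin

lemma preadditive_ideal_negligible: "preadditive_ideal CB' (negligible K)"
proof -
  interpret preadditive CB' by (rule preadditive_CB')
  have mem: "\<exists>f\<in>span (br \<epsilon> \<epsilon>'). m = bcls \<epsilon> \<epsilon>' f \<and> Psi f \<in> null S \<alpha> \<epsilon> \<epsilon>'" if "m \<in> negligible K \<epsilon> \<epsilon>'" for \<epsilon> \<epsilon>' m
    using that unfolding negligible_eq by blast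
  have I: "bcls \<epsilon> \<epsilon>' f \<in> negligible K \<epsilon> \<epsilon>'" if "f \<in> span (br \<epsilon> \<epsilon>')" "Psi f \<in> null S \<alpha> \<epsilon> \<epsilon>'" for \<epsilon> \<epsilon>' f
    using that unfolding negligible_eq by blast
  show ?thesis
  proof
    fix X Y m assume "m \<in> negligible K X Y"
    then show "m \<in> Arr CB' X Y" by (simp add: negligible_def)
  next
    fix X Y
    show "Zer CB' X Y \<in> negligible K X Y" unfolding Zer_CB' by (rule I) (simp_all add: null_eq)
  next
    fix X Y m m' assume "m \<in> negligible K X Y" "m' \<in> negligible K X Y"
    then obtain f f' where f: "f \<in> span (br X Y)" "m = bcls X Y f" "Psi f \<in> null S \<alpha> X Y"
      and f': "f' \<in> span (br X Y)" "m' = bcls X Y f'" "Psi f' \<in> null S \<alpha> X Y" using mem by metis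
    have "Psi (f + f') \<in> null S \<alpha> X Y" using f(3) f'(3) by (simp add: lin_ext_add null_eq nul_add)
    then show "Add CB' X Y m m' \<in> negligible K X Y"
      unfolding f(2) f'(2) Add_CB'[OF f(1) f'(1)] by (rule I[OF span_add[OF f(1) f'(1)]])
  next
    fix X Y m assume "m \<in> negligible K X Y"
    then obtain f where f: "f \<in> span (br X Y)" "m = bcls X Y f" "Psi f \<in> null S \<alpha> X Y" using mem by metis
    have f': "- f \<in> span (br X Y)" by (rule span_uminus[OF f(1)])
    have "Psi (- f) \<in> null S \<alpha> X Y" using f(3) by (simp add: lin_ext_uminus null_eq nul_uminus)
    then have "bcls X Y (- f) \<in> negligible K X Y" by (rule I[OF f'])
    moreover have "Add CB' X Y m (bcls X Y (- f)) = Zer CB' X Y"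
      unfolding f(2) Add_CB'[OF f(1) f'] Zer_CB' by simp
    ultimately show "\<exists>m'\<in>negligible K X Y. Add CB' X Y m m' = Zer CB' X Y" by blast
  next
    fix X Y Z m g assume "m \<in> negligible K X Y" and g: "g \<in> Arr CB' Y Z"
    then obtain f where f: "f \<in> span (br X Y)" "m = bcls X Y f" "Psi f \<in> null S \<alpha> X Y" using mem by metis
    obtain g' where g': "g' \<in> span (br Y Z)" "g = bcls Y Z g'" using g unfolding Arr_CB' by blast
    have "stack_lin (length Y) (Psi g') (Psi f) \<in> null S \<alpha> X Z" by (rule stack_null_left[OF f(3) Psi_br[OF g'(1)]])
    then have "Psi (stack_lin (length Y) g' f) \<in> null S \<alpha> X Z"
      using Psi_stack[OF f(1) g'(1)] nul_add unfolding null_eq by fastforce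
    then show "Cmp CB' X Y Z g m \<in> negligible K X Z"
      unfolding f(2) g'(2) Cmp_CB'[OF f(1) g'(1)] by (rule I[OF stack_br[OF f(1) g'(1)]])
  next
    fix X Y Z m g assume g: "g \<in> Arr CB' X Y" and "m \<in> negligible K Y Z"
    then obtain f where f: "f \<in> span (br Y Z)" "m = bcls Y Z f" "Psi f \<in> null S \<alpha> Y Z" using mem by metis
    obtain g' where g': "g' \<in> span (br X Y)" "g = bcls X Y g'" using g unfolding Arr_CB' by blast
    have "stack_lin (length Y) (Psi f) (Psi g') \<in> null S \<alpha> X Z" by (rule stack_null_right[OF Psi_br[OF g'(1)] f(3)])
    then have "Psi (stack_lin (length Y) f g') \<in> null S \<alpha> X Z"
      using Psi_stack[OF g'(1) f(1)] nul_add unfolding null_eq by fastforce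
    then show "Cmp CB' X Y Z m g \<in> negligible K X Z"
      unfolding f(2) g'(2) Cmp_CB'[OF g'(1) f(1)] by (rule I[OF stack_br[OF g'(1) f(1)]])
  qed
qed

lemma CB_eq: "CB = quot CB' (negligible K)"
  by (simp add: C_brauer_def)

lemma preadditive_CB: "preadditive CB"
  unfolding CB_eq by (rule preadditive_ideal.preadditive_quot[OF preadditive_ideal_negligible])

definition "nb \<epsilon> \<epsilon>' f = coset CB' (negligible K) \<epsilon> \<epsilon>' (bcls \<epsilon> \<epsilon>' f)"

lemma bcls_Arr: "f \<in> span (br \<epsilon> \<epsilon>') \<Longrightarrow> bcls \<epsilon> \<epsilon>' f \<in> Arr CB' \<epsilon> \<epsilon>'"
  unfolding Arr_CB' by (rule imageI)

lemma Obj_CB: "Obj CB = UNIV"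
  unfolding CB_eq preadditive_ideal.quot_simps[OF preadditive_ideal_negligible] by (rule Obj_CB')

lemma Arr_CB: "Arr CB \<epsilon> \<epsilon>' = nb \<epsilon> \<epsilon>' ` span (br \<epsilon> \<epsilon>')"
  unfolding CB_eq preadditive_ideal.quot_simps[OF preadditive_ideal_negligible] Arr_CB' nb_def
  by (rule image_image)

lemma Ide_CB: "Ide CB \<epsilon> = nb \<epsilon> \<epsilon> (gen (id_diag \<epsilon>))"
  unfolding CB_eq preadditive_ideal.quot_simps[OF preadditive_ideal_negligible] Ide_CB' nb_def ..

lemma Cmp_CB: "f \<in> span (br \<epsilon> \<epsilon>') \<Longrightarrow> g \<in> span (br \<epsilon>' \<epsilon>'') \<Longrightarrow>
    Cmp CB \<epsilon> \<epsilon>' \<epsilon>'' (nb \<epsilon>' \<epsilon>'' g) (nb \<epsilon> \<epsilon>' f) = nb \<epsilon> \<epsilon>'' (stack_lin (length \<epsilon>') g f)"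
  unfolding nb_def CB_eq
  using preadditive_ideal.Cmp_quot[OF preadditive_ideal_negligible, where X = \<epsilon> and Y = \<epsilon>' and Z = \<epsilon>''
      and f = "bcls \<epsilon> \<epsilon>' f" and g = "bcls \<epsilon>' \<epsilon>'' g"] bcls_Arr Cmp_CB'
  by (simp add: Obj_CB')

lemma Add_CB: "f \<in> span (br \<epsilon> \<epsilon>') \<Longrightarrow> g \<in> span (br \<epsilon> \<epsilon>') \<Longrightarrow>
    Add CB \<epsilon> \<epsilon>' (nb \<epsilon> \<epsilon>' f) (nb \<epsilon> \<epsilon>' g) = nb \<epsilon> \<epsilon>' (f + g)"
  unfolding nb_def CB_eq
  using preadditive_ideal.Add_quot[OF preadditive_ideal_negligible, where X = \<epsilon> and Y = \<epsilon>'
      and f = "bcls \<epsilon> \<epsilon>' f" and g = "bcls \<epsilon> \<epsilon>' g"] bcls_Arr Add_CB'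
  by (simp add: Obj_CB')

text \<open>This is faithfulness: by \<open>negligible_iff\<close> a difference whose image is null
  is negligible.\<close>

lemma nb_eqI:
  assumes f: "f \<in> span (br \<epsilon> \<epsilon>')" and g: "g \<in> span (br \<epsilon> \<epsilon>')" and "Psi f - Psi g \<in> null S \<alpha> \<epsilon> \<epsilon>'"
  shows "nb \<epsilon> \<epsilon>' f = nb \<epsilon> \<epsilon>' g"
proof -
  have d: "f - g \<in> span (br \<epsilon> \<epsilon>')" by (rule span_diff[OF f g])
  have "bcls \<epsilon> \<epsilon>' (f - g) \<in> negligible K \<epsilon> \<epsilon>'"
    unfolding negligible_iff[OF d] using assms(3) by (simp add: lin_ext_diff)
  moreover have "bcls \<epsilon> \<epsilon>' f = Add CB' \<epsilon> \<epsilon>' (bcls \<epsilon> \<epsilon>' g) (bcls \<epsilon> \<epsilon>' (f - g))"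
    unfolding Add_CB'[OF g d] by simp
  ultimately have "bcls \<epsilon> \<epsilon>' f \<in> coset CB' (negligible K) \<epsilon> \<epsilon>' (bcls \<epsilon> \<epsilon>' g)"
    unfolding coset_def by blast
  from preadditive_ideal.coset_eq[OF preadditive_ideal_negligible _ _ bcls_Arr[OF g] this]
  show ?thesis by (simp add: nb_def Obj_CB')
qed

text \<open>The entry of the one-by-one matrix that \<open>F_functor\<close> assigns to a
  morphism.\<close>

definition phi :: "sign list \<Rightarrow> sign list \<Rightarrow> (('a, 'k) lin set, 'k) lin set set \<Rightarrow> ('a, 'k) lin set" where
  "phi \<epsilon> \<epsilon>' X = (\<Union>Y\<in>X. \<Union>f\<in>Y. cls S \<alpha> \<epsilon> \<epsilon>' (Psi f))"

text \<open>The representatives in the two unions differ by a combination with null image and by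
  Brauer relations, and \<open>Psi\<close> sends the latter to null combinations too.\<close>

lemma phi_nb:
  assumes f: "f \<in> span (br \<epsilon> \<epsilon>')"
  shows "phi \<epsilon> \<epsilon>' (nb \<epsilon> \<epsilon>' f) = cls S \<alpha> \<epsilon> \<epsilon>' (Psi f)"
proof -
  have "(\<Union>g\<in>Y. cls S \<alpha> \<epsilon> \<epsilon>' (Psi g)) = cls S \<alpha> \<epsilon> \<epsilon>' (Psi f)" if Y: "Y \<in> nb \<epsilon> \<epsilon>' f" for Y
  proof -
    obtain m where m: "m \<in> negligible K \<epsilon> \<epsilon>'" "Y = Add CB' \<epsilon> \<epsilon>' (bcls \<epsilon> \<epsilon>' f) m"
      using Y unfolding nb_def coset_def by blast
    obtain h where h: "h \<in> span (br \<epsilon> \<epsilon>')" "m = bcls \<epsilon> \<epsilon>' h" "Psi h \<in> null S \<alpha> \<epsilon> \<epsilon>'"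
      using m(1) unfolding negligible_eq by blast
    have Y': "Y = bcls \<epsilon> \<epsilon>' (f + h)" unfolding m(2) h(2) by (rule Add_CB'[OF f h(1)])
    show ?thesis
    proof (rule UN_cls)
      show "Y \<noteq> {}" unfolding Y' using bcls_refl by blast
      fix g assume "g \<in> Y"
      then have "g - (f + h) \<in> brauer_rel K \<epsilon> \<epsilon>'" unfolding Y' mem_bcls .
      from Psi_rel[OF this] have "Psi (g - (f + h)) + Psi h \<in> null S \<alpha> \<epsilon> \<epsilon>'"
        using h(3) unfolding null_eq by (rule nul_add)
      then show "Psi g - Psi f \<in> null S \<alpha> \<epsilon> \<epsilon>'" by (simp add: lin_ext_diff lin_ext_add)
    qed
  qed
  then have "phi \<epsilon> \<epsilon>' (nb \<epsilon> \<epsilon>' f) = (\<Union>Y\<in>nb \<epsilon> \<epsilon>' f. cls S \<alpha> \<epsilon> \<epsilon>' (Psi f))"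
    unfolding phi_def by (rule SUP_cong[OF refl])
  also have "\<dots> = cls S \<alpha> \<epsilon> \<epsilon>' (Psi f)"
  proof (rule SUP_const)
    show "nb \<epsilon> \<epsilon>' f \<noteq> {}" unfolding nb_def
      using preadditive_ideal.coset_refl[OF preadditive_ideal_negligible _ _ bcls_Arr[OF f]] by (auto simp: Obj_CB')
  qed
  finally show ?thesis .
qed

text \<open>A representative of the idempotent attached to \<epsilon>: the image of the identity
  diagram is a product of arcs that carry the unit of \<open>K\<close>.\<close>

definition "eL \<epsilon> = Psi (gen (id_diag \<epsilon>))"

lemma id_br: "gen (id_diag \<epsilon>) \<in> span (br \<epsilon> \<epsilon>)"
  unfolding cobs_no_inner_eq by (rule span_gen[OF id_diag_cob])

lemma id_S: "gen (id_diag \<epsilon>) \<in> span (cobs S \<epsilon> \<epsilon>)"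
  unfolding cobs_eq by (rule span_gen[OF id_diag_cob])

lemma eL_span: "eL \<epsilon> \<in> span (cobs S \<epsilon> \<epsilon>)"
  unfolding eL_def by (rule Psi_br[OF id_br])

lemma stack_S: "f \<in> span (cobs S \<epsilon> \<epsilon>') \<Longrightarrow> g \<in> span (cobs S \<epsilon>' \<epsilon>'') \<Longrightarrow> stack_lin (length \<epsilon>') g f \<in> span (cobs S \<epsilon> \<epsilon>'')"
  unfolding cobs_eq by (rule stack_lin_span)

lemmas stack_S_assoc = stack_lin_assoc[where i = True and L = S, folded cobs_eq]
lemmas stack_S_id = stack_lin_id[where i = True and L = S, folded cobs_eq]
lemmas stack_br_id = stack_lin_id[where i = False, folded cobs_no_inner_eq]

text \<open>The half-interval of \<open>D\<close> meets a strand of the image of the identity at the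
  middle point \<open>Mid j\<close>; this is \<open>kill_glue\<close> with all middle points
  glued.\<close>

lemma kill_bot:
  assumes D: "D \<in> cobs S \<epsilon> \<epsilon>'" and h: "half (Bot j) D"
  shows "stack_lin (length \<epsilon>) (gen D) (eL \<epsilon>) \<in> null S \<alpha> \<epsilon> \<epsilon>'"
proof -
  note D' = D[unfolded cobs_eq] and e' = eL_span[unfolded cobs_eq] and i' = id_br[unfolded cobs_no_inner_eq]
  have j: "j < length \<epsilon>"
    using half_pts[OF h D'] by (auto simp: tail_pts_eq head_pts_eq pos_def neg_def)
  have "stack_lin (length \<epsilon>) (gen D) (eL \<epsilon>) = glue_lin (Mid ` {..<length \<epsilon>})
      (Psi (relabel (relab Bot Mid) (gen (id_diag \<epsilon>))) * gen (map_diag (relab Mid Top) D))"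
    unfolding eL_def Psi_relabel[OF i'] using stack_lin_eq[OF e'[of \<epsilon>, unfolded eL_def] span_gen[OF D']] by simp
  also have "\<dots> \<in> N (tail_pts \<epsilon> \<epsilon>') (head_pts \<epsilon> \<epsilon>')"
  proof (rule kill_glue)
    show "relabel (relab Bot Mid) (gen (id_diag \<epsilon>)) \<in> span (cob False L (Bot ` pos \<epsilon> \<union> Mid ` neg \<epsilon>) (Bot ` neg \<epsilon> \<union> Mid ` pos \<epsilon>))"
      by (rule relabel_relab_span[OF i']) auto
    show "map_diag (relab Mid Top) D \<in> cob True S (Mid ` pos \<epsilon> \<union> Top ` neg \<epsilon>') (Mid ` neg \<epsilon> \<union> Top ` pos \<epsilon>')"
      by (rule cob_relab[OF D']) (auto simp: inj_on_def)
    show "half (Mid j) (map_diag (relab Mid Top) D)" using half_map_diag[OF h, of "relab Mid Top"] by simp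
  qed (use j in \<open>auto simp: neg_iff Mid_lessThan tail_pts_eq head_pts_eq image_iff\<close>)
  finally show ?thesis by (simp add: null_eq)
qed

lemma kill_top:
  assumes D: "D \<in> cobs S \<epsilon> \<epsilon>'" and h: "half (Top j) D"
  shows "stack_lin (length \<epsilon>') (eL \<epsilon>') (gen D) \<in> null S \<alpha> \<epsilon> \<epsilon>'"
proof -
  note D' = D[unfolded cobs_eq] and e' = eL_span[unfolded cobs_eq] and i' = id_br[unfolded cobs_no_inner_eq]
  have j: "j < length \<epsilon>'"
    using half_pts[OF h D'] by (auto simp: tail_pts_eq head_pts_eq pos_def neg_def)
  have "stack_lin (length \<epsilon>') (eL \<epsilon>') (gen D) = glue_lin (Mid ` {..<length \<epsilon>'})
      (Psi (relabel (relab Mid Top) (gen (id_diag \<epsilon>'))) * gen (map_diag (relab Bot Mid) D))"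
    unfolding eL_def Psi_relabel[OF i'] using stack_lin_eq[OF span_gen[OF D'] e'[of \<epsilon>', unfolded eL_def]]
    by (simp add: mult.commute)
  also have "\<dots> \<in> N (tail_pts \<epsilon> \<epsilon>') (head_pts \<epsilon> \<epsilon>')"
  proof (rule kill_glue)
    show "relabel (relab Mid Top) (gen (id_diag \<epsilon>')) \<in> span (cob False L (Mid ` pos \<epsilon>' \<union> Top ` neg \<epsilon>') (Mid ` neg \<epsilon>' \<union> Top ` pos \<epsilon>'))"
      by (rule relabel_relab_span[OF i']) auto
    show "map_diag (relab Bot Mid) D \<in> cob True S (Bot ` pos \<epsilon> \<union> Mid ` neg \<epsilon>') (Bot ` neg \<epsilon> \<union> Mid ` pos \<epsilon>')"
      by (rule cob_relab[OF D']) (auto simp: inj_on_def)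
    show "half (Mid j) (map_diag (relab Bot Mid) D)" using half_map_diag[OF h, of "relab Bot Mid"] by simp
  qed (use j in \<open>auto simp: neg_iff Mid_lessThan tail_pts_eq head_pts_eq image_iff\<close>)
  finally show ?thesis by (simp add: null_eq)
qed

lemma sandwich_half:
  assumes y: "y \<in> Hf (tail_pts \<epsilon> \<epsilon>') (head_pts \<epsilon> \<epsilon>')"
  shows "stack_lin (length \<epsilon>') (eL \<epsilon>') (stack_lin (length \<epsilon>) y (eL \<epsilon>)) \<in> null S \<alpha> \<epsilon> \<epsilon>'"
  using y
proof (induction y rule: span_induct)
  case zero
  show ?case by (simp add: null_eq)
next
  case (add y D c)
  then obtain p where p: "half p D" and D: "D \<in> cobs S \<epsilon> \<epsilon>'" unfolding cobs_eq by blast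
  have "p \<in> tail_pts \<epsilon> \<epsilon>' \<union> head_pts \<epsilon> \<epsilon>'" using half_pts[OF p D[unfolded cobs_eq]] by simp
  then consider j where "p = Bot j" | j where "p = Top j" unfolding tail_head_pts by blast
  then have "stack_lin (length \<epsilon>') (eL \<epsilon>') (stack_lin (length \<epsilon>) (gen D) (eL \<epsilon>)) \<in> null S \<alpha> \<epsilon> \<epsilon>'"
  proof cases
    case 1
    then show ?thesis using stack_null_left[OF kill_bot[OF D] eL_span] p by simp
  next
    case 2
    then show ?thesis using stack_null_right[OF eL_span kill_top[OF D]] p
      by (simp add: stack_S_assoc[OF eL_span span_gen[OF D] eL_span])
  qed
  then show ?case using add(3) unfolding null_eq
    by (simp add: stack_lin_linear nul_add nul_scale del: scale_simps(5))
qed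

text \<open>Write \<open>x\<close> as \<open>Psi f + y\<close> modulo null combinations and sandwich
  it between the idempotents: modulo null combinations \<open>x\<close> is unchanged by assumption,
  \<open>Psi f\<close> is unchanged by functoriality, and \<open>y\<close> vanishes because its
  diagrams contain half-intervals.\<close>

lemma full_phi:
  assumes x: "x \<in> span (cobs S \<epsilon> \<epsilon>')"
    and r: "stack_lin (length \<epsilon>) x (eL \<epsilon>) - x \<in> null S \<alpha> \<epsilon> \<epsilon>'"
    and l: "stack_lin (length \<epsilon>') (eL \<epsilon>') x - x \<in> null S \<alpha> \<epsilon> \<epsilon>'"
  shows "\<exists>f\<in>span (br \<epsilon> \<epsilon>'). cls S \<alpha> \<epsilon> \<epsilon>' (Psi f) = cls S \<alpha> \<epsilon> \<epsilon>' x"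
proof -
  let ?N = "null S \<alpha> \<epsilon> \<epsilon>'"
  let ?e = "\<lambda>z. stack_lin (length \<epsilon>') (eL \<epsilon>') (stack_lin (length \<epsilon>) z (eL \<epsilon>))"
  have e_diff: "?e (y - z) = ?e y - ?e z" for y z
    using stack_lin_add_left[of "length \<epsilon>" y "scale (- 1) z"] stack_lin_add_right[of "length \<epsilon>'" "eL \<epsilon>'"]
    by (metis (no_types, lifting) add_uminus_conv_diff scale_simps(3) scale_uminus stack_lin_scale_left stack_lin_scale_right)
  obtain f y where f: "f \<in> span (br \<epsilon> \<epsilon>')" and y: "y \<in> Hf (tail_pts \<epsilon> \<epsilon>') (head_pts \<epsilon> \<epsilon>')"
    and nu: "x - Psi f - y \<in> ?N"
    using good_span[OF x[unfolded cobs_eq] finite_tail_pts finite_head_pts]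
    by (rule goodE) (simp add: cobs_no_inner_eq null_eq)
  have 1: "?e (x - Psi f - y) \<in> ?N"
    by (rule stack_null_left[OF stack_null_right[OF eL_span nu] eL_span])
  have 2: "?e x - x \<in> ?N"
  proof -
    have "stack_lin (length \<epsilon>') (eL \<epsilon>') (stack_lin (length \<epsilon>) x (eL \<epsilon>) - x) \<in> ?N"
      by (rule stack_null_left[OF r eL_span])
    moreover have "stack_lin (length \<epsilon>') (eL \<epsilon>') (z - z') = stack_lin (length \<epsilon>') (eL \<epsilon>') z - stack_lin (length \<epsilon>') (eL \<epsilon>') z'" for z z'
      using stack_lin_add_right[of "length \<epsilon>'" "eL \<epsilon>'" "z - z'" z'] by simp
    ultimately show ?thesis using l nul_trans unfolding null_eq by metis
  qed
  have 3: "?e (Psi f) - Psi f \<in> ?N"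
  proof -
    note fi = stack_br[OF id_br f]
    have a: "Psi (stack_lin (length \<epsilon>) f (gen (id_diag \<epsilon>))) - stack_lin (length \<epsilon>) (Psi f) (eL \<epsilon>) \<in> ?N"
      using Psi_stack[OF id_br f] by (simp add: eL_def)
    have b: "Psi (stack_lin (length \<epsilon>') (gen (id_diag \<epsilon>')) f) - stack_lin (length \<epsilon>') (eL \<epsilon>') (Psi f) \<in> ?N"
      using Psi_stack[OF f id_br] by (simp add: eL_def)
    have "stack_lin (length \<epsilon>') (eL \<epsilon>') (Psi f - stack_lin (length \<epsilon>) (Psi f) (eL \<epsilon>)) \<in> ?N"
      by (rule stack_null_left[OF _ eL_span]) (use a in \<open>simp add: stack_br_id(2)[OF f]\<close>)
    moreover have "stack_lin (length \<epsilon>') (eL \<epsilon>') (z - z') = stack_lin (length \<epsilon>') (eL \<epsilon>') z - stack_lin (length \<epsilon>') (eL \<epsilon>') z'" for z z'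
      using stack_lin_add_right[of "length \<epsilon>'" "eL \<epsilon>'" "z - z'" z'] by simp
    moreover have "Psi f - stack_lin (length \<epsilon>') (eL \<epsilon>') (Psi f) \<in> ?N" using b by (simp add: stack_br_id(1)[OF f])
    ultimately have "Psi f - ?e (Psi f) \<in> ?N" using nul_trans unfolding null_eq by metis
    then show ?thesis unfolding null_eq by (rule nul_sym)
  qed
  \<comment> \<open>By linearity of the sandwich everything in this expression cancels except
    \<open>x - Psi f\<close>.\<close>
  have "?e (x - Psi f - y) - (?e x - x) + (?e (Psi f) - Psi f) + ?e y \<in> ?N"
    using 1 2 3 sandwich_half[OF y] unfolding null_eq by (blast intro: nul_add nul_diff)
  then have "x - Psi f \<in> ?N" by (simp add: e_diff)
  then have "Psi f - x \<in> ?N" unfolding null_eq by (rule nul_sym)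
  then show ?thesis using f by (auto simp: cls_eq_iff)
qed

lemma phi_Ide: "phi \<epsilon> \<epsilon> (Ide CB \<epsilon>) = cls S \<alpha> \<epsilon> \<epsilon> (eL \<epsilon>)"
  unfolding Ide_CB eL_def by (rule phi_nb[OF id_br])

lemma additive_semifunctor_phi: "additive_semifunctor CB C phi"
proof -
  interpret CB: preadditive CB by (rule preadditive_CB)
  interpret CA: preadditive C by (rule preadditive_C_alpha)
  show ?thesis
  proof
    fix X show "X \<in> Obj C" by (simp add: Obj_C_alpha)
  next
    fix X Y m assume "m \<in> Arr CB X Y"
    then obtain f where f: "f \<in> span (br X Y)" "m = nb X Y f" unfolding Arr_CB by blast
    show "phi X Y m \<in> Arr C X Y"
      unfolding f(2) phi_nb[OF f(1)] Arr_C_alpha by (rule imageI[OF Psi_br[OF f(1)]])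
  next
    fix X Y Z m m' assume "m \<in> Arr CB X Y" "m' \<in> Arr CB Y Z"
    then obtain f g where f: "f \<in> span (br X Y)" "m = nb X Y f" and g: "g \<in> span (br Y Z)" "m' = nb Y Z g"
      unfolding Arr_CB by blast
    show "phi X Z (Cmp CB X Y Z m' m) = Cmp C X Y Z (phi Y Z m') (phi X Y m)"
      unfolding f(2) g(2) Cmp_CB[OF f(1) g(1)] phi_nb[OF f(1)] phi_nb[OF g(1)] phi_nb[OF stack_br[OF f(1) g(1)]]
        Cmp_C_alpha[OF Psi_br[OF f(1)] Psi_br[OF g(1)]] cls_eq_iff
      by (rule Psi_stack[OF f(1) g(1)])
  next
    fix X Y
    show "inj_on (phi X Y) (Arr CB X Y)"
    proof (rule inj_onI)
      fix m m' assume "m \<in> Arr CB X Y" "m' \<in> Arr CB X Y" and e: "phi X Y m = phi X Y m'"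
      then obtain f g where f: "f \<in> span (br X Y)" "m = nb X Y f" and g: "g \<in> span (br X Y)" "m' = nb X Y g"
        unfolding Arr_CB by blast
      show "m = m'" unfolding f(2) g(2)
        using e[unfolded f(2) g(2) phi_nb[OF f(1)] phi_nb[OF g(1)] cls_eq_iff] by (rule nb_eqI[OF f(1) g(1)])
    qed
  next
    fix X Y h assume h: "h \<in> Arr C X Y" and r: "Cmp C X X Y h (phi X X (Ide CB X)) = h"
      and l: "Cmp C X Y Y (phi Y Y (Ide CB Y)) h = h"
    obtain x where x: "x \<in> span (cobs S X Y)" "h = cls S \<alpha> X Y x" using h unfolding Arr_C_alpha by blast
    have "\<exists>f\<in>span (br X Y). cls S \<alpha> X Y (Psi f) = cls S \<alpha> X Y x"
      by (rule full_phi[OF x(1) r[unfolded x(2) phi_Ide Cmp_C_alpha[OF eL_span x(1)] cls_eq_iff]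
          l[unfolded x(2) phi_Ide Cmp_C_alpha[OF x(1) eL_span] cls_eq_iff]])
    then obtain f where f: "f \<in> span (br X Y)" "cls S \<alpha> X Y (Psi f) = h" unfolding x(2) by blast
    then have "h = phi X Y (nb X Y f)" by (simp only: phi_nb[OF f(1)])
    then show "h \<in> phi X Y ` Arr CB X Y" unfolding Arr_CB using f(1) by blast
  next
    fix X Y m m' assume "m \<in> Arr CB X Y" "m' \<in> Arr CB X Y"
    then obtain f g where f: "f \<in> span (br X Y)" "m = nb X Y f" and g: "g \<in> span (br X Y)" "m' = nb X Y g"
      unfolding Arr_CB by blast
    show "phi X Y (Add CB X Y m m') = Add C X Y (phi X Y m) (phi X Y m')"
      unfolding f(2) g(2) Add_CB[OF f(1) g(1)] phi_nb[OF f(1)] phi_nb[OF g(1)] phi_nb[OF span_add[OF f(1) g(1)]]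
        Add_C_alpha[OF Psi_br[OF f(1)] Psi_br[OF g(1)]] lin_ext_add ..
  qed
qed

lemma positions_singletons: "positions (map (\<lambda>x. [x]) Xs) = map (\<lambda>a. (a, 0)) [0..<length Xs]"
proof -
  have "map (\<lambda>a. map (Pair a) [0..<length (map (\<lambda>x. [x]) Xs ! a)]) [0..<length Xs] = map (\<lambda>a. [(a, 0)]) [0..<length Xs]"
    by (rule map_cong[OF refl]) simp
  then show ?thesis by (simp only: positions_def length_map concat_map_singleton)
qed

text \<open>F takes each sign sequence to a one-element list, so the blocks in
  \<open>block_image\<close> are one by one and the concatenation merely flattens
  singletons.\<close>

lemma Kar_functor_F: "Kar_functor (F_functor S \<alpha> vs ws) = idem_functor (\<lambda>Xs. Xs) (map_entries phi)"
proof -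
  let ?F = "F_functor S \<alpha> vs ws"
  have o: "fst \<circ> FObj ?F = (\<lambda>x. [x])" by (auto simp: F_functor_def)
  have b: "block_image ?F Xs Ys M = map_entries phi Xs Ys M" for Xs Ys M
    unfolding block_image_def o positions_singletons
    by (rule eq_matI) (auto simp: map_entries_def F_functor_def phi_def Let_def)
  show ?thesis
    unfolding Kar_functor_def idem_functor_def o b by (simp add: concat_map_singleton split_def)
qed

section \<open>Decomposition of identities\<close>

text \<open>The additive closure, modulo null combinations, of the arrows that factor through some
  idempotent \<open>eL \<delta>\<close>. As an inductive predicate it handles sums, sandwiches and
  changes of representative without explicit lists; \<open>dom_list\<close> recovers a list at the
  end.\<close>

inductive dom :: "sign list \<Rightarrow> sign list \<Rightarrow> ('a, 'k) lin \<Rightarrow> bool" where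
  dom_null: "x \<in> null S \<alpha> \<epsilon> \<epsilon>' \<Longrightarrow> dom \<epsilon> \<epsilon>' x"
| dom_base: "a \<in> span (cobs S \<delta> \<epsilon>') \<Longrightarrow> b \<in> span (cobs S \<epsilon> \<delta>) \<Longrightarrow>
    dom \<epsilon> \<epsilon>' (stack_lin (length \<delta>) a (stack_lin (length \<delta>) (eL \<delta>) b))"
| dom_add: "dom \<epsilon> \<epsilon>' x \<Longrightarrow> dom \<epsilon> \<epsilon>' y \<Longrightarrow> dom \<epsilon> \<epsilon>' (x + y)"

lemma dom_sum: "(\<And>i. i \<in> I \<Longrightarrow> dom \<epsilon> \<epsilon>' (x i)) \<Longrightarrow> dom \<epsilon> \<epsilon>' (sum x I)"
  by (induction I rule: infinite_finite_induct) (auto intro: dom_add dom_null simp: null_eq)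

lemma dom_cong: "dom \<epsilon> \<epsilon>' y \<Longrightarrow> x - y \<in> null S \<alpha> \<epsilon> \<epsilon>' \<Longrightarrow> dom \<epsilon> \<epsilon>' x"
  using dom_add[OF _ dom_null, of \<epsilon> \<epsilon>' y "x - y"] by simp

text \<open>This ideal property lets the induction in \<open>dom_id\<close> use the decomposition of
  a shorter identity inside an arrow that factors through it.\<close>

lemma dom_sandwich:
  assumes "dom \<epsilon> \<epsilon>' x" "a \<in> span (cobs S \<epsilon>' \<delta>')" "b \<in> span (cobs S \<delta> \<epsilon>)"
  shows "dom \<delta> \<delta>' (stack_lin (length \<epsilon>') a (stack_lin (length \<epsilon>) x b))"
  using assms
proof (induction rule: dom.induct)
  case (dom_null x \<epsilon> \<epsilon>')
  then show ?case by (intro dom.dom_null stack_null_left stack_null_right)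
next
  case (dom_base a' \<gamma> \<epsilon>' b' \<epsilon>)
  note e = eL_span[of \<gamma>]
  note eb = stack_S[OF dom_base(2) e]
  have "stack_lin (length \<epsilon>') a (stack_lin (length \<epsilon>) (stack_lin (length \<gamma>) a' (stack_lin (length \<gamma>) (eL \<gamma>) b')) b)
    = stack_lin (length \<gamma>) (stack_lin (length \<epsilon>') a a') (stack_lin (length \<gamma>) (eL \<gamma>) (stack_lin (length \<epsilon>) b' b))"
    by (simp add: stack_S_assoc[OF dom_base(4) eb dom_base(1), symmetric] stack_S_assoc[OF dom_base(4) dom_base(2) e, symmetric]
      stack_S_assoc[OF stack_S[OF stack_S[OF dom_base(4) dom_base(2)] e] dom_base(1) dom_base(3)])
  then show ?case
    using dom.dom_base[OF stack_S[OF dom_base(1,3)] stack_S[OF dom_base(4,2)]] by simp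
next
  case (dom_add \<epsilon> \<epsilon>' x y)
  then show ?case by (simp add: stack_lin_linear dom.dom_add)
qed

lemma dom_list:
  assumes "dom \<epsilon> \<epsilon>' x"
  shows "\<exists>M. (\<forall>(\<delta>, a, b)\<in>set M. a \<in> span (cobs S \<delta> \<epsilon>') \<and> b \<in> span (cobs S \<epsilon> \<delta>)) \<and>
    x - sum_list (map (\<lambda>(\<delta>, a, b). stack_lin (length \<delta>) a (stack_lin (length \<delta>) (eL \<delta>) b)) M) \<in> null S \<alpha> \<epsilon> \<epsilon>'"
  using assms
proof (induction rule: dom.induct)
  case (dom_null x \<epsilon> \<epsilon>')
  then show ?case by (intro exI[of _ "[]"]) simp
next
  case (dom_base a \<delta> \<epsilon>' b \<epsilon>)
  then show ?case by (intro exI[of _ "[(\<delta>, a, b)]"]) (simp add: null_eq)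
next
  case (dom_add \<epsilon> \<epsilon>' x y)
  let ?s = "\<lambda>M. sum_list (map (\<lambda>(\<delta>, a, b). stack_lin (length \<delta>) a (stack_lin (length \<delta>) (eL \<delta>) b)) M)"
  let ?P = "\<lambda>M. \<forall>(\<delta>, a, b)\<in>set M. a \<in> span (cobs S \<delta> \<epsilon>') \<and> b \<in> span (cobs S \<epsilon> \<delta>)"
  obtain M M' where M: "?P M" "x - ?s M \<in> null S \<alpha> \<epsilon> \<epsilon>'" and M': "?P M'" "y - ?s M' \<in> null S \<alpha> \<epsilon> \<epsilon>'"
    using dom_add.IH by blast
  have "?P (M @ M')" using M(1) M'(1) by (simp add: ball_Un)
  moreover have "x + y - ?s (M @ M') \<in> null S \<alpha> \<epsilon> \<epsilon>'"
    using nul_add[OF M(2)[unfolded null_eq] M'(2)[unfolded null_eq]] unfolding null_eq by (simp add: algebra_simps)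
  ultimately show ?case by blast
qed

lemma glue_lin_strands:
  assumes x: "x \<in> span (cob i B T H)" and f: "finite T" "finite H" and P: "finite P" "\<And>p. p \<in> P \<Longrightarrow> \<rho> p \<notin> P"
    and \<sigma>: "\<And>p. p \<in> P \<Longrightarrow> if \<sigma> p = Pos then p \<in> H \<and> p \<notin> T else p \<in> T \<and> p \<notin> H"
  shows "glue_lin P (x * gen (\<Sum>p\<in>P. strand (\<sigma> p) p (\<rho> p))) = relabel (\<lambda>p. if p \<in> P then \<rho> p else p) x"
  using x
proof (induction x rule: span_induct)
  case (add x D c)
  have "glue_set P (D + (\<Sum>p\<in>P. strand (\<sigma> p) p (\<rho> p))) = map_diag (\<lambda>p. if p \<in> P then \<rho> p else p) D"
    by (rule glue_set_strands[OF P]) (use \<sigma> cob_pts[OF add(2) f] in \<open>auto split: if_splits\<close>)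
  with add show ?case
    by (simp add: glue_lin_linear relabel_linear distrib_right scale_mult_left mult_single del: scale_simps(5))
qed (simp add: glue_lin_linear relabel_linear)

text \<open>A morphism with a half-interval ending at the \<open>k\<close>-th top point factors through the
  sequence with the \<open>k\<close>-th sign removed.\<close>

lemma factor_through_removal:
  fixes \<epsilon> :: "sign list"
  assumes k: "k < length \<epsilon>" and \<delta>: "\<delta> = take k \<epsilon> @ drop (Suc k) \<epsilon>"
    and u: "u \<in> Sp (Top ` (neg \<epsilon> \<inter> {k})) (Top ` (pos \<epsilon> \<inter> {k}))"
    and z: "z \<in> Sp (Bot ` pos \<epsilon> \<union> Top ` (neg \<epsilon> - {k})) (Bot ` neg \<epsilon> \<union> Top ` (pos \<epsilon> - {k}))"
  shows "\<exists>a\<in>span (cobs S \<delta> \<epsilon>). \<exists>b\<in>span (cobs S \<epsilon> \<delta>). u * z = stack_lin (length \<delta>) a b"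
proof -
  \<comment> \<open>\<open>\<sigma>\<close> opens a gap at position \<open>k\<close> and
    \<open>\<tau>\<close> closes it: they translate positions of \<delta> into positions of
    \<epsilon> other than \<open>k\<close>, and back.\<close>
  define \<sigma> where "\<sigma> j = (if j < k then j else Suc j)" for j
  define \<tau> where "\<tau> j = (if j < k then j else j - 1)" for j
  have len: "length \<delta> = length \<epsilon> - 1" using k by (simp add: \<delta>)
  have \<delta>_nth: "\<delta> ! j = \<epsilon> ! \<sigma> j" if "j < length \<delta>" for j
    using that k by (auto simp: \<delta> \<sigma>_def nth_append)
  have \<tau>\<sigma>: "\<tau> (\<sigma> j) = j" "\<sigma> j \<noteq> k" for j by (auto simp: \<tau>_def \<sigma>_def)
  have \<sigma>\<tau>: "\<sigma> (\<tau> i) = i" if "i \<noteq> k" for i using that by (auto simp: \<tau>_def \<sigma>_def)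
  have \<sigma>_less: "\<sigma> j < length \<epsilon>" if "j < length \<delta>" for j using that len k by (auto simp: \<sigma>_def)
  have \<tau>_less: "\<tau> i < length \<delta>" if "i < length \<epsilon>" "i \<noteq> k" for i using that len k by (auto simp: \<tau>_def)
  have inj_\<sigma>: "inj \<sigma>" using \<tau>\<sigma>(1) by (metis injI)
  have img: "\<sigma> ` {j. j < length \<delta> \<and> \<delta> ! j = s} = {i. i < length \<epsilon> \<and> \<epsilon> ! i = s} - {k}" for s
  proof (intro subset_antisym subsetI)
    fix i assume "i \<in> {i. i < length \<epsilon> \<and> \<epsilon> ! i = s} - {k}"
    then have i: "i < length \<epsilon>" "\<epsilon> ! i = s" "i \<noteq> k" by auto
    then have "\<tau> i \<in> {j. j < length \<delta> \<and> \<delta> ! j = s}" using \<tau>_less[of i] \<delta>_nth[of "\<tau> i"] \<sigma>\<tau>[of i] by simp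
    then show "i \<in> \<sigma> ` {j. j < length \<delta> \<and> \<delta> ! j = s}" using \<sigma>\<tau>[OF i(3)] by (metis imageI)
  qed (use \<sigma>_less \<delta>_nth \<tau>\<sigma> in auto)
  have \<sigma>p: "\<sigma> ` pos \<delta> = pos \<epsilon> - {k}" "\<sigma> ` neg \<delta> = neg \<epsilon> - {k}" unfolding pos_def neg_def by (rule img)+
  have \<tau>p: "\<tau> ` (pos \<epsilon> - {k}) = pos \<delta>" "\<tau> ` (neg \<epsilon> - {k}) = neg \<delta>"
    unfolding \<sigma>p[symmetric] by (simp_all add: image_image \<tau>\<sigma>)
  have inj_\<tau>: "inj_on \<tau> (- {k})" using \<sigma>\<tau> by (metis ComplD inj_on_inverseI singletonI)
  let ?T = "Bot ` pos \<epsilon> \<union> Top ` (neg \<epsilon> - {k})" and ?H = "Bot ` neg \<epsilon> \<union> Top ` (pos \<epsilon> - {k})"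
  have f: "finite ?T" "finite ?H" by auto
  \<comment> \<open>The lower factor is \<open>z\<close> itself, with its top points renumbered as
    those of \<delta>.\<close>
  define b where "b = relabel (relab Bot (Top \<circ> \<tau>)) z"
  have injb: "inj_on (relab Bot (q \<circ> \<tau>)) (Bot ` A \<union> Top ` (B - {k}))" if "inj q" "\<And>i j. Bot i \<noteq> q j" for A B q
    by (rule inj_on_relab) (use that inj_on_subset[OF inj_\<tau>, of "B - {k}"] in \<open>auto simp: inj_on_def\<close>)
  have b: "b \<in> span (cobs S \<epsilon> \<delta>)"
    using relabel_span[OF z injb[of Top "pos \<epsilon>" "neg \<epsilon>"] injb[of Top "neg \<epsilon>" "pos \<epsilon>"]]
    unfolding b_def cobs_eq tail_pts_eq head_pts_eq \<tau>p[symmetric] by (simp add: image_Un image_image)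
  \<comment> \<open>Undecorated strands from \<delta> to the positions of \<epsilon> other than
    \<open>k\<close>. Placed next to \<open>u\<close>, which occupies the \<open>k\<close>-th top
    point, they make up the upper factor \<open>a\<close>.\<close>
  define G :: "'a diag" where "G = map_diag (relab Bot (Top \<circ> \<sigma>)) (id_diag \<delta>)"
  have G: "G \<in> cob True S (Bot ` pos \<delta> \<union> Top ` (neg \<epsilon> - {k})) (Bot ` neg \<delta> \<union> Top ` (pos \<epsilon> - {k}))"
  proof -
    have "inj_on \<sigma> A" for A using inj_\<sigma> by (rule inj_on_subset) simp
    then have "G \<in> cob True S (Bot ` pos \<delta> \<union> (Top \<circ> \<sigma>) ` neg \<delta>) (Bot ` neg \<delta> \<union> (Top \<circ> \<sigma>) ` pos \<delta>)"
      unfolding G_def by (intro cob_relab[OF id_diag_cob]) (auto simp: inj_on_def)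
    then show ?thesis by (simp add: \<sigma>p[symmetric] image_comp)
  qed
  define a where "a = u * gen G"
  have a: "a \<in> span (cobs S \<delta> \<epsilon>)"
  proof -
    have "u * gen G \<in> Sp (Top ` (neg \<epsilon> \<inter> {k}) \<union> (Bot ` pos \<delta> \<union> Top ` (neg \<epsilon> - {k})))
        (Top ` (pos \<epsilon> \<inter> {k}) \<union> (Bot ` neg \<delta> \<union> Top ` (pos \<epsilon> - {k})))"
      by (rule mult_cob_span[OF u span_gen[OF G]]) auto
    moreover have "Top ` (neg \<epsilon> \<inter> {k}) \<union> (Bot ` pos \<delta> \<union> Top ` (neg \<epsilon> - {k})) = tail_pts \<delta> \<epsilon>"
      "Top ` (pos \<epsilon> \<inter> {k}) \<union> (Bot ` neg \<delta> \<union> Top ` (pos \<epsilon> - {k})) = head_pts \<delta> \<epsilon>"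
      by (auto simp: tail_pts_eq head_pts_eq)
    ultimately show ?thesis by (simp add: a_def cobs_eq)
  qed
  let ?P = "Mid ` {..<length \<delta>}"
  define idx where "idx p = (case p of Mid j \<Rightarrow> j | _ \<Rightarrow> 0)" for p
  let ?z = "relabel (relab Bot (Mid \<circ> \<tau>)) z"
  have zs: "?z \<in> Sp (Bot ` pos \<epsilon> \<union> Mid ` neg \<delta>) (Bot ` neg \<epsilon> \<union> Mid ` pos \<delta>)"
    using relabel_span[OF z injb[of Mid "pos \<epsilon>" "neg \<epsilon>"] injb[of Mid "neg \<epsilon>" "pos \<epsilon>"]]
    unfolding \<tau>p[symmetric] by (simp add: image_Un image_image)
  have "stack_lin (length \<delta>) a b = glue_lin ?P (relabel (relab Bot Mid) b * relabel (relab Mid Top) a)"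
    by (rule stack_lin_eq[OF b[unfolded cobs_eq] a[unfolded cobs_eq]])
  also have "relabel (relab Bot Mid) b = ?z"
    unfolding b_def relabel_relabel by (rule relabel_cong[OF z f]) auto
  also have "relabel (relab Mid Top) a = u * gen (\<Sum>p\<in>?P. strand (\<delta> ! idx p) p (Top (\<sigma> (idx p))))"
  proof -
    have "relabel (relab Mid Top) u = u" by (rule relabel_ident[OF u]) auto
    moreover have "map_diag (relab Mid Top) G = (\<Sum>p\<in>?P. strand (\<delta> ! idx p) p (Top (\<sigma> (idx p))))"
      by (simp add: G_def map_diag_map_diag id_diag_eq map_diag_sum sum_image_Mid idx_def)
    ultimately show ?thesis by (simp add: a_def relabel_mult)
  qed
  also have "?z * (u * gen (\<Sum>p\<in>?P. strand (\<delta> ! idx p) p (Top (\<sigma> (idx p)))))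
     = u * (?z * gen (\<Sum>p\<in>?P. strand (\<delta> ! idx p) p (Top (\<sigma> (idx p)))))" by (simp only: mult_ac)
  also have "glue_lin ?P \<dots> = u * glue_lin ?P (?z * gen (\<Sum>p\<in>?P. strand (\<delta> ! idx p) p (Top (\<sigma> (idx p)))))"
    by (rule glue_lin_mult2[OF u]) auto
  also have "glue_lin ?P (?z * gen (\<Sum>p\<in>?P. strand (\<delta> ! idx p) p (Top (\<sigma> (idx p)))))
     = relabel (\<lambda>p. if p \<in> ?P then Top (\<sigma> (idx p)) else p) ?z"
  proof (rule glue_lin_strands[OF zs])
    fix p assume "p \<in> ?P"
    then obtain j where j: "j < length \<delta>" "p = Mid j" by blast
    then show "if \<delta> ! idx p = Pos then p \<in> Bot ` neg \<epsilon> \<union> Mid ` pos \<delta> \<and> p \<notin> Bot ` pos \<epsilon> \<union> Mid ` neg \<delta>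
        else p \<in> Bot ` pos \<epsilon> \<union> Mid ` neg \<delta> \<and> p \<notin> Bot ` neg \<epsilon> \<union> Mid ` pos \<delta>"
      by (cases "\<delta> ! j") (simp_all add: idx_def pos_def neg_def image_iff)
  qed auto
  also have "\<dots> = z"
  proof -
    have "\<tau> i < length \<delta>" "Top (\<sigma> (\<tau> i)) = Top i" if "i \<in> (neg \<epsilon> - {k}) \<union> (pos \<epsilon> - {k})" for i
      using that \<tau>_less[of i] \<sigma>\<tau>[of i] by (auto simp: pos_def neg_def)
    then show ?thesis unfolding relabel_relabel
      by (intro relabel_ident[OF z f]) (auto simp: idx_def)
  qed
  finally show ?thesis using a b by metis
qed

lemma gen_sum: "finite I \<Longrightarrow> gen (sum d I) = (\<Prod>i\<in>I. gen (d i) :: ('l, 'f::field) lin)"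
  by (induction I rule: finite_induct) (simp_all add: gen_mult_gen[symmetric] del: gen_mult_gen)

lemma F_sum: "finite I \<Longrightarrow> F (sum d I) = (\<Prod>i\<in>I. F (d i))"
  by (induction I rule: finite_induct) (simp_all add: F_zero F_add)

text \<open>The factors are exchanged one after the other from the left: in the \<open>k\<close>-th
  summand those before \<open>k\<close> are already \<open>g i\<close> and those after
  \<open>k\<close> are still \<open>f i\<close>. It is applied to identity strands and strands
  carrying the unit of \<open>K\<close>, where \<open>f k - g k\<close> is a sum of pairs of
  half-intervals modulo null combinations.\<close>

lemma prod_diff_telescope:
  fixes f g :: "nat \<Rightarrow> 'r::comm_ring_1"
  shows "(\<Prod>i<m. f i) - (\<Prod>i<m. g i) = (\<Sum>k<m. (f k - g k) * (\<Prod>i\<in>{..<m} - {k}. if i < k then g i else f i))"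
proof (induction m)
  case (Suc m)
  have "(\<Prod>i\<in>{..<Suc m} - {k}. if i < k then g i else f i) = (\<Prod>i\<in>{..<m} - {k}. if i < k then g i else f i) * f m"
    if "k < m" for k
  proof -
    have "{..<Suc m} - {k} = insert m ({..<m} - {k})" using that by auto
    then show ?thesis using that by (simp add: mult.commute)
  qed
  then have "(\<Sum>k<m. (f k - g k) * (\<Prod>i\<in>{..<Suc m} - {k}. if i < k then g i else f i))
     = (\<Sum>k<m. (f k - g k) * (\<Prod>i\<in>{..<m} - {k}. if i < k then g i else f i)) * f m"
    by (simp add: sum_distrib_right mult.assoc)
  also have "\<dots> = ((\<Prod>i<m. f i) - (\<Prod>i<m. g i)) * f m" by (simp only: Suc)
  finally have 1: "(\<Sum>k<m. (f k - g k) * (\<Prod>i\<in>{..<Suc m} - {k}. if i < k then g i else f i))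
     = ((\<Prod>i<m. f i) - (\<Prod>i<m. g i)) * f m" .
  have "{..<Suc m} - {m} = {..<m}" by auto
  then have "(\<Prod>i\<in>{..<Suc m} - {m}. if i < m then g i else f i) = (\<Prod>i<m. g i)" by simp
  then show ?case using 1 by (simp add: algebra_simps)
qed simp

lemma prod_span:
  assumes "finite I" "\<And>j. j \<in> I \<Longrightarrow> x j \<in> Sp {t j} {h j}" "inj_on t I" "inj_on h I"
  shows "prod x I \<in> Sp (t ` I) (h ` I)"
  using assms
proof (induction I rule: finite_induct)
  case (insert j I)
  have "x j * prod x I \<in> Sp ({t j} \<union> t ` I) ({h j} \<union> h ` I)"
    by (rule mult_cob_span) (use insert in auto)
  then show ?case using insert.hyps by simp
qed (use one_span in simp)

definition tp :: "sign list \<Rightarrow> nat \<Rightarrow> pt" where "tp \<epsilon> i = (if \<epsilon> ! i = Pos then Bot i else Top i)"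
definition hp :: "sign list \<Rightarrow> nat \<Rightarrow> pt" where "hp \<epsilon> i = (if \<epsilon> ! i = Pos then Top i else Bot i)"

lemma strand_tp_hp: "strand (\<epsilon> ! i) (Bot i) (Top i) = sg (Some (tp \<epsilon> i)) (Some (hp \<epsilon> i)) []"
  by (simp add: strand_def tp_def hp_def)

lemma inj_tp: "inj (tp \<epsilon>)" and inj_hp: "inj (hp \<epsilon>)"
  by (auto simp: inj_def tp_def hp_def split: if_splits)

lemma dom_id: "dom \<epsilon> \<epsilon> (gen (id_diag \<epsilon>))"
proof (induction "length \<epsilon>" arbitrary: \<epsilon> rule: less_induct)
  case less
  let ?m = "length \<epsilon>"
  define I where "I i = (gen (sg (Some (tp \<epsilon> i)) (Some (hp \<epsilon> i)) []) :: ('a, 'k) lin)" for i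
  define E where "E i = arc (tp \<epsilon> i) (hp \<epsilon> i) (wpl [])" for i
  have I: "I i \<in> Sp {tp \<epsilon> i} {hp \<epsilon> i}" for i unfolding I_def by (rule sg_cob) simp
  have E: "E i \<in> Sp {tp \<epsilon> i} {hp \<epsilon> i}" for i unfolding E_def by (rule arc_span[OF wpl_A]) simp
  \<comment> \<open>The identity is a product of one arc per position, and so is its image under F;
    only the labels of the arcs differ.\<close>
  have idI: "gen (id_diag \<epsilon>) = (\<Prod>i<?m. I i)"
    unfolding id_diag_eq strand_tp_hp I_def by (rule gen_sum) simp
  have idE: "eL \<epsilon> = (\<Prod>i<?m. E i)"
    unfolding eL_def id_diag_eq strand_tp_hp E_def by (simp add: F_sum F_sg)
  have summand: "dom \<epsilon> \<epsilon> ((I k - E k) * (\<Prod>i\<in>{..<?m} - {k}. if i < k then E i else I i))" if k: "k < ?m" for k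
  proof -
    define R where "R = (\<Prod>i\<in>{..<?m} - {k}. if i < k then E i else I i)"
    let ?t = "tp \<epsilon> k" and ?h = "hp \<epsilon> k"
    have R: "R \<in> Sp (tp \<epsilon> ` ({..<?m} - {k})) (hp \<epsilon> ` ({..<?m} - {k}))"
      unfolding R_def by (rule prod_span) (use I E inj_on_subset[OF inj_tp] inj_on_subset[OF inj_hp] in auto)
    have tk: "?t \<notin> tp \<epsilon> ` ({..<?m} - {k})" "?h \<notin> hp \<epsilon> ` ({..<?m} - {k})"
      using inj_tp[of \<epsilon>] inj_hp[of \<epsilon>] by (auto dest: injD)
    have cover: "insert ?t (tp \<epsilon> ` ({..<?m} - {k})) = tail_pts \<epsilon> \<epsilon>" "insert ?h (hp \<epsilon> ` ({..<?m} - {k})) = head_pts \<epsilon> \<epsilon>"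
      using k by (auto simp: tail_pts_eq head_pts_eq tp_def hp_def pos_def neg_def sign_neq image_iff split: if_splits)
    let ?q = "\<lambda>j. put ?h (V j) * put ?t (W j)"
    have "oneL - wpl [] \<in> N {Top (Suc 0)} {Top 0}" using eqv_sym[OF wpl_Nil] by (simp add: eqv_def)
    then have "arc ?t ?h (oneL - wpl []) * R \<in> N ({?t} \<union> tp \<epsilon> ` ({..<?m} - {k})) ({?h} \<union> hp \<epsilon> ` ({..<?m} - {k}))"
      by (intro nul_mult[OF nul_arc R]) (use tk in auto)
    \<comment> \<open>Modulo null combinations the undecorated arc minus the unit of
      \<open>K\<close> is the sum of the pairs built from \<open>V j\<close> and \<open>W j\<close>,
      since these are the terms subtracted in \<open>oneL\<close>.\<close>
    then have "(I k - E k) * R - (\<Sum>j<n. ?q j * R) \<in> null S \<alpha> \<epsilon> \<epsilon>"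
      using cover by (simp add: null_eq relabel_linear arc_oneL I_def E_def left_diff_distrib sum_distrib_left algebra_simps)
    moreover have "dom \<epsilon> \<epsilon> (\<Sum>j<n. ?q j * R)"
    proof (rule dom_sum)
      fix j assume "j \<in> {..<n}"
      then have j: "j < n" by simp
      let ?\<delta> = "take k \<epsilon> @ drop (Suc k) \<epsilon>"
      have v: "put ?h (V j) \<in> Sp {} {?h}" and w: "put ?t (W j) \<in> Sp {?t} {}"
        using put_span_head[OF V_span[OF j]] put_span_tail[OF W_span[OF j]] by auto
      have "\<exists>a\<in>span (cobs S ?\<delta> \<epsilon>). \<exists>b\<in>span (cobs S \<epsilon> ?\<delta>). ?q j * R = stack_lin (length ?\<delta>) a b"
      \<comment> \<open>One half of the pair ends at the top and is split off as \<open>u\<close>;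
        the other ends at the bottom and stays in \<open>z\<close>. The orientation of the strand
        decides which is which.\<close>
      proof (cases "\<epsilon> ! k")
        case Pos
        then have th: "?t = Bot k" "?h = Top k" and kp: "k \<in> pos \<epsilon>" "k \<notin> neg \<epsilon>" using k by (auto simp: tp_def hp_def pos_def neg_def)
        have "put ?t (W j) * R \<in> Sp ({?t} \<union> tp \<epsilon> ` ({..<?m} - {k})) ({} \<union> hp \<epsilon> ` ({..<?m} - {k}))"
          by (rule mult_cob_span[OF w R]) (use tk in auto)
        moreover have "{?t} \<union> tp \<epsilon> ` ({..<?m} - {k}) = Bot ` pos \<epsilon> \<union> Top ` (neg \<epsilon> - {k})"
          using cover(1) kp by (simp add: tail_pts_eq)
        moreover have "{} \<union> hp \<epsilon> ` ({..<?m} - {k}) = Bot ` neg \<epsilon> \<union> Top ` (pos \<epsilon> - {k})"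
          unfolding Un_empty_left Diff_insert_absorb[OF tk(2), unfolded cover(2), symmetric] by (auto simp: head_pts_eq th)
        ultimately have z: "put ?t (W j) * R \<in> Sp (Bot ` pos \<epsilon> \<union> Top ` (neg \<epsilon> - {k})) (Bot ` neg \<epsilon> \<union> Top ` (pos \<epsilon> - {k}))"
          by simp
        have u: "put ?h (V j) \<in> Sp (Top ` (neg \<epsilon> \<inter> {k})) (Top ` (pos \<epsilon> \<inter> {k}))" using v th kp by simp
        show ?thesis using factor_through_removal[OF k refl u z] by (simp add: mult.assoc)
      next
        case Neg
        then have th: "?t = Top k" "?h = Bot k" and kp: "k \<in> neg \<epsilon>" "k \<notin> pos \<epsilon>" using k by (auto simp: tp_def hp_def pos_def neg_def)
        have "put ?h (V j) * R \<in> Sp ({} \<union> tp \<epsilon> ` ({..<?m} - {k})) ({?h} \<union> hp \<epsilon> ` ({..<?m} - {k}))"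
          by (rule mult_cob_span[OF v R]) (use tk in auto)
        moreover have "{?h} \<union> hp \<epsilon> ` ({..<?m} - {k}) = Bot ` neg \<epsilon> \<union> Top ` (pos \<epsilon> - {k})"
          using cover(2) kp by (simp add: head_pts_eq)
        moreover have "{} \<union> tp \<epsilon> ` ({..<?m} - {k}) = Bot ` pos \<epsilon> \<union> Top ` (neg \<epsilon> - {k})"
          unfolding Un_empty_left Diff_insert_absorb[OF tk(1), unfolded cover(1), symmetric] by (auto simp: tail_pts_eq th)
        ultimately have z: "put ?h (V j) * R \<in> Sp (Bot ` pos \<epsilon> \<union> Top ` (neg \<epsilon> - {k})) (Bot ` neg \<epsilon> \<union> Top ` (pos \<epsilon> - {k}))"
          by simp
        have u: "put ?t (W j) \<in> Sp (Top ` (neg \<epsilon> \<inter> {k})) (Top ` (pos \<epsilon> \<inter> {k}))" using w th kp by simp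
        show ?thesis using factor_through_removal[OF k refl u z] by (simp add: mult_ac)
      qed
      then obtain a b where a: "a \<in> span (cobs S ?\<delta> \<epsilon>)" and b: "b \<in> span (cobs S \<epsilon> ?\<delta>)"
        and q: "?q j * R = stack_lin (length ?\<delta>) a b" by (elim bexE)
      \<comment> \<open>Inserting the identity of the shorter sequence between \<open>a\<close> and
        \<open>b\<close> brings in the induction hypothesis.\<close>
      have "dom ?\<delta> ?\<delta> (gen (id_diag ?\<delta>))" by (rule less) (use k in simp)
      from dom_sandwich[OF this a b] show "dom \<epsilon> \<epsilon> (?q j * R)"
        unfolding q stack_S_id(1)[OF b] .
    qed
    ultimately show ?thesis unfolding R_def[symmetric] by (rule dom_cong[rotated])
  qed
  \<comment> \<open>The idempotent itself is a base case, with identities as outer factors.\<close>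
  have "dom \<epsilon> \<epsilon> (stack_lin ?m (gen (id_diag \<epsilon>)) (stack_lin ?m (eL \<epsilon>) (gen (id_diag \<epsilon>))))"
    by (rule dom_base[OF id_S id_S])
  then have "dom \<epsilon> \<epsilon> (eL \<epsilon>)" by (simp only: stack_S_id[OF eL_span])
  moreover have "dom \<epsilon> \<epsilon> ((\<Prod>i<?m. I i) - (\<Prod>i<?m. E i))"
    unfolding prod_diff_telescope by (rule dom_sum) (use summand in simp)
  ultimately have "dom \<epsilon> \<epsilon> (eL \<epsilon> + ((\<Prod>i<?m. I i) - (\<Prod>i<?m. E i)))" by (rule dom_add)
  then show ?case by (simp add: idI idE)
qed

lemma dominates_ex: "\<exists>M. additive_semifunctor.dominates CB C phi \<epsilon> M"
proof -
  obtain M where M: "\<forall>(\<delta>, a, b)\<in>set M. a \<in> span (cobs S \<delta> \<epsilon>) \<and> b \<in> span (cobs S \<epsilon> \<delta>)"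
    "gen (id_diag \<epsilon>) - sum_list (map (\<lambda>(\<delta>, a, b). stack_lin (length \<delta>) a (stack_lin (length \<delta>) (eL \<delta>) b)) M) \<in> null S \<alpha> \<epsilon> \<epsilon>"
    using dom_list[OF dom_id[of \<epsilon>]] by (elim exE conjE)
  let ?s = "\<lambda>(\<delta>, a, b). stack_lin (length \<delta>) a (stack_lin (length \<delta>) (eL \<delta>) b)"
  let ?M = "map (\<lambda>(\<delta>, a, b). (\<delta>, cls S \<alpha> \<delta> \<epsilon> a, cls S \<alpha> \<epsilon> \<delta> b)) M"
  have c: "(case (case l of (\<delta>, a, b) \<Rightarrow> (\<delta>, cls S \<alpha> \<delta> \<epsilon> a, cls S \<alpha> \<epsilon> \<delta> b)) of
       (Z, a, b) \<Rightarrow> Cmp C \<epsilon> Z \<epsilon> a (Cmp C \<epsilon> Z Z (phi Z Z (Ide CB Z)) b)) = cls S \<alpha> \<epsilon> \<epsilon> (?s l)"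
    and s: "?s l \<in> span (cobs S \<epsilon> \<epsilon>)" if l: "l \<in> set M" for l
  proof -
    obtain \<delta> a b where lab: "l = (\<delta>, a, b)" by (cases l)
    have a: "a \<in> span (cobs S \<delta> \<epsilon>)" and b: "b \<in> span (cobs S \<epsilon> \<delta>)" using M(1) l lab by auto
    show "(case (case l of (\<delta>, a, b) \<Rightarrow> (\<delta>, cls S \<alpha> \<delta> \<epsilon> a, cls S \<alpha> \<epsilon> \<delta> b)) of
       (Z, a, b) \<Rightarrow> Cmp C \<epsilon> Z \<epsilon> a (Cmp C \<epsilon> Z Z (phi Z Z (Ide CB Z)) b)) = cls S \<alpha> \<epsilon> \<epsilon> (?s l)"
      unfolding lab by (simp only: split phi_Ide Cmp_C_alpha[OF b eL_span] Cmp_C_alpha[OF stack_S[OF b eL_span] a])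
    show "?s l \<in> span (cobs S \<epsilon> \<epsilon>)" unfolding lab by (simp only: split stack_S[OF stack_S[OF b eL_span] a])
  qed
  have "Sum C \<epsilon> \<epsilon> (map (\<lambda>(Z, a, b). Cmp C \<epsilon> Z \<epsilon> a (Cmp C \<epsilon> Z Z (phi Z Z (Ide CB Z)) b)) ?M)
    = Sum C \<epsilon> \<epsilon> (map (\<lambda>l. cls S \<alpha> \<epsilon> \<epsilon> (?s l)) M)"
    by (rule arg_cong[of _ _ "Sum C \<epsilon> \<epsilon>"]) (unfold map_map comp_def, rule map_cong[OF refl], erule c)
  also have "\<dots> = cls S \<alpha> \<epsilon> \<epsilon> (sum_list (map ?s M))" by (rule Sum_C_alpha[OF s])
  also have "\<dots> = Ide C \<epsilon>"
    unfolding Ide_C_alpha cls_eq_iff using M(2) unfolding null_eq by (rule nul_sym)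
  finally have "Sum C \<epsilon> \<epsilon> (map (\<lambda>(Z, a, b). Cmp C \<epsilon> Z \<epsilon> a (Cmp C \<epsilon> Z Z (phi Z Z (Ide CB Z)) b)) ?M) = Ide C \<epsilon>" .
  moreover have "\<forall>(Z, a, b)\<in>set ?M. Z \<in> Obj CB \<and> a \<in> Arr C Z \<epsilon> \<and> b \<in> Arr C \<epsilon> Z"
    using M(1) by (auto simp: Obj_CB Arr_C_alpha)
  ultimately show ?thesis
    unfolding additive_semifunctor.dominates_def[OF additive_semifunctor_phi] by blast
qed

end

theorem proposition2p17:
  fixes S :: "'a set" and \<alpha> :: "('a, 'k::field) evaluation"
    and vs ws :: "('a, 'k) lin set list"
  assumes "finite S"
    and "rational S \<alpha>"
    and "is_basis (C_alpha S \<alpha>) [] [Pos] vs"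
    and "dual_basis S \<alpha> vs ws"
  shows "is_equivalence (Kar (C_brauer (K_alg S \<alpha> vs ws))) (Kar (C_alpha S \<alpha>))
           (Kar_functor (F_functor S \<alpha> vs ws))"
proof -
  interpret evaluation_basis S \<alpha> vs ws
    using assms by unfold_locales (auto simp: is_basis_def)
  show ?thesis
    unfolding Kar_functor_F
    by (rule additive_semifunctor.is_equivalence_Kar[OF additive_semifunctor_phi dominates_ex])
qed

end
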